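(* Let $T:Y\times U\to U$, $(y_d,f)\mapsto u^*$, be the solution operator of the optimal control problem $$\min_{u\in U,\,y\in Y}\ \tfrac12\|y-y_d\|_Y^2+\tfrac12\langle u,Nu\rangle_U+\theta(u)\quad\text{s.t.}\quad y=S(u+f),$$ where $N$ and $\theta$ satisfy the pointwise assumption given in the context. For any compact set $K\subset Y\times U$ and any $\varepsilon>0$, there exists a two-layer iUzawa-Net $\mathcal T(y_d,f;\theta_{\mathcal T})$ (number of layers $L=2$) such that $$\sup_{(y_d,f)^\top\in K}\big\|T(y_d,f)-\mathcal T(y_d,f;\theta_{\mathcal T})\big\|_U\le\varepsilon .$$
   Context: **Problem.** $\Omega\subset\mathbb R^d$ ($d\ge1$) is a bounded domain with Lipschitz boundary and, without loss of generality, $\overline\Omega\subset(0,2\pi)^d$, so that $\Omega$ is identified with a subset of the torus $\mathbb T^d=\mathbb R^d/(2\pi\mathbb Z)^d$. $U=Y=L^2(\Omega)$. $N:U\to U$ is linear, bounded, self-adjoint and positive definite with $\langle u,Nu\rangle_U\ge c_0\|u\|_U^2$ for some $c_0>0$. $S:U\to Y$ is the bounded linear solution operator of a well-posed linear PDE on $\Omega$, with adjoint $S^*$. $\theta:U\to\mathbb R\cup\{+\infty\}$ is convex, lower semicontinuous and proper. For each $(y_d,f)\in Y\times U$ the problem has a unique optimal control $u^*$, and $T(y_d,f):=u^*$. **Pointwise assumption.** (i) $(Nu)(x)=\lambda(x)u(x)$ a.e. in $\Omega$, with $\lambda\in L^\infty(\Omega)$ and $\lambda(x)\ge c_0>0$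 a.e. (ii) There are an integer $m\ge1$, a closed set $E\subset\mathbb R^m$, and functions $\psi_\xi:\mathbb R\to\mathbb R\cup\{+\infty\}$, $\xi\in E$, each convex, lower semicontinuous and proper, such that $\theta(u)=\int_\Omega\psi_{\mu(x)}(u(x))\,dx$ for all $u\in L^2(\Omega)$, for some $\mu\in L^\infty(\Omega;\mathbb R^m)$ with $\mu(x)\in E$ a.e. (the integral is $+\infty$ if the integrand is $+\infty$ on a set of positive measure). **Network modules.** An extension operator is a bounded linear $\mathcal E:L^2(\Omega)\to L^2(\mathbb T^d)$ with $\mathcal E(u)|_\Omega=u$. $\mathcal F$ is the Fourier transform on $\mathbb T^d$, and $\mathcal F_{k_{\max}}$ is the Fourier transform truncated to the modes $k\in(\mathbb Z\cap[-k_{\max},k_{\max}])^d$. *FNO module:* $u\mapsto(\mathcal Q\circ\mathcal K_{\rm FNO}\circ\mathcal P)(\mathcal E u)|_\Omega$, where $\mathcal E$ is an extension operator, $(\mathcal Pv)(x)=Pv(x)$ with $P:\mathbb R\to\mathbb R^{m_p}$ a learnable linear map, $(\mathcal Qv)(x)=Qv(x)$ with $Q:\mathbb R^{m_p}\to\mathbb R$ a learnable linear map, and $\mathcal K_{\rm FNO}:L^2(\mathbb T^d;\mathbb R^{m_p})\to L^2(\mathbb T^d;\mathbb R^{m_p})$ is given by $\mathcal K_{\rm FNO}(v)=v^{(L')}$, $v^{(0)}=v$, $$v^{(\ell+1)}=\sigma\big(\mathcal F^{-1}(\mathcal R_\ell\cdot\mathcal F_{k_{\max}}(v^{(\ell)}))+W_\ell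 v^{(\ell)}\big),\qquad \ell=0,\dots,L'-1.$$ Here $L'$ is the number of Fourier layers, $\mathcal R_\ell:(\mathbb Z\cap[-k_{\max},k_{\max}])^d\to\mathbb C^{m_p\times m_p}$ and $W_\ell\in\mathbb R^{m_p\times m_p}$ are learnable, and $\sigma$ is a nonlinear activation function acting pointwise. *$\mathcal Q_S$ module:* $\mathcal Q_S(u)=\big((\mathcal P^\top\circ\mathcal K\circ\mathcal P)(\mathcal Eu)\big)|_\Omega+\gamma u$, with $\mathcal K(v)(x)=V^\top Vv(x)+(\phi_-^\top*\phi*v)(x)$, where $\mathcal E$ is an extension operator, $(\mathcal Pv)(x)=Pv(x)$ and $(\mathcal P^\top v)(x)=P^\top v(x)$ with $P:\mathbb R\to\mathbb R^{m_p}$ linear, $V\in\mathbb R^{m_p\times m_p}$, $\phi\in L^2(\mathbb T^d;\mathbb R^{m_p\times m_p})$ ($P,V,\phi$ learnable), $\phi_-^\top(x):=\phi(-x)^\top$, $(v_1*v_2)(x)=\int_{\mathbb T^d}v_1(x-y)v_2(y)\,dy$ (matrix product), and $\gamma>0$ is a hyperparameter. *$\mathcal Q_A$ module:* $(\mathcal Q_Au)(x)=\mathcal N(u(x),\mu(x),\lambda(x))$ a.e. in $\Omega$, where $\mathcal N:\mathbb R^{m+2}\to\mathbb R$ is a ReLU network with $M$ layers: $v^{(0)}=W_0(r,r,\xi,\eta)^\top$, $v^{(l)}=\mathrm{ReLU}\big(W_l(v^{(l-1)},r,\xi,\eta)^\top+b_l\big)$ for $1\le l\le M-1$, $\mathcal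 N(r,\xi,\eta)=W_M(v^{(M-1)},r,\xi,\eta)^\top+b_M$, with weight matrices $W_l$ and bias vectors $b_l$. **iUzawa-Net with $L$ layers.** Fix $\tau\ge0$. For $k=0,\dots,L-1$ let $\mathcal S^k:U\to Y$ and $\mathcal A^k:Y\to U$ be FNO modules, $\mathcal Q_S^k$ a $\mathcal Q_S$ module and $\mathcal Q_A^k$ a $\mathcal Q_A$ module. Set $u^0=0$, $p^0=0$, $$u^{k+1}=\mathcal Q_A^k(\tau u^k-\mathcal A^kp^k),\qquad p^{k+1}=p^k+\mathcal Q_S^k\big(\mathcal S^k(u^{k+1}+f)-p^k-y_d\big),$$ and $\mathcal T(y_d,f;\theta_{\mathcal T})=u^L$, where $\theta_{\mathcal T}$ collects all trainable parameters. *)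

theory Defs
  imports "HOL-Analysis.Analysis"
begin

section \<open>The spaces $L^2$\<close>

text \<open>
  Elements of $L^2(D)$ are represented by real functions on the whole space, of which only the
  values on \<open>D\<close> matter and which are identified when they agree almost everywhere on \<open>D\<close>.
\<close>

definition L2 :: "(real^'d) set \<Rightarrow> (real^'d \<Rightarrow> real) set" where
  "L2 D = {u. u \<in> borel_measurable (lebesgue_on D) \<and> integrable (lebesgue_on D) (\<lambda>x. (u x)\<^sup>2)}"

definition L2_inner :: "(real^'d) set \<Rightarrow> (real^'d \<Rightarrow> real) \<Rightarrow> (real^'d \<Rightarrow> real) \<Rightarrow> real" where
  "L2_inner D u v = (LINT x|lebesgue_on D. u x * v x)"

definition L2_norm :: "(real^'d) set \<Rightarrow> (real^'d \<Rightarrow> real) \<Rightarrow> real" where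
  "L2_norm D u = sqrt (L2_inner D u u)"

definition L2_eq :: "(real^'d) set \<Rightarrow> (real^'d \<Rightarrow> real) \<Rightarrow> (real^'d \<Rightarrow> real) \<Rightarrow> bool" where
  "L2_eq D u v \<longleftrightarrow> (AE x in lebesgue_on D. u x = v x)"

text \<open>
  The topology of the seminorm on representatives.  It is the pullback of the norm topology of
  the quotient space, so a set of representatives is compact (a function respecting a.e. equality
  is lower semicontinuous) iff this holds in the quotient.
\<close>

definition L2_topology :: "(real^'d) set \<Rightarrow> (real^'d \<Rightarrow> real) topology" where
  "L2_topology D = topology (\<lambda>\<U>. \<U> \<subseteq> L2 D \<and>
     (\<forall>u\<in>\<U>. \<exists>r>0. \<forall>v\<in>L2 D. L2_norm D (\<lambda>x. v x - u x) < r \<longrightarrow> v \<in> \<U>))"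

lemma openin_L2_topology:
  fixes D :: "(real^'d) set"
  shows "openin (L2_topology D) \<U> \<longleftrightarrow> \<U> \<subseteq> L2 D \<and>
     (\<forall>u\<in>\<U>. \<exists>r>0. \<forall>v\<in>L2 D. L2_norm D (\<lambda>x. v x - u x) < r \<longrightarrow> v \<in> \<U>)"
proof -
  have "istopology (\<lambda>\<U>. \<U> \<subseteq> L2 D \<and>
     (\<forall>u\<in>\<U>. \<exists>r>0. \<forall>v\<in>L2 D. L2_norm D (\<lambda>x. v x - u x) < r \<longrightarrow> v \<in> \<U>))"
    unfolding istopology_def
  proof (intro conjI allI impI)
    fix A B
    assume A: "A \<subseteq> L2 D \<and> (\<forall>u\<in>A. \<exists>r>0. \<forall>v\<in>L2 D. L2_norm D (\<lambda>x. v x - u x) < r \<longrightarrow> v \<in> A)"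
      and B: "B \<subseteq> L2 D \<and> (\<forall>u\<in>B. \<exists>r>0. \<forall>v\<in>L2 D. L2_norm D (\<lambda>x. v x - u x) < r \<longrightarrow> v \<in> B)"
    show "A \<inter> B \<subseteq> L2 D" using A by blast
    show "\<forall>u\<in>A \<inter> B. \<exists>r>0. \<forall>v\<in>L2 D. L2_norm D (\<lambda>x. v x - u x) < r \<longrightarrow> v \<in> A \<inter> B"
    proof
      fix u assume "u \<in> A \<inter> B"
      then obtain r s where
        "r > 0" "\<forall>v\<in>L2 D. L2_norm D (\<lambda>x. v x - u x) < r \<longrightarrow> v \<in> A"
        "s > 0" "\<forall>v\<in>L2 D. L2_norm D (\<lambda>x. v x - u x) < s \<longrightarrow> v \<in> B"
        using A B by blast
      then show "\<exists>r>0. \<forall>v\<in>L2 D. L2_norm D (\<lambda>x. v x - u x) < r \<longrightarrow> v \<in> A \<inter> B"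
        by (intro exI[of _ "min r s"]) auto
    qed
  next
    fix \<K> :: "(real^'d \<Rightarrow> real) set set"
    assume K: "\<forall>A\<in>\<K>. A \<subseteq> L2 D \<and>
      (\<forall>u\<in>A. \<exists>r>0. \<forall>v\<in>L2 D. L2_norm D (\<lambda>x. v x - u x) < r \<longrightarrow> v \<in> A)"
    show "\<Union>\<K> \<subseteq> L2 D" using K by blast
    show "\<forall>u\<in>\<Union>\<K>. \<exists>r>0. \<forall>v\<in>L2 D. L2_norm D (\<lambda>x. v x - u x) < r \<longrightarrow> v \<in> \<Union>\<K>"
      using K by (meson UnionE UnionI)
  qed
  then show ?thesis
    unfolding L2_topology_def by (simp add: topology_inverse')
qed

lemma topspace_L2_topology: "topspace (L2_topology D) = L2 D"
proof
  show "topspace (L2_topology D) \<subseteq> L2 D"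
    using openin_topspace[of "L2_topology D"] unfolding openin_L2_topology by blast
  have "openin (L2_topology D) (L2 D)"
    unfolding openin_L2_topology by (auto intro: exI[of _ 1])
  then show "L2 D \<subseteq> topspace (L2_topology D)"
    by (rule openin_subset)
qed

text \<open>Boundedness together with linearity makes \<open>A\<close> respect a.e. equality.\<close>

definition L2_bounded_linear ::
  "(real^'d) set \<Rightarrow> (real^'d) set \<Rightarrow> ((real^'d \<Rightarrow> real) \<Rightarrow> (real^'d \<Rightarrow> real)) \<Rightarrow> bool" where
  "L2_bounded_linear D D' A \<longleftrightarrow>
     (\<forall>u\<in>L2 D. A u \<in> L2 D') \<and>
     (\<forall>u\<in>L2 D. \<forall>v\<in>L2 D. L2_eq D' (A (\<lambda>x. u x + v x)) (\<lambda>x. A u x + A v x)) \<and>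
     (\<forall>c. \<forall>u\<in>L2 D. L2_eq D' (A (\<lambda>x. c * u x)) (\<lambda>x. c * A u x)) \<and>
     (\<exists>C. \<forall>u\<in>L2 D. L2_norm D' (A u) \<le> C * L2_norm D u)"

definition L2_self_adjoint ::
  "(real^'d) set \<Rightarrow> ((real^'d \<Rightarrow> real) \<Rightarrow> (real^'d \<Rightarrow> real)) \<Rightarrow> bool" where
  "L2_self_adjoint D A \<longleftrightarrow>
     (\<forall>u\<in>L2 D. \<forall>v\<in>L2 D. L2_inner D (A u) v = L2_inner D u (A v))"

text \<open>$L^\infty(D;F)$\<close>

definition Linfty :: "(real^'d) set \<Rightarrow> (real^'d \<Rightarrow> 'b::euclidean_space) set" where
  "Linfty D = {g. g \<in> borel_measurable (lebesgue_on D) \<and>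
                  (\<exists>C. AE x in lebesgue_on D. norm (g x) \<le> C)}"


section \<open>The domain\<close>

text \<open>
  Near each boundary point, \<open>D\<close> is the strict subgraph of a Lipschitz function \<open>g\<close> over the
  hyperplane orthogonal to some unit vector \<open>e\<close>; the argument \<open>x - (x \<bullet> e) *\<^sub>R e\<close> is the
  orthogonal projection of \<open>x\<close> to that hyperplane.
\<close>

definition lipschitz_boundary :: "(real^'d) set \<Rightarrow> bool" where
  "lipschitz_boundary D \<longleftrightarrow>
     (\<forall>z\<in>frontier D. \<exists>r>0. \<exists>e g C. norm e = 1 \<and> C-lipschitz_on {y. y \<bullet> e = 0} g \<and>
        D \<inter> ball z r = {x \<in> ball z r. x \<bullet> e < g (x - (x \<bullet> e) *\<^sub>R e)})"

definition lipschitz_domain :: "(real^'d) set \<Rightarrow> bool" where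
  "lipschitz_domain D \<longleftrightarrow>
     open D \<and> connected D \<and> D \<noteq> {} \<and> bounded D \<and> lipschitz_boundary D"


section \<open>The optimal control problem\<close>

definition lsc_map :: "'a topology \<Rightarrow> ('a \<Rightarrow> ereal) \<Rightarrow> bool" where
  "lsc_map X f \<longleftrightarrow> (\<forall>a. closedin X {x \<in> topspace X. f x \<le> a})"

definition convex_lsc_proper :: "(real \<Rightarrow> ereal) \<Rightarrow> bool" where
  "convex_lsc_proper \<psi> \<longleftrightarrow>
     (\<forall>r s. \<forall>t\<in>{0<..<1}. \<psi> (t * r + (1 - t) * s) \<le> ereal t * \<psi> r + ereal (1 - t) * \<psi> s) \<and>
     lsc_map euclidean \<psi> \<and>
     (\<forall>r. \<psi> r \<noteq> -\<infinity>) \<and> (\<exists>r. \<psi> r \<noteq> \<infinity>)"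

definition L2_convex_lsc_proper ::
  "(real^'d) set \<Rightarrow> ((real^'d \<Rightarrow> real) \<Rightarrow> ereal) \<Rightarrow> bool" where
  "L2_convex_lsc_proper D \<theta> \<longleftrightarrow>
     (\<forall>u\<in>L2 D. \<forall>v\<in>L2 D. \<forall>t\<in>{0<..<1}.
        \<theta> (\<lambda>x. t * u x + (1 - t) * v x) \<le> ereal t * \<theta> u + ereal (1 - t) * \<theta> v) \<and>
     lsc_map (L2_topology D) \<theta> \<and>
     (\<forall>u\<in>L2 D. \<theta> u \<noteq> -\<infinity>) \<and> (\<exists>u\<in>L2 D. \<theta> u \<noteq> \<infinity>)"

text \<open>
  The Lebesgue integral of a function with values in $(-\infty,\infty]$: positive part minus
  negative part (\<open>e2ennreal\<close> sends negative numbers to 0).  The integral is required to exist with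
  a value different from \<open>-\<infinity>\<close>, so the integral of the negative part is finite.
\<close>

definition has_ereal_integral :: "'a measure \<Rightarrow> ('a \<Rightarrow> ereal) \<Rightarrow> ereal \<Rightarrow> bool" where
  "has_ereal_integral M g I \<longleftrightarrow>
     g \<in> borel_measurable M \<and>
     (\<integral>\<^sup>+ x. e2ennreal (- g x) \<partial>M) < \<infinity> \<and>
     I = enn2ereal (\<integral>\<^sup>+ x. e2ennreal (g x) \<partial>M) - enn2ereal (\<integral>\<^sup>+ x. e2ennreal (- g x) \<partial>M)"

definition admissible ::
  "(real^'d) set \<Rightarrow> ((real^'d \<Rightarrow> real) \<Rightarrow> (real^'d \<Rightarrow> real)) \<Rightarrow> (real^'d \<Rightarrow> real)
   \<Rightarrow> ((real^'d \<Rightarrow> real) \<times> (real^'d \<Rightarrow> real)) set" where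
  "admissible D S f =
     {(u, y). u \<in> L2 D \<and> y \<in> L2 D \<and> L2_eq D y (S (\<lambda>x. u x + f x))}"

definition cost ::
  "(real^'d) set \<Rightarrow> ((real^'d \<Rightarrow> real) \<Rightarrow> (real^'d \<Rightarrow> real)) \<Rightarrow> ((real^'d \<Rightarrow> real) \<Rightarrow> ereal)
   \<Rightarrow> (real^'d \<Rightarrow> real) \<Rightarrow> (real^'d \<Rightarrow> real) \<Rightarrow> (real^'d \<Rightarrow> real) \<Rightarrow> ereal" where
  "cost D N \<theta> yd u y =
     ereal (1/2 * (L2_norm D (\<lambda>x. y x - yd x))\<^sup>2 + 1/2 * L2_inner D u (N u)) + \<theta> u"

definition optimal_control ::
  "(real^'d) set \<Rightarrow> ((real^'d \<Rightarrow> real) \<Rightarrow> (real^'d \<Rightarrow> real)) \<Rightarrow>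
   ((real^'d \<Rightarrow> real) \<Rightarrow> (real^'d \<Rightarrow> real)) \<Rightarrow> ((real^'d \<Rightarrow> real) \<Rightarrow> ereal) \<Rightarrow>
   (real^'d \<Rightarrow> real) \<Rightarrow> (real^'d \<Rightarrow> real) \<Rightarrow> (real^'d \<Rightarrow> real) \<Rightarrow> bool" where
  "optimal_control D S N \<theta> yd f u \<longleftrightarrow>
     (\<exists>y. (u, y) \<in> admissible D S f \<and>
          (\<forall>(u', y')\<in>admissible D S f. cost D N \<theta> yd u y \<le> cost D N \<theta> yd u' y'))"

definition solution_operator ::
  "(real^'d) set \<Rightarrow> ((real^'d \<Rightarrow> real) \<Rightarrow> (real^'d \<Rightarrow> real)) \<Rightarrow>
   ((real^'d \<Rightarrow> real) \<Rightarrow> (real^'d \<Rightarrow> real)) \<Rightarrow> ((real^'d \<Rightarrow> real) \<Rightarrow> ereal) \<Rightarrow>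
   ((real^'d \<Rightarrow> real) \<times> (real^'d \<Rightarrow> real) \<Rightarrow> (real^'d \<Rightarrow> real)) \<Rightarrow> bool" where
  "solution_operator D S N \<theta> T \<longleftrightarrow>
     (\<forall>yd\<in>L2 D. \<forall>f\<in>L2 D.
        optimal_control D S N \<theta> yd f (T (yd, f)) \<and>
        (\<forall>u. optimal_control D S N \<theta> yd f u \<longrightarrow> L2_eq D u (T (yd, f))))"


section \<open>Functions on the torus\<close>

text \<open>
  Functions on $\mathbb T^d$ are \<open>2\<pi>\<close>-periodic functions on $\mathbb R^d$, and integrals over
  $\mathbb T^d$ are integrals over the cube $(0,2\pi)^d$.  Vector and matrix fields are written
  with the point first and natural-number component indices after it; components are indexed by
  \<open>{..<m}\<close> and others are never used.
\<close>

definition torus_cube :: "(real^'d) set" where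
  "torus_cube = {x. \<forall>i. 0 < x $ i \<and> x $ i < 2 * pi}"

definition L2_torus :: "(real^'d \<Rightarrow> real) set" where
  "L2_torus = {v \<in> L2 torus_cube. \<forall>x i. v (x + axis i (2 * pi)) = v x}"

definition extension_operator ::
  "(real^'d) set \<Rightarrow> ((real^'d \<Rightarrow> real) \<Rightarrow> (real^'d \<Rightarrow> real)) \<Rightarrow> bool" where
  "extension_operator D E \<longleftrightarrow>
     L2_bounded_linear D torus_cube E \<and>
     (\<forall>u\<in>L2 D. E u \<in> L2_torus \<and> L2_eq D (E u) u)"

definition freq_phase :: "int^'d \<Rightarrow> real^'d \<Rightarrow> real" where
  "freq_phase k x = (\<Sum>i\<in>UNIV. of_int (k $ i) * x $ i)"

definition fourier_coeff :: "(real^'d \<Rightarrow> real) \<Rightarrow> int^'d \<Rightarrow> complex" where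
  "fourier_coeff v k =
     (LINT x|lebesgue_on torus_cube. complex_of_real (v x) * cis (- freq_phase k x))
       / of_real ((2 * pi) ^ CARD('d))"

definition freq_modes :: "nat \<Rightarrow> (int^'d) set" where
  "freq_modes kmax = {k. \<forall>i. \<bar>k $ i\<bar> \<le> int kmax}"

lemma finite_freq_modes: "finite (freq_modes kmax :: (int^'d) set)"
proof -
  have "freq_modes kmax \<subseteq>
      (\<lambda>f. \<chi> i. f i) ` (PiE (UNIV :: 'd set) (\<lambda>_. {- int kmax..int kmax}))"
  proof
    fix k :: "int^'d" assume "k \<in> freq_modes kmax"
    then have "\<bar>k $ i\<bar> \<le> int kmax" for i
      by (simp add: freq_modes_def)
    then have "(\<lambda>i. k $ i) \<in> PiE UNIV (\<lambda>_. {- int kmax..int kmax})"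
      by (auto simp: PiE_UNIV_domain abs_le_iff minus_le_iff)
    then show "k \<in> (\<lambda>f. \<chi> i. f i) ` (PiE (UNIV :: 'd set) (\<lambda>_. {- int kmax..int kmax}))"
      by (intro image_eqI[of _ _ "\<lambda>i. k $ i"]) auto
  qed
  then show ?thesis
    by (rule finite_subset) (intro finite_imageI finite_PiE; simp)
qed

text \<open>Convolution of an $m \times m$ matrix field with an $\mathbb R^m$-valued field.\<close>

definition torus_conv ::
  "nat \<Rightarrow> (real^'d \<Rightarrow> nat \<Rightarrow> nat \<Rightarrow> real) \<Rightarrow> (real^'d \<Rightarrow> nat \<Rightarrow> real) \<Rightarrow>
   (real^'d \<Rightarrow> nat \<Rightarrow> real)" where
  "torus_conv m \<phi> v = (\<lambda>x i. LINT y|lebesgue_on torus_cube. (\<Sum>j<m. \<phi> (x - y) i j * v y j))"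


section \<open>Network modules\<close>

subsection \<open>FNO modules\<close>

text \<open>
  For Hermitian multipliers (see \<open>hermitian_multiplier\<close>) the truncated Fourier sum is real, and
  \<open>Re\<close> merely changes the type.
\<close>

definition fno_layer ::
  "(real \<Rightarrow> real) \<Rightarrow> nat \<Rightarrow> nat \<Rightarrow> (int^'d \<Rightarrow> nat \<Rightarrow> nat \<Rightarrow> complex) \<Rightarrow> (nat \<Rightarrow> nat \<Rightarrow> real) \<Rightarrow>
   (real^'d \<Rightarrow> nat \<Rightarrow> real) \<Rightarrow> (real^'d \<Rightarrow> nat \<Rightarrow> real)" where
  "fno_layer \<sigma> m kmax R W v = (\<lambda>x i.
     \<sigma> (Re (\<Sum>k\<in>freq_modes kmax.
              (\<Sum>j<m. R k i j * fourier_coeff (\<lambda>y. v y j) k) * cis (freq_phase k x))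
        + (\<Sum>j<m. W i j * v x j)))"

primrec fno_kernel ::
  "(real \<Rightarrow> real) \<Rightarrow> nat \<Rightarrow> nat \<Rightarrow> (nat \<Rightarrow> int^'d \<Rightarrow> nat \<Rightarrow> nat \<Rightarrow> complex) \<Rightarrow>
   (nat \<Rightarrow> nat \<Rightarrow> nat \<Rightarrow> real) \<Rightarrow> nat \<Rightarrow> (real^'d \<Rightarrow> nat \<Rightarrow> real) \<Rightarrow> (real^'d \<Rightarrow> nat \<Rightarrow> real)" where
  "fno_kernel \<sigma> m kmax R W 0 v = v"
| "fno_kernel \<sigma> m kmax R W (Suc l) v =
     fno_layer \<sigma> m kmax (R l) (W l) (fno_kernel \<sigma> m kmax R W l v)"

text \<open>The condition on \<open>R\<close> under which the Fourier layer maps real fields to real fields.\<close>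

definition hermitian_multiplier ::
  "nat \<Rightarrow> nat \<Rightarrow> (int^'d \<Rightarrow> nat \<Rightarrow> nat \<Rightarrow> complex) \<Rightarrow> bool" where
  "hermitian_multiplier m kmax R \<longleftrightarrow>
     (\<forall>k\<in>freq_modes kmax. \<forall>i<m. \<forall>j<m. R (- k) i j = cnj (R k i j))"

definition fno_module ::
  "(real^'d) set \<Rightarrow> (real \<Rightarrow> real) \<Rightarrow> ((real^'d \<Rightarrow> real) \<Rightarrow> (real^'d \<Rightarrow> real)) \<Rightarrow> bool" where
  "fno_module D \<sigma> A \<longleftrightarrow>
     (\<exists>E m kmax L' P Q R W.
        extension_operator D E \<and> m \<ge> 1 \<and> L' \<ge> 1 \<and>
        (\<forall>l<L'. hermitian_multiplier m kmax (R l)) \<and>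
        A = (\<lambda>u x. \<Sum>i<m. Q i * fno_kernel \<sigma> m kmax R W L' (\<lambda>y j. P j * E u y) x i))"

subsection \<open>\<open>Q\<^sub>S\<close> modules\<close>

definition qs_kernel ::
  "nat \<Rightarrow> (nat \<Rightarrow> nat \<Rightarrow> real) \<Rightarrow> (real^'d \<Rightarrow> nat \<Rightarrow> nat \<Rightarrow> real) \<Rightarrow>
   (real^'d \<Rightarrow> nat \<Rightarrow> real) \<Rightarrow> (real^'d \<Rightarrow> nat \<Rightarrow> real)" where
  "qs_kernel m V \<phi> v = (\<lambda>x i.
     (\<Sum>j<m. (\<Sum>l<m. V l i * V l j) * v x j)
     + torus_conv m (\<lambda>z a b. \<phi> (- z) b a) (torus_conv m \<phi> v) x i)"

definition qs_module ::
  "(real^'d) set \<Rightarrow> real \<Rightarrow> ((real^'d \<Rightarrow> real) \<Rightarrow> (real^'d \<Rightarrow> real)) \<Rightarrow> bool" where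
  "qs_module D \<gamma> A \<longleftrightarrow>
     (\<exists>E m P V \<phi>.
        extension_operator D E \<and> m \<ge> 1 \<and>
        (\<forall>i<m. \<forall>j<m. (\<lambda>x. \<phi> x i j) \<in> L2_torus) \<and>
        A = (\<lambda>u x. (\<Sum>i<m. P i * qs_kernel m V \<phi> (\<lambda>y j. P j * E u y) x i) + \<gamma> * u x))"

subsection \<open>\<open>Q\<^sub>A\<close> modules\<close>

text \<open>
  Column labels of a weight matrix acting on a vector \<open>(v, r, \<xi>, \<eta>)\<close>, where \<open>v\<close> is the previous
  layer, \<open>r\<close> and \<open>\<eta>\<close> are scalars and \<open>\<xi> \<in> \<real>\<^sup>m\<close>.
\<close>

datatype 'm column = Hidden nat | In_r | In_xi 'm | In_eta

definition weight_apply ::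
  "(nat \<Rightarrow> 'm::finite column \<Rightarrow> real) \<Rightarrow> nat \<Rightarrow> (nat \<Rightarrow> real) \<Rightarrow> real \<Rightarrow> real^'m \<Rightarrow> real \<Rightarrow>
   nat \<Rightarrow> real" where
  "weight_apply W n v r \<xi> \<eta> i =
     (\<Sum>j<n. W i (Hidden j) * v j) + W i In_r * r + (\<Sum>j\<in>UNIV. W i (In_xi j) * \<xi> $ j)
     + W i In_eta * \<eta>"

text \<open>\<open>n l\<close> is the width of the \<open>l\<close>-th layer; layer 0 has the input \<open>(r, r, \<xi>, \<eta>)\<close>.\<close>

primrec relu_layers ::
  "(nat \<Rightarrow> nat) \<Rightarrow> (nat \<Rightarrow> nat \<Rightarrow> 'm::finite column \<Rightarrow> real) \<Rightarrow> (nat \<Rightarrow> nat \<Rightarrow> real) \<Rightarrow>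
   real \<Rightarrow> real^'m \<Rightarrow> real \<Rightarrow> nat \<Rightarrow> (nat \<Rightarrow> real)" where
  "relu_layers n W b r \<xi> \<eta> 0 = weight_apply (W 0) 1 (\<lambda>_. r) r \<xi> \<eta>"
| "relu_layers n W b r \<xi> \<eta> (Suc l) = (\<lambda>i.
     max 0 (weight_apply (W (Suc l)) (n l) (relu_layers n W b r \<xi> \<eta> l) r \<xi> \<eta> i + b (Suc l) i))"

definition relu_net ::
  "nat \<Rightarrow> (nat \<Rightarrow> nat) \<Rightarrow> (nat \<Rightarrow> nat \<Rightarrow> 'm::finite column \<Rightarrow> real) \<Rightarrow> (nat \<Rightarrow> nat \<Rightarrow> real) \<Rightarrow>
   real \<Rightarrow> real^'m \<Rightarrow> real \<Rightarrow> real" where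
  "relu_net M n W b r \<xi> \<eta> =
     weight_apply (W M) (n (M - 1)) (relu_layers n W b r \<xi> \<eta> (M - 1)) r \<xi> \<eta> 0 + b M 0"

definition qa_module ::
  "(real^'d \<Rightarrow> real^'m) \<Rightarrow> (real^'d \<Rightarrow> real) \<Rightarrow> ((real^'d \<Rightarrow> real) \<Rightarrow> (real^'d \<Rightarrow> real)) \<Rightarrow> bool"
  where
  "qa_module \<mu> lam A \<longleftrightarrow>
     (\<exists>M n W b. M \<ge> 1 \<and> (\<forall>l. n l \<ge> 1) \<and>
        A = (\<lambda>u x. relu_net M n W b (u x) (\<mu> x) (lam x)))"


section \<open>The iUzawa-Net\<close>

primrec iuzawa_iter ::
  "real \<Rightarrow> (nat \<Rightarrow> (real^'d \<Rightarrow> real) \<Rightarrow> (real^'d \<Rightarrow> real)) \<Rightarrow>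
   (nat \<Rightarrow> (real^'d \<Rightarrow> real) \<Rightarrow> (real^'d \<Rightarrow> real)) \<Rightarrow>
   (nat \<Rightarrow> (real^'d \<Rightarrow> real) \<Rightarrow> (real^'d \<Rightarrow> real)) \<Rightarrow>
   (nat \<Rightarrow> (real^'d \<Rightarrow> real) \<Rightarrow> (real^'d \<Rightarrow> real)) \<Rightarrow>
   (real^'d \<Rightarrow> real) \<Rightarrow> (real^'d \<Rightarrow> real) \<Rightarrow> nat \<Rightarrow> (real^'d \<Rightarrow> real) \<times> (real^'d \<Rightarrow> real)" where
  "iuzawa_iter \<tau> S A QS QA yd f 0 = ((\<lambda>x. 0), (\<lambda>x. 0))"
| "iuzawa_iter \<tau> S A QS QA yd f (Suc k) =
     (let u = fst (iuzawa_iter \<tau> S A QS QA yd f k);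
          p = snd (iuzawa_iter \<tau> S A QS QA yd f k);
          u' = QA k (\<lambda>x. \<tau> * u x - A k p x);
          p' = (\<lambda>x. p x + QS k (\<lambda>z. S k (\<lambda>y. u' y + f y) z - p z - yd z) x)
      in (u', p'))"

definition iuzawa_net ::
  "(real^'d) set \<Rightarrow> (real^'d \<Rightarrow> real^'m) \<Rightarrow> (real^'d \<Rightarrow> real) \<Rightarrow> (real \<Rightarrow> real) \<Rightarrow> real \<Rightarrow> real \<Rightarrow>
   nat \<Rightarrow> ((real^'d \<Rightarrow> real) \<times> (real^'d \<Rightarrow> real) \<Rightarrow> (real^'d \<Rightarrow> real)) \<Rightarrow> bool" where
  "iuzawa_net D \<mu> lam \<sigma> \<tau> \<gamma> L \<T> \<longleftrightarrow>
     (\<exists>S A QS QA.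
        (\<forall>k<L. fno_module D \<sigma> (S k) \<and> fno_module D \<sigma> (A k) \<and>
               qs_module D \<gamma> (QS k) \<and> qa_module \<mu> lam (QA k)) \<and>
        \<T> = (\<lambda>(yd, f). fst (iuzawa_iter \<tau> S A QS QA yd f L)))"

text \<open>
  A continuous superposition operator \<open>v \<mapsto> \<sigma> \<circ> v\<close> maps $L^2$ of a set of finite measure to itself
  iff \<open>\<sigma>\<close> has at most linear growth.  A linear activation with an offset does not count as
  nonlinear.
\<close>

definition nonlinear_activation :: "(real \<Rightarrow> real) \<Rightarrow> bool" where
  "nonlinear_activation \<sigma> \<longleftrightarrow>
     continuous_on UNIV \<sigma> \<and> (\<exists>C. \<forall>s. \<bar>\<sigma> s\<bar> \<le> C * (1 + \<bar>s\<bar>)) \<and>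
     \<not> (\<exists>a b. \<forall>s. \<sigma> s = a * s + b)"

end

theory Submission
  imports Defs "HOL-Computational_Algebra.Polynomial"
begin

text \<open>
  Comparing two optimal controls with their midpoint shows that \<open>T\<close> is Lipschitz, so on a compact
  set it is, up to a small error, a Lipschitz map of the finitely many averages of \<open>y\<^sub>d\<close> and \<open>f\<close>
  over the cells of a partition, with values constant on the cells.

  The first update produces a constant \<open>c\<close>, so that the functionals of \<open>c + f\<close> used by \<open>\<S>\<^sup>0\<close> stay
  near a nonzero value \<open>b\<close>; this replaces the missing biases of FNO modules.  One Fourier layer
  approximates every \<open>\<omega> b * F (x, z)\<close>, where \<open>z\<close> are ratios of functionals to \<open>b\<close> and \<open>\<omega>\<close> is a
  fixed injective profile extracted from finite differences of the activation.  In this way \<open>\<S>\<^sup>0\<close>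
  writes the averages of \<open>f\<close> into functions orthogonal to all indicators of cells, so \<open>p\<^sup>1\<close>
  still contains the averages of \<open>y\<^sub>d\<close>.  Next, \<open>\<A>\<^sup>1\<close> reads both families from \<open>p\<^sup>1\<close>,
  quantises them and outputs at \<open>x\<close> the number \<open>\<omega> b * 4 ^ k\<close>, whose exponent encodes the quantised
  data and the cell containing \<open>x\<close>; a continuous digit map misrounds only near its jumps, and
  shifting the grid by a coordinate of \<open>x\<close> confines this to a set of small measure.  The
  activation network \<open>\<Q>\<^sub>A\<^sup>1\<close> only has to apply a continuous function of one variable to decode
  this number.
\<close>

section \<open>Profiles of the activation\<close>

text \<open>The obstacle is homogeneity. A Fourier layer has no biases, so \<sigma> acts on forms
  linear in the functionals of the input. After division by one functional b they become
  \<open>b * l\<close> with l affine in the remaining ratios. Since b varies with the data, what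
  gets approximated is a product of a function of b and a function of position and ratios. The last
  activation network sees a single number at each point and must both remove the unknown factor
  \<open>\<omega> b\<close> and compute the control. Hence the second factor is restricted to powers
  of 4: the ranges of \<open>\<omega> b * 4 ^ k\<close> are disjoint, and k and b can be separated.
  Discrete values call for quantisation, and as the modules produce continuous functions, errors at
  the jumps must be confined to small sets of positions, with a measure bound uniform in the data. A
  second obstacle is that p^1 is the only quantity containing both data. So f is stored there in
  oscillations that are orthogonal to each other and to the cell indicators, with an amplitude so
  large that the component of y_d along them is negligible in comparison.\<close>

inductive_set nets :: "(real \<Rightarrow> real) \<Rightarrow> ('a \<Rightarrow> real) set \<Rightarrow> (real \<Rightarrow> 'a \<Rightarrow> real) set"
  for \<sigma> :: "real \<Rightarrow> real" and L :: "('a \<Rightarrow> real) set" where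
  zero: "(\<lambda>b x. 0) \<in> nets \<sigma> L"
| step: "g \<in> nets \<sigma> L \<Longrightarrow> l \<in> L \<Longrightarrow> (\<lambda>b x. g b x + q * \<sigma> (b * l x)) \<in> nets \<sigma> L"

lemma nets_add:
  assumes "g \<in> nets \<sigma> L" "h \<in> nets \<sigma> L"
  shows "(\<lambda>b x. g b x + h b x) \<in> nets \<sigma> L"
  using assms(2)
proof (induction rule: nets.induct)
  case zero
  then show ?case using assms(1) by simp
next
  case (step h l q)
  from nets.step[OF step.IH step.hyps(2), of q] show ?case by (simp add: add.assoc)
qed

lemma nets_scale:
  assumes "g \<in> nets \<sigma> L"
  shows "(\<lambda>b x. c * g b x) \<in> nets \<sigma> L"
  using assms
proof (induction rule: nets.induct)
  case zero
  then show ?case using nets.zero by simp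
next
  case (step h l q)
  from nets.step[OF step.IH step.hyps(2), of "c * q"] show ?case by (simp add: algebra_simps)
qed

lemma nets_sum:
  assumes "\<And>i. i \<in> I \<Longrightarrow> g i \<in> nets \<sigma> L"
  shows "(\<lambda>b x. \<Sum>i\<in>I. g i b x) \<in> nets \<sigma> L"
  using assms
  by (induction I rule: infinite_finite_induct) (auto intro: nets.zero nets_add)

text \<open>Since \<sigma> sees only the product \<open>b * l x\<close>, a dilation of b can be
  moved into the forms.\<close>

lemma nets_compose:
  assumes "g \<in> nets \<sigma> L" and "\<And>l. l \<in> L \<Longrightarrow> (\<lambda>x. k * l (\<phi> x)) \<in> L'"
  shows "(\<lambda>b x. g (k * b) (\<phi> x)) \<in> nets \<sigma> L'"
  using assms(1)
proof (induction rule: nets.induct)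
  case zero
  then show ?case by (rule nets.zero)
next
  case (step h l q)
  from nets.step[OF step.IH assms(2)[OF step.hyps(2)], of q] show ?case
    by (simp add: mult_ac)
qed

lemma nets_finite_sum:
  assumes "g \<in> nets \<sigma> L"
  obtains n :: nat and q l where "\<And>i. i < n \<Longrightarrow> l i \<in> L" "g = (\<lambda>b x. \<Sum>i<n. q i * \<sigma> (b * l i x))"
proof -
  have "\<exists>n q l. (\<forall>i<n. l i \<in> L) \<and> g = (\<lambda>b x. \<Sum>i<n::nat. q i * \<sigma> (b * l i x))"
    using assms
  proof (induction rule: nets.induct)
    case zero
    show ?case by (rule exI[of _ 0]) simp
  next
    case (step g l q)
    then obtain n q' l' where IH: "\<forall>i<n. l' i \<in> L"
      "g = (\<lambda>b x. \<Sum>i<n::nat. q' i * \<sigma> (b * l' i x))" by blast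
    have "(\<forall>i<Suc n. (l'(n := l)) i \<in> L) \<and> (\<lambda>b x. g b x + q * \<sigma> (b * l x)) =
       (\<lambda>b x. \<Sum>i<Suc n. (q'(n := q)) i * \<sigma> (b * (l'(n := l)) i x))"
      using IH step.hyps by (auto simp: less_Suc_eq)
    then show ?case by blast
  qed
  then obtain n q l where "\<forall>i<n. l i \<in> L" "g = (\<lambda>b x. \<Sum>i<n::nat. q i * \<sigma> (b * l i x))"
    by blast
  then show ?thesis by (intro that[of n l q]) auto
qed

text \<open>In the applications b is a functional of the unknown input, so the net must be chosen
  before b; hence one g serves all b in I.\<close>

definition net_approx ::
  "(real \<Rightarrow> real) \<Rightarrow> ('a \<Rightarrow> real) set \<Rightarrow> real set \<Rightarrow> 'a set \<Rightarrow> (real \<Rightarrow> 'a \<Rightarrow> real) \<Rightarrow> bool" where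
  "net_approx \<sigma> L I X F \<longleftrightarrow>
     (\<forall>e>0. \<exists>g\<in>nets \<sigma> L. \<forall>b\<in>I. \<forall>x\<in>X. \<bar>F b x - g b x\<bar> \<le> e)"

lemma net_approxI:
  assumes "\<And>e. e > 0 \<Longrightarrow> \<exists>g\<in>nets \<sigma> L. \<forall>b\<in>I. \<forall>x\<in>X. \<bar>F b x - g b x\<bar> \<le> e"
  shows "net_approx \<sigma> L I X F"
  using assms unfolding net_approx_def by blast

lemma net_approxD:
  assumes "net_approx \<sigma> L I X F" "e > 0"
  obtains g where "g \<in> nets \<sigma> L" "\<And>b x. b \<in> I \<Longrightarrow> x \<in> X \<Longrightarrow> \<bar>F b x - g b x\<bar> \<le> e"
  using assms unfolding net_approx_def by meson

lemma net_approx_limit: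
  assumes "\<And>e. e > 0 \<Longrightarrow> \<exists>G. net_approx \<sigma> L I X G \<and> (\<forall>b\<in>I. \<forall>x\<in>X. \<bar>F b x - G b x\<bar> \<le> e)"
  shows "net_approx \<sigma> L I X F"
proof (rule net_approxI)
  fix e :: real assume "e > 0"
  then obtain G where G: "net_approx \<sigma> L I X G" "\<forall>b\<in>I. \<forall>x\<in>X. \<bar>F b x - G b x\<bar> \<le> e/2"
    using assms[of "e/2"] by auto
  obtain g where g: "g \<in> nets \<sigma> L" "\<And>b x. b \<in> I \<Longrightarrow> x \<in> X \<Longrightarrow> \<bar>G b x - g b x\<bar> \<le> e/2"
    using net_approxD[OF G(1), of "e/2"] \<open>e > 0\<close> by auto
  have "\<bar>F b x - g b x\<bar> \<le> e" if "b \<in> I" "x \<in> X" for b x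
    using bspec[OF bspec[OF G(2) that(1)] that(2)] g(2)[OF that] by linarith
  with g(1) show "\<exists>g\<in>nets \<sigma> L. \<forall>b\<in>I. \<forall>x\<in>X. \<bar>F b x - g b x\<bar> \<le> e" by blast
qed

lemma net_approx_nets:
  assumes "g \<in> nets \<sigma> L" shows "net_approx \<sigma> L I X g"
  by (rule net_approxI) (use assms in \<open>auto intro!: bexI[of _ g]\<close>)

lemma net_approx_add:
  assumes F: "net_approx \<sigma> L I X F" and G: "net_approx \<sigma> L I X G"
  shows "net_approx \<sigma> L I X (\<lambda>b x. F b x + G b x)"
proof (rule net_approxI)
  fix e :: real assume "e > 0"
  then obtain f g where f: "f \<in> nets \<sigma> L" "\<And>b x. b \<in> I \<Longrightarrow> x \<in> X \<Longrightarrow> \<bar>F b x - f b x\<bar> \<le> e/2"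
    and g: "g \<in> nets \<sigma> L" "\<And>b x. b \<in> I \<Longrightarrow> x \<in> X \<Longrightarrow> \<bar>G b x - g b x\<bar> \<le> e/2"
    using net_approxD[OF F, of "e/2"] net_approxD[OF G, of "e/2"] by (metis half_gt_zero)
  have "\<bar>F b x + G b x - (f b x + g b x)\<bar> \<le> e" if "b \<in> I" "x \<in> X" for b x
    using f(2)[OF that] g(2)[OF that] by linarith
  then show "\<exists>g\<in>nets \<sigma> L. \<forall>b\<in>I. \<forall>x\<in>X. \<bar>F b x + G b x - g b x\<bar> \<le> e"
    using nets_add[OF f(1) g(1)] by (intro bexI[where x = "\<lambda>b x. f b x + g b x"]) auto
qed

lemma net_approx_scale:
  assumes F: "net_approx \<sigma> L I X F"
  shows "net_approx \<sigma> L I X (\<lambda>b x. c * F b x)"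
proof (rule net_approxI)
  fix e :: real assume "e > 0"
  then have "e / (\<bar>c\<bar> + 1) > 0" by simp
  then obtain f where f: "f \<in> nets \<sigma> L" "\<And>b x. b \<in> I \<Longrightarrow> x \<in> X \<Longrightarrow> \<bar>F b x - f b x\<bar> \<le> e / (\<bar>c\<bar> + 1)"
    using net_approxD[OF F] by metis
  have "\<bar>c * F b x - c * f b x\<bar> \<le> e" if "b \<in> I" "x \<in> X" for b x
  proof -
    have "\<bar>c * F b x - c * f b x\<bar> = \<bar>c\<bar> * \<bar>F b x - f b x\<bar>"
      by (simp add: abs_mult flip: right_diff_distrib)
    also have "\<dots> \<le> (\<bar>c\<bar> + 1) * (e / (\<bar>c\<bar> + 1))"
      by (intro mult_mono f(2) that) auto
    finally show ?thesis by simp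
  qed
  then show "\<exists>g\<in>nets \<sigma> L. \<forall>b\<in>I. \<forall>x\<in>X. \<bar>c * F b x - g b x\<bar> \<le> e"
    using nets_scale[OF f(1)] by (intro bexI[where x = "\<lambda>b x. c * f b x"]) auto
qed

lemma net_approx_zero: "net_approx \<sigma> L I X (\<lambda>b x. 0)"
  by (rule net_approx_nets[OF nets.zero])

lemma net_approx_sum:
  assumes "\<And>i. i \<in> J \<Longrightarrow> net_approx \<sigma> L I X (F i)"
  shows "net_approx \<sigma> L I X (\<lambda>b x. \<Sum>i\<in>J. F i b x)"
  using assms
  by (induction J rule: infinite_finite_induct) (auto intro: net_approx_zero net_approx_add)

lemma net_approx_compose:
  assumes F: "net_approx \<sigma> L I X F"
    and L': "\<And>l. l \<in> L \<Longrightarrow> (\<lambda>x. k * l (\<phi> x)) \<in> L'"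
    and I: "\<And>b. b \<in> I' \<Longrightarrow> k * b \<in> I" and X: "\<And>x. x \<in> X' \<Longrightarrow> \<phi> x \<in> X"
  shows "net_approx \<sigma> L' I' X' (\<lambda>b x. F (k * b) (\<phi> x))"
proof (rule net_approxI)
  fix e :: real assume "e > 0"
  then obtain f where f: "f \<in> nets \<sigma> L" "\<And>b x. b \<in> I \<Longrightarrow> x \<in> X \<Longrightarrow> \<bar>F b x - f b x\<bar> \<le> e"
    using net_approxD[OF F] by metis
  show "\<exists>g\<in>nets \<sigma> L'. \<forall>b\<in>I'. \<forall>x\<in>X'. \<bar>F (k * b) (\<phi> x) - g b x\<bar> \<le> e"
    using nets_compose[OF f(1) L'] f(2)[OF I X]
    by (intro bexI[where x = "\<lambda>b x. f (k * b) (\<phi> x)"]) auto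
qed

lemma net_approx_subset:
  assumes F: "net_approx \<sigma> L I X F" and "I' \<subseteq> I" "X' \<subseteq> X"
    "\<And>b x. b \<in> I' \<Longrightarrow> x \<in> X' \<Longrightarrow> G b x = F b x"
  shows "net_approx \<sigma> L I' X' G"
proof (rule net_approxI)
  fix e :: real assume "e > 0"
  then obtain f where f: "f \<in> nets \<sigma> L" "\<And>b x. b \<in> I \<Longrightarrow> x \<in> X \<Longrightarrow> \<bar>F b x - f b x\<bar> \<le> e"
    using net_approxD[OF F] by metis
  then show "\<exists>g\<in>nets \<sigma> L. \<forall>b\<in>I'. \<forall>x\<in>X'. \<bar>G b x - g b x\<bar> \<le> e"
    using assms by (intro bexI[of _ f]) (auto simp: subset_iff)
qed

text \<open>Riemann sums are compared with an antiderivative, so no integrals occur.\<close>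

lemma mvt_increment:
  fixes A g :: "real \<Rightarrow> real"
  assumes "\<And>t. (A has_real_derivative g t) (at t)"
  obtains \<xi> where "\<bar>\<xi> - a\<bar> \<le> \<bar>d\<bar>" "A (a + d) - A a = d * g \<xi>"
proof (cases d "0::real" rule: linorder_cases)
  case less
  then obtain z where "z > a + d" "z < a" "A a - A (a + d) = (a - (a + d)) * g z"
    using MVT2[of "a + d" a A g] assms by auto
  then show ?thesis using less by (intro that[of z]) (auto simp: algebra_simps)
next
  case equal
  then show ?thesis by (intro that[of a]) auto
next
  case greater
  then obtain z where "z > a" "z < a + d" "A (a + d) - A a = (a + d - a) * g z"
    using MVT2[of a "a + d" A g] assms by auto
  then show ?thesis using greater by (intro that[of z]) (auto simp: algebra_simps)
qed

text \<open>On each subinterval the increment of A is the step times a value of g at an intermediate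
  point, which differs from the left value by at most the oscillation. The second copy of |h| in the
  range bound allows for this point overshooting by one step.\<close>

lemma riemann_sum_error:
  fixes A g :: "real \<Rightarrow> real"
  assumes A: "\<And>t. (A has_real_derivative g t) (at t)"
    and n: "n > 0"
    and osc: "\<And>u v. \<bar>u\<bar> \<le> M \<Longrightarrow> \<bar>v\<bar> \<le> M \<Longrightarrow> \<bar>u - v\<bar> \<le> \<bar>h\<bar> / real n \<Longrightarrow> \<bar>g u - g v\<bar> \<le> \<rho>"
    and M: "\<bar>t\<bar> + \<bar>h\<bar> + \<bar>h\<bar> \<le> M"
  shows "\<bar>A (t + h) - A t - h / real n * (\<Sum>k<n. g (t + real k * (h / real n)))\<bar> \<le> \<bar>h\<bar> * \<rho>"
proof -
  let ?d = "h / real n"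
  have tele: "A (t + h) - A t = (\<Sum>k<n. A (t + real (Suc k) * ?d) - A (t + real k * ?d))"
    using n by (subst sum_lessThan_telescope) auto
  have step: "\<bar>A (t + real (Suc k) * ?d) - A (t + real k * ?d) - ?d * g (t + real k * ?d)\<bar> \<le> \<bar>?d\<bar> * \<rho>"
    if k: "k < n" for k
  proof -
    obtain \<xi> where \<xi>: "\<bar>\<xi> - (t + real k * ?d)\<bar> \<le> \<bar>?d\<bar>"
      "A (t + real k * ?d + ?d) - A (t + real k * ?d) = ?d * g \<xi>"
      using mvt_increment[OF A, of "t + real k * ?d" ?d] by metis
    have kd: "\<bar>real k * ?d\<bar> \<le> \<bar>h\<bar>"
      using k n by (simp add: abs_mult divide_simps mult.commute[of _ "\<bar>h\<bar>"] mult_left_mono)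
    have d: "\<bar>?d\<bar> \<le> \<bar>h\<bar>" using n by (simp add: divide_simps mult_le_cancel_left1)
    have "\<bar>g \<xi> - g (t + real k * ?d)\<bar> \<le> \<rho>"
    proof (rule osc)
      show "\<bar>\<xi> - (t + real k * ?d)\<bar> \<le> \<bar>h\<bar> / real n" using \<xi>(1) by (simp add: abs_divide)
    qed (use \<xi>(1) kd d M in linarith)+
    then have "\<bar>?d\<bar> * \<bar>g \<xi> - g (t + real k * ?d)\<bar> \<le> \<bar>?d\<bar> * \<rho>"
      by (intro mult_left_mono) auto
    moreover have "A (t + real (Suc k) * ?d) - A (t + real k * ?d) - ?d * g (t + real k * ?d)
      = ?d * (g \<xi> - g (t + real k * ?d))"
    proof -
      have "t + real (Suc k) * ?d = t + real k * ?d + ?d" by (simp only: of_nat_Suc distrib_right mult_1_left add.assoc add.commute)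
      then show ?thesis using \<xi>(2) by (simp only: right_diff_distrib)
    qed
    ultimately show ?thesis by (simp add: abs_mult)
  qed
  have "\<bar>A (t + h) - A t - ?d * (\<Sum>k<n. g (t + real k * ?d))\<bar>
     = \<bar>\<Sum>k<n. A (t + real (Suc k) * ?d) - A (t + real k * ?d) - ?d * g (t + real k * ?d)\<bar>"
    unfolding tele by (simp add: sum_subtractf sum_distrib_left)
  also have "\<dots> \<le> (\<Sum>k<n. \<bar>?d\<bar> * \<rho>)"
    by (rule order_trans[OF sum_abs sum_mono]) (use step in auto)
  also have "\<dots> = \<bar>h\<bar> * \<rho>" using n by (simp add: abs_divide)
  finally show ?thesis .
qed

lemma antiderivative_exists:
  fixes g :: "real \<Rightarrow> real"
  assumes "continuous_on UNIV g"
  obtains A where "\<And>t. (A has_real_derivative g t) (at t)" "A 0 = 0"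
proof -
  have "\<exists>F. \<forall>x\<in>UNIV. (F has_vector_derivative g x) (at x)"
  proof -
    define F where "F x = (if x \<ge> 0 then integral {0..x} g else - integral {x..0} g)" for x
    have F: "F x = integral {a..x} g - integral {a..0} g" if "a \<le> x" "a \<le> 0" for a x
    proof -
      have int: "g integrable_on {u..v}" for u v
        by (rule integrable_continuous_real) (rule continuous_on_subset[OF assms], simp)
      show ?thesis
      proof (cases "x \<ge> 0")
        case True
        then show ?thesis using Henstock_Kurzweil_Integration.integral_combine[OF that(2) True int] by (simp add: F_def)
      next
        case False
        then show ?thesis
          using Henstock_Kurzweil_Integration.integral_combine[OF that(1), of 0 g] int by (simp add: F_def)
      qed
    qed
    have "(F has_vector_derivative g x) (at x)" for x
    proof -
      define a where "a = min x 0 - 1"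
      define b where "b = max x 0 + 1"
      have "((\<lambda>u. integral {a..u} g) has_vector_derivative g x) (at x within {a..b})"
        by (rule integral_has_vector_derivative) (use assms in \<open>auto simp: a_def b_def intro: continuous_on_subset\<close>)
      then have "((\<lambda>u. integral {a..u} g) has_vector_derivative g x) (at x)"
        using at_within_Icc_at[of a x b] by (simp add: a_def b_def)
      then have "((\<lambda>u. integral {a..u} g - integral {a..0} g) has_vector_derivative g x) (at x)"
        by (auto intro!: derivative_eq_intros simp: has_vector_derivative_def)
      then show ?thesis
      proof (rule has_vector_derivative_transform_within_open[where S = "{a<..<b}"])
        show "integral {a..u} g - integral {a..0} g = F u" if "u \<in> {a<..<b}" for u
          using F[of a u] that by (simp add: a_def)
      qed (auto simp: a_def b_def)
    qed
    then show ?thesis by blast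
  qed
  then obtain F where "\<And>x. (F has_real_derivative g x) (at x)"
    by (auto simp: has_real_derivative_iff_has_vector_derivative)
  then show ?thesis
    by (intro that[of "\<lambda>x. F x - F 0"]) (auto intro!: derivative_eq_intros simp del: UNIV_I)
qed

text \<open>The mixed increment of an antiderivative over h and y * e is evaluated in two ways: as
  two Riemann sums in h, and by the mean value theorem in y * e. Dividing by e puts e under \<rho>1,
  so the resolution n has to be chosen after e.\<close>

lemma shift_average_error:
  fixes g :: "real \<Rightarrow> real"
  assumes g: "continuous_on UNIV g" and n: "n > 0" and e: "e > 0"
    and osc1: "\<And>u v. \<bar>u\<bar> \<le> M \<Longrightarrow> \<bar>v\<bar> \<le> M \<Longrightarrow> \<bar>u - v\<bar> \<le> \<bar>h\<bar> / real n \<Longrightarrow> \<bar>g u - g v\<bar> \<le> \<rho>1"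
    and osc2: "\<And>u v. \<bar>u\<bar> \<le> M \<Longrightarrow> \<bar>v\<bar> \<le> M \<Longrightarrow> \<bar>u - v\<bar> \<le> \<bar>y * e\<bar> \<Longrightarrow> \<bar>g u - g v\<bar> \<le> \<rho>2"
    and M: "\<bar>t\<bar> + 2 * \<bar>h\<bar> + \<bar>y * e\<bar> \<le> M"
  shows "\<bar>y * (g (t + h) - g t) - h / real n / e *
     (\<Sum>k<n. g (t + y * e + real k * (h / real n)) - g (t + real k * (h / real n)))\<bar>
     \<le> 2 * \<bar>h\<bar> * \<rho>1 / e + 2 * \<bar>y\<bar> * \<rho>2"
proof -
  obtain A where A: "\<And>t. (A has_real_derivative g t) (at t)"
    using antiderivative_exists[OF g] by blast
  define S where "S t = h / real n * (\<Sum>k<n. g (t + real k * (h / real n)))" for t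
  have S1: "\<bar>A (t + h) - A t - S t\<bar> \<le> \<bar>h\<bar> * \<rho>1"
    unfolding S_def by (rule riemann_sum_error[OF A n osc1, where M = M]) (use M in auto)
  have S2: "\<bar>A (t + y * e + h) - A (t + y * e) - S (t + y * e)\<bar> \<le> \<bar>h\<bar> * \<rho>1"
    unfolding S_def by (rule riemann_sum_error[OF A n osc1, where M = M]) (use M in auto)
  obtain \<xi> where \<xi>: "\<bar>\<xi> - t\<bar> \<le> \<bar>y * e\<bar>" "A (t + y * e) - A t = y * e * g \<xi>"
    using mvt_increment[OF A] by metis
  obtain \<eta> where \<eta>: "\<bar>\<eta> - (t + h)\<bar> \<le> \<bar>y * e\<bar>" "A (t + h + y * e) - A (t + h) = y * e * g \<eta>"
    using mvt_increment[OF A] by metis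
  have g1: "\<bar>g \<xi> - g t\<bar> \<le> \<rho>2" by (rule osc2) (use \<xi> M in auto)
  have g2: "\<bar>g \<eta> - g (t + h)\<bar> \<le> \<rho>2" by (rule osc2) (use \<eta> M in auto)
  have "\<bar>y * e * (g \<eta> - g \<xi>) - (S (t + y * e) - S t)\<bar> \<le> 2 * (\<bar>h\<bar> * \<rho>1)"
  proof -
    have "A (t + h + y * e) = A (t + y * e + h)" by (simp add: add_ac)
    then have "y * e * (g \<eta> - g \<xi>) = (A (t + y * e + h) - A (t + y * e)) - (A (t + h) - A t)"
      using \<xi>(2) \<eta>(2) by (simp add: algebra_simps)
    then show ?thesis using S1 S2 by linarith
  qed
  then have "\<bar>y * e * (g \<eta> - g \<xi>) - (S (t + y * e) - S t)\<bar> / e \<le> 2 * (\<bar>h\<bar> * \<rho>1) / e"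
    using e by (intro divide_right_mono) auto
  moreover have "\<bar>y * e * (g \<eta> - g \<xi>) - (S (t + y * e) - S t)\<bar> / e
     = \<bar>y * (g \<eta> - g \<xi>) - (S (t + y * e) - S t) / e\<bar>"
    using e by (simp add: divide_simps abs_if) (simp add: algebra_simps)
  moreover have "\<bar>y * (g (t + h) - g t) - y * (g \<eta> - g \<xi>)\<bar> \<le> 2 * \<bar>y\<bar> * \<rho>2"
  proof -
    have "y * (g (t + h) - g t) - y * (g \<eta> - g \<xi>) = y * ((g (t + h) - g \<eta>) + (g \<xi> - g t))"
      by (simp add: algebra_simps)
    then have "\<bar>y * (g (t + h) - g t) - y * (g \<eta> - g \<xi>)\<bar> = \<bar>y\<bar> * \<bar>(g (t + h) - g \<eta>) + (g \<xi> - g t)\<bar>"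
      by (simp add: abs_mult)
    also have "\<dots> \<le> \<bar>y\<bar> * (2 * \<rho>2)"
      using g1 g2 by (intro mult_left_mono) linarith+
    finally show ?thesis by simp
  qed
  moreover have "(S (t + y * e) - S t) / e = h / real n / e *
     (\<Sum>k<n. g (t + y * e + real k * (h / real n)) - g (t + real k * (h / real n)))"
    by (simp add: S_def sum_subtractf algebra_simps diff_divide_distrib)
  ultimately have 1: "\<bar>y * (g \<eta> - g \<xi>) - h / real n / e *
     (\<Sum>k<n. g (t + y * e + real k * (h / real n)) - g (t + real k * (h / real n)))\<bar>
     \<le> 2 * \<bar>h\<bar> * \<rho>1 / e"
    and 2: "\<bar>y * (g (t + h) - g t) - y * (g \<eta> - g \<xi>)\<bar> \<le> 2 * \<bar>y\<bar> * \<rho>2"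
    by (simp_all add: mult.assoc)
  have tri: "\<bar>u - w\<bar> \<le> c + d" if "\<bar>v - w\<bar> \<le> c" "\<bar>u - v\<bar> \<le> d" for u v w c d :: real
    using that by linarith
  show ?thesis by (rule tri[OF 1 2])
qed

section \<open>Multiplication by a variable through shifts of the argument\<close>

definition shift_forms :: "(real \<times> real \<Rightarrow> real) set" where
  "shift_forms = {\<lambda>x. w * fst x + c + snd x | w c. True}"

text \<open>All M are required at once because differences in t evaluate the net outside the square
  under consideration. Continuity in all arguments supplies the uniform moduli for passing to
  limits.\<close>

definition shift_approx :: "(real \<Rightarrow> real) \<Rightarrow> (real \<Rightarrow> real \<times> real \<Rightarrow> real) \<Rightarrow> bool" where
  "shift_approx \<sigma> G \<longleftrightarrow> continuous_on UNIV (\<lambda>z. G (fst z) (snd z)) \<and>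
     (\<forall>M. net_approx \<sigma> shift_forms {-M..M} ({-M..M} \<times> {-M..M}) G)"

lemma shift_approx_add:
  "shift_approx \<sigma> F \<Longrightarrow> shift_approx \<sigma> G \<Longrightarrow> shift_approx \<sigma> (\<lambda>b x. F b x + G b x)"
  unfolding shift_approx_def by (auto intro: net_approx_add continuous_on_add)

lemma shift_approx_scale:
  "shift_approx \<sigma> F \<Longrightarrow> shift_approx \<sigma> (\<lambda>b x. c * F b x)"
  unfolding shift_approx_def by (auto intro: net_approx_scale continuous_on_mult_left)

lemma shift_approx_zero: "shift_approx \<sigma> (\<lambda>b x. 0)"
  unfolding shift_approx_def by (auto intro: net_approx_zero)

lemma shift_approx_sum:
  assumes "\<And>i. i \<in> J \<Longrightarrow> shift_approx \<sigma> (F i)"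
  shows "shift_approx \<sigma> (\<lambda>b x. \<Sum>i\<in>J. F i b x)"
  using assms
  by (induction J rule: infinite_finite_induct) (auto intro: shift_approx_zero shift_approx_add)

lemma shift_approx_base:
  assumes "continuous_on UNIV \<sigma>"
  shows "shift_approx \<sigma> (\<lambda>b x. \<sigma> (b * (snd x + c)))"
  unfolding shift_approx_def
proof (intro conjI allI)
  show "continuous_on UNIV (\<lambda>z. \<sigma> (fst z * (snd (snd z) + c)))"
    by (rule continuous_on_compose2[OF assms]) (auto intro!: continuous_intros)
  have "(\<lambda>b x. 0 + 1 * \<sigma> (b * (\<lambda>x. 0 * fst x + c + snd x) x)) \<in> nets \<sigma> shift_forms"
    by (rule nets.step[OF nets.zero]) (unfold shift_forms_def, blast)
  then have "(\<lambda>b x. \<sigma> (b * (snd x + c))) \<in> nets \<sigma> shift_forms" by (simp add: add_ac)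
  then show "net_approx \<sigma> shift_forms {- M..M} ({- M..M} \<times> {- M..M}) (\<lambda>b x. \<sigma> (b * (snd x + c)))" for M
    by (rule net_approx_nets)
qed

text \<open>The coefficient of the second component is kept equal to 1, so adding a multiple of the
  first component to it only changes w and c.\<close>

lemma nets_shift:
  assumes "g \<in> nets \<sigma> shift_forms"
  shows "(\<lambda>b x. g b (fst x, snd x + c + e * fst x)) \<in> nets \<sigma> shift_forms"
proof -
  have "(\<lambda>b x. g (1 * b) (fst x, snd x + c + e * fst x)) \<in> nets \<sigma> shift_forms"
  proof (rule nets_compose[OF assms])
    fix l assume "l \<in> shift_forms"
    then obtain w d where l: "l = (\<lambda>x. w * fst x + d + snd x)" unfolding shift_forms_def by blast
    have "(\<lambda>x. 1 * l (fst x, snd x + c + e * fst x)) = (\<lambda>x. (w + e) * fst x + (d + c) + snd x)"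
      by (auto simp: l algebra_simps)
    then show "(\<lambda>x. 1 * l (fst x, snd x + c + e * fst x)) \<in> shift_forms"
      unfolding shift_forms_def by blast
  qed
  then show ?thesis by simp
qed

text \<open>
  Multiplication by \<open>y\<close> costs one difference in \<open>t\<close>: it is the limit of averages of
  \<open>(G (t + e y) - G t) / e\<close>, and \<open>\<sigma>\<close> need not be differentiable.
\<close>

lemma shift_approx_difference:
  assumes G: "shift_approx \<sigma> G"
  shows "shift_approx \<sigma> (\<lambda>b x. fst x * (G b (fst x, snd x + h) - G b x))"
  unfolding shift_approx_def
proof (intro conjI allI)
  have cont: "continuous_on UNIV (\<lambda>z. G (fst z) (snd z))" using G by (simp add: shift_approx_def)
  show "continuous_on UNIV (\<lambda>z. fst (snd z) * (G (fst z) (fst (snd z), snd (snd z) + h) - G (fst z) (snd z)))"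
  proof (intro continuous_intros cont)
    show "continuous_on UNIV (\<lambda>z. G (fst z) (fst (snd z), snd (snd z) + h))"
      by (rule continuous_on_compose2[OF cont, of UNIV "\<lambda>z. (fst z, (fst (snd z), snd (snd z) + h))", simplified])
        (intro continuous_intros)
  qed
  fix M0 :: real
  show "net_approx \<sigma> shift_forms {-M0..M0} ({-M0..M0} \<times> {-M0..M0})
     (\<lambda>b x. fst x * (G b (fst x, snd x + h) - G b x))"
  proof (rule net_approxI)
    fix \<epsilon> :: real assume \<epsilon>: "\<epsilon> > 0"
    define M where "M = \<bar>M0\<bar> + 1"
    have M: "M \<ge> 1" "M0 \<le> M" by (auto simp: M_def)
    define M' where "M' = M + 2 * \<bar>h\<bar> + M"
    have "compact ({-M'..M'} \<times> ({-M'..M'} \<times> {-M'..M'}))" by (intro compact_Times compact_Icc)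
    then have uc: "uniformly_continuous_on ({-M'..M'} \<times> ({-M'..M'} \<times> {-M'..M'})) (\<lambda>z. G (fst z) (snd z))"
      by (intro compact_uniformly_continuous continuous_on_subset[OF cont]) auto
    have osc: "\<exists>d>0. \<forall>b y u v. \<bar>b\<bar> \<le> M' \<longrightarrow> \<bar>y\<bar> \<le> M' \<longrightarrow> \<bar>u\<bar> \<le> M' \<longrightarrow> \<bar>v\<bar> \<le> M' \<longrightarrow> \<bar>u - v\<bar> \<le> d
        \<longrightarrow> \<bar>G b (y,u) - G b (y,v)\<bar> \<le> \<rho>" if "\<rho> > 0" for \<rho>
    proof -
      obtain d where d: "d > 0" and dd: "\<And>z z'. z \<in> {-M'..M'} \<times> ({-M'..M'} \<times> {-M'..M'}) \<Longrightarrow>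
         z' \<in> {-M'..M'} \<times> ({-M'..M'} \<times> {-M'..M'}) \<Longrightarrow> dist z' z < d \<Longrightarrow>
         dist (G (fst z') (snd z')) (G (fst z) (snd z)) < \<rho>"
        using uc \<open>\<rho> > 0\<close> unfolding uniformly_continuous_on_def by metis
      have "\<bar>G b (y,u) - G b (y,v)\<bar> \<le> \<rho>" if "\<bar>b\<bar> \<le> M'" "\<bar>y\<bar> \<le> M'" "\<bar>u\<bar> \<le> M'" "\<bar>v\<bar> \<le> M'" "\<bar>u - v\<bar> \<le> d/2"
        for b y u v
        using dd[of "(b,(y,v))" "(b,(y,u))"] that d
        by (auto simp: dist_Pair_Pair dist_real_def abs_le_iff)
      then show ?thesis using d by (intro exI[of _ "d/2"]) auto
    qed
    \<comment> \<open>The order of choice matters: \<rho>2 bounds the oscillation over y * e and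
      thereby fixes e; \<rho>1 comes afterwards because its contribution is divided by e.\<close>
    define \<rho>2 where "\<rho>2 = \<epsilon> / (8 * M)"
    have "\<rho>2 > 0" using \<epsilon> M by (simp add: \<rho>2_def)
    then obtain d2 where d2: "d2 > 0" "\<And>b y u v. \<bar>b\<bar> \<le> M' \<Longrightarrow> \<bar>y\<bar> \<le> M' \<Longrightarrow> \<bar>u\<bar> \<le> M' \<Longrightarrow> \<bar>v\<bar> \<le> M' \<Longrightarrow>
        \<bar>u - v\<bar> \<le> d2 \<Longrightarrow> \<bar>G b (y,u) - G b (y,v)\<bar> \<le> \<rho>2"
      using osc by metis
    define e where "e = min 1 (d2 / M)"
    have e: "e > 0" "e \<le> 1" "e * M \<le> d2" using d2(1) M
      by (auto simp: e_def min_def field_simps split: if_splits)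
    define \<rho>1 where "\<rho>1 = \<epsilon> * e / (8 * (\<bar>h\<bar> + 1))"
    have "\<rho>1 > 0" using \<epsilon> e by (simp add: \<rho>1_def)
    then obtain d1 where d1: "d1 > 0" "\<And>b y u v. \<bar>b\<bar> \<le> M' \<Longrightarrow> \<bar>y\<bar> \<le> M' \<Longrightarrow> \<bar>u\<bar> \<le> M' \<Longrightarrow> \<bar>v\<bar> \<le> M' \<Longrightarrow>
        \<bar>u - v\<bar> \<le> d1 \<Longrightarrow> \<bar>G b (y,u) - G b (y,v)\<bar> \<le> \<rho>1"
      using osc by metis
    obtain n0 :: nat where n0: "\<bar>h\<bar> / d1 < real n0" using reals_Archimedean2 by blast
    define n where "n = Suc n0"
    have n: "n > 0" "\<bar>h\<bar> / real n \<le> d1"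
      using n0 d1(1) by (auto simp: n_def field_simps)
    have "net_approx \<sigma> shift_forms {-M'..M'} ({-M'..M'} \<times> {-M'..M'}) G"
      using G by (simp add: shift_approx_def)
    then obtain g where g: "g \<in> nets \<sigma> shift_forms"
      "\<And>b y t. \<bar>b\<bar> \<le> M' \<Longrightarrow> \<bar>y\<bar> \<le> M' \<Longrightarrow> \<bar>t\<bar> \<le> M' \<Longrightarrow> \<bar>G b (y,t) - g b (y,t)\<bar> \<le> \<rho>1"
      using net_approxD[OF _ \<open>\<rho>1 > 0\<close>] by (metis SigmaI abs_le_iff atLeastAtMost_iff minus_le_iff)
    define \<delta> where "\<delta> = h / real n"
    \<comment> \<open>The Riemann sum of (G (t + e * y) - G t) / e over the interval from t to t +
      h, with G replaced by its net.\<close>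
    define N where "N = (\<lambda>b x. \<delta> / e * (\<Sum>k<n. g b (fst x, snd x + real k * \<delta> + e * fst x)
        + (-1) * g b (fst x, snd x + real k * \<delta> + 0 * fst x)))"
    have N: "N \<in> nets \<sigma> shift_forms"
      unfolding N_def by (intro nets_scale nets_sum nets_add nets_shift g(1))
    have "\<bar>y * (G b (y, t + h) - G b (y,t)) - N b (y,t)\<bar> \<le> \<epsilon>"
      if b: "\<bar>b\<bar> \<le> M" and y: "\<bar>y\<bar> \<le> M" and t: "\<bar>t\<bar> \<le> M" for b y t
    proof -
      have M'M: "M \<le> M'" using M by (simp add: M'_def)
      have ye: "\<bar>y * e\<bar> \<le> M" "\<bar>y * e\<bar> \<le> d2"
      proof -
        have "\<bar>y * e\<bar> = \<bar>y\<bar> * e" using e by (simp add: abs_mult)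
        also have "\<dots> \<le> M * e" using y e by (intro mult_right_mono) auto
        finally have *: "\<bar>y * e\<bar> \<le> M * e" .
        have "M * e \<le> M * 1" using e M by (intro mult_left_mono) auto
        then show "\<bar>y * e\<bar> \<le> M" "\<bar>y * e\<bar> \<le> d2" using * e(3) by (auto simp: mult.commute)
      qed
      have c: "continuous_on UNIV (\<lambda>t. G b (y,t))"
        by (rule continuous_on_compose2[OF cont, of UNIV "\<lambda>t. (b,(y,t))", simplified])
          (intro continuous_intros)
      have 1: "\<bar>y * (G b (y, t + h) - G b (y,t)) - \<delta> / e *
         (\<Sum>k<n. G b (y, t + y * e + real k * \<delta>) - G b (y, t + real k * \<delta>))\<bar>
         \<le> 2 * \<bar>h\<bar> * \<rho>1 / e + 2 * \<bar>y\<bar> * \<rho>2"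
        unfolding \<delta>_def
      proof (rule shift_average_error[OF c n(1) e(1), where M = M'])
        fix u v :: real assume uv: "\<bar>u\<bar> \<le> M'" "\<bar>v\<bar> \<le> M'"
        show "\<bar>G b (y, u) - G b (y, v)\<bar> \<le> \<rho>1" if "\<bar>u - v\<bar> \<le> \<bar>h\<bar> / real n"
          using d1(2)[OF order_trans[OF b M'M] order_trans[OF y M'M] uv order_trans[OF that n(2)]] .
        show "\<bar>G b (y, u) - G b (y, v)\<bar> \<le> \<rho>2" if "\<bar>u - v\<bar> \<le> \<bar>y * e\<bar>"
          using d2(2)[OF order_trans[OF b M'M] order_trans[OF y M'M] uv order_trans[OF that ye(2)]] .
      next
        show "\<bar>t\<bar> + 2 * \<bar>h\<bar> + \<bar>y * e\<bar> \<le> M'" unfolding M'_def using t ye(1) by linarith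
      qed
      have kd: "\<bar>real k * \<delta>\<bar> \<le> \<bar>h\<bar>" if "k < n" for k
        using that n
        by (simp add: \<delta>_def abs_mult divide_simps mult.commute[of _ "\<bar>h\<bar>"] mult_left_mono)
      have "\<bar>(\<Sum>k<n. G b (y, t + y * e + real k * \<delta>) - G b (y, t + real k * \<delta>)) -
          (\<Sum>k<n. g b (y, t + y * e + real k * \<delta>) - g b (y, t + real k * \<delta>))\<bar> \<le> (\<Sum>k<n. 2 * \<rho>1)"
        unfolding sum_subtractf[symmetric]
      proof (rule order_trans[OF sum_abs sum_mono])
        fix k assume "k \<in> {..<n}"
        then have k: "\<bar>real k * \<delta>\<bar> \<le> \<bar>h\<bar>" using kd by simp
        have "\<bar>G b (y, t + y * e + real k * \<delta>) - g b (y, t + y * e + real k * \<delta>)\<bar> \<le> \<rho>1"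
        proof (rule g(2)[OF order_trans[OF b M'M] order_trans[OF y M'M]])
          show "\<bar>t + y * e + real k * \<delta>\<bar> \<le> M'" unfolding M'_def using k t ye(1) by linarith
        qed
        moreover have "\<bar>G b (y, t + real k * \<delta>) - g b (y, t + real k * \<delta>)\<bar> \<le> \<rho>1"
        proof (rule g(2)[OF order_trans[OF b M'M] order_trans[OF y M'M]])
          show "\<bar>t + real k * \<delta>\<bar> \<le> M'" unfolding M'_def using k t M by linarith
        qed
        ultimately show "\<bar>G b (y, t + y * e + real k * \<delta>) - G b (y, t + real k * \<delta>) -
           (g b (y, t + y * e + real k * \<delta>) - g b (y, t + real k * \<delta>))\<bar> \<le> 2 * \<rho>1" by linarith
      qed
      then have "\<bar>\<delta> / e\<bar> * \<bar>(\<Sum>k<n. G b (y, t + y * e + real k * \<delta>) - G b (y, t + real k * \<delta>)) -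
          (\<Sum>k<n. g b (y, t + y * e + real k * \<delta>) - g b (y, t + real k * \<delta>))\<bar> \<le> \<bar>\<delta> / e\<bar> * (real n * (2 * \<rho>1))"
        by (intro mult_left_mono) auto
      also have "\<dots> = 2 * \<bar>h\<bar> * \<rho>1 / e" using n e by (simp add: \<delta>_def abs_divide)
      finally have sums: "\<bar>\<delta> / e\<bar> * \<bar>(\<Sum>k<n. G b (y, t + y * e + real k * \<delta>) - G b (y, t + real k * \<delta>)) -
          (\<Sum>k<n. g b (y, t + y * e + real k * \<delta>) - g b (y, t + real k * \<delta>))\<bar> \<le> 2 * \<bar>h\<bar> * \<rho>1 / e" .
      have 2: "\<bar>\<delta> / e * (\<Sum>k<n. G b (y, t + y * e + real k * \<delta>) - G b (y, t + real k * \<delta>)) - N b (y,t)\<bar>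
          \<le> 2 * \<bar>h\<bar> * \<rho>1 / e"
      proof -
        have "N b (y,t) = \<delta> / e * (\<Sum>k<n. g b (y, t + y * e + real k * \<delta>) - g b (y, t + real k * \<delta>))"
          by (simp add: N_def mult.commute[of e] add_ac)
        then show ?thesis
          using sums
          by (simp only: abs_mult[symmetric] right_diff_distrib)
      qed
      have 3: "2 * \<bar>h\<bar> * \<rho>1 / e \<le> \<epsilon> / 4"
      proof -
        have "2 * a * (\<epsilon> * e / (8 * k)) / e = \<epsilon> / 4 * (a / k)" if "k > 0" for a k
          using e that by (simp add: field_simps)
        from this[of "\<bar>h\<bar> + 1" "\<bar>h\<bar>"]
        have "2 * \<bar>h\<bar> * \<rho>1 / e = \<epsilon> / 4 * (\<bar>h\<bar> / (\<bar>h\<bar> + 1))" by (simp add: \<rho>1_def)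
        also have "\<dots> \<le> \<epsilon> / 4 * 1" using \<epsilon> by (intro mult_left_mono) auto
        finally show ?thesis by simp
      qed
      have 4: "2 * \<bar>y\<bar> * \<rho>2 \<le> \<epsilon> / 4"
      proof -
        have "2 * \<bar>y\<bar> * \<rho>2 \<le> 2 * M * \<rho>2" using y \<open>\<rho>2 > 0\<close> by (intro mult_right_mono) auto
        also have "\<dots> = \<epsilon> / 4" using M by (simp add: \<rho>2_def)
        finally show ?thesis .
      qed
      show ?thesis using 1 2 3 4 \<epsilon> by linarith
    qed
    then have "\<forall>b\<in>{-M0..M0}. \<forall>x\<in>{-M0..M0} \<times> {-M0..M0}.
        \<bar>fst x * (G b (fst x, snd x + h) - G b x) - N b x\<bar> \<le> \<epsilon>"
      using M(2) by auto
    then show "\<exists>g\<in>nets \<sigma> shift_forms. \<forall>b\<in>{-M0..M0}. \<forall>x\<in>{-M0..M0} \<times> {-M0..M0}.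
        \<bar>fst x * (G b (fst x, snd x + h) - G b x) - g b x\<bar> \<le> \<epsilon>"
      using N by blast
  qed
qed

text \<open>Polynomials act on functions through the shift by \<open>r\<close>.\<close>

definition shift_poly :: "real poly \<Rightarrow> real \<Rightarrow> (real \<Rightarrow> real) \<Rightarrow> real \<Rightarrow> real" where
  "shift_poly p r F t = (\<Sum>i\<le>degree p. coeff p i * F (t + real i * r))"

lemma shift_poly_altdef:
  assumes "degree p \<le> n"
  shows "shift_poly p r F t = (\<Sum>i\<le>n. coeff p i * F (t + real i * r))"
  unfolding shift_poly_def
  by (rule sum.mono_neutral_left) (use assms in \<open>auto simp: coeff_eq_0\<close>)

lemma shift_poly_0 [simp]: "shift_poly 0 r F t = 0"
  by (simp add: shift_poly_def)

lemma shift_poly_add: "shift_poly (p + q) r F t = shift_poly p r F t + shift_poly q r F t"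
  using shift_poly_altdef[of p "max (degree p) (degree q)"]
    shift_poly_altdef[of q "max (degree p) (degree q)"]
    shift_poly_altdef[of "p + q" "max (degree p) (degree q)"] degree_add_le_max[of p q]
  by (simp add: sum.distrib algebra_simps)

lemma shift_poly_smult: "shift_poly (smult c p) r F t = c * shift_poly p r F t"
  using shift_poly_altdef[of "smult c p" "degree p"] degree_smult_le[of c p]
  by (simp add: shift_poly_def sum_distrib_left algebra_simps)

lemma shift_poly_diff: "shift_poly (p - q) r F t = shift_poly p r F t - shift_poly q r F t"
  using shift_poly_add[of p "smult (-1) q" r F t] by (simp only: shift_poly_smult) simp

lemma shift_poly_pCons: "shift_poly (pCons a p) r F t = a * F t + shift_poly p r F (t + r)"
proof -
  have "shift_poly (pCons a p) r F t = (\<Sum>i\<le>Suc (degree p). coeff (pCons a p) i * F (t + real i * r))"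
    by (rule shift_poly_altdef) (rule degree_pCons_le)
  then show ?thesis
    by (simp only: sum.atMost_Suc_shift) (simp add: shift_poly_def algebra_simps)
qed

lemma shift_poly_X_mult: "shift_poly ([:0, 1:] * p) r F t = shift_poly p r F (t + r)"
  by (simp add: shift_poly_pCons)

lemma shift_poly_X_power_mult: "shift_poly ([:0, 1:] ^ m * p) r F t = shift_poly p r F (t + real m * r)"
proof (induction m arbitrary: t)
  case (Suc m)
  have "shift_poly ([:0, 1:] ^ Suc m * p) r F t = shift_poly ([:0, 1:] * ([:0, 1:] ^ m * p)) r F t"
    by (simp add: mult.assoc)
  also have "\<dots> = shift_poly p r F (t + r + real m * r)"
    by (simp only: shift_poly_X_mult Suc)
  finally show ?case by (simp add: algebra_simps)
qed simp

lemma shift_poly_X_minus_1_mult: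
  "shift_poly ([:-1, 1:] * p) r F t = shift_poly p r F (t + r) - shift_poly p r F t"
proof -
  have "[:-1, 1:] * p = [:0, 1:] * p - p" by simp
  then show ?thesis by (simp only: shift_poly_diff shift_poly_X_mult)
qed

text \<open>This turns the recursion for the polynomials into a recursion in the step size r, where
  the growth of F can be estimated.\<close>

lemma shift_poly_pcompose:
  "shift_poly (pcompose p ([:0, 1:] ^ m)) r F t = shift_poly p (real m * r) F t"
proof (induction p arbitrary: t)
  case (pCons a p)
  have "shift_poly [:a:] r F t = a * F t" for a by (simp add: shift_poly_pCons)
  then show ?case
    by (simp add: pcompose_pCons shift_poly_add shift_poly_X_power_mult pCons.IH shift_poly_pCons)
qed simp

lemma shift_approx_shift_poly:
  assumes "continuous_on UNIV \<sigma>"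
  shows "shift_approx \<sigma> (\<lambda>b x. shift_poly p r (\<lambda>s. \<sigma> (b * s)) (snd x))"
  unfolding shift_poly_def
  by (intro shift_approx_sum shift_approx_scale shift_approx_base assms)

text \<open>Each factor X - 1 is one difference in t, and one difference pays for one factor
  y.\<close>

lemma shift_approx_power:
  assumes "continuous_on UNIV \<sigma>"
  shows "shift_approx \<sigma> (\<lambda>b x. fst x ^ j * shift_poly ([:-1, 1:] ^ j * q) r (\<lambda>s. \<sigma> (b * s)) (snd x))"
proof (induction j)
  case 0
  then show ?case using shift_approx_shift_poly[OF assms] by simp
next
  case (Suc j)
  have "[:-1, 1:] ^ Suc j * q = [:-1, 1:] * ([:-1, 1:] ^ j * q)" by (simp only: power_Suc mult.assoc)
  then show ?case
    using shift_approx_difference[OF Suc, of r]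
    by (simp only: shift_poly_X_minus_1_mult fst_conv snd_conv power_Suc mult.assoc right_diff_distrib)
qed

text \<open>
  Each step raises the order of the zero at \<open>1\<close>, and the corrections decay so fast that the
  associated shift operators converge on functions of linear growth.
\<close>

primrec vanish_poly :: "nat \<Rightarrow> nat \<Rightarrow> real poly" where
  "vanish_poly m 0 = [:-1, 1:] ^ 2"
| "vanish_poly m (Suc k) = vanish_poly m k
     - smult (1 / real m ^ (k + 2)) (pcompose (vanish_poly m k) ([:0, 1:] ^ m))"

lemma pcompose_power: "pcompose (p ^ n) q = pcompose p q ^ n"
  by (induction n) (simp_all add: pcompose_1 pcompose_mult)

text \<open>Since X^m - 1 = (X - 1) * s with s(1) = m, substituting X^m multiplies the lowest-order
  term at 1 by m^(k+2). The weight in the recursion is its inverse, so the lowest-order terms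
  cancel: the cofactor w vanishes at 1.\<close>

lemma vanish_poly_dvd:
  assumes "m > 0"
  shows "[:-1, 1:] ^ (k + 2) dvd vanish_poly m k"
proof (induction k)
  case (Suc k)
  then obtain q where q: "vanish_poly m k = [:-1, 1:] ^ (k + 2) * q" by (auto simp: dvd_def)
  define s :: "real poly" where "s = (\<Sum>i<m. [:0, 1:] ^ i)"
  have s: "pcompose [:-1, 1:] ([:0, 1:] ^ m) = [:-1, 1:] * s"
  proof -
    have "pcompose [:-1, 1:] ([:0, 1:] ^ m) = [:0, 1:] ^ m - (1 :: real poly)"
      by (simp add: pcompose_pCons one_pCons)
    also have "\<dots> = ([:0, 1:] - 1) * s" unfolding s_def by (rule power_diff_1_eq)
    finally show ?thesis by (simp add: one_pCons)
  qed
  have s1: "poly s 1 = real m" by (simp add: s_def poly_sum)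
  define w where "w = q - smult (1 / real m ^ (k + 2)) (s ^ (k + 2) * pcompose q ([:0, 1:] ^ m))"
  have "vanish_poly m (Suc k) = [:-1, 1:] ^ (k + 2) * q
     - smult (1 / real m ^ (k + 2)) (([:-1, 1:] * s) ^ (k + 2) * pcompose q ([:0, 1:] ^ m))"
    by (simp only: vanish_poly.simps q pcompose_mult pcompose_power s)
  also have "\<dots> = [:-1, 1:] ^ (k + 2) * w"
    by (simp only: w_def power_mult_distrib right_diff_distrib mult_smult_right mult.assoc)
  finally have "vanish_poly m (Suc k) = [:-1, 1:] ^ (k + 2) * w" .
  moreover have "poly w 1 = 0" using assms s1 by (simp add: w_def poly_pcompose)
  then have "[:-1, 1:] dvd w" by (simp add: poly_eq_0_iff_dvd)
  moreover have "[:-1, 1:] ^ (Suc k + 2) = [:-1, 1:] ^ (k + 2) * [:-1, 1 :: real:]"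
    by (simp only: add_Suc power_Suc2)
  ultimately show ?case by (simp only: mult_dvd_mono dvd_refl)
qed (simp only: vanish_poly.simps add_0 dvd_refl)

lemma shift_poly_vanish_Suc:
  "shift_poly (vanish_poly m (Suc k)) r F t = shift_poly (vanish_poly m k) r F t
     - 1 / real m ^ (k + 2) * shift_poly (vanish_poly m k) (real m * r) F t"
  by (simp only: vanish_poly.simps shift_poly_diff shift_poly_smult shift_poly_pcompose)

lemma shift_poly_vanish_0:
  "shift_poly (vanish_poly m 0) r F t = F (t + 2 * r) - 2 * F (t + r) + F t"
proof -
  have "vanish_poly m 0 = [:1, -2, 1:]" by (simp add: power2_eq_square)
  then show ?thesis by (simp add: shift_poly_pCons algebra_simps)
qed

lemma shift_poly_vanish_const: "shift_poly (vanish_poly m k) r (\<lambda>_. c) t = 0"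
proof (induction k arbitrary: r)
  case 0
  show ?case unfolding shift_poly_vanish_0 by simp
next
  case (Suc k)
  then show ?case unfolding shift_poly_vanish_Suc by simp
qed

text \<open>Linear growth makes the passage from r to m * r cost at most a factor m, while the
  weight contributes m^-(k+2). What remains is at most 4^-(k+1), and the factor 2 - (1/2)^k leaves
  room for adding these terms.\<close>

lemma shift_poly_vanish_bound:
  assumes m: "m \<ge> 4" and F: "\<And>s. \<bar>F s\<bar> \<le> C * (1 + \<bar>s\<bar>)" and C: "C \<ge> 0"
  shows "\<bar>shift_poly (vanish_poly m k) r F t\<bar> \<le> (2 - (1/2) ^ k) * (4 * C * (1 + \<bar>t\<bar> + 2 * \<bar>r\<bar>))"
proof (induction k arbitrary: r)
  case 0
  have "\<bar>F (t + 2 * r)\<bar> \<le> C * (1 + \<bar>t\<bar> + 2 * \<bar>r\<bar>)"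
    by (rule order_trans[OF F mult_left_mono[OF _ C]]) linarith
  moreover have "\<bar>F (t + r)\<bar> \<le> C * (1 + \<bar>t\<bar> + 2 * \<bar>r\<bar>)"
    by (rule order_trans[OF F mult_left_mono[OF _ C]]) linarith
  moreover have "\<bar>F t\<bar> \<le> C * (1 + \<bar>t\<bar> + 2 * \<bar>r\<bar>)"
    by (rule order_trans[OF F mult_left_mono[OF _ C]]) linarith
  ultimately show ?case unfolding shift_poly_vanish_0 by simp linarith
next
  case (Suc k)
  define B where "B = 4 * C * (1 + \<bar>t\<bar> + 2 * \<bar>r\<bar>)"
  have B: "B \<ge> 0" using C by (simp add: B_def)
  have Bm: "4 * C * (1 + \<bar>t\<bar> + 2 * \<bar>real m * r\<bar>) \<le> real m * B"
  proof -
    have "1 + \<bar>t\<bar> + 2 * \<bar>real m * r\<bar> \<le> real m * (1 + \<bar>t\<bar> + 2 * \<bar>r\<bar>)"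
      using m mult_right_mono[of 1 "real m" "1 + \<bar>t\<bar>"] by (simp add: abs_mult algebra_simps)
    then have "4 * C * (1 + \<bar>t\<bar> + 2 * \<bar>real m * r\<bar>) \<le> 4 * C * (real m * (1 + \<bar>t\<bar> + 2 * \<bar>r\<bar>))"
      using C by (intro mult_left_mono) auto
    then show ?thesis by (simp add: B_def algebra_simps)
  qed
  define x :: real where "x = (1/2) ^ k"
  have x: "0 < x" "x \<le> 1" by (auto simp: x_def power_le_one)
  have "\<bar>shift_poly (vanish_poly m k) (real m * r) F t\<bar> \<le> (2 - x) * (real m * B)"
    using Suc.IH[of "real m * r"] Bm x unfolding x_def[symmetric]
    by (meson diff_ge_0_iff_ge dual_order.trans mult_left_mono one_le_numeral)
  also have "\<dots> \<le> 2 * (real m * B)" using x B by (intro mult_right_mono) auto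
  finally have *: "\<bar>shift_poly (vanish_poly m k) (real m * r) F t\<bar> \<le> 2 * (real m * B)" .
  have "\<bar>1 / real m ^ (k + 2) * shift_poly (vanish_poly m k) (real m * r) F t\<bar>
     = 1 / real m ^ (k + 2) * \<bar>shift_poly (vanish_poly m k) (real m * r) F t\<bar>"
    by (simp add: abs_mult)
  also have "\<dots> \<le> 1 / real m ^ (k + 2) * (2 * (real m * B))"
    by (intro mult_left_mono *) auto
  also have "\<dots> = 2 * (1 / real m) ^ (k + 1) * B"
    using m by (simp add: field_simps power_one_over)
  also have "\<dots> \<le> 2 * (1 / 4) ^ (k + 1) * B"
    using m B by (intro mult_right_mono mult_left_mono power_mono) (auto simp: field_simps)
  also have "\<dots> \<le> x / 2 * B"
  proof -
    have "(1/4 :: real) ^ k = x * x"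
      unfolding x_def power_mult_distrib[symmetric] by simp
    then have "2 * (1 / 4 :: real) ^ (k + 1) = x * x / 2" by simp
    also have "\<dots> \<le> x / 2" using x mult_left_mono[of x 1 x] by simp
    finally show ?thesis using B by (intro mult_right_mono) auto
  qed
  finally have "\<bar>shift_poly (vanish_poly m (Suc k)) r F t\<bar> \<le> (2 - x) * B + x / 2 * B"
    using Suc.IH[of r] unfolding shift_poly_vanish_Suc x_def[symmetric] B_def[symmetric] by linarith
  then show ?case unfolding B_def[symmetric] by (simp add: x_def algebra_simps)
qed

lemma shift_poly_vanish_step:
  assumes m: "m \<ge> 4" and F: "\<And>s. \<bar>F s\<bar> \<le> C * (1 + \<bar>s\<bar>)" and C: "C \<ge> 0"
  shows "\<bar>shift_poly (vanish_poly m (Suc k)) r F t - shift_poly (vanish_poly m k) r F t\<bar>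
     \<le> 8 * C * (1 + \<bar>t\<bar> + 2 * \<bar>r\<bar>) / real m * (1/4) ^ k"
proof -
  define B where "B = 4 * C * (1 + \<bar>t\<bar> + 2 * \<bar>r\<bar>)"
  have B: "B \<ge> 0" using C by (simp add: B_def)
  have Bm: "4 * C * (1 + \<bar>t\<bar> + 2 * \<bar>real m * r\<bar>) \<le> real m * B"
  proof -
    have "1 + \<bar>t\<bar> + 2 * \<bar>real m * r\<bar> \<le> real m * (1 + \<bar>t\<bar> + 2 * \<bar>r\<bar>)"
      using m mult_right_mono[of 1 "real m" "1 + \<bar>t\<bar>"] by (simp add: abs_mult algebra_simps)
    then have "4 * C * (1 + \<bar>t\<bar> + 2 * \<bar>real m * r\<bar>) \<le> 4 * C * (real m * (1 + \<bar>t\<bar> + 2 * \<bar>r\<bar>))"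
      using C by (intro mult_left_mono) auto
    then show ?thesis by (simp add: B_def algebra_simps)
  qed
  have "\<bar>shift_poly (vanish_poly m k) (real m * r) F t\<bar> \<le> 2 * (real m * B)"
    by (rule order_trans[OF shift_poly_vanish_bound[OF m F C]])
       (intro mult_mono Bm, use C in auto)
  then have "1 / real m ^ (k + 2) * \<bar>shift_poly (vanish_poly m k) (real m * r) F t\<bar>
     \<le> 1 / real m ^ (k + 2) * (2 * (real m * B))"
    by (intro mult_left_mono) auto
  also have "\<dots> = 2 * B / real m * (1 / real m) ^ k"
    using m by (simp add: field_simps power_one_over)
  also have "\<dots> \<le> 2 * B / real m * (1 / 4) ^ k"
    using m B by (intro mult_left_mono power_mono) (auto simp: field_simps)
  finally show ?thesis by (simp add: shift_poly_vanish_Suc abs_mult B_def del: vanish_poly.simps)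
qed

lemma geometric_limit:
  fixes f :: "nat \<Rightarrow> real"
  assumes "\<And>k. \<bar>f (Suc k) - f k\<bar> \<le> A * (1/4) ^ k"
  obtains l where "\<And>k. \<bar>l - f k\<bar> \<le> 2 * A * (1/4) ^ k"
proof -
  have A: "A \<ge> 0" using assms[of 0] by simp
  \<comment> \<open>The factor 1 - (1/4)^n strengthens the claim so that the induction closes; the
    constant 4/3 of the geometric series is rounded up to 2.\<close>
  have *: "\<bar>f (k + n) - f k\<bar> \<le> 2 * A * (1/4) ^ k * (1 - (1/4) ^ n)" for k n
  proof (induction n)
    case (Suc n)
    have "\<bar>f (k + Suc n) - f k\<bar> \<le> A * (1/4) ^ (k + n) + 2 * A * (1/4) ^ k * (1 - (1/4) ^ n)"
      using Suc assms[of "k + n"] by simp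
    also have "\<dots> = 2 * A * (1/4) ^ k * (1 - (1/4) ^ n + (1/4) ^ n / 2)"
      by (simp add: algebra_simps power_add)
    also have "\<dots> \<le> 2 * A * (1/4) ^ k * (1 - (1/4) ^ Suc n)"
      using A by (intro mult_left_mono) auto
    finally show ?case .
  qed simp
  have **: "\<bar>f (k + n) - f k\<bar> \<le> 2 * A * (1/4) ^ k" for k n
    by (rule order_trans[OF *]) (rule mult_left_le, use A in auto)
  have lim0: "(\<lambda>k. 2 * A * (1/4) ^ k) \<longlonglongrightarrow> 0"
    by (intro tendsto_mult_right_zero LIMSEQ_power_zero) auto
  have "Cauchy f"
  proof (rule metric_CauchyI)
    fix e :: real assume "e > 0"
    then have "eventually (\<lambda>k. 2 * A * (1/4) ^ k < e / 2) sequentially"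
      using order_tendstoD(2)[OF lim0, of "e/2"] by simp
    then obtain N where N: "2 * A * (1/4) ^ N < e / 2" by (auto simp: eventually_sequentially)
    have "dist (f i) (f j) < e" if "i \<ge> N" "j \<ge> N" for i j
      using **[of N "i - N"] **[of N "j - N"] N that unfolding dist_real_def by simp
    then show "\<exists>M. \<forall>m\<ge>M. \<forall>n\<ge>M. dist (f m) (f n) < e" by blast
  qed
  then obtain l where l: "f \<longlonglongrightarrow> l" by (auto simp: Cauchy_convergent_iff convergent_def)
  have "\<bar>l - f k\<bar> \<le> 2 * A * (1/4) ^ k" for k
  proof (rule tendsto_upperbound)
    show "(\<lambda>n. \<bar>f (k + n) - f k\<bar>) \<longlonglongrightarrow> \<bar>l - f k\<bar>"
      using LIMSEQ_ignore_initial_segment[OF l, of k]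
      by (intro tendsto_intros) (simp add: add.commute)
  qed (use ** in auto)
  then show ?thesis by (rule that)
qed

section \<open>One profile for all powers\<close>

definition scalar_forms :: "(real \<Rightarrow> real) set" where
  "scalar_forms = {\<lambda>y. w * y + c | w c. True}"

text \<open>Vanishing second differences make \<sigma> - \<sigma>(0) additive. For a continuous
  additive f with antiderivative A one gets A(x + y) = A(x) + A(y) + y f(x); exchanging x and y
  shows y f(x) = x f(y), so f is linear.\<close>

lemma second_difference_nonzero:
  fixes \<sigma> :: "real \<Rightarrow> real"
  assumes cont: "continuous_on UNIV \<sigma>" and nonaff: "\<not> (\<exists>a b. \<forall>s. \<sigma> s = a * s + b)"
  obtains t r where "\<sigma> (t + 2 * r) - 2 * \<sigma> (t + r) + \<sigma> t \<noteq> 0"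
proof (rule ccontr)
  assume "\<not> thesis"
  then have 0: "\<sigma> (t + 2 * r) - 2 * \<sigma> (t + r) + \<sigma> t = 0" for t r using that by blast
  define f where "f s = \<sigma> s - \<sigma> 0" for s
  have f2: "f (2 * r) = 2 * f r" for r using 0[of 0 r] by (simp add: f_def)
  have "f (x + y) = f x + f y" for x y
  proof -
    have "\<sigma> (2 * x + 2 * (y - x)) - 2 * \<sigma> (2 * x + (y - x)) + \<sigma> (2 * x) = 0" by (rule 0)
    then have "f (2 * y) - 2 * f (x + y) + f (2 * x) = 0" by (simp add: f_def algebra_simps)
    then show ?thesis by (simp add: f2)
  qed
  moreover have "continuous_on UNIV f" unfolding f_def by (intro continuous_intros cont)
  ultimately obtain A where A: "\<And>t. (A has_real_derivative f t) (at t)" "A 0 = 0"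
    and add: "\<And>x y. f (x + y) = f x + f y"
    using antiderivative_exists by metis
  have *: "A (x + y) - A y - y * f x = A x" for x y
  proof -
    have "((\<lambda>y. A (x + y) - A y - y * f x) has_real_derivative 0) (at y)" for y
    proof -
      have "((\<lambda>y. A (x + y)) has_real_derivative f (x + y) * 1) (at y)"
        by (rule DERIV_chain2[OF A(1)]) (auto intro!: derivative_eq_intros)
      then show ?thesis by (auto intro!: derivative_eq_intros A(1) simp: add)
    qed
    then have "A (x + y) - A y - y * f x = A (x + 0) - A 0 - 0 * f x"
      by (intro DERIV_isconst_all) auto
    then show ?thesis using A(2) by simp
  qed
  have "f s = f 1 * s" for s
    using *[of s 1] *[of 1 s] by (simp add: add.commute[of 1] mult.commute)
  then have "\<sigma> s = f 1 * s + \<sigma> 0" for s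
    by (metis diff_add_cancel f_def)
  then show False using nonaff by blast
qed

text \<open>
  A limit of shift operators that kill more and more monomials, yet stay close to a second
  difference of \<open>\<sigma>\<close>: this gives one profile \<open>\<omega>\<close> that serves all powers \<open>y ^ j\<close>.
\<close>

lemma profile_exists:
  fixes \<sigma> :: "real \<Rightarrow> real"
  assumes cont: "continuous_on UNIV \<sigma>" and nonaff: "\<not> (\<exists>a b. \<forall>s. \<sigma> s = a * s + b)"
    and growth: "\<And>s. \<bar>\<sigma> s\<bar> \<le> C * (1 + \<bar>s\<bar>)"
  obtains \<omega> where "continuous_on UNIV \<omega>" "\<omega> 0 = 0" "\<omega> 1 \<noteq> 0"
    "\<And>j M. net_approx \<sigma> scalar_forms {-M..M} {-M..M} (\<lambda>b y. \<omega> b * y ^ j)"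
proof -
  have C: "C \<ge> 0" using growth[of 0] by simp
  obtain t r where tr: "\<sigma> (t + 2 * r) - 2 * \<sigma> (t + r) + \<sigma> t \<noteq> 0" (is "?D \<noteq> 0")
    using second_difference_nonzero[OF cont nonaff] by blast
  define B where "B = 8 * C * (1 + \<bar>t\<bar> + 2 * \<bar>r\<bar>)"
  have B: "B \<ge> 0" using C by (simp add: B_def)
  \<comment> \<open>The limit profile differs from the second difference at b = 1 by at most 4 * B /
    m, so a large m keeps \<open>\<omega> 1\<close> away from 0.\<close>
  obtain m0 :: nat where m0: "4 * B / \<bar>?D\<bar> < real m0" using reals_Archimedean2 by blast
  define m where "m = m0 + 4"
  have m: "m \<ge> 4" "4 * B / real m < \<bar>?D\<bar>"
  proof -
    show "m \<ge> 4" by (simp add: m_def)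
    have "4 * B / \<bar>?D\<bar> < real m" using m0 by (simp add: m_def)
    then show "4 * B / real m < \<bar>?D\<bar>" using tr by (simp add: field_simps m_def)
  qed
  define h where "h k b = shift_poly (vanish_poly m k) r (\<lambda>s. \<sigma> (b * s)) t" for k b
  have gb: "\<bar>\<sigma> (b * s)\<bar> \<le> C * (1 + \<bar>b\<bar>) * (1 + \<bar>s\<bar>)" for b s
  proof -
    have "1 + \<bar>b * s\<bar> \<le> (1 + \<bar>b\<bar>) * (1 + \<bar>s\<bar>)" by (simp add: abs_mult algebra_simps)
    then show ?thesis
      using order_trans[OF growth mult_left_mono[OF _ C]] by (simp add: mult.assoc)
  qed
  have step: "\<bar>h (Suc k) b - h k b\<bar> \<le> B * (1 + \<bar>b\<bar>) / real m * (1/4) ^ k" for k b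
  proof -
    have "\<bar>h (Suc k) b - h k b\<bar> \<le> 8 * (C * (1 + \<bar>b\<bar>)) * (1 + \<bar>t\<bar> + 2 * \<bar>r\<bar>) / real m * (1/4) ^ k"
      unfolding h_def by (rule shift_poly_vanish_step[OF m(1) gb]) (use C in simp)
    also have "8 * (C * (1 + \<bar>b\<bar>)) * (1 + \<bar>t\<bar> + 2 * \<bar>r\<bar>) = B * (1 + \<bar>b\<bar>)"
      by (simp only: B_def mult_ac)
    finally show ?thesis .
  qed
  have "\<exists>l. \<forall>k. \<bar>l - h k b\<bar> \<le> 2 * (B * (1 + \<bar>b\<bar>) / real m) * (1/4) ^ k" for b
    using geometric_limit[of "\<lambda>k. h k b" "B * (1 + \<bar>b\<bar>) / real m", OF step] by blast
  then obtain \<omega> where \<omega>: "\<And>b k. \<bar>\<omega> b - h k b\<bar> \<le> 2 * (B * (1 + \<bar>b\<bar>) / real m) * (1/4) ^ k"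
    by metis
  have unif: "\<exists>k\<ge>j. \<forall>b\<in>{-M..M}. \<bar>\<omega> b - h k b\<bar> \<le> e" if "e > 0" for M e :: real and j
  proof -
    have "(\<lambda>k. 2 * (B * (1 + \<bar>M\<bar>) / real m) * (1/4) ^ k) \<longlonglongrightarrow> 0"
      by (intro tendsto_mult_right_zero LIMSEQ_power_zero) auto
    then have "eventually (\<lambda>k. 2 * (B * (1 + \<bar>M\<bar>) / real m) * (1/4) ^ k < e) sequentially"
      using \<open>e > 0\<close> by (rule order_tendstoD(2))
    then obtain k where k: "k \<ge> j" "2 * (B * (1 + \<bar>M\<bar>) / real m) * (1/4) ^ k < e"
      unfolding eventually_sequentially by (meson le_cases order_refl)
    have "\<bar>\<omega> b - h k b\<bar> \<le> e" if "b \<in> {-M..M}" for b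
    proof -
      have "B * (1 + \<bar>b\<bar>) / real m \<le> B * (1 + \<bar>M\<bar>) / real m"
        using that B by (intro divide_right_mono mult_left_mono) auto
      then have "2 * (B * (1 + \<bar>b\<bar>) / real m) * (1/4) ^ k \<le> 2 * (B * (1 + \<bar>M\<bar>) / real m) * (1/4) ^ k"
        by (intro mult_right_mono) auto
      then show ?thesis using \<omega>[of b k] k(2) by linarith
    qed
    then show ?thesis using k(1) by blast
  qed
  have conth: "continuous_on UNIV (h k)" for k
    unfolding h_def shift_poly_def
    by (intro continuous_intros continuous_on_compose2[OF cont]) auto
  have cont\<omega>: "continuous_on {-M<..<M} \<omega>" for M
  proof (rule uniform_limit_theorem)
    define N where "N n = (SOME k. \<forall>b\<in>{-M..M}. \<bar>\<omega> b - h k b\<bar> \<le> 1 / real (Suc n))" for n :: nat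
    have N: "\<forall>b\<in>{-M..M}. \<bar>\<omega> b - h (N n) b\<bar> \<le> 1 / real (Suc n)" for n
      unfolding N_def by (rule someI_ex) (use unif[of "1 / real (Suc n)" 0 M] in auto)
    show "\<forall>\<^sub>F n in sequentially. continuous_on {-M<..<M} (h (N n))"
      by (intro always_eventually allI continuous_on_subset[OF conth]) auto
    show "uniform_limit {-M<..<M} (\<lambda>n. h (N n)) \<omega> sequentially"
    proof (rule uniform_limitI)
      fix e :: real assume "e > 0"
      then obtain n0 where "inverse (real (Suc n0)) < e" using reals_Archimedean by blast
      then have *: "1 / real (Suc n) < e" if "n \<ge> n0" for n
      proof -
        have "1 / real (Suc n) \<le> 1 / real (Suc n0)" using that by (simp add: field_simps)
        then show ?thesis using \<open>inverse (real (Suc n0)) < e\<close> by (simp add: inverse_eq_divide)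
      qed
      show "\<forall>\<^sub>F n in sequentially. \<forall>x\<in>{-M<..<M}. dist (h (N n) x) (\<omega> x) < e"
        unfolding eventually_sequentially dist_real_def
      proof (intro exI[of _ n0] allI impI ballI)
        fix n x assume n: "n0 \<le> n" and x: "x \<in> {-M<..<M}"
        have "\<bar>\<omega> x - h (N n) x\<bar> \<le> 1 / real (Suc n)" using N[of n] x by auto
        then show "\<bar>h (N n) x - \<omega> x\<bar> < e" using *[OF n] by (simp add: abs_minus_commute)
      qed
    qed
  qed auto
  have 1: "continuous_on UNIV \<omega>"
  proof -
    have "isCont \<omega> b" for b
      using cont\<omega>[of "\<bar>b\<bar> + 1"] by (rule continuous_on_interior) auto
    then show ?thesis by (simp add: continuous_at_imp_continuous_on)
  qed
  \<comment> \<open>At b = 0 the sampled function is constant, and the polynomials kill constants.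
    Together with \<open>\<omega> 1 \<noteq> 0\<close> this rules out a constant profile.\<close>
  have 2: "\<omega> 0 = 0"
  proof -
    have "h k 0 = 0" for k by (simp add: h_def shift_poly_vanish_const)
    then have "\<bar>\<omega> 0\<bar> \<le> 0 + e" if "e > 0" for e
      using unif[OF that, of 0 1] by (auto dest!: bspec[where x = 0])
    then have "\<bar>\<omega> 0\<bar> \<le> 0" by (rule field_le_epsilon)
    then show ?thesis by simp
  qed
  have 3: "\<omega> 1 \<noteq> 0"
  proof -
    have "\<bar>\<omega> 1 - ?D\<bar> \<le> 4 * B / real m"
      using \<omega>[of 1 0] unfolding h_def shift_poly_vanish_0 by simp
    then show ?thesis using m(2) by auto
  qed
  have 4: "net_approx \<sigma> scalar_forms {-M..M} {-M..M} (\<lambda>b y. \<omega> b * y ^ j)" for j M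
  proof (rule net_approx_limit)
    fix e :: real assume e: "e > 0"
    define P where "P = (\<bar>M\<bar> + 1) ^ j"
    have P: "P > 0" by (simp add: P_def)
    obtain k where k: "k \<ge> j" "\<And>b. b \<in> {-M..M} \<Longrightarrow> \<bar>\<omega> b - h k b\<bar> \<le> e / P"
      using unif[of "e / P" j M] e P by auto
    define G where "G b y = y ^ j * h k b" for b y :: real
    \<comment> \<open>The power y ^ j asks only for a zero of order j at 1; any larger k also works
      and brings the profile closer to its limit.\<close>
    have "[:-1, 1:] ^ j dvd vanish_poly m k"
      by (rule dvd_trans[OF le_imp_power_dvd vanish_poly_dvd]) (use k m in auto)
    then obtain q where q: "vanish_poly m k = [:-1, 1:] ^ j * q" by (auto simp: dvd_def)
    define M' where "M' = max \<bar>M\<bar> \<bar>t\<bar>"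
    have "net_approx \<sigma> shift_forms {-M'..M'} ({-M'..M'} \<times> {-M'..M'})
      (\<lambda>b x. fst x ^ j * shift_poly (vanish_poly m k) r (\<lambda>s. \<sigma> (b * s)) (snd x))"
      using shift_approx_power[OF cont, of j q r] unfolding shift_approx_def q by blast
    then have "net_approx \<sigma> scalar_forms {-M..M} {-M..M} (\<lambda>b y. (\<lambda>b x. fst x ^ j * shift_poly (vanish_poly m k) r (\<lambda>s. \<sigma> (b * s)) (snd x)) (1 * b) (y, t))"
    proof (rule net_approx_compose)
      fix l assume "l \<in> shift_forms"
      then obtain w d where l: "l = (\<lambda>x. w * fst x + d + snd x)" unfolding shift_forms_def by blast
      have "(\<lambda>x. 1 * l (x, t)) = (\<lambda>y. w * y + (d + t))" by (simp add: l add_ac)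
      then show "(\<lambda>x. 1 * l (x, t)) \<in> scalar_forms" unfolding scalar_forms_def by blast
    qed (auto simp: M'_def)
    then have "net_approx \<sigma> scalar_forms {-M..M} {-M..M} G"
      by (simp add: G_def[abs_def] h_def)
    moreover have "\<bar>\<omega> b * y ^ j - G b y\<bar> \<le> e" if "b \<in> {-M..M}" "y \<in> {-M..M}" for b y
    proof -
      have "\<bar>y\<bar> ^ j \<le> P" unfolding P_def using that by (intro power_mono) auto
      then have "\<bar>\<omega> b - h k b\<bar> * \<bar>y\<bar> ^ j \<le> e / P * P"
        using k(2)[OF that(1)] e P by (intro mult_mono) auto
      moreover have "\<omega> b * y ^ j - G b y = (\<omega> b - h k b) * y ^ j" by (simp add: G_def algebra_simps)
      ultimately show ?thesis using P by (simp add: abs_mult power_abs)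
    qed
    ultimately show "\<exists>G. net_approx \<sigma> scalar_forms {-M..M} {-M..M} G \<and>
        (\<forall>b\<in>{-M..M}. \<forall>y\<in>{-M..M}. \<bar>\<omega> b * y ^ j - G b y\<bar> \<le> e)" by blast
  qed
  show ?thesis by (rule that[OF 1 2 3 4])
qed

lemma net_approx_dilation:
  assumes "net_approx \<sigma> scalar_forms {-\<bar>k\<bar> * M..\<bar>k\<bar> * M} Y (\<lambda>b y. f b * g y)"
  shows "net_approx \<sigma> scalar_forms {-M..M} Y (\<lambda>b y. f (k * b) * g y)"
proof -
  have "net_approx \<sigma> scalar_forms {-M..M} Y (\<lambda>b y. (\<lambda>b y. f b * g y) (k * b) y)"
  proof (rule net_approx_compose[OF assms])
    fix l assume "l \<in> scalar_forms"
    then obtain w d where l: "l = (\<lambda>x. w * x + d)" unfolding scalar_forms_def by blast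
    have "(\<lambda>x. k * l x) = (\<lambda>y. (k * w) * y + (k * d))" by (simp add: l algebra_simps)
    then show "(\<lambda>x. k * l x) \<in> scalar_forms" unfolding scalar_forms_def by blast
  next
    fix b assume "b \<in> {-M..M}"
    then have "\<bar>k * b\<bar> \<le> \<bar>k\<bar> * M" unfolding abs_mult by (intro mult_left_mono) auto
    then show "k * b \<in> {-\<bar>k\<bar> * M..\<bar>k\<bar> * M}" by auto
  qed
  then show ?thesis by simp
qed

text \<open>
  Averaging the profile over dilations makes it differentiable on \<open>(0, \<infinity>)\<close>; it is then
  injective near a suitable point, which is moved to \<open>1\<close> by a dilation.
\<close>

lemma injective_profile_exists:
  fixes \<sigma> :: "real \<Rightarrow> real"
  assumes cont: "continuous_on UNIV \<sigma>" and nonaff: "\<not> (\<exists>a b. \<forall>s. \<sigma> s = a * s + b)"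
    and growth: "\<And>s. \<bar>\<sigma> s\<bar> \<le> C * (1 + \<bar>s\<bar>)"
  obtains \<omega> \<delta> where "0 < \<delta>" "\<delta> \<le> 1/2" "continuous_on {1-\<delta>..1+\<delta>} \<omega>" "inj_on \<omega> {1-\<delta>..1+\<delta>}"
    "\<omega> 1 = 1" "\<And>b. b \<in> {1-\<delta>..1+\<delta>} \<Longrightarrow> \<bar>\<omega> b - 1\<bar> \<le> 1/2"
    "\<And>j M. net_approx \<sigma> scalar_forms {1-\<delta>..1+\<delta>} {-M..M} (\<lambda>b y. \<omega> b * y ^ j)"
proof -
  obtain \<omega>0 where c0: "continuous_on UNIV \<omega>0" and z0: "\<omega>0 0 = 0" and n0: "\<omega>0 1 \<noteq> 0"
    and app0: "\<And>j M. net_approx \<sigma> scalar_forms {-M..M} {-M..M} (\<lambda>b y. \<omega>0 b * y ^ j)"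
    using profile_exists[OF cont nonaff growth] by blast
  obtain A where A: "\<And>t. (A has_real_derivative \<omega>0 t) (at t)" "A 0 = 0"
    using antiderivative_exists[OF c0] by blast
  \<comment> \<open>The average of \<open>\<omega>0 (s * b)\<close> over s in [0, 1], hence a limit
    of combinations of dilated profiles, for which nets are available.\<close>
  define \<omega>1 where "\<omega>1 b = A b / b" for b
  define D where "D b = (b * \<omega>0 b - A b) / b\<^sup>2" for b
  have der: "(\<omega>1 has_real_derivative D b) (at b)" if "b \<noteq> 0" for b
    unfolding \<omega>1_def D_def by (rule derivative_eq_intros A refl that)+
      (use that in \<open>simp add: power2_eq_square mult.commute\<close>)
  have contA: "continuous_on UNIV A"
    using A(1) by (meson DERIV_isCont continuous_at_imp_continuous_on)
  have contD: "continuous_on {0<..} D"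
    unfolding D_def by (intro continuous_intros continuous_on_subset[OF c0] continuous_on_subset[OF contA]) auto
  \<comment> \<open>If the derivative vanished on the half line, \<omega>0 would be constant there
    and, by continuity, equal to its value 0 at the origin, contrary to
    \<open>\<omega>0 1 \<noteq> 0\<close>.\<close>
  obtain b0 where b0: "b0 > 0" "D b0 \<noteq> 0"
  proof (rule ccontr)
    note witness = that
    assume "\<not> thesis"
    then have D0: "D b = 0" if "b > 0" for b using witness[OF that] by blast
    have c: "\<omega>1 b = \<omega>1 1" if "b > 0" for b
    proof -
      have "(\<omega>1 has_real_derivative 0) (at x within {0<..})" if "x > 0" for x
        using has_field_derivative_at_within[OF der[of x], of "{0<..}"] D0[OF that] that by simp
      then have "\<exists>c. \<forall>x\<in>{0<..}. \<omega>1 x = c"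
        by (intro has_field_derivative_zero_constant) auto
      then show ?thesis using that by force
    qed
    have Ac: "A b = b * \<omega>1 1" "\<omega>0 b = \<omega>1 1" if "b > 0" for b
    proof -
      show *: "A b = b * \<omega>1 1" using c[OF that] that by (simp add: \<omega>1_def field_simps)
      show "\<omega>0 b = \<omega>1 1" using D0[OF that] * that by (simp add: D_def)
    qed
    have "\<omega>1 1 = \<omega>0 0"
    proof (rule tendsto_unique[of "at_right 0"])
      show "(\<omega>0 \<longlongrightarrow> \<omega>0 0) (at_right 0)"
        using c0 by (metis UNIV_I continuous_on filterlim_at_split filterlim_within_subset subset_UNIV)
      show "(\<omega>0 \<longlongrightarrow> \<omega>1 1) (at_right 0)"
        by (rule Lim_transform_eventually[OF tendsto_const])
           (auto simp: eventually_at_right_field Ac intro!: exI[of _ 1])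
    qed auto
    then show False using Ac(2)[of 1] n0 z0 by simp
  qed
  have "\<exists>d>0. \<forall>b. \<bar>b - b0\<bar> \<le> d \<longrightarrow> b > 0 \<and> D b \<noteq> 0"
  proof -
    have "isCont D b0" using contD b0 by (simp add: continuous_on_eq_continuous_at)
    then obtain e where e: "e > 0" "\<And>b. dist b b0 < e \<Longrightarrow> dist (D b) (D b0) < \<bar>D b0\<bar>"
      using b0(2) unfolding continuous_at_eps_delta by (metis zero_less_abs_iff)
    have "b > 0 \<and> D b \<noteq> 0" if "\<bar>b - b0\<bar> \<le> min (e/2) (b0/2)" for b
    proof
      show "b > 0" using that b0(1) by linarith
      show "D b \<noteq> 0" using e(2)[of b] that e(1) by (auto simp: dist_real_def)
    qed
    then show ?thesis using e(1) b0(1) by (intro exI[of _ "min (e/2) (b0/2)"]) auto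
  qed
  then obtain d where d: "d > 0" "\<And>b. \<bar>b - b0\<bar> \<le> d \<Longrightarrow> b > 0 \<and> D b \<noteq> 0" by blast
  have inj1: "u = v" if "\<bar>u - b0\<bar> \<le> d" "\<bar>v - b0\<bar> \<le> d" "\<omega>1 u = \<omega>1 v" for u v
  proof (rule ccontr)
    have aux: False if uv: "u < v" "\<bar>u - b0\<bar> \<le> d" "\<bar>v - b0\<bar> \<le> d" "\<omega>1 u = \<omega>1 v" for u v
    proof -
      have "\<exists>z>u. z < v \<and> \<omega>1 v - \<omega>1 u = (v - u) * D z"
      proof (rule MVT2[OF uv(1)])
        fix x assume "u \<le> x" "x \<le> v"
        then have "\<bar>x - b0\<bar> \<le> d" using uv by linarith
        then show "(\<omega>1 has_real_derivative D x) (at x)" using der d(2) by force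
      qed
      then obtain z where "u < z" "z < v" "\<omega>1 v - \<omega>1 u = (v - u) * D z" by blast
      moreover from this have "D z \<noteq> 0" using uv by (intro d(2)[THEN conjunct2]) linarith
      ultimately show False using uv by auto
    qed
    assume "u \<noteq> v"
    then show False using aux[of u v] aux[of v u] that by linarith
  qed
  have pos1: "b > 0" if "\<bar>b - b0\<bar> \<le> d" for b using d(2)[OF that] by blast
  \<comment> \<open>The profile may vanish at b0. Being injective near b0 it has at most one zero
    there, so a step of d/2 avoids it and normalisation to the value 1 becomes possible.\<close>
  obtain b1 where b1: "\<bar>b1 - b0\<bar> \<le> d/2" "\<omega>1 b1 \<noteq> 0"
  proof (cases "\<omega>1 b0 = 0")
    case True
    then have "\<omega>1 (b0 + d/2) \<noteq> 0" using inj1[of b0 "b0 + d/2"] d(1) by auto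
    then show ?thesis using d(1) by (intro that[of "b0 + d/2"]) auto
  next
    case False
    then show ?thesis using d(1) by (intro that[of b0]) auto
  qed
  have b1pos: "b1 > 0" using b1(1) d(1) by (intro pos1) linarith
  define \<omega> where "\<omega> b = \<omega>1 (b1 * b) / \<omega>1 b1" for b
  have ic: "isCont \<omega>1 b" if "b > 0" for b using der[of b] that by (auto intro: DERIV_isCont)
  have "isCont \<omega> 1"
  proof -
    have "isCont (\<lambda>b. \<omega>1 (b1 * b)) 1"
      by (rule isCont_o2[where f = "\<lambda>b. b1 * b" and g = \<omega>1]) (use ic[OF b1pos] in auto)
    then show ?thesis unfolding \<omega>_def using b1(2) by (intro continuous_intros) auto
  qed
  then obtain d' where d': "d' > 0" "\<And>b. dist b 1 < d' \<Longrightarrow> dist (\<omega> b) (\<omega> 1) < 1/2"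
    unfolding continuous_at_eps_delta by (metis half_gt_zero zero_less_one)
  have \<omega>1: "\<omega> 1 = 1" using b1(2) by (simp add: \<omega>_def)
  define \<delta> where "\<delta> = min (1/2) (min (d'/2) (d / (2 * b1)))"
  have \<delta>: "0 < \<delta>" "\<delta> \<le> 1/2" "\<delta> < d'" "\<delta> * b1 \<le> d/2"
  proof -
    show "0 < \<delta>" "\<delta> \<le> 1/2" "\<delta> < d'" using d' d(1) b1pos by (auto simp: \<delta>_def)
    have "\<delta> \<le> d / (2 * b1)" by (simp add: \<delta>_def)
    then show "\<delta> * b1 \<le> d/2" using b1pos by (simp add: field_simps)
  qed
  have near: "\<bar>b1 * b - b0\<bar> \<le> d" if "b \<in> {1-\<delta>..1+\<delta>}" for b
  proof -
    have "b1 * b - b1 = b1 * (b - 1)" by (simp add: algebra_simps)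
    then have "\<bar>b1 * b - b1\<bar> = b1 * \<bar>b - 1\<bar>" using b1pos by (simp add: abs_mult)
    also have "\<dots> \<le> b1 * \<delta>" using that b1pos by (intro mult_left_mono) auto
    also have "\<dots> \<le> d/2" using \<delta>(4) by (simp add: mult.commute)
    finally show ?thesis using b1(1) by linarith
  qed
  have 1: "continuous_on {1-\<delta>..1+\<delta>} \<omega>"
  proof -
    have "continuous_on {1-\<delta>..1+\<delta>} (\<lambda>b. \<omega>1 (b1 * b))"
    proof (rule continuous_on_compose2[of "{0<..}" \<omega>1])
      show "continuous_on {0<..} \<omega>1" using ic by (simp add: continuous_at_imp_continuous_on)
      show "(\<lambda>b. b1 * b) ` {1-\<delta>..1+\<delta>} \<subseteq> {0<..}" using near pos1 by blast
    qed (intro continuous_intros)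
    then show ?thesis unfolding \<omega>_def using b1(2) by (intro continuous_intros) auto
  qed
  have 2: "inj_on \<omega> {1-\<delta>..1+\<delta>}"
  proof (rule inj_onI)
    fix u v assume uv: "u \<in> {1-\<delta>..1+\<delta>}" "v \<in> {1-\<delta>..1+\<delta>}" "\<omega> u = \<omega> v"
    then have "\<omega>1 (b1 * u) = \<omega>1 (b1 * v)" using b1(2) by (simp add: \<omega>_def)
    then have "b1 * u = b1 * v" by (rule inj1[OF near[OF uv(1)] near[OF uv(2)]])
    then show "u = v" using b1pos by simp
  qed
  have 3: "\<bar>\<omega> b - 1\<bar> \<le> 1/2" if "b \<in> {1-\<delta>..1+\<delta>}" for b
  proof -
    have "\<bar>b - 1\<bar> < d'" using that \<delta>(3) by auto
    then show ?thesis using d'(2)[of b] \<omega>1 by (simp add: dist_real_def)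
  qed
  have app1: "net_approx \<sigma> scalar_forms {-M..M} {-M..M} (\<lambda>b y. (if b = 0 then 0 else \<omega>1 b) * y ^ j)"
    if M0: "M \<ge> 0" for j and M :: real
  proof (rule net_approx_limit)
    fix e :: real assume e: "e > 0"
    define P where "P = (\<bar>M\<bar> + 1) ^ j"
    have P: "P > 0" by (simp add: P_def)
    define M' where "M' = 3 * \<bar>M\<bar>"
    have "uniformly_continuous_on {-M'..M'} \<omega>0"
      by (intro compact_uniformly_continuous continuous_on_subset[OF c0]) auto
    then obtain d where d: "d > 0" "\<And>u v. u \<in> {-M'..M'} \<Longrightarrow> v \<in> {-M'..M'} \<Longrightarrow> dist v u < d \<Longrightarrow> dist (\<omega>0 v) (\<omega>0 u) < e / P"
      unfolding uniformly_continuous_on_def using e P by (metis divide_pos_pos)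
    obtain n0 :: nat where n0: "\<bar>M\<bar> / d < real n0" using reals_Archimedean2 by blast
    define n where "n = Suc n0"
    have n: "n > 0" "\<bar>M\<bar> / real n < d"
      using n0 d(1) by (auto simp: n_def field_simps)
    \<comment> \<open>A Riemann sum of the average over dilations. All ratios k/n are at most 1, so
      the dilated arguments stay in the interval where nets are given.\<close>
    define G where "G b y = (1 / real n) * (\<Sum>k<n. \<omega>0 (real k / real n * b) * y ^ j)" for b y :: real
    have kn: "\<bar>real k / real n\<bar> \<le> 1" if "k < n" for k using that by simp
    have "net_approx \<sigma> scalar_forms {-M..M} {-M..M} G"
      unfolding G_def
    proof (intro net_approx_scale net_approx_sum net_approx_dilation)
      fix k assume "k \<in> {..<n}"
      then have k: "\<bar>real k / real n\<bar> \<le> 1" using kn by simp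
      show "net_approx \<sigma> scalar_forms {- \<bar>real k / real n\<bar> * M..\<bar>real k / real n\<bar> * M} {- M..M} (\<lambda>b y. \<omega>0 b * y ^ j)"
      proof -
        have "\<bar>real k / real n\<bar> * M \<le> M" using mult_right_mono[OF k M0] by simp
        then show ?thesis by (intro net_approx_subset[OF app0[of M j]]) auto
      qed
    qed
    moreover have "\<bar>(if b = 0 then 0 else \<omega>1 b) * y ^ j - G b y\<bar> \<le> e" if yb: "b \<in> {-M..M}" "y \<in> {-M..M}" for b y
    proof (cases "b = 0")
      case True
      then show ?thesis using z0 e by (simp add: G_def)
    next
      case False
      have "\<bar>A (0 + b) - A 0 - b / real n * (\<Sum>k<n. \<omega>0 (0 + real k * (b / real n)))\<bar> \<le> \<bar>b\<bar> * (e / P)"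
      proof (rule riemann_sum_error[OF A(1) n(1), where M = M'])
        fix u v :: real assume uv: "\<bar>u\<bar> \<le> M'" "\<bar>v\<bar> \<le> M'" "\<bar>u - v\<bar> \<le> \<bar>b\<bar> / real n"
        have "\<bar>b\<bar> / real n \<le> \<bar>M\<bar> / real n" using yb by (intro divide_right_mono) auto
        then have "\<bar>u - v\<bar> < d" using uv(3) n(2) by linarith
        then show "\<bar>\<omega>0 u - \<omega>0 v\<bar> \<le> e / P"
          using d(2)[of v u] uv by (auto simp: dist_real_def abs_le_iff)
      qed (use yb in \<open>auto simp: M'_def\<close>)
      then have "\<bar>b\<bar> * \<bar>\<omega>1 b - 1 / real n * (\<Sum>k<n. \<omega>0 (real k / real n * b))\<bar> \<le> \<bar>b\<bar> * (e / P)"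
        using A(2) False by (simp add: \<omega>1_def abs_mult[symmetric] right_diff_distrib mult.commute[of b])
      then have *: "\<bar>\<omega>1 b - 1 / real n * (\<Sum>k<n. \<omega>0 (real k / real n * b))\<bar> \<le> e / P"
        by (rule mult_left_le_imp_le) (use False in simp)
      have "\<bar>y\<bar> ^ j \<le> P" unfolding P_def using yb by (intro power_mono) auto
      then have "\<bar>\<omega>1 b - 1 / real n * (\<Sum>k<n. \<omega>0 (real k / real n * b))\<bar> * \<bar>y\<bar> ^ j \<le> e / P * P"
        using * e P by (intro mult_mono) auto
      moreover have "\<omega>1 b * y ^ j - G b y = (\<omega>1 b - 1 / real n * (\<Sum>k<n. \<omega>0 (real k / real n * b))) * y ^ j"
        by (simp only: G_def sum_distrib_right[symmetric]) (simp add: algebra_simps)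
      ultimately show ?thesis using False P by (simp add: abs_mult power_abs)
    qed
    ultimately show "\<exists>G. net_approx \<sigma> scalar_forms {-M..M} {-M..M} G \<and>
        (\<forall>b\<in>{-M..M}. \<forall>y\<in>{-M..M}. \<bar>(if b = 0 then 0 else \<omega>1 b) * y ^ j - G b y\<bar> \<le> e)" by blast
  qed
  have 4: "net_approx \<sigma> scalar_forms {1-\<delta>..1+\<delta>} {-M..M} (\<lambda>b y. \<omega> b * y ^ j)" for j M
  proof -
    define M' where "M' = max \<bar>M\<bar> (b1 * 2)"
    have M': "M' \<ge> b1 * 2" "M' \<ge> \<bar>M\<bar>" by (auto simp: M'_def)
    have "net_approx \<sigma> scalar_forms {-\<bar>b1\<bar> * 2..\<bar>b1\<bar> * 2} {-M'..M'} (\<lambda>b y. (if b = 0 then 0 else \<omega>1 b) * y ^ j)"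
      by (rule net_approx_subset[OF app1[of M' j]]) (use M' b1pos in auto)
    from net_approx_scale[OF net_approx_dilation[OF this], of "1 / \<omega>1 b1"]
    show ?thesis
    proof (rule net_approx_subset)
      show "\<omega> b * y ^ j = 1 / \<omega>1 b1 * ((if b1 * b = 0 then 0 else \<omega>1 (b1 * b)) * y ^ j)"
        if "b \<in> {1-\<delta>..1+\<delta>}" for b y :: real
        using pos1[OF near[OF that]] by (auto simp: \<omega>_def)
    qed (use \<delta> M' in auto)
  qed
  show ?thesis by (rule that[OF \<delta>(1,2) 1 2 \<omega>1 3 4])
qed

text \<open>As the same \<omega> accompanies every power, Taylor polynomials may be summed.
  Exponentials are the aim because products of exponentials of forms are again exponentials of
  forms, which gives an algebra.\<close>

lemma net_approx_exp:
  assumes app: "\<And>j M. net_approx \<sigma> scalar_forms I {-M..M} (\<lambda>b y. \<omega> b * y ^ j)"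
    and bd: "\<And>b. b \<in> I \<Longrightarrow> \<bar>\<omega> b\<bar> \<le> W"
  shows "net_approx \<sigma> scalar_forms I {-M..M} (\<lambda>b y. \<omega> b * exp y)"
proof (rule net_approx_limit)
  fix e :: real assume e: "e > 0"
  have "(\<lambda>n. exp \<bar>M\<bar> * (\<bar>W\<bar> + 1) * (inverse (fact n) * \<bar>M\<bar> ^ n)) \<longlonglongrightarrow> 0"
    by (intro tendsto_mult_right_zero summable_LIMSEQ_zero summable_exp)
  then have "eventually (\<lambda>n. exp \<bar>M\<bar> * (\<bar>W\<bar> + 1) * (inverse (fact n) * \<bar>M\<bar> ^ n) < e) sequentially"
    using e by (rule order_tendstoD(2))
  then obtain n where n: "exp \<bar>M\<bar> * (\<bar>W\<bar> + 1) * (inverse (fact n) * \<bar>M\<bar> ^ n) < e"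
    by (auto simp: eventually_sequentially)
  define G where "G b y = (\<Sum>i<n. 1 / fact i * (\<omega> b * y ^ i))" for b y
  have "net_approx \<sigma> scalar_forms I {-M..M} G"
    unfolding G_def by (intro net_approx_sum net_approx_scale app)
  moreover have "\<bar>\<omega> b * exp y - G b y\<bar> \<le> e" if "b \<in> I" "y \<in> {-M..M}" for b y
  proof -
    obtain t where t: "\<bar>t\<bar> \<le> \<bar>y\<bar>" "exp y = (\<Sum>m<n. y ^ m / fact m) + exp t / fact n * y ^ n"
      using Maclaurin_exp_le by blast
    have yM: "\<bar>y\<bar> \<le> \<bar>M\<bar>" using that by auto
    have "\<omega> b * exp y - G b y = \<omega> b * (exp y - (\<Sum>m<n. y ^ m / fact m))"
      by (simp add: G_def right_diff_distrib sum_distrib_left)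
    also have "\<dots> = \<omega> b * (exp t / fact n * y ^ n)" using t(2) by simp
    finally have "\<bar>\<omega> b * exp y - G b y\<bar> = (exp t * \<bar>\<omega> b\<bar>) * (inverse (fact n) * \<bar>y\<bar> ^ n)"
      by (simp only: abs_mult abs_divide power_abs abs_exp_cancel) (simp add: divide_simps)
    also have "\<dots> \<le> (exp \<bar>M\<bar> * (\<bar>W\<bar> + 1)) * (inverse (fact n) * \<bar>M\<bar> ^ n)"
      using yM t(1) bd[OF that(1)] by (intro mult_mono power_mono) auto
    finally show ?thesis using n by linarith
  qed
  ultimately show "\<exists>G. net_approx \<sigma> scalar_forms I {-M..M} G \<and> (\<forall>b\<in>I. \<forall>y\<in>{-M..M}. \<bar>\<omega> b * exp y - G b y\<bar> \<le> e)"
    by blast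
qed

section \<open>The seminormed space of square integrable functions\<close>

lemma L2_measurable: "u \<in> L2 D \<Longrightarrow> u \<in> borel_measurable (lebesgue_on D)"
  by (simp add: L2_def)

lemma L2_integrable_mult:
  assumes "u \<in> L2 D" "v \<in> L2 D"
  shows "integrable (lebesgue_on D) (\<lambda>x. u x * v x)"
proof (rule Bochner_Integration.integrable_bound)
  show "integrable (lebesgue_on D) (\<lambda>x. (u x)\<^sup>2 + (v x)\<^sup>2)"
    using assms by (simp add: L2_def)
  show "(\<lambda>x. u x * v x) \<in> borel_measurable (lebesgue_on D)"
    by (intro borel_measurable_times L2_measurable assms)
  have "\<bar>a * b\<bar> \<le> a\<^sup>2 + b\<^sup>2" for a b :: real
  proof -
    have "2 * \<bar>a\<bar> * \<bar>b\<bar> \<le> a\<^sup>2 + b\<^sup>2" using sum_squares_bound[of "\<bar>a\<bar>" "\<bar>b\<bar>"] by simp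
    moreover have "0 \<le> \<bar>a\<bar> * \<bar>b\<bar>" by simp
    ultimately show ?thesis by (simp only: abs_mult mult.assoc)
  qed
  then show "AE x in lebesgue_on D. norm (u x * v x) \<le> norm ((u x)\<^sup>2 + (v x)\<^sup>2)"
    by (intro AE_I2) simp
qed

lemma L2_zero [simp]: "(\<lambda>x. 0) \<in> L2 D"
  by (simp add: L2_def)

lemma L2_add:
  assumes "u \<in> L2 D" "v \<in> L2 D"
  shows "(\<lambda>x. u x + v x) \<in> L2 D"
proof -
  have "integrable (lebesgue_on D) (\<lambda>x. (u x)\<^sup>2 + 2 * (u x * v x) + (v x)\<^sup>2)"
    using assms L2_integrable_mult[OF assms] by (simp add: L2_def)
  moreover have "(\<lambda>x. u x + v x) \<in> borel_measurable (lebesgue_on D)"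
    by (intro borel_measurable_add L2_measurable assms)
  ultimately show ?thesis
    by (simp add: L2_def power2_sum algebra_simps)
qed

lemma L2_scale:
  assumes "u \<in> L2 D"
  shows "(\<lambda>x. c * u x) \<in> L2 D"
proof -
  have "(\<lambda>x. c * u x) \<in> borel_measurable (lebesgue_on D)"
    by (rule borel_measurable_times[OF borel_measurable_const L2_measurable[OF assms]])
  then show ?thesis using assms by (simp add: L2_def power_mult_distrib)
qed

lemma L2_diff: "u \<in> L2 D \<Longrightarrow> v \<in> L2 D \<Longrightarrow> (\<lambda>x. u x - v x) \<in> L2 D"
  using L2_add[OF _ L2_scale[of v D "-1"]] by simp

lemma L2_minus: "u \<in> L2 D \<Longrightarrow> (\<lambda>x. - u x) \<in> L2 D"
  using L2_scale[of u D "-1"] by simp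

lemma L2_sum: "(\<And>i. i \<in> I \<Longrightarrow> u i \<in> L2 D) \<Longrightarrow> (\<lambda>x. \<Sum>i\<in>I. u i x) \<in> L2 D"
  by (induction I rule: infinite_finite_induct) (auto intro: L2_add)

lemma L2_bounded:
  assumes "D \<in> lmeasurable" "g \<in> borel_measurable (lebesgue_on D)" "\<And>x. x \<in> D \<Longrightarrow> \<bar>g x\<bar> \<le> C"
  shows "g \<in> L2 D"
proof -
  interpret finite_measure "lebesgue_on D"
    using assms(1) by (rule finite_measure_lebesgue_on)
  have "integrable (lebesgue_on D) (\<lambda>x. (g x)\<^sup>2)"
  proof (rule integrable_const_bound[where B = "C\<^sup>2"])
    have "norm ((g x)\<^sup>2) \<le> C\<^sup>2" if "x \<in> D" for x
      using assms(3)[OF that] by (simp add: abs_le_square_iff[symmetric])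
    then show "AE x in lebesgue_on D. norm ((g x)\<^sup>2) \<le> C\<^sup>2"
      by (intro AE_I2) simp
  qed (use assms(2) in measurable)
  then show ?thesis using assms(2) by (simp add: L2_def)
qed

lemma L2_const: "D \<in> lmeasurable \<Longrightarrow> (\<lambda>x. c) \<in> L2 D"
  by (rule L2_bounded[where C = "\<bar>c\<bar>"]) auto

lemma L2_mult_bounded:
  assumes "u \<in> L2 D" "h \<in> borel_measurable (lebesgue_on D)" "\<And>x. x \<in> D \<Longrightarrow> \<bar>h x\<bar> \<le> C"
  shows "(\<lambda>x. h x * u x) \<in> L2 D"
proof -
  have "integrable (lebesgue_on D) (\<lambda>x. (h x * u x)\<^sup>2)"
  proof (rule Bochner_Integration.integrable_bound)
    show "integrable (lebesgue_on D) (\<lambda>x. C\<^sup>2 * (u x)\<^sup>2)"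
      using assms(1) by (simp add: L2_def)
    have "norm ((h x * u x)\<^sup>2) \<le> norm (C\<^sup>2 * (u x)\<^sup>2)" if "x \<in> D" for x
      using assms(3)[OF that]
      by (simp add: power_mult_distrib mult_right_mono abs_le_square_iff[symmetric])
    then show "AE x in lebesgue_on D. norm ((h x * u x)\<^sup>2) \<le> norm (C\<^sup>2 * (u x)\<^sup>2)"
      by (intro AE_I2) simp
  qed (intro borel_measurable_power borel_measurable_times assms(2) L2_measurable assms(1))
  moreover have "(\<lambda>x. h x * u x) \<in> borel_measurable (lebesgue_on D)"
    by (intro borel_measurable_times assms(2) L2_measurable assms(1))
  ultimately show ?thesis by (simp add: L2_def)
qed

section \<open>Inner product and seminorm on representatives\<close>

lemma L2_inner_commute: "L2_inner D u v = L2_inner D v u"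
  by (simp add: L2_inner_def mult.commute)

lemma L2_inner_add_left:
  assumes "u \<in> L2 D" "v \<in> L2 D" "w \<in> L2 D"
  shows "L2_inner D (\<lambda>x. u x + v x) w = L2_inner D u w + L2_inner D v w"
  using L2_integrable_mult[OF assms(1,3)] L2_integrable_mult[OF assms(2,3)]
  by (simp add: L2_inner_def distrib_right)

lemma L2_inner_add_right:
  assumes "u \<in> L2 D" "v \<in> L2 D" "w \<in> L2 D"
  shows "L2_inner D w (\<lambda>x. u x + v x) = L2_inner D w u + L2_inner D w v"
  using L2_inner_add_left[OF assms] by (simp add: L2_inner_commute)

lemma L2_inner_scale_left: "L2_inner D (\<lambda>x. c * u x) v = c * L2_inner D u v"
  by (simp add: L2_inner_def mult.assoc)

lemma L2_inner_scale_right: "L2_inner D u (\<lambda>x. c * v x) = c * L2_inner D u v"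
  by (simp add: L2_inner_def mult.left_commute)

lemma L2_inner_diff_left:
  assumes "u \<in> L2 D" "v \<in> L2 D" "w \<in> L2 D"
  shows "L2_inner D (\<lambda>x. u x - v x) w = L2_inner D u w - L2_inner D v w"
  using L2_integrable_mult[OF assms(1,3)] L2_integrable_mult[OF assms(2,3)]
  by (simp add: L2_inner_def left_diff_distrib)

lemma L2_inner_sum_left:
  assumes "\<And>i. i \<in> I \<Longrightarrow> u i \<in> L2 D" "v \<in> L2 D"
  shows "L2_inner D (\<lambda>x. \<Sum>i\<in>I. u i x) v = (\<Sum>i\<in>I. L2_inner D (u i) v)"
  using assms
proof (induction I rule: infinite_finite_induct)
  case (insert i I)
  then show ?case by (simp add: L2_inner_add_left L2_sum)
qed (auto simp: L2_inner_def)

lemma L2_inner_sum_right: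
  assumes "\<And>i. i \<in> I \<Longrightarrow> u i \<in> L2 D" "v \<in> L2 D"
  shows "L2_inner D v (\<lambda>x. \<Sum>i\<in>I. u i x) = (\<Sum>i\<in>I. L2_inner D v (u i))"
  using L2_inner_sum_left[OF assms] by (simp add: L2_inner_commute)

lemma L2_inner_cong_AE:
  assumes "AE x in lebesgue_on D. u x = u' x" "AE x in lebesgue_on D. v x = v' x"
    "u \<in> L2 D" "u' \<in> L2 D" "v \<in> L2 D" "v' \<in> L2 D"
  shows "L2_inner D u v = L2_inner D u' v'"
  unfolding L2_inner_def
proof (rule integral_cong_AE)
  show "AE x in lebesgue_on D. u x * v x = u' x * v' x"
    using assms(1,2) by eventually_elim simp
qed (use assms in \<open>auto simp: L2_def\<close>)

lemma L2_inner_self_nonneg: "L2_inner D u u \<ge> 0"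
  by (simp add: L2_inner_def integral_nonneg_AE)

lemma L2_norm_nonneg [simp]: "L2_norm D u \<ge> 0"
  by (simp add: L2_norm_def L2_inner_self_nonneg)

lemma L2_norm_square: "(L2_norm D u)\<^sup>2 = L2_inner D u u"
  by (simp add: L2_norm_def L2_inner_self_nonneg)

lemma L2_norm_cong_AE:
  assumes "AE x in lebesgue_on D. u x = u' x" "u \<in> L2 D" "u' \<in> L2 D"
  shows "L2_norm D u = L2_norm D u'"
  unfolding L2_norm_def using L2_inner_cong_AE[OF assms(1,1)] assms by simp

lemma L2_norm_zero [simp]: "L2_norm D (\<lambda>x. 0) = 0"
  by (simp add: L2_norm_def L2_inner_def)

lemma L2_norm_scale: "L2_norm D (\<lambda>x. c * u x) = \<bar>c\<bar> * L2_norm D u"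
proof -
  have "L2_inner D (\<lambda>x. c * u x) (\<lambda>x. c * u x) = c\<^sup>2 * L2_inner D u u"
    by (simp only: L2_inner_scale_left L2_inner_scale_right power2_eq_square mult.assoc)
  then show ?thesis by (simp add: L2_norm_def real_sqrt_mult)
qed

lemma L2_Cauchy_Schwarz:
  assumes "u \<in> L2 D" "v \<in> L2 D"
  shows "\<bar>L2_inner D u v\<bar> \<le> L2_norm D u * L2_norm D v"
proof -
  define a b c where "a = L2_inner D u u" and "b = L2_inner D u v" and "c = L2_inner D v v"
  have q: "a + 2 * t * b + t\<^sup>2 * c \<ge> 0" for t
  proof -
    have "L2_inner D (\<lambda>x. u x + t * v x) (\<lambda>x. u x + t * v x) = a + 2 * t * b + t\<^sup>2 * c"
    proof -
      have sv: "(\<lambda>x. t * v x) \<in> L2 D" by (rule L2_scale[OF assms(2)])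
      have "L2_inner D v u = b" by (simp add: b_def L2_inner_commute)
      then have "L2_inner D (\<lambda>x. u x + t * v x) (\<lambda>x. u x + t * v x) = (a + t * b) + (t * b + t * (t * c))"
        unfolding L2_inner_add_left[OF assms(1) sv L2_add[OF assms(1) sv]]
          L2_inner_add_right[OF assms(1) sv assms(1)] L2_inner_add_right[OF assms(1) sv assms(2)]
          L2_inner_scale_left L2_inner_scale_right
        by (simp add: a_def b_def c_def distrib_left)
      then show ?thesis by (simp add: power2_eq_square algebra_simps)
    qed
    then show ?thesis using L2_inner_self_nonneg by metis
  qed
  have ac: "a \<ge> 0" "c \<ge> 0" by (auto simp: a_def c_def L2_inner_self_nonneg)
  have "b\<^sup>2 \<le> a * c"
  proof (cases "c = 0")
    case True
    \<comment> \<open>In the degenerate case the quadratic is the affine function a + 2 t b, which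
      would take the value -1 at the chosen t.\<close>
    have "b = 0"
    proof (rule ccontr)
      assume "b \<noteq> 0"
      then show False using q[of "- (a + 1) / (2 * b)"] True by (simp add: field_simps)
    qed
    then show ?thesis using ac by simp
  next
    case False
    then have "c > 0" using ac by simp
    then show ?thesis using q[of "- b / c"] by (simp add: field_simps power2_eq_square)
  qed
  then have "sqrt (b\<^sup>2) \<le> sqrt (a * c)" by (rule real_sqrt_le_mono)
  then show ?thesis by (simp add: real_sqrt_mult L2_norm_def a_def b_def c_def)
qed

lemma L2_triangle:
  assumes "u \<in> L2 D" "v \<in> L2 D"
  shows "L2_norm D (\<lambda>x. u x + v x) \<le> L2_norm D u + L2_norm D v"
proof (rule power2_le_imp_le)
  have "(L2_norm D (\<lambda>x. u x + v x))\<^sup>2 = (L2_norm D u)\<^sup>2 + 2 * L2_inner D u v + (L2_norm D v)\<^sup>2"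
    unfolding L2_norm_square L2_inner_add_left[OF assms L2_add[OF assms]]
      L2_inner_add_right[OF assms assms(1)] L2_inner_add_right[OF assms assms(2)]
    by (simp add: L2_inner_commute[of D v u])
  then show "(L2_norm D (\<lambda>x. u x + v x))\<^sup>2 \<le> (L2_norm D u + L2_norm D v)\<^sup>2"
    using L2_Cauchy_Schwarz[OF assms] by (simp add: power2_sum)
qed simp

lemma L2_norm_minus_commute: "L2_norm D (\<lambda>x. u x - v x) = L2_norm D (\<lambda>x. v x - u x)"
proof -
  have "(u x - v x) * (u x - v x) = (v x - u x) * (v x - u x)" for x by (simp add: algebra_simps)
  then show ?thesis by (simp add: L2_norm_def L2_inner_def)
qed

lemma L2_triangle_diff:
  assumes "u \<in> L2 D" "v \<in> L2 D" "w \<in> L2 D"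
  shows "L2_norm D (\<lambda>x. u x - w x) \<le> L2_norm D (\<lambda>x. u x - v x) + L2_norm D (\<lambda>x. v x - w x)"
  using L2_triangle[OF L2_diff[OF assms(1,2)] L2_diff[OF assms(2,3)]] by simp

lemma L2_triangle_minus:
  assumes "u \<in> L2 D" "v \<in> L2 D"
  shows "L2_norm D (\<lambda>x. u x - v x) \<le> L2_norm D u + L2_norm D v"
  using L2_triangle[OF assms(1) L2_minus[OF assms(2)]] L2_norm_scale[of D "-1" v] by simp

lemma L2_norm_sum_le:
  assumes "\<And>i. i \<in> I \<Longrightarrow> u i \<in> L2 D"
  shows "L2_norm D (\<lambda>x. \<Sum>i\<in>I. u i x) \<le> (\<Sum>i\<in>I. L2_norm D (u i))"
  using assms
proof (induction I rule: infinite_finite_induct)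
  case (insert i I)
  then have "L2_norm D (\<lambda>x. u i x + (\<Sum>i\<in>I. u i x)) \<le> L2_norm D (u i) + L2_norm D (\<lambda>x. \<Sum>i\<in>I. u i x)"
    by (intro L2_triangle L2_sum) auto
  with insert show ?case by simp
qed auto

text \<open>The form in which exceptional sets are paid for: small off B, merely bounded on B, with
  the measure of B balancing the bound M.\<close>

lemma L2_norm_split_bound:
  assumes D: "D \<in> lmeasurable" and u: "u \<in> L2 D" and B: "B \<in> lmeasurable" "B \<subseteq> D"
    and good: "AE x in lebesgue_on D. x \<notin> B \<longrightarrow> \<bar>u x\<bar> \<le> e"
    and bad: "\<And>x. x \<in> B \<Longrightarrow> \<bar>u x\<bar> \<le> M"
  shows "(L2_norm D u)\<^sup>2 \<le> e\<^sup>2 * measure lebesgue D + M\<^sup>2 * measure lebesgue B"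
proof -
  have Ds: "D \<in> sets lebesgue" and Bs: "B \<in> sets lebesgue" using D B by auto
  have mD: "measure (lebesgue_on D) D = measure lebesgue D" "measure (lebesgue_on D) B = measure lebesgue B"
    using Ds Bs B by (simp_all add: measure_restrict_space)
  interpret finite_measure "lebesgue_on D" by (rule finite_measure_lebesgue_on[OF D])
  have Bon: "B \<in> sets (lebesgue_on D)" using Bs B Ds by (simp add: sets_restrict_space_iff)
  have "L2_inner D u u \<le> (LINT x|lebesgue_on D. e\<^sup>2 + M\<^sup>2 * indicator B x)"
    unfolding L2_inner_def
  proof (rule integral_mono_AE)
    show "integrable (lebesgue_on D) (\<lambda>x. u x * u x)" by (rule L2_integrable_mult[OF u u])
    show "integrable (lebesgue_on D) (\<lambda>x. e\<^sup>2 + M\<^sup>2 * indicator B x)"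
      using Bon by (auto intro!: Bochner_Integration.integrable_add simp: emeasure_eq_measure)
    show "AE x in lebesgue_on D. u x * u x \<le> e\<^sup>2 + M\<^sup>2 * indicator B x"
      using good
    proof eventually_elim
      case (elim x)
      show ?case
      proof (cases "x \<in> B")
        case True
        have "(u x)\<^sup>2 \<le> M\<^sup>2" using bad[OF True] by (simp add: abs_le_square_iff[symmetric])
        then show ?thesis using True by (simp add: power2_eq_square add_increasing)
      next
        case False
        then have "(u x)\<^sup>2 \<le> e\<^sup>2" using elim by (simp add: abs_le_square_iff[symmetric])
        then show ?thesis using False by (simp add: power2_eq_square)
      qed
    qed
  qed
  also have "\<dots> = e\<^sup>2 * measure lebesgue D + M\<^sup>2 * measure lebesgue B"
    using Bon Ds mD B(2)
    by (subst Bochner_Integration.integral_add) (auto simp: emeasure_eq_measure mult.commute Int_absorb2)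
  finally show ?thesis by (simp add: L2_norm_square)
qed

section \<open>Lipschitz continuity of the solution operator\<close>

lemma L2_bounded_linear_add:
  assumes "L2_bounded_linear D D' A" "u \<in> L2 D" "v \<in> L2 D"
  shows "AE x in lebesgue_on D'. A (\<lambda>x. u x + v x) x = A u x + A v x"
  using assms by (simp add: L2_bounded_linear_def L2_eq_def)

lemma L2_bounded_linear_scale:
  assumes "L2_bounded_linear D D' A" "u \<in> L2 D"
  shows "AE x in lebesgue_on D'. A (\<lambda>x. c * u x) x = c * A u x"
  using assms by (simp add: L2_bounded_linear_def L2_eq_def)

lemma L2_bounded_linear_combine:
  assumes A: "L2_bounded_linear D D' A" and uv: "u \<in> L2 D" "v \<in> L2 D"
  shows "AE x in lebesgue_on D'. A (\<lambda>x. a * u x + b * v x) x = a * A u x + b * A v x"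
  using L2_bounded_linear_add[OF A L2_scale[OF uv(1), of a] L2_scale[OF uv(2), of b]]
    L2_bounded_linear_scale[OF A uv(1), of a] L2_bounded_linear_scale[OF A uv(2), of b]
  by eventually_elim simp

lemma L2_bounded_linear_diff:
  assumes A: "L2_bounded_linear D D' A" and uv: "u \<in> L2 D" "v \<in> L2 D"
  shows "AE x in lebesgue_on D'. A (\<lambda>x. u x - v x) x = A u x - A v x"
  using L2_bounded_linear_combine[OF A uv, of 1 "-1"] by simp

text \<open>A pointwise identity, integrated. Here x1, x2 will be the states of two problems and g1,
  g2 their data terms; the coupling of the two differences is the only term without a sign.\<close>

lemma L2_midpoint_square:
  assumes "x1 \<in> L2 D" "x2 \<in> L2 D" "g1 \<in> L2 D" "g2 \<in> L2 D"
  shows "L2_inner D (\<lambda>x. x1 x + g1 x) (\<lambda>x. x1 x + g1 x) + L2_inner D (\<lambda>x. x2 x + g2 x) (\<lambda>x. x2 x + g2 x)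
     - L2_inner D (\<lambda>x. 1/2 * (x1 x + x2 x) + g1 x) (\<lambda>x. 1/2 * (x1 x + x2 x) + g1 x)
     - L2_inner D (\<lambda>x. 1/2 * (x1 x + x2 x) + g2 x) (\<lambda>x. 1/2 * (x1 x + x2 x) + g2 x)
     = 1/2 * L2_inner D (\<lambda>x. x1 x - x2 x) (\<lambda>x. x1 x - x2 x)
       + L2_inner D (\<lambda>x. x1 x - x2 x) (\<lambda>x. g1 x - g2 x)" (is "?a + ?b - ?c - ?d = 1/2 * ?e + ?f")
proof -
  define A where "A = (\<lambda>x. x1 x + g1 x)"
  define B where "B = (\<lambda>x. x2 x + g2 x)"
  define C where "C = (\<lambda>x. 1/2 * (x1 x + x2 x) + g1 x)"
  define E where "E = (\<lambda>x. 1/2 * (x1 x + x2 x) + g2 x)"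
  define X where "X = (\<lambda>x. x1 x - x2 x)"
  define G where "G = (\<lambda>x. g1 x - g2 x)"
  have L: "A \<in> L2 D" "B \<in> L2 D" "C \<in> L2 D" "E \<in> L2 D" "X \<in> L2 D" "G \<in> L2 D"
    unfolding A_def B_def C_def E_def X_def G_def by (intro L2_add L2_diff L2_scale assms)+
  have eq: "A x * A x + B x * B x - C x * C x - E x * E x = 1/2 * (X x * X x) + X x * G x" for x
    by (simp add: A_def B_def C_def E_def X_def G_def field_simps)
  have "(LINT x|lebesgue_on D. A x * A x + B x * B x - C x * C x - E x * E x)
     = L2_inner D A A + L2_inner D B B - L2_inner D C C - L2_inner D E E"
    using L2_integrable_mult[OF L(1,1)] L2_integrable_mult[OF L(2,2)] L2_integrable_mult[OF L(3,3)]
      L2_integrable_mult[OF L(4,4)] by (simp add: L2_inner_def)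
  moreover have "(LINT x|lebesgue_on D. 1/2 * (X x * X x) + X x * G x) = 1/2 * L2_inner D X X + L2_inner D X G"
    using L2_integrable_mult[OF L(5,5)] L2_integrable_mult[OF L(5,6)] by (simp add: L2_inner_def)
  ultimately have "L2_inner D A A + L2_inner D B B - L2_inner D C C - L2_inner D E E
     = 1/2 * L2_inner D X X + L2_inner D X G" by (simp only: eq)
  then show ?thesis unfolding A_def B_def C_def E_def X_def G_def .
qed

lemma L2_midpoint_product:
  assumes "u \<in> L2 D" "v \<in> L2 D" "n1 \<in> L2 D" "n2 \<in> L2 D"
  shows "L2_inner D u n1 + L2_inner D v n2
     - 2 * L2_inner D (\<lambda>x. 1/2 * (u x + v x)) (\<lambda>x. 1/2 * (n1 x + n2 x))
     = 1/2 * L2_inner D (\<lambda>x. u x - v x) (\<lambda>x. n1 x - n2 x)"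
proof -
  define A where "A = (\<lambda>x. 1/2 * (u x + v x))"
  define B where "B = (\<lambda>x. 1/2 * (n1 x + n2 x))"
  define X where "X = (\<lambda>x. u x - v x)"
  define G where "G = (\<lambda>x. n1 x - n2 x)"
  have L: "A \<in> L2 D" "B \<in> L2 D" "X \<in> L2 D" "G \<in> L2 D"
    unfolding A_def B_def X_def G_def by (intro L2_add L2_diff L2_scale assms)+
  have eq: "u x * n1 x + v x * n2 x - 2 * (A x * B x) = 1/2 * (X x * G x)" for x
    by (simp add: A_def B_def X_def G_def field_simps)
  have "(LINT x|lebesgue_on D. u x * n1 x + v x * n2 x - 2 * (A x * B x))
     = L2_inner D u n1 + L2_inner D v n2 - 2 * L2_inner D A B"
    using L2_integrable_mult[OF assms(1,3)] L2_integrable_mult[OF assms(2,4)] L2_integrable_mult[OF L(1,2)]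
    by (simp add: L2_inner_def)
  moreover have "(LINT x|lebesgue_on D. 1/2 * (X x * G x)) = 1/2 * L2_inner D X G"
    by (simp add: L2_inner_def)
  ultimately have "L2_inner D u n1 + L2_inner D v n2 - 2 * L2_inner D A B = 1/2 * L2_inner D X G"
    by (simp only: eq)
  then show ?thesis unfolding A_def B_def X_def G_def .
qed

text \<open>
  With \<open>m\<close> the midpoint of two optimal controls, adding the optimality inequalities of both
  problems against \<open>m\<close> cancels \<open>\<theta>\<close> by convexity and leaves a quadratic estimate.
\<close>

lemma solution_operator_Lipschitz:
  assumes D: "D \<in> lmeasurable"
    and S: "L2_bounded_linear D D S"
    and N: "L2_bounded_linear D D N" "c0 > 0"
      "\<forall>u\<in>L2 D. L2_inner D u (N u) \<ge> c0 * (L2_norm D u)\<^sup>2"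
    and \<theta>: "L2_convex_lsc_proper D \<theta>"
    and T: "solution_operator D S N \<theta> T"
  obtains C where "C \<ge> 0"
    "\<And>yd f yd' f'. yd \<in> L2 D \<Longrightarrow> f \<in> L2 D \<Longrightarrow> yd' \<in> L2 D \<Longrightarrow> f' \<in> L2 D \<Longrightarrow>
       L2_norm D (\<lambda>x. T (yd, f) x - T (yd', f') x)
         \<le> C * (L2_norm D (\<lambda>x. yd x - yd' x) + L2_norm D (\<lambda>x. f x - f' x))"
proof -
  obtain C1 where C1: "\<And>u. u \<in> L2 D \<Longrightarrow> L2_norm D (S u) \<le> C1 * L2_norm D u"
    using S unfolding L2_bounded_linear_def by blast
  define C where "C = \<bar>C1\<bar>"
  have SC: "L2_norm D (S u) \<le> C * L2_norm D u" if "u \<in> L2 D" for u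
  proof -
    have "C1 * L2_norm D u \<le> C * L2_norm D u" by (intro mult_right_mono) (auto simp: C_def)
    then show ?thesis using C1[OF that] by linarith
  qed
  have SL: "S u \<in> L2 D" if "u \<in> L2 D" for u using S that by (simp add: L2_bounded_linear_def)
  have NL: "N u \<in> L2 D" if "u \<in> L2 D" for u using N that by (simp add: L2_bounded_linear_def)
  note Sadd = L2_bounded_linear_add[OF S]
  have lin: "AE x in lebesgue_on D. A (\<lambda>x. 1/2 * u x + (1 - 1/2) * v x) x = 1/2 * (A u x + A v x)"
    if A: "L2_bounded_linear D D A" and uv: "u \<in> L2 D" "v \<in> L2 D" for A u v
    using L2_bounded_linear_combine[OF A uv, of "1/2" "1 - 1/2"] by eventually_elim simp
  \<comment> \<open>The reduced cost without \<theta>. Splitting S (u + f) by linearity is valid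
    almost everywhere only, so admissible states are first exchanged for this
    representative.\<close>
  define J where "J yd f u = 1/2 * (L2_norm D (\<lambda>x. S u x + S f x - yd x))\<^sup>2 + 1/2 * L2_inner D u (N u)" for yd f u
  have cost_J: "cost D N \<theta> yd u y = ereal (J yd f u) + \<theta> u"
    if "u \<in> L2 D" "f \<in> L2 D" "yd \<in> L2 D" "(u, y) \<in> admissible D S f" for yd f u y
  proof -
    have y: "y \<in> L2 D" "AE x in lebesgue_on D. y x = S (\<lambda>x. u x + f x) x"
      using that by (auto simp: admissible_def L2_eq_def)
    have "AE x in lebesgue_on D. y x - yd x = S u x + S f x - yd x"
      using y(2) Sadd[OF that(1,2)] by eventually_elim simp
    then have "L2_norm D (\<lambda>x. y x - yd x) = L2_norm D (\<lambda>x. S u x + S f x - yd x)"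
      by (rule L2_norm_cong_AE) (intro L2_diff L2_add SL that y)+
    then show ?thesis by (simp add: cost_def J_def)
  qed
  have adm: "(u, S (\<lambda>x. u x + f x)) \<in> admissible D S f" if "u \<in> L2 D" "f \<in> L2 D" for u f
    using that by (simp add: admissible_def L2_eq_def SL L2_add)
  have opt: "T (yd, f) \<in> L2 D \<and> (\<forall>u\<in>L2 D. ereal (J yd f (T (yd, f))) + \<theta> (T (yd, f)) \<le> ereal (J yd f u) + \<theta> u)"
    if "yd \<in> L2 D" "f \<in> L2 D" for yd f
  proof -
    have "optimal_control D S N \<theta> yd f (T (yd, f))"
      using T that by (simp add: solution_operator_def)
    then obtain y where y: "(T (yd, f), y) \<in> admissible D S f"
      "\<And>u' y'. (u', y') \<in> admissible D S f \<Longrightarrow> cost D N \<theta> yd (T (yd, f)) y \<le> cost D N \<theta> yd u' y'"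
      unfolding optimal_control_def by blast
    have TL: "T (yd, f) \<in> L2 D" using y(1) by (simp add: admissible_def)
    have "ereal (J yd f (T (yd, f))) + \<theta> (T (yd, f)) \<le> ereal (J yd f u) + \<theta> u" if "u \<in> L2 D" for u
      using y(2)[OF adm[OF that \<open>f \<in> L2 D\<close>]]
      by (simp add: cost_J[OF TL \<open>f \<in> L2 D\<close> \<open>yd \<in> L2 D\<close> y(1)]
          cost_J[OF that \<open>f \<in> L2 D\<close> \<open>yd \<in> L2 D\<close> adm[OF that \<open>f \<in> L2 D\<close>]])
    then show ?thesis using TL by blast
  qed
  \<comment> \<open>In the extended reals \<theta> can be cancelled only where it is finite;
    comparison with a point of its effective domain provides this.\<close>
  have finite_\<theta>: "\<bar>\<theta> (T (yd, f))\<bar> \<noteq> \<infinity>" if d: "yd \<in> L2 D" "f \<in> L2 D" for yd f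
  proof -
    obtain u0 where u0: "u0 \<in> L2 D" "\<theta> u0 \<noteq> \<infinity>" using \<theta> by (auto simp: L2_convex_lsc_proper_def)
    have "\<theta> u0 \<noteq> -\<infinity>" "\<theta> (T (yd, f)) \<noteq> -\<infinity>"
      using \<theta> u0 opt[OF d] by (auto simp: L2_convex_lsc_proper_def)
    moreover have "ereal (J yd f (T (yd, f))) + \<theta> (T (yd, f)) \<le> ereal (J yd f u0) + \<theta> u0"
      using opt[OF d] u0 by blast
    ultimately show ?thesis using u0(2) by (cases "\<theta> u0"; cases "\<theta> (T (yd, f))") auto
  qed
  have main: "L2_norm D (\<lambda>x. T (yd, f) x - T (yd', f') x)
         \<le> 2 * C * (C + 1) / c0 * (L2_norm D (\<lambda>x. yd x - yd' x) + L2_norm D (\<lambda>x. f x - f' x))"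
    if d: "yd \<in> L2 D" "f \<in> L2 D" and d': "yd' \<in> L2 D" "f' \<in> L2 D" for yd f yd' f'
  proof -
    define u v where "u = T (yd, f)" and "v = T (yd', f')"
    define m where "m = (\<lambda>x. 1/2 * u x + (1 - 1/2) * v x)"
    have uv: "u \<in> L2 D" "v \<in> L2 D" using opt d d' by (auto simp: u_def v_def)
    have mL: "m \<in> L2 D" unfolding m_def by (intro L2_add L2_scale uv)
    obtain a b where a: "\<theta> u = ereal a" and b: "\<theta> v = ereal b"
      using finite_\<theta>[OF d] finite_\<theta>[OF d'] unfolding u_def v_def by (metis ereal_cases abs_ereal.simps(2,3))
    have "\<theta> m \<le> ereal (1/2) * \<theta> u + ereal (1 - 1/2) * \<theta> v"
    proof -
      have "(1/2 :: real) \<in> {0<..<1}" by simp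
      then show ?thesis using \<theta> uv unfolding L2_convex_lsc_proper_def m_def by blast
    qed
    then have "\<theta> m \<le> ereal ((a + b) / 2)" by (simp add: a b add_divide_distrib)
    moreover have "\<theta> m \<noteq> -\<infinity>" using \<theta> mL by (auto simp: L2_convex_lsc_proper_def)
    ultimately obtain c where c: "\<theta> m = ereal c" "c \<le> (a + b) / 2" by (cases "\<theta> m") auto
    have "J yd f u + a \<le> J yd f m + c" "J yd' f' v + b \<le> J yd' f' m + c"
      using opt[OF d] opt[OF d'] mL a b c unfolding u_def[symmetric] v_def[symmetric] by force+
    \<comment> \<open>The convexity bound is used for both problems at once: twice the value at the
      midpoint is at most a + b, so \<theta> drops out of the sum.\<close>
    then have key: "J yd f u + J yd' f' v \<le> J yd f m + J yd' f' m" using c(2) by argo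
    define w where "w = (\<lambda>x. u x - v x)"
    have wL: "w \<in> L2 D" unfolding w_def by (intro L2_diff uv)
    define s1 s2 g1 g2 where "s1 = S u" and "s2 = S v" and "g1 = (\<lambda>x. S f x - yd x)" and "g2 = (\<lambda>x. S f' x - yd' x)"
    have sL: "s1 \<in> L2 D" "s2 \<in> L2 D" unfolding s1_def s2_def by (intro SL uv)+
    have gL: "g1 \<in> L2 D" "g2 \<in> L2 D" unfolding g1_def g2_def by (intro L2_diff SL d d')+
    define n1 n2 where "n1 = N u" and "n2 = N v"
    have nL: "n1 \<in> L2 D" "n2 \<in> L2 D" unfolding n1_def n2_def by (intro NL uv)+
    have Jexp: "J yd f u = 1/2 * L2_inner D (\<lambda>x. s1 x + g1 x) (\<lambda>x. s1 x + g1 x) + 1/2 * L2_inner D u n1"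
      "J yd' f' v = 1/2 * L2_inner D (\<lambda>x. s2 x + g2 x) (\<lambda>x. s2 x + g2 x) + 1/2 * L2_inner D v n2"
      by (simp_all add: J_def L2_norm_square s1_def s2_def g1_def g2_def n1_def n2_def add_diff_eq)
    have Jm: "J yd0 f0 m = 1/2 * L2_inner D (\<lambda>x. 1/2 * (s1 x + s2 x) + g x) (\<lambda>x. 1/2 * (s1 x + s2 x) + g x)
        + 1/2 * L2_inner D (\<lambda>x. 1/2 * (u x + v x)) (\<lambda>x. 1/2 * (n1 x + n2 x))"
      if "g = (\<lambda>x. S f0 x - yd0 x)" "f0 \<in> L2 D" "yd0 \<in> L2 D" for yd0 f0 g
    proof -
      have gL': "g \<in> L2 D" unfolding that(1) by (intro L2_diff SL that)
      have ae: "AE x in lebesgue_on D. S m x + S f0 x - yd0 x = 1/2 * (s1 x + s2 x) + g x"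
        using lin[OF S uv] unfolding m_def[symmetric]
        by eventually_elim (simp add: s1_def s2_def that(1))
      have "L2_inner D (\<lambda>x. S m x + S f0 x - yd0 x) (\<lambda>x. S m x + S f0 x - yd0 x)
         = L2_inner D (\<lambda>x. 1/2 * (s1 x + s2 x) + g x) (\<lambda>x. 1/2 * (s1 x + s2 x) + g x)"
        by (rule L2_inner_cong_AE[OF ae ae]) (intro L2_diff L2_add L2_scale SL mL that sL gL')+
      moreover have "L2_inner D m (N m) = L2_inner D (\<lambda>x. 1/2 * (u x + v x)) (\<lambda>x. 1/2 * (n1 x + n2 x))"
      proof (rule L2_inner_cong_AE)
        show "AE x in lebesgue_on D. m x = 1/2 * (u x + v x)" by (simp add: m_def)
        show "AE x in lebesgue_on D. N m x = 1/2 * (n1 x + n2 x)"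
          using lin[OF N(1) uv] by (simp add: m_def n1_def n2_def)
      qed (intro NL mL L2_scale L2_add uv nL)+
      ultimately show ?thesis by (simp add: J_def L2_norm_square)
    qed
    have quad: "1/2 * L2_inner D (\<lambda>x. s1 x - s2 x) (\<lambda>x. s1 x - s2 x)
        + L2_inner D (\<lambda>x. s1 x - s2 x) (\<lambda>x. g1 x - g2 x)
        + 1/2 * L2_inner D (\<lambda>x. u x - v x) (\<lambda>x. n1 x - n2 x) \<le> 0"
      using key L2_midpoint_square[OF sL gL] L2_midpoint_product[OF uv nL]
      unfolding Jexp Jm[OF g1_def d(2,1)] Jm[OF g2_def d'(2,1)] by linarith
    have Nw: "L2_inner D (\<lambda>x. u x - v x) (\<lambda>x. n1 x - n2 x) \<ge> c0 * (L2_norm D w)\<^sup>2"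
    proof -
      have "L2_inner D w (N w) = L2_inner D (\<lambda>x. u x - v x) (\<lambda>x. n1 x - n2 x)"
        unfolding w_def
        by (rule L2_inner_cong_AE)
          (use L2_bounded_linear_diff[OF N(1) uv] in
            \<open>auto simp: n1_def n2_def intro!: L2_diff NL uv\<close>)
      then show ?thesis using N(3) wL by metis
    qed
    have sw: "L2_norm D (\<lambda>x. s1 x - s2 x) \<le> C * L2_norm D w"
    proof -
      have "L2_norm D (\<lambda>x. s1 x - s2 x) = L2_norm D (S w)"
        unfolding w_def using L2_bounded_linear_diff[OF S uv]
        by (intro L2_norm_cong_AE) (auto simp: s1_def s2_def elim: eventually_mono intro!: L2_diff SL uv)
      then show ?thesis using SC[OF wL] by simp
    qed
    define G where "G = L2_norm D (\<lambda>x. yd x - yd' x) + L2_norm D (\<lambda>x. f x - f' x)"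
    have G: "G \<ge> 0" by (simp add: G_def)
    have gg: "L2_norm D (\<lambda>x. g1 x - g2 x) \<le> (C + 1) * G"
    proof -
      have "L2_norm D (\<lambda>x. g1 x - g2 x) = L2_norm D (\<lambda>x. (S f x - S f' x) - (yd x - yd' x))"
        by (simp add: g1_def g2_def algebra_simps)
      also have "\<dots> \<le> L2_norm D (\<lambda>x. S f x - S f' x) + L2_norm D (\<lambda>x. yd x - yd' x)"
        by (intro L2_triangle_minus L2_diff SL d d')
      also have "L2_norm D (\<lambda>x. S f x - S f' x) = L2_norm D (S (\<lambda>x. f x - f' x))"
        using L2_bounded_linear_diff[OF S d(2) d'(2)]
        by (intro L2_norm_cong_AE) (auto elim: eventually_mono intro!: L2_diff SL d d')
      also have "\<dots> \<le> C * L2_norm D (\<lambda>x. f x - f' x)" by (intro SC L2_diff d d')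
      also have "C * L2_norm D (\<lambda>x. f x - f' x) + L2_norm D (\<lambda>x. yd x - yd' x) \<le> (C + 1) * G"
        by (simp add: G_def algebra_simps C_def)
      finally show ?thesis by simp
    qed
    have "c0 * (L2_norm D w)\<^sup>2 \<le> 2 * \<bar>L2_inner D (\<lambda>x. s1 x - s2 x) (\<lambda>x. g1 x - g2 x)\<bar>"
      using quad Nw L2_inner_self_nonneg[of D "\<lambda>x. s1 x - s2 x"] by linarith
    also have "\<dots> \<le> 2 * (L2_norm D (\<lambda>x. s1 x - s2 x) * L2_norm D (\<lambda>x. g1 x - g2 x))"
      by (intro mult_left_mono L2_Cauchy_Schwarz L2_diff sL gL) auto
    also have "\<dots> \<le> 2 * ((C * L2_norm D w) * ((C + 1) * G))"
      using G by (intro mult_left_mono mult_mono sw gg) (auto simp: C_def)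
    finally have "L2_norm D w * (c0 * L2_norm D w) \<le> L2_norm D w * (2 * C * (C + 1) * G)"
      by (simp add: power2_eq_square algebra_simps)
    then have "c0 * L2_norm D w \<le> 2 * C * (C + 1) * G"
    proof (cases "L2_norm D w = 0")
      case True
      then show ?thesis using G by (simp add: C_def)
    next
      case False
      then have "L2_norm D w > 0" using L2_norm_nonneg[of D w] by linarith
      then show ?thesis using \<open>L2_norm D w * (c0 * L2_norm D w) \<le> _\<close> by simp
    qed
    then show ?thesis using N(2) by (simp add: w_def u_def v_def G_def field_simps)
  qed
  show ?thesis by (rule that[OF _ main]) (use N(2) in \<open>simp add: C_def\<close>)
qed

section \<open>Extension operators with prescribed low Fourier coefficients\<close>

lemma torus_cube_eq_box: "torus_cube = box (0 :: real^'d) (\<chi> i. 2 * pi)"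
  by (auto simp: torus_cube_def mem_box_cart)

lemma open_torus_cube: "open (torus_cube :: (real^'d) set)"
  unfolding torus_cube_eq_box by (rule open_box)

lemma lmeasurable_torus_cube: "(torus_cube :: (real^'d) set) \<in> lmeasurable"
  by (simp add: torus_cube_eq_box)

lemma freq_phase_add: "freq_phase k (x + y) = freq_phase k x + freq_phase k y"
  by (simp add: freq_phase_def distrib_left sum.distrib)

lemma freq_phase_scaleR: "freq_phase k (c *\<^sub>R x) = c * freq_phase k x"
  by (simp add: freq_phase_def sum_distrib_left mult_ac)

lemma freq_phase_uminus: "freq_phase (- k) x = - freq_phase k x"
  by (simp add: freq_phase_def sum_negf)

lemma freq_phase_minus: "freq_phase (k - k') x = freq_phase k x - freq_phase k' x"
  by (simp add: freq_phase_def left_diff_distrib sum_subtractf)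

lemma freq_phase_inner: "freq_phase k x = (\<chi> i. of_int (k $ i)) \<bullet> x"
  by (simp add: freq_phase_def inner_vec_def)

lemma continuous_on_freq_phase [continuous_intros]:
  "continuous_on A f \<Longrightarrow> continuous_on A (\<lambda>x. freq_phase k (f x))"
  unfolding freq_phase_inner by (intro continuous_intros)

lemma borel_measurable_cis_freq_phase: "(\<lambda>x. cis (freq_phase k x)) \<in> borel_measurable borel"
  by (intro borel_measurable_continuous_onI) (simp add: cis_conv_exp, intro continuous_intros)

lemma borel_measurable_lebesgue_on_borel:
  assumes "f \<in> borel_measurable borel"
  shows "f \<in> borel_measurable (lebesgue_on D)"
  using measurable_completion[of f lborel borel] assms
  by (auto intro: measurable_restrict_space1)

lemma L2_integrable:
  assumes "D \<in> lmeasurable" "u \<in> L2 D"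
  shows "integrable (lebesgue_on D) u"
  using L2_integrable_mult[OF assms(2) L2_const[OF assms(1), of 1]] by simp

lemma L2_integrable_complex:
  fixes h :: "real^'d \<Rightarrow> complex"
  assumes D: "D \<in> lmeasurable" and u: "u \<in> L2 D" and g: "g \<in> L2 D"
    and h: "h \<in> borel_measurable (lebesgue_on D)" "\<And>x. norm (h x) \<le> C * (1 + \<bar>g x\<bar>)"
  shows "integrable (lebesgue_on D) (\<lambda>x. complex_of_real (u x) * h x)"
proof (rule Bochner_Integration.integrable_bound)
  show "integrable (lebesgue_on D) (\<lambda>x. C * \<bar>u x\<bar> + C * \<bar>u x * g x\<bar>)"
    by (intro Bochner_Integration.integrable_add integrable_mult_right integrable_abs L2_integrable[OF D u]
        L2_integrable_mult[OF u g])
  show "(\<lambda>x. complex_of_real (u x) * h x) \<in> borel_measurable (lebesgue_on D)"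
    by (intro borel_measurable_times h(1) borel_measurable_continuous_on[OF _ L2_measurable[OF u]]
        continuous_on_of_real continuous_on_id)
  have "norm (complex_of_real (u x) * h x) \<le> norm (C * \<bar>u x\<bar> + C * \<bar>u x * g x\<bar>)" for x
  proof -
    have "norm (complex_of_real (u x) * h x) = \<bar>u x\<bar> * norm (h x)" by (simp add: norm_mult)
    also have "\<dots> \<le> \<bar>u x\<bar> * (C * (1 + \<bar>g x\<bar>))" by (intro mult_left_mono h(2)) auto
    also have "\<dots> = C * \<bar>u x\<bar> + C * \<bar>u x * g x\<bar>" by (simp add: abs_mult algebra_simps)
    finally show ?thesis by simp
  qed
  then show "AE x in lebesgue_on D. norm (complex_of_real (u x) * h x) \<le> norm (C * \<bar>u x\<bar> + C * \<bar>u x * g x\<bar>)"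
    by simp
qed

lemma L2_integrable_cis:
  assumes "D \<in> lmeasurable" "u \<in> L2 D"
  shows "integrable (lebesgue_on D) (\<lambda>x. complex_of_real (u x) * cis (- freq_phase k x))"
proof (rule L2_integrable_complex[OF assms L2_zero, where C = 1])
  show "(\<lambda>x. cis (- freq_phase k x)) \<in> borel_measurable (lebesgue_on D)"
    using borel_measurable_lebesgue_on_borel[OF borel_measurable_cis_freq_phase, of "- k"]
    by (simp add: freq_phase_uminus)
qed simp

lemma fourier_coeff_add:
  assumes "u \<in> L2 torus_cube" "v \<in> L2 torus_cube"
  shows "fourier_coeff (\<lambda>x. u x + v x) k = fourier_coeff u k + fourier_coeff v k"
  using L2_integrable_cis[OF lmeasurable_torus_cube assms(1), of k]
    L2_integrable_cis[OF lmeasurable_torus_cube assms(2), of k]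
  by (simp add: fourier_coeff_def distrib_right add_divide_distrib)

lemma fourier_coeff_scale: "fourier_coeff (\<lambda>x. c * u x) k = of_real c * fourier_coeff u k"
  by (simp add: fourier_coeff_def mult.assoc)

lemma fourier_coeff_sum:
  assumes "\<And>i. i \<in> I \<Longrightarrow> u i \<in> L2 torus_cube"
  shows "fourier_coeff (\<lambda>x. \<Sum>i\<in>I. u i x) k = (\<Sum>i\<in>I. fourier_coeff (u i) k)"
  using assms
proof (induction I rule: infinite_finite_induct)
  case (insert i I)
  then show ?case by (simp add: fourier_coeff_add L2_sum)
qed (auto simp: fourier_coeff_def)

lemma fourier_coeff_cong:
  assumes "\<And>x. x \<in> torus_cube \<Longrightarrow> u x = v x"
  shows "fourier_coeff u k = fourier_coeff v k"
  unfolding fourier_coeff_def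
  by (intro arg_cong2[where f = "(/)"] refl Bochner_Integration.integral_cong) (auto simp: assms)

lemma integral_lebesgue_on_if:
  fixes f :: "real^'d \<Rightarrow> complex"
  assumes "A \<in> sets lebesgue" "D \<in> sets lebesgue" "A \<subseteq> D"
  shows "(LINT x|lebesgue_on D. (if x \<in> A then f x else 0)) = (LINT x|lebesgue_on A. f x)"
proof -
  have "(LINT x|lebesgue_on D. (if x \<in> A then f x else 0)) = (LINT x|lebesgue. indicator D x *\<^sub>R (if x \<in> A then f x else 0))"
    by (rule integral_restrict_space) (use assms in auto)
  also have "\<dots> = (LINT x|lebesgue. indicator A x *\<^sub>R f x)"
    using assms(3) by (intro Bochner_Integration.integral_cong) (auto simp: indicator_def)
  also have "\<dots> = (LINT x|lebesgue_on A. f x)"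
    by (rule integral_restrict_space[symmetric]) (use assms in auto)
  finally show ?thesis .
qed

lemma fourier_coeff_ball:
  fixes a :: "real^'d"
  assumes "ball a r \<subseteq> torus_cube"
  shows "fourier_coeff (indicator (ball a r)) k =
     cis (- freq_phase k a) * ((LINT y|lborel. indicator (ball 0 r) y *\<^sub>R cis (- freq_phase k y)) / of_real ((2 * pi) ^ CARD('d)))"
proof -
  have m: "(\<lambda>x. indicator (ball b r) x *\<^sub>R cis (- freq_phase k x)) \<in> borel_measurable borel" for b :: "real^'d"
    using borel_measurable_cis_freq_phase[of "- k"]
    by (intro borel_measurable_scaleR borel_measurable_indicator) (auto simp: freq_phase_uminus)
  have "(LINT x|lebesgue_on torus_cube. complex_of_real (indicator (ball a r) x) * cis (- freq_phase k x))
     = (LINT x|lebesgue_on torus_cube. (if x \<in> ball a r then cis (- freq_phase k x) else 0))"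
    by (intro Bochner_Integration.integral_cong) (auto simp: indicator_def)
  also have "\<dots> = (LINT x|lebesgue_on (ball a r). cis (- freq_phase k x))"
    by (rule integral_lebesgue_on_if) (use assms lmeasurable_torus_cube in auto)
  also have "\<dots> = (LINT x|lebesgue. indicator (ball a r) x *\<^sub>R cis (- freq_phase k x))"
    by (rule integral_restrict_space) auto
  also have "\<dots> = (LINT x|lborel. indicator (ball a r) x *\<^sub>R cis (- freq_phase k x))"
    by (rule integral_completion) (use m in simp)
  also have "\<dots> = (LINT x|distr lborel borel ((+) a). indicator (ball a r) x *\<^sub>R cis (- freq_phase k x))"
    by (simp add: lborel_distr_plus)
  also have "\<dots> = (LINT y|lborel. indicator (ball a r) (a + y) *\<^sub>R cis (- freq_phase k (a + y)))"
    by (rule integral_distr) (use m in auto)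
  also have "\<dots> = (LINT y|lborel. cis (- freq_phase k a) * (indicator (ball 0 r) y *\<^sub>R cis (- freq_phase k y)))"
    by (intro Bochner_Integration.integral_cong)
       (auto simp: indicator_def dist_norm freq_phase_add cis_mult)
  also have "\<dots> = cis (- freq_phase k a) * (LINT y|lborel. indicator (ball 0 r) y *\<^sub>R cis (- freq_phase k y))"
    by (rule integral_mult_right_zero)
  finally show ?thesis by (simp add: fourier_coeff_def)
qed

text \<open>With phases of size at most 1 the real part of the integrand is at least cos 1 \<ge> 1/2
  on the whole ball, so nothing can cancel.\<close>

lemma ball_coeff_nonzero:
  fixes k :: "int^'d"
  assumes "r > 0" and small: "\<And>y :: real^'d. norm y < r \<Longrightarrow> \<bar>freq_phase k y\<bar> \<le> 1"
  shows "(LINT y|lborel. indicator (ball 0 r) y *\<^sub>R cis (- freq_phase k y)) \<noteq> 0"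
proof -
  have m: "(\<lambda>x. indicator (ball 0 r) x *\<^sub>R cis (- freq_phase k x)) \<in> borel_measurable borel"
    using borel_measurable_cis_freq_phase[of "- k"]
    by (intro borel_measurable_scaleR borel_measurable_indicator) (auto simp: freq_phase_uminus)
  have indi: "integrable lborel (indicator (ball (0 :: real^'d) r) :: _ \<Rightarrow> real)"
    using emeasure_bounded_finite[OF bounded_ball] by (simp add: integrable_indicator_iff less_top)
  have int: "integrable lborel (\<lambda>y. indicator (ball 0 r) y *\<^sub>R cis (- freq_phase k y))"
    by (rule Bochner_Integration.integrable_bound[OF indi]) (use m in \<open>auto simp: indicator_def\<close>)
  have "Re (LINT y|lborel. indicator (ball 0 r) y *\<^sub>R cis (- freq_phase k y))
     = (LINT y|lborel. Re (indicator (ball 0 r) y *\<^sub>R cis (- freq_phase k y)))"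
    by (rule integral_Re[OF int, symmetric])
  also have "\<dots> \<ge> (LINT y|lborel. 1/2 * indicator (ball (0 :: real^'d) r) y)"
  proof (rule integral_mono)
    show "integrable lborel (\<lambda>y. Re (indicator (ball 0 r) y *\<^sub>R cis (- freq_phase k y)))"
      using int by (rule integrable_Re)
    fix y :: "real^'d"
    show "1/2 * indicator (ball 0 r) y \<le> Re (indicator (ball 0 r) y *\<^sub>R cis (- freq_phase k y))"
    proof (cases "y \<in> ball 0 r")
      case True
      then have "\<bar>freq_phase k y\<bar> \<le> 1" using small by simp
      then have "cos 1 \<le> cos \<bar>freq_phase k y\<bar>" using pi_gt3 by (intro cos_monotone_0_pi_le) auto
      moreover have "(1/2 :: real) \<le> cos 1"
      proof -
        have "cos (pi / 3) \<le> cos (1 :: real)" using pi_gt3 by (intro cos_monotone_0_pi_le) auto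
        then show ?thesis by (simp add: cos_60)
      qed
      ultimately show ?thesis using True by simp
    qed simp
  qed (use indi in simp)
  finally have "1/2 * measure lborel (ball (0 :: real^'d) r) \<le> Re (LINT y|lborel. indicator (ball 0 r) y *\<^sub>R cis (- freq_phase k y))"
    by simp
  moreover have "measure lborel (ball (0 :: real^'d) r) > 0"
    by (rule content_ball_pos[OF \<open>r > 0\<close>])
  ultimately have "Re (LINT y|lborel. indicator (ball 0 r) y *\<^sub>R cis (- freq_phase k y)) > 0" by linarith
  then show ?thesis by (metis less_irrefl zero_complex.sel(1))
qed

text \<open>The coefficients of the Lagrange basis polynomials invert the Vandermonde system with
  nodes \<open>w k\<close>. The sum runs one index past their degree, which only adds zeros.\<close>

lemma lagrange_coefficients:
  fixes w :: "'a \<Rightarrow> complex"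
  assumes "finite F" "inj_on w F"
  obtains \<beta> where "\<And>k k'. k \<in> F \<Longrightarrow> k' \<in> F \<Longrightarrow>
     (\<Sum>s\<le>card F. \<beta> k s * w k' ^ s) = (if k = k' then 1 else 0)"
proof -
  define L where "L k = (\<Prod>j\<in>F - {k}. smult (1 / (w k - w j)) [:- w j, 1:])" for k
  have deg: "degree (L k) \<le> card F" for k
  proof -
    have "degree (L k) \<le> (\<Sum>j\<in>F - {k}. degree (smult (1 / (w k - w j)) [:- w j, 1:]))"
      unfolding L_def by (rule order_trans[OF degree_prod_sum_le]) (use assms in \<open>auto simp: o_def\<close>)
    also have "\<dots> \<le> (\<Sum>j\<in>F - {k}. 1)"
      by (intro sum_mono order_trans[OF degree_smult_le]) simp
    also have "\<dots> \<le> card F" using assms by (simp add: card_Diff1_le)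
    finally show ?thesis .
  qed
  have "poly (L k) (w k') = (if k = k' then 1 else 0)" if "k \<in> F" "k' \<in> F" for k k'
  proof (cases "k = k'")
    case True
    have "poly (L k) (w k) = (\<Prod>j\<in>F - {k}. 1)"
      unfolding L_def poly_prod
    proof (rule prod.cong)
      fix j assume "j \<in> F - {k}"
      then have "w k \<noteq> w j" using assms(2) that by (auto dest: inj_onD)
      then have nz: "w k - w j \<noteq> 0" by simp
      have "poly (smult c [:- w j, 1:]) (w k) = c * (w k - w j)" for c
        by (simp add: algebra_simps)
      then show "poly (smult (1 / (w k - w j)) [:- w j, 1:]) (w k) = 1"
        by (simp only: times_divide_eq_left mult_1_left divide_self[OF nz])
    qed simp
    then show ?thesis using True by simp
  next
    case False
    then have "poly (L k) (w k') = 0"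
      unfolding L_def poly_prod using assms that by (intro prod_zero bexI[of _ k']) auto
    then show ?thesis using False by simp
  qed
  moreover have "poly (L k) z = (\<Sum>s\<le>card F. coeff (L k) s * z ^ s)" for k z
    unfolding poly_altdef
    by (rule sum.mono_neutral_left) (use deg in \<open>auto simp: coeff_eq_0\<close>)
  ultimately show ?thesis by (intro that[of "\<lambda>k s. coeff (L k) s"]) auto
qed

text \<open>The forbidden directions form a finite union of hyperplanes, a null set.\<close>

lemma generic_direction_exists:
  assumes "finite (F :: (int^'d) set)"
  obtains q :: "real^'d" where "\<And>k. k \<in> F \<Longrightarrow> k \<noteq> 0 \<Longrightarrow> freq_phase k q \<noteq> 0"
proof -
  have "negligible (\<Union>k\<in>F - {0}. {q :: real^'d. freq_phase k q = 0})"
  proof (intro negligible_Union finite_imageI finite_Diff assms)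
    fix t assume "t \<in> (\<lambda>k. {q :: real^'d. freq_phase k q = 0}) ` (F - {0})"
    then obtain k where t: "t = {q :: real^'d. freq_phase k q = 0}" and "k \<noteq> 0" by auto
    then have "((\<chi> i. of_int (k $ i)) :: real^'d) \<noteq> 0" by (auto simp: vec_eq_iff)
    then show "negligible t"
      unfolding t freq_phase_inner by (intro negligible_hyperplane) simp
  qed
  then have "(\<Union>k\<in>F - {0}. {q :: real^'d. freq_phase k q = 0}) \<noteq> UNIV"
    using non_negligible_UNIV by metis
  then show ?thesis using that by blast
qed

lemma cis_eq_imp:
  assumes "cis a = cis b" "\<bar>a - b\<bar> < 2 * pi"
  shows "a = b"
proof -
  have "cis (a - b) = 1" using assms(1) by (simp add: cis_divide[symmetric])
  then have "cos (a - b) = 1" by (simp add: complex_eq_iff)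
  then obtain n :: int where n: "a - b = of_int n * (2 * pi)" by (auto simp: cos_one_2pi_int)
  then have "\<bar>of_int n :: real\<bar> < 1" using assms(2) by (simp add: abs_mult)
  then have "n = 0" by simp
  then show ?thesis using n by simp
qed

section \<open>Periodic representatives and extension by zero\<close>

definition torus_fold :: "real^'d \<Rightarrow> real^'d" where
  "torus_fold x = (\<chi> i. x $ i - 2 * pi * of_int \<lfloor>x $ i / (2 * pi)\<rfloor>)"

lemma torus_fold_periodic: "torus_fold (x + axis i (2 * pi)) = torus_fold x"
proof -
  have "(x + axis i (2 * pi)) $ j - 2 * pi * of_int \<lfloor>(x + axis i (2 * pi)) $ j / (2 * pi)\<rfloor>
     = x $ j - 2 * pi * of_int \<lfloor>x $ j / (2 * pi)\<rfloor>" for j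
  proof (cases "j = i")
    case True
    have "(x $ i + 2 * pi) / (2 * pi) = x $ i / (2 * pi) + 1" by (simp add: add_divide_distrib)
    then have "\<lfloor>(x $ i + 2 * pi) / (2 * pi)\<rfloor> = \<lfloor>x $ i / (2 * pi)\<rfloor> + 1" by simp
    then show ?thesis using True by (simp add: axis_def algebra_simps)
  qed (simp add: axis_def)
  then show ?thesis by (simp add: torus_fold_def vec_eq_iff)
qed

lemma torus_fold_eq: "x \<in> torus_cube \<Longrightarrow> torus_fold x = x"
proof -
  assume x: "x \<in> torus_cube"
  have "\<lfloor>x $ i / (2 * pi)\<rfloor> = 0" for i
    using x by (auto simp: torus_cube_def floor_eq_iff divide_simps less_imp_le)
  then show ?thesis by (simp add: torus_fold_def vec_eq_iff)
qed

text \<open>\<open>L2_torus\<close> demands periodicity at every point. Folding produces it for any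
  function and changes nothing inside the open cube.\<close>

lemma torus_fold_L2_torus:
  assumes "u \<in> L2 torus_cube"
  shows "(\<lambda>x. u (torus_fold x)) \<in> L2_torus"
proof -
  have "(\<lambda>x. u (torus_fold x)) \<in> borel_measurable (lebesgue_on torus_cube) \<longleftrightarrow> u \<in> borel_measurable (lebesgue_on torus_cube)"
    by (rule measurable_cong) (simp add: torus_fold_eq)
  moreover have "integrable (lebesgue_on torus_cube) (\<lambda>x. (u (torus_fold x))\<^sup>2) \<longleftrightarrow> integrable (lebesgue_on torus_cube) (\<lambda>x. (u x)\<^sup>2)"
    by (rule Bochner_Integration.integrable_cong) (simp_all add: torus_fold_eq)
  ultimately show ?thesis using assms by (simp add: L2_torus_def L2_def torus_fold_periodic)
qed

lemma L2_cong_on: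
  assumes "D \<in> sets lebesgue" "\<And>x. x \<in> D \<Longrightarrow> u x = v x"
  shows "u \<in> L2 D \<longleftrightarrow> v \<in> L2 D" "L2_norm D u = L2_norm D v"
proof -
  have "u \<in> borel_measurable (lebesgue_on D) \<longleftrightarrow> v \<in> borel_measurable (lebesgue_on D)"
    by (rule measurable_cong) (simp add: assms)
  moreover have "integrable (lebesgue_on D) (\<lambda>x. (u x)\<^sup>2) \<longleftrightarrow> integrable (lebesgue_on D) (\<lambda>x. (v x)\<^sup>2)"
    by (rule Bochner_Integration.integrable_cong) (simp_all add: assms)
  ultimately show "u \<in> L2 D \<longleftrightarrow> v \<in> L2 D" by (simp add: L2_def)
  have "(LINT x|lebesgue_on D. u x * u x) = (LINT x|lebesgue_on D. v x * v x)"
    by (rule Bochner_Integration.integral_cong) (simp_all add: assms)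
  then show "L2_norm D u = L2_norm D v" by (simp add: L2_norm_def L2_inner_def)
qed

lemma L2_zero_extension:
  assumes D: "D \<in> lmeasurable" "D' \<in> lmeasurable" "D \<subseteq> D'" and u: "u \<in> L2 D"
  shows "(\<lambda>x. if x \<in> D then u x else 0) \<in> L2 D'"
    and "L2_norm D' (\<lambda>x. if x \<in> D then u x else 0) = L2_norm D u"
proof -
  have Ds: "D \<in> sets lebesgue" "D' \<in> sets lebesgue" using D by auto
  have m: "(\<lambda>x. if x \<in> D then u x else 0) \<in> borel_measurable (lebesgue_on D')"
    using L2_measurable[OF u] borel_measurable_if[OF Ds(1)] by (auto intro: measurable_restrict_space1)
  have ind: "indicator D' x *\<^sub>R (if x \<in> D then u x else 0)\<^sup>2 = indicator D x *\<^sub>R (u x)\<^sup>2" for x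
    using D(3) by (auto simp: indicator_def)
  have "integrable lebesgue (\<lambda>x. indicator D x *\<^sub>R (u x)\<^sup>2)"
    using u Ds by (simp add: L2_def integrable_restrict_space)
  then have "integrable lebesgue (\<lambda>x. indicator D' x *\<^sub>R (if x \<in> D then u x else 0)\<^sup>2)" by (simp only: ind)
  then have "integrable (lebesgue_on D') (\<lambda>x. (if x \<in> D then u x else 0)\<^sup>2)"
    using Ds by (subst integrable_restrict_space) auto
  with m show "(\<lambda>x. if x \<in> D then u x else 0) \<in> L2 D'" by (simp add: L2_def)
  have "(LINT x|lebesgue_on D'. (if x \<in> D then u x else 0)\<^sup>2) = (LINT x|lebesgue. indicator D' x *\<^sub>R (if x \<in> D then u x else 0)\<^sup>2)"
    by (rule integral_restrict_space) (use Ds in auto)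
  also have "\<dots> = (LINT x|lebesgue. indicator D x *\<^sub>R (u x)\<^sup>2)" by (simp only: ind)
  also have "\<dots> = (LINT x|lebesgue_on D. (u x)\<^sup>2)"
    by (rule integral_restrict_space[symmetric]) (use Ds in auto)
  finally show "L2_norm D' (\<lambda>x. if x \<in> D then u x else 0) = L2_norm D u"
    by (simp add: L2_norm_def L2_inner_def power2_eq_square)
qed

text \<open>
  Outside \<open>D\<close> an extension is arbitrary.  Translates of a small ball along a generic direction
  have Fourier coefficients whose dependence on the translate is a Vandermonde system, so finitely
  many coefficients can be prescribed.
\<close>

lemma extension_operator_prescribed:
  fixes D :: "(real^'d) set" and g :: "int^'d \<Rightarrow> real^'d \<Rightarrow> real"
  assumes D: "D \<in> lmeasurable" "closure D \<subset> torus_cube"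
    and g: "\<And>k. g k \<in> L2 D" "\<And>k. g (- k) = g k"
  obtains E where "extension_operator D E"
    "\<And>u k. u \<in> L2 D \<Longrightarrow> k \<in> freq_modes K \<Longrightarrow> fourier_coeff (E u) k = of_real (L2_inner D u (g k))"
proof -
  define F where "F = (freq_modes K :: (int^'d) set)"
  have F: "finite F" by (simp add: F_def finite_freq_modes)
  have Fneg: "- k \<in> F \<longleftrightarrow> k \<in> F" for k by (simp add: F_def freq_modes_def)
  \<comment> \<open>The direction must distinguish modes from each other, so genericity is asked for
    the differences of modes.\<close>
  have "finite ((\<lambda>(k, k'). k - k') ` (F \<times> F))" using F by simp
  then obtain q :: "real^'d" where q: "\<And>k. k \<in> (\<lambda>(k, k'). k - k') ` (F \<times> F) \<Longrightarrow> k \<noteq> 0 \<Longrightarrow> freq_phase k q \<noteq> 0"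
    using generic_direction_exists by metis
  have "open (torus_cube - closure D)" by (intro open_Diff open_torus_cube) simp
  moreover obtain p where p: "p \<in> torus_cube - closure D" using D(2) by blast
  ultimately obtain e0 where e0: "e0 > 0" "ball p e0 \<subseteq> torus_cube - closure D"
    by (meson open_contains_ball)
  define B where "B = (\<Sum>k\<in>F. norm ((\<chi> i. of_int (k $ i)) :: real^'d)) + 1"
  have B: "B > 0" by (simp add: B_def add_nonneg_pos sum_nonneg)
  have phaseB: "\<bar>freq_phase k y\<bar> \<le> B * norm y" if "k \<in> F" for k y
  proof -
    have "norm ((\<chi> i. of_int (k $ i)) :: real^'d) \<le> B"
      using member_le_sum[OF that, of "\<lambda>k. norm ((\<chi> i. of_int (k $ i)) :: real^'d)"] F by (simp add: B_def)
    then have "norm ((\<chi> i. of_int (k $ i)) :: real^'d) * norm y \<le> B * norm y" by (intro mult_right_mono) auto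
    then show ?thesis unfolding freq_phase_inner using Cauchy_Schwarz_ineq2 order_trans by blast
  qed
  \<comment> \<open>The bound 1 / B keeps the phases on the ball below 1, so its coefficients do not
    vanish; e0 / 2 leaves room for translating the ball.\<close>
  define r where "r = min (e0 / 2) (1 / B)"
  have r: "r > 0" "r \<le> e0 / 2" "B * r \<le> 1" using e0 B by (auto simp: r_def min_def field_simps)
  define M where "M = card F"
  \<comment> \<open>The first bound keeps all translates in the gap between \<open>closure D\<close>
    and the boundary of the cube; the second makes the phases so small that \<open>cis\<close> is
    injective on them and the nodes w are distinct.\<close>
  define \<epsilon> where "\<epsilon> = min (e0 / (2 * (real M + 1) * (norm q + 1))) (1 / (B * (norm q + 1)))"
  have np: "norm q + 1 > 0" by (simp add: add_nonneg_pos)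
  have \<epsilon>: "\<epsilon> > 0" "\<epsilon> * (real M + 1) * (norm q + 1) \<le> e0 / 2" "\<epsilon> * (B * (norm q + 1)) \<le> 1"
  proof -
    show "\<epsilon> > 0" using e0 B np by (simp add: \<epsilon>_def)
    have "\<epsilon> \<le> e0 / (2 * (real M + 1) * (norm q + 1))" by (simp add: \<epsilon>_def)
    then have "\<epsilon> * (2 * (real M + 1) * (norm q + 1)) \<le> e0"
      using np by (subst (asm) pos_le_divide_eq) auto
    then show "\<epsilon> * (real M + 1) * (norm q + 1) \<le> e0 / 2" by (simp add: algebra_simps)
    have "\<epsilon> \<le> 1 / (B * (norm q + 1))" by (simp add: \<epsilon>_def)
    then show "\<epsilon> * (B * (norm q + 1)) \<le> 1" using np B by (subst (asm) pos_le_divide_eq) auto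
  qed
  define a where "a s = p + (real s * \<epsilon>) *\<^sub>R q" for s :: nat
  have ball_a: "ball (a s) r \<subseteq> torus_cube - closure D" if "s \<le> M" for s
  proof -
    have "dist (a s) p = real s * \<epsilon> * norm q" using \<epsilon>(1) by (simp add: a_def dist_norm)
    also have "\<dots> \<le> (real M + 1) * \<epsilon> * (norm q + 1)"
      using that \<epsilon>(1) by (intro mult_mono) auto
    also have "\<dots> \<le> e0 / 2" using \<epsilon>(2) by (simp add: mult_ac)
    finally have *: "dist (a s) p \<le> e0 / 2" .
    have "y \<in> ball p e0" if "y \<in> ball (a s) r" for y
      using that * r(2) dist_triangle[of p y "a s"] by (simp add: dist_commute)
    then show ?thesis using e0 by blast
  qed
  define w where "w k = cis (- \<epsilon> * freq_phase k q)" for k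
  have inj: "inj_on w F"
  proof (rule inj_onI)
    fix k k' assume k: "k \<in> F" "k' \<in> F" "w k = w k'"
    have small: "\<bar>\<epsilon> * freq_phase k q\<bar> \<le> 1" if "k \<in> F" for k
    proof -
      have "\<bar>\<epsilon> * freq_phase k q\<bar> \<le> \<epsilon> * (B * norm q)"
        using phaseB[OF that, of q] \<epsilon>(1) by (simp add: abs_mult)
      also have "\<dots> \<le> \<epsilon> * (B * (norm q + 1))" using \<epsilon>(1) B by (intro mult_left_mono) auto
      finally show ?thesis using \<epsilon>(3) by linarith
    qed
    have "- \<epsilon> * freq_phase k q = - \<epsilon> * freq_phase k' q"
    proof (rule cis_eq_imp)
      show "cis (- \<epsilon> * freq_phase k q) = cis (- \<epsilon> * freq_phase k' q)" using k(3) by (simp add: w_def)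
      show "\<bar>- \<epsilon> * freq_phase k q - - \<epsilon> * freq_phase k' q\<bar> < 2 * pi"
        using small[OF k(1)] small[OF k(2)] pi_gt3 by linarith
    qed
    then have "freq_phase (k - k') q = 0" using \<epsilon>(1) by (simp add: freq_phase_minus)
    moreover have "k - k' \<in> (\<lambda>(k, k'). k - k') ` (F \<times> F)" using k by force
    ultimately show "k = k'" using q by force
  qed
  obtain \<beta> where \<beta>: "\<And>k k'. k \<in> F \<Longrightarrow> k' \<in> F \<Longrightarrow> (\<Sum>s\<le>M. \<beta> k s * w k' ^ s) = (if k = k' then 1 else 0)"
    using lagrange_coefficients[OF F inj] unfolding M_def by metis
  define C where "C k = cis (- freq_phase k p) * ((LINT y|lborel. indicator (ball (0 :: real^'d) r) y *\<^sub>R cis (- freq_phase k y)) / of_real ((2 * pi) ^ CARD('d)))" for k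
  have C0: "C k \<noteq> 0" if "k \<in> F" for k
  proof -
    have "(LINT y|lborel. indicator (ball (0 :: real^'d) r) y *\<^sub>R cis (- freq_phase k y)) \<noteq> 0"
    proof (rule ball_coeff_nonzero[OF r(1)])
      fix y :: "real^'d" assume "norm y < r"
      then have "B * norm y \<le> B * r" using B by (intro mult_left_mono) auto
      then show "\<bar>freq_phase k y\<bar> \<le> 1" using phaseB[OF that, of y] r(3) by linarith
    qed
    then show ?thesis by (simp add: C_def)
  qed
  have coeff_ball: "fourier_coeff (indicator (ball (a s) r)) k = C k * w k ^ s" if "s \<le> M" for s k
  proof -
    have "fourier_coeff (indicator (ball (a s) r)) k = cis (- freq_phase k (a s)) * ((LINT y|lborel. indicator (ball (0 :: real^'d) r) y *\<^sub>R cis (- freq_phase k y)) / of_real ((2 * pi) ^ CARD('d)))"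
      by (rule fourier_coeff_ball) (use ball_a[OF that] in blast)
    moreover have "cis (- freq_phase k (a s)) = cis (- freq_phase k p) * w k ^ s"
    proof -
      have "w k ^ s = cis (real s * (- \<epsilon> * freq_phase k q))" unfolding w_def by (rule Complex.DeMoivre)
      moreover have "- freq_phase k (a s) = - freq_phase k p + real s * (- \<epsilon> * freq_phase k q)"
        by (simp add: a_def freq_phase_add freq_phase_scaleR)
      ultimately show ?thesis by (simp only: cis_mult)
    qed
    ultimately show ?thesis by (simp add: C_def mult_ac)
  qed
  have fcneg: "fourier_coeff u (- k) = cnj (fourier_coeff u k)" for u and k :: "int^'d"
  proof -
    have "(LINT x|lebesgue_on torus_cube. complex_of_real (u x) * cis (freq_phase k x))
       = (LINT x|lebesgue_on torus_cube. cnj (complex_of_real (u x) * cis (- freq_phase k x)))"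
      by (intro Bochner_Integration.integral_cong) (auto simp: cis_cnj)
    also have "\<dots> = cnj (LINT x|lebesgue_on torus_cube. complex_of_real (u x) * cis (- freq_phase k x))"
      by (rule Bochner_Integration.integral_cnj)
    finally show ?thesis by (simp add: fourier_coeff_def freq_phase_uminus)
  qed
  have wneg: "w (- k) = cnj (w k)" for k by (simp add: w_def freq_phase_uminus cis_cnj)
  have Cneg: "C (- k) = cnj (C k)" for k
    using coeff_ball[of 0 k] coeff_ball[of 0 "- k"] fcneg[of "indicator (ball (a 0) r)" k] by simp
  \<comment> \<open>Integrating u against \<open>h k\<close> gives the defect: the prescribed
    coefficient minus that of the extension of u by zero. The balls have to make up for it.\<close>
  define h where "h k x = complex_of_real (g k x) - cis (- freq_phase k x) / of_real ((2 * pi) ^ CARD('d))" for k x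
  define H where "H s x = (\<Sum>k\<in>F. \<beta> k s / C k * h k x)" for s x
  define u0 where "u0 u x = (if x \<in> D then u x else 0)" for u :: "real^'d \<Rightarrow> real" and x
  define E0 where "E0 u x = u0 u x + (\<Sum>s\<le>M. L2_inner D u (\<lambda>x. Re (H s x)) * indicator (ball (a s) r) x)" for u x
  define E where "E u x = E0 u (torus_fold x)" for u x
  define P :: real where "P = (2 * pi) ^ CARD('d)"
  have Ds: "D \<in> sets lebesgue" and Dc: "D \<subseteq> torus_cube" "D \<subseteq> closure D"
    using D closure_subset by auto
  have cis_m: "(\<lambda>x. cis (- freq_phase k x)) \<in> borel_measurable (lebesgue_on D)" for k :: "int^'d"
    using borel_measurable_lebesgue_on_borel[OF borel_measurable_cis_freq_phase, of "- k"]
    by (simp add: freq_phase_uminus)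
  have ReH: "(\<lambda>x. Re (H s x)) \<in> L2 D" for s
  proof -
    have tL: "(\<lambda>x. f (cis (- freq_phase k x))) \<in> L2 D"
      if "f \<in> borel_measurable borel" "\<And>z. \<bar>f z\<bar> \<le> norm z" for f and k :: "int^'d"
      by (rule L2_bounded[OF D(1), where C = 1])
         (use measurable_compose[OF cis_m that(1)] that(2)[of "cis _"] in auto)
    have "(\<lambda>x. Re (H s x)) = (\<lambda>x. \<Sum>k\<in>F. Re (\<beta> k s / C k) * (g k x - 1 / P * Re (cis (- freq_phase k x)))
        - Im (\<beta> k s / C k) * (- (1 / P) * Im (cis (- freq_phase k x))))"
    proof
      fix x
      have "h k x = complex_of_real (g k x) - complex_of_real (1 / P) * cis (- freq_phase k x)" for k
        by (simp add: h_def P_def)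
      then show "Re (H s x) = (\<Sum>k\<in>F. Re (\<beta> k s / C k) * (g k x - 1 / P * Re (cis (- freq_phase k x)))
        - Im (\<beta> k s / C k) * (- (1 / P) * Im (cis (- freq_phase k x))))"
        by (simp only: H_def Re_sum times_complex.sel minus_complex.sel Re_complex_of_real
            Im_complex_of_real) simp
    qed
    moreover have "(\<lambda>x. \<Sum>k\<in>F. Re (\<beta> k s / C k) * (g k x - 1 / P * Re (cis (- freq_phase k x)))
        - Im (\<beta> k s / C k) * (- (1 / P) * Im (cis (- freq_phase k x)))) \<in> L2 D"
      by (intro L2_sum L2_diff L2_scale g(1) tL[of Re] tL[of Im])
         (auto simp: abs_Re_le_cmod abs_Im_le_cmod borel_measurable_Re borel_measurable_Im)
    ultimately show ?thesis by simp
  qed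
  define DD where "DD u k = complex_of_real (L2_inner D u (g k)) - fourier_coeff (u0 u) k" for u k
  have u0_fc: "fourier_coeff (u0 u) k = (LINT x|lebesgue_on D. complex_of_real (u x) * cis (- freq_phase k x)) / of_real P" for u k
  proof -
    have "(LINT x|lebesgue_on torus_cube. complex_of_real (u0 u x) * cis (- freq_phase k x))
       = (LINT x|lebesgue_on torus_cube. (if x \<in> D then complex_of_real (u x) * cis (- freq_phase k x) else 0))"
      by (intro Bochner_Integration.integral_cong) (auto simp: u0_def)
    also have "\<dots> = (LINT x|lebesgue_on D. complex_of_real (u x) * cis (- freq_phase k x))"
      by (rule integral_lebesgue_on_if) (use Ds Dc lmeasurable_torus_cube in auto)
    finally show ?thesis by (simp add: fourier_coeff_def P_def)
  qed
  have h_int: "integrable (lebesgue_on D) (\<lambda>x. complex_of_real (u x) * h k x)"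
    "(LINT x|lebesgue_on D. complex_of_real (u x) * h k x) = DD u k" if u: "u \<in> L2 D" for u k
  proof -
    have eq: "complex_of_real (u x) * h k x = complex_of_real (u x * g k x)
       - complex_of_real (u x) * cis (- freq_phase k x) / of_real P" for x
      by (simp add: h_def P_def right_diff_distrib)
    have i: "integrable (lebesgue_on D) (\<lambda>x. complex_of_real (u x * g k x))"
      "integrable (lebesgue_on D) (\<lambda>x. complex_of_real (u x) * cis (- freq_phase k x) / of_real P)"
      using L2_integrable_mult[OF u g(1)] L2_integrable_cis[OF D(1) u] by (auto simp: integrable_of_real simp del: of_real_mult)
    show "integrable (lebesgue_on D) (\<lambda>x. complex_of_real (u x) * h k x)"
      unfolding eq by (rule Bochner_Integration.integrable_diff[OF i])
    have "(LINT x|lebesgue_on D. complex_of_real (u x * g k x)) = complex_of_real (L2_inner D u (g k))"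
      unfolding L2_inner_def by (rule integral_complex_of_real)
    then show "(LINT x|lebesgue_on D. complex_of_real (u x) * h k x) = DD u k"
      unfolding eq Bochner_Integration.integral_diff[OF i] by (simp add: DD_def u0_fc del: of_real_mult)
  qed
  have rho: "L2_inner D u (\<lambda>x. Re (H s x)) = Re (\<Sum>k\<in>F. \<beta> k s / C k * DD u k)" if u: "u \<in> L2 D" for u s
  proof -
    have eq: "complex_of_real (u x) * H s x = (\<Sum>k\<in>F. \<beta> k s / C k * (complex_of_real (u x) * h k x))" for x
      by (simp add: H_def sum_distrib_left mult_ac)
    have i: "integrable (lebesgue_on D) (\<lambda>x. complex_of_real (u x) * H s x)"
      unfolding eq by (intro Bochner_Integration.integrable_sum integrable_mult_right h_int(1)[OF u])
    have "L2_inner D u (\<lambda>x. Re (H s x)) = (LINT x|lebesgue_on D. Re (complex_of_real (u x) * H s x))"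
      by (simp add: L2_inner_def)
    also have "\<dots> = Re (LINT x|lebesgue_on D. complex_of_real (u x) * H s x)" by (rule integral_Re[OF i])
    also have "(LINT x|lebesgue_on D. complex_of_real (u x) * H s x) = (\<Sum>k\<in>F. \<beta> k s / C k * DD u k)"
      unfolding eq by (subst Bochner_Integration.integral_sum)
        (auto simp: h_int[OF u] integral_mult_right_zero intro!: integrable_mult_right )
    finally show ?thesis .
  qed
  have ball_L2: "indicator (ball (a s) r) \<in> L2 torus_cube" for s
    by (rule L2_bounded[OF lmeasurable_torus_cube, where C = 1])
       (auto simp: indicator_def intro!: borel_measurable_lebesgue_on_borel[OF borel_measurable_indicator])
  have u0_L2: "u0 u \<in> L2 torus_cube" "L2_norm torus_cube (u0 u) = L2_norm D u" if "u \<in> L2 D" for u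
    using L2_zero_extension[OF D(1) lmeasurable_torus_cube Dc(1) that] by (simp_all add: u0_def[abs_def])
  have corr_L2: "(\<lambda>x. L2_inner D u (\<lambda>x. Re (H s x)) * indicator (ball (a s) r) x) \<in> L2 torus_cube" for u s
    by (rule L2_scale[OF ball_L2])
  have sum_L2: "(\<lambda>x. \<Sum>s\<le>M. L2_inner D u (\<lambda>x. Re (H s x)) * indicator (ball (a s) r) x) \<in> L2 torus_cube" for u
    by (intro L2_sum corr_L2)
  have E0_L2: "E0 u \<in> L2 torus_cube" if "u \<in> L2 D" for u
    unfolding E0_def[abs_def] by (intro L2_add u0_L2 that sum_L2)
  have cube_s: "torus_cube \<in> sets (lebesgue :: (real^'d) measure)" using lmeasurable_torus_cube by auto
  have EE0: "E u x = E0 u x" if "x \<in> torus_cube" for u x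
    using that by (simp add: E_def torus_fold_eq)
  have E_L2: "E u \<in> L2 torus_cube" "L2_norm torus_cube (E u) = L2_norm torus_cube (E0 u)" if "u \<in> L2 D" for u
    using L2_cong_on[OF cube_s EE0] E0_L2[OF that] by auto
  have fc: "fourier_coeff (E u) k = of_real (L2_inner D u (g k))" if u: "u \<in> L2 D" and k: "k \<in> F" for u k
  proof -
    define z where "z s = (\<Sum>k\<in>F. \<beta> k s / C k * DD u k)" for s
    have zsum: "(\<Sum>s\<le>M. z s * w k ^ s) = DD u k / C k" if k: "k \<in> F" for k
    proof -
      have "(\<Sum>s\<le>M. z s * w k ^ s) = (\<Sum>k'\<in>F. DD u k' / C k' * (\<Sum>s\<le>M. \<beta> k' s * w k ^ s))"
        unfolding z_def sum_distrib_left sum_distrib_right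
        by (subst sum.swap) (simp add: mult_ac)
      also have "\<dots> = (\<Sum>k'\<in>F. DD u k' / C k' * (if k' = k then 1 else 0))"
        by (intro sum.cong refl) (simp add: \<beta> k)
      also have "\<dots> = DD u k / C k" using F k by (simp add: if_distrib cong: if_cong)
      finally show ?thesis .
    qed
    have DDneg: "DD u (- k) = cnj (DD u k)" for k by (simp add: DD_def g(2) fcneg)
    \<comment> \<open>The weights of the balls must be real, while the solution z is complex.
      Passing from k to - k conjugates the defect, C and w, so the conjugate of z solves the same
      system, and hence so does its real part.\<close>
    have "(\<Sum>s\<le>M. cnj (z s) * w k ^ s) = cnj (\<Sum>s\<le>M. z s * w (- k) ^ s)"
      by (simp add: wneg)
    also have "\<dots> = DD u k / C k" using k by (subst zsum) (auto simp: Fneg DDneg Cneg)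
    finally have zsum': "(\<Sum>s\<le>M. cnj (z s) * w k ^ s) = DD u k / C k" .
    have re: "complex_of_real (L2_inner D u (\<lambda>x. Re (H s x))) = (z s + cnj (z s)) / 2" for s
      unfolding rho[OF u] z_def[symmetric] by (simp add: complex_add_cnj)
    have "fourier_coeff (E u) k = fourier_coeff (E0 u) k" by (rule fourier_coeff_cong) (rule EE0)
    also have "\<dots> = fourier_coeff (u0 u) k + (\<Sum>s\<le>M. complex_of_real (L2_inner D u (\<lambda>x. Re (H s x))) * (C k * w k ^ s))"
      unfolding E0_def[abs_def] fourier_coeff_add[OF u0_L2(1)[OF u] sum_L2] fourier_coeff_sum[OF corr_L2]
      by (simp add: fourier_coeff_scale coeff_ball)
    also have "(\<Sum>s\<le>M. complex_of_real (L2_inner D u (\<lambda>x. Re (H s x))) * (C k * w k ^ s))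
        = C k / 2 * ((\<Sum>s\<le>M. z s * w k ^ s) + (\<Sum>s\<le>M. cnj (z s) * w k ^ s))"
      unfolding re by (simp add: sum_distrib_left sum.distrib[symmetric] algebra_simps add_divide_distrib)
    also have "\<dots> = DD u k" unfolding zsum[OF k] zsum' using C0[OF k] by simp
    finally show ?thesis by (simp add: DD_def)
  qed
  have ext: "extension_operator D E"
    unfolding extension_operator_def L2_bounded_linear_def
  proof (intro conjI ballI allI)
    show "E u \<in> L2 torus_cube" if "u \<in> L2 D" for u by (rule E_L2[OF that])
    show "L2_eq torus_cube (E (\<lambda>x. u x + v x)) (\<lambda>x. E u x + E v x)" if "u \<in> L2 D" "v \<in> L2 D" for u v
    proof -
      have "E (\<lambda>x. u x + v x) x = E u x + E v x" for x
        by (simp add: E_def E0_def u0_def L2_inner_add_left[OF that ReH] distrib_right sum.distrib)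
      then show ?thesis by (simp add: L2_eq_def)
    qed
    show "L2_eq torus_cube (E (\<lambda>x. c * u x)) (\<lambda>x. c * E u x)" if "u \<in> L2 D" for c u
    proof -
      have "E (\<lambda>x. c * u x) x = c * E u x" for x
        by (simp only: E_def E0_def u0_def L2_inner_scale_left distrib_left sum_distrib_left
            mult.assoc if_distrib[where f = "\<lambda>z. c * z"] mult_zero_right)
      then show ?thesis by (simp add: L2_eq_def)
    qed
    define Q where "Q = (\<Sum>s\<le>M. L2_norm D (\<lambda>x. Re (H s x)) * L2_norm torus_cube (indicator (ball (a s) r)))"
    have "L2_norm torus_cube (E u) \<le> (1 + Q) * L2_norm D u" if u: "u \<in> L2 D" for u
    proof -
      have "L2_norm torus_cube (E u) \<le> L2_norm torus_cube (u0 u) + L2_norm torus_cube (\<lambda>x. \<Sum>s\<le>M. L2_inner D u (\<lambda>x. Re (H s x)) * indicator (ball (a s) r) x)"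
        unfolding E_L2(2)[OF u] E0_def[abs_def] by (rule L2_triangle[OF u0_L2(1)[OF u] sum_L2])
      also have "L2_norm torus_cube (\<lambda>x. \<Sum>s\<le>M. L2_inner D u (\<lambda>x. Re (H s x)) * indicator (ball (a s) r) x)
         \<le> (\<Sum>s\<le>M. \<bar>L2_inner D u (\<lambda>x. Re (H s x))\<bar> * L2_norm torus_cube (indicator (ball (a s) r)))"
        by (rule order_trans[OF L2_norm_sum_le[OF corr_L2]]) (simp add: L2_norm_scale)
      also have "\<dots> \<le> (\<Sum>s\<le>M. L2_norm D u * L2_norm D (\<lambda>x. Re (H s x)) * L2_norm torus_cube (indicator (ball (a s) r)))"
        by (intro sum_mono mult_right_mono L2_Cauchy_Schwarz u ReH) auto
      also have "\<dots> = L2_norm D u * Q" by (simp add: Q_def sum_distrib_left mult.assoc)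
      finally show ?thesis using u0_L2(2)[OF u] by (simp add: algebra_simps)
    qed
    then show "\<exists>C. \<forall>u\<in>L2 D. L2_norm torus_cube (E u) \<le> C * L2_norm D u" by blast
    show "E u \<in> L2_torus" if "u \<in> L2 D" for u
      unfolding E_def[abs_def] by (rule torus_fold_L2_torus[OF E0_L2[OF that]])
    show "L2_eq D (E u) u" if "u \<in> L2 D" for u
    proof -
      have "E u x = u x" if x: "x \<in> D" for x
      proof -
        have "indicator (ball (a s) r) x = (0 :: real)" if "s \<le> M" for s
          using ball_a[OF that] x Dc by (auto simp: indicator_def)
        then show ?thesis using x Dc by (simp add: EE0 subset_iff E0_def u0_def)
      qed
      then show ?thesis unfolding L2_eq_def by (intro AE_I2) simp
    qed
  qed
  show ?thesis by (rule that[OF ext fc]) (simp_all add: F_def)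
qed

section \<open>Universality of one Fourier layer\<close>

text \<open>Nets come without products; these sums have them whenever L is closed under addition,
  which makes the Stone-Weierstrass theorem applicable.\<close>

inductive_set exp_sums :: "('a \<Rightarrow> real) set \<Rightarrow> ('a \<Rightarrow> real) set" for L :: "('a \<Rightarrow> real) set" where
  zero: "(\<lambda>x. 0) \<in> exp_sums L"
| step: "f \<in> exp_sums L \<Longrightarrow> l \<in> L \<Longrightarrow> (\<lambda>x. f x + c * exp (l x)) \<in> exp_sums L"

lemma exp_sums_add:
  assumes "f \<in> exp_sums L" "g \<in> exp_sums L"
  shows "(\<lambda>x. f x + g x) \<in> exp_sums L"
  using assms(2)
proof (induction rule: exp_sums.induct)
  case zero
  then show ?case using assms(1) by simp
next
  case (step h l c)
  from exp_sums.step[OF step.IH step.hyps(2), of c] show ?case by (simp add: add.assoc)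
qed

lemma exp_sums_mult_exp:
  assumes L: "\<And>l l'. l \<in> L \<Longrightarrow> l' \<in> L \<Longrightarrow> (\<lambda>x. l x + l' x) \<in> L"
    and "f \<in> exp_sums L" "l \<in> L"
  shows "(\<lambda>x. f x * (c * exp (l x))) \<in> exp_sums L"
  using assms(2)
proof (induction rule: exp_sums.induct)
  case zero
  then show ?case by (simp add: exp_sums.zero)
next
  case (step h l' c')
  have "(\<lambda>x. l' x + l x) \<in> L" by (rule L[OF step.hyps(2) assms(3)])
  from exp_sums.step[OF step.IH this, of "c' * c"] show ?case
    by (simp add: algebra_simps exp_add)
qed

lemma exp_sums_mult:
  assumes L: "\<And>l l'. l \<in> L \<Longrightarrow> l' \<in> L \<Longrightarrow> (\<lambda>x. l x + l' x) \<in> L"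
    and "f \<in> exp_sums L" "g \<in> exp_sums L"
  shows "(\<lambda>x. f x * g x) \<in> exp_sums L"
  using assms(3)
proof (induction rule: exp_sums.induct)
  case zero
  then show ?case by (simp add: exp_sums.zero)
next
  case (step h l c)
  have "(\<lambda>x. f x * (c * exp (l x))) \<in> exp_sums L"
    by (rule exp_sums_mult_exp[OF _ assms(2) step.hyps(2)]) (rule L)
  from exp_sums_add[OF step.IH this] show ?case by (simp only: distrib_left)
qed

lemma exp_sums_const:
  assumes "(\<lambda>x. 0) \<in> L"
  shows "(\<lambda>x. c) \<in> exp_sums L"
  using exp_sums.step[OF exp_sums.zero assms, of c] by simp

lemma exp_sums_exp: "l \<in> L \<Longrightarrow> (\<lambda>x. exp (l x)) \<in> exp_sums L"
  using exp_sums.step[OF exp_sums.zero, of l L 1] by simp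

lemma exp_sums_compose:
  assumes "f \<in> exp_sums L" "\<And>l. l \<in> L \<Longrightarrow> (\<lambda>x. l (\<phi> x)) \<in> L'"
  shows "(\<lambda>x. f (\<phi> x)) \<in> exp_sums L'"
  using assms(1)
  by (induction rule: exp_sums.induct) (auto intro: exp_sums.intros assms(2))

definition exp_approx :: "('a \<Rightarrow> real) set \<Rightarrow> 'a set \<Rightarrow> ('a \<Rightarrow> real) \<Rightarrow> bool" where
  "exp_approx L X F \<longleftrightarrow> (\<forall>e>0. \<exists>f\<in>exp_sums L. \<forall>x\<in>X. \<bar>F x - f x\<bar> \<le> e)"

lemma exp_approxD:
  assumes "exp_approx L X F" "e > 0"
  obtains f where "f \<in> exp_sums L" "\<And>x. x \<in> X \<Longrightarrow> \<bar>F x - f x\<bar> \<le> e"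
  using assms unfolding exp_approx_def by meson

lemma exp_approx_exp_sums: "f \<in> exp_sums L \<Longrightarrow> exp_approx L X f"
  unfolding exp_approx_def by (auto intro!: bexI[of _ f])

lemma exp_approx_add:
  assumes F: "exp_approx L X F" and G: "exp_approx L X G"
  shows "exp_approx L X (\<lambda>x. F x + G x)"
  unfolding exp_approx_def
proof (intro allI impI)
  fix e :: real assume "e > 0"
  then obtain f g where f: "f \<in> exp_sums L" "\<And>x. x \<in> X \<Longrightarrow> \<bar>F x - f x\<bar> \<le> e/2"
    and g: "g \<in> exp_sums L" "\<And>x. x \<in> X \<Longrightarrow> \<bar>G x - g x\<bar> \<le> e/2"
    using exp_approxD[OF F, of "e/2"] exp_approxD[OF G, of "e/2"] by (metis half_gt_zero)
  have "\<bar>F x + G x - (f x + g x)\<bar> \<le> e" if "x \<in> X" for x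
    using f(2)[OF that] g(2)[OF that] by linarith
  then show "\<exists>f\<in>exp_sums L. \<forall>x\<in>X. \<bar>F x + G x - f x\<bar> \<le> e"
    using exp_sums_add[OF f(1) g(1)] by (intro bexI[where x = "\<lambda>x. f x + g x"]) auto
qed

lemma exp_approx_mult:
  assumes L: "\<And>l l'. l \<in> L \<Longrightarrow> l' \<in> L \<Longrightarrow> (\<lambda>x. l x + l' x) \<in> L"
    and F: "exp_approx L X F" and G: "exp_approx L X G"
    and bF: "\<And>x. x \<in> X \<Longrightarrow> \<bar>F x\<bar> \<le> B" and bG: "\<And>x. x \<in> X \<Longrightarrow> \<bar>G x\<bar> \<le> C"
  shows "exp_approx L X (\<lambda>x. F x * G x)"
  unfolding exp_approx_def
proof (intro allI impI)
  fix e :: real assume e: "e > 0"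
  define M where "M = \<bar>B\<bar> + \<bar>C\<bar> + 1"
  have M: "M > 0" by (simp add: M_def)
  define d where "d = min 1 (e / (2 * M))"
  have d: "d > 0" "d \<le> 1" "d * M \<le> e / 2" using e M
    by (auto simp: d_def min_def field_simps)
  obtain f where f: "f \<in> exp_sums L" "\<And>x. x \<in> X \<Longrightarrow> \<bar>F x - f x\<bar> \<le> d"
    using exp_approxD[OF F d(1)] by metis
  obtain g where g: "g \<in> exp_sums L" "\<And>x. x \<in> X \<Longrightarrow> \<bar>G x - g x\<bar> \<le> d"
    using exp_approxD[OF G d(1)] by metis
  have bound: "\<forall>x\<in>X. \<bar>F x * G x - f x * g x\<bar> \<le> e"
  proof
    fix x assume x: "x \<in> X"
    have "F x * G x - f x * g x = F x * (G x - g x) + g x * (F x - f x)" by (simp add: algebra_simps)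
    then have "\<bar>F x * G x - f x * g x\<bar> \<le> \<bar>F x\<bar> * \<bar>G x - g x\<bar> + \<bar>g x\<bar> * \<bar>F x - f x\<bar>"
      using abs_triangle_ineq[of "F x * (G x - g x)" "g x * (F x - f x)"] by (simp only: abs_mult)
    also have "\<dots> \<le> M * d + M * d"
    proof (intro add_mono mult_mono)
      show "\<bar>F x\<bar> \<le> M" using bF[OF x] by (simp add: M_def)
      show "\<bar>g x\<bar> \<le> M" using bG[OF x] g(2)[OF x] d(2) unfolding M_def by linarith
    qed (use f(2)[OF x] g(2)[OF x] M in auto)
    finally have "\<bar>F x * G x - f x * g x\<bar> \<le> M * d + M * d" .
    moreover have "M * d \<le> e / 2" using d(3) by (simp only: mult.commute)
    ultimately show "\<bar>F x * G x - f x * g x\<bar> \<le> e" by linarith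
  qed
  define h where "h = (\<lambda>x. f x * g x)"
  have hL: "h \<in> exp_sums L"
    unfolding h_def by (rule exp_sums_mult[OF _ f(1) g(1)]) (rule L)
  show "\<exists>f\<in>exp_sums L. \<forall>x\<in>X. \<bar>F x * G x - f x\<bar> \<le> e"
  proof (rule bexI[where x = h])
    show "\<forall>x\<in>X. \<bar>F x * G x - h x\<bar> \<le> e" unfolding h_def by (rule bound)
  qed (rule hL)
qed

lemma exp_approx_const:
  assumes "(\<lambda>x. 0) \<in> L"
  shows "exp_approx L X (\<lambda>x. c)"
  by (rule exp_approx_exp_sums) (rule exp_sums_const[OF assms])

lemma exp_approx_sum:
  assumes "(\<lambda>x. 0) \<in> L" "\<And>i. i \<in> J \<Longrightarrow> exp_approx L X (F i)"
  shows "exp_approx L X (\<lambda>x. \<Sum>i\<in>J. F i x)"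
  using assms(2)
proof (induction J rule: infinite_finite_induct)
  case (insert i J)
  have "exp_approx L X (\<lambda>x. \<Sum>i\<in>J. F i x)"
    by (rule insert.IH) (rule insert.prems, simp)
  moreover have "exp_approx L X (F i)" by (rule insert.prems) simp
  ultimately have "exp_approx L X (\<lambda>x. F i x + (\<Sum>i\<in>J. F i x))"
    by (intro exp_approx_add)
  then show ?case using insert.hyps by simp
qed (simp_all add: exp_approx_const[OF assms(1)])

lemma exp_approx_prod:
  assumes L: "\<And>l l'. l \<in> L \<Longrightarrow> l' \<in> L \<Longrightarrow> (\<lambda>x. l x + l' x) \<in> L" "(\<lambda>x. 0) \<in> L"
    and F: "\<And>i. i \<in> J \<Longrightarrow> exp_approx L X (F i)"
    and B: "\<And>i x. i \<in> J \<Longrightarrow> x \<in> X \<Longrightarrow> \<bar>F i x\<bar> \<le> B i"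
  shows "exp_approx L X (\<lambda>x. \<Prod>i\<in>J. F i x)"
  using F B
proof (induction J rule: infinite_finite_induct)
  case (insert i J)
  have IH: "exp_approx L X (\<lambda>x. \<Prod>i\<in>J. F i x)"
  proof (rule insert.IH)
    show "exp_approx L X (F i')" if "i' \<in> J" for i' by (rule insert.prems(1)) (simp add: that)
    show "\<bar>F i' x\<bar> \<le> B i'" if "i' \<in> J" "x \<in> X" for i' x by (rule insert.prems(2)) (simp_all add: that)
  qed
  have "exp_approx L X (\<lambda>x. F i x * (\<Prod>i\<in>J. F i x))"
  proof (rule exp_approx_mult[OF _ _ IH])
    show "(\<lambda>x. l x + l' x) \<in> L" if "l \<in> L" "l' \<in> L" for l l' by (rule L(1)[OF that])
    show "exp_approx L X (F i)" by (rule insert.prems(1)) simp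
    show "\<bar>F i x\<bar> \<le> B i" if "x \<in> X" for x by (rule insert.prems(2)) (simp_all add: that)
    fix x assume x: "x \<in> X"
    have "\<bar>\<Prod>i\<in>J. F i x\<bar> = (\<Prod>i\<in>J. \<bar>F i x\<bar>)" by (rule abs_prod)
    also have "\<dots> \<le> (\<Prod>i\<in>J. B i)"
      by (rule prod_mono) (simp add: insert.prems(2) x)
    finally show "\<bar>\<Prod>i\<in>J. F i x\<bar> \<le> (\<Prod>i\<in>J. B i)" .
  qed
  moreover have "(\<lambda>x. \<Prod>i\<in>insert i J. F i x) = (\<lambda>x. F i x * (\<Prod>i\<in>J. F i x))"
    using insert.hyps by simp
  ultimately show ?case by (simp only:)
qed (simp_all add: exp_approx_const[OF L(2)])

text \<open>The return from the algebra to nets: every exponential of a form is reached through the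
  profile, and the factor \<open>\<omega> b\<close> is common to all summands.\<close>

lemma net_approx_exp_approx:
  assumes app: "\<And>j M. net_approx \<sigma> scalar_forms I {-M..M} (\<lambda>b y. \<omega> b * y ^ j)"
    and bd: "\<And>b. b \<in> I \<Longrightarrow> \<bar>\<omega> b\<bar> \<le> W"
    and L: "\<And>l c d. l \<in> L \<Longrightarrow> (\<lambda>x. c * l x + d) \<in> L"
    and bL: "\<And>l. l \<in> L \<Longrightarrow> \<exists>M. \<forall>x\<in>X. \<bar>l x\<bar> \<le> M"
    and F: "exp_approx L X F"
  shows "net_approx \<sigma> L I X (\<lambda>b x. \<omega> b * F x)"
proof (rule net_approx_limit)
  fix e :: real assume e: "e > 0"
  then obtain f where f: "f \<in> exp_sums L" "\<And>x. x \<in> X \<Longrightarrow> \<bar>F x - f x\<bar> \<le> e / (\<bar>W\<bar> + 1)"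
    using exp_approxD[OF F, of "e / (\<bar>W\<bar> + 1)"] by auto
  have "net_approx \<sigma> L I X (\<lambda>b x. \<omega> b * f x)" using f(1)
  proof (induction rule: exp_sums.induct)
    case zero
    then show ?case by (simp add: net_approx_zero)
  next
    case (step g l c)
    obtain M where M: "\<forall>x\<in>X. \<bar>l x\<bar> \<le> M" using bL[OF step.hyps(2)] by blast
    have "net_approx \<sigma> L I X (\<lambda>b x. (\<lambda>b y. \<omega> b * exp y) (1 * b) (l x))"
    proof (rule net_approx_compose[OF net_approx_exp[OF app bd, of M]])
      fix s assume "s \<in> scalar_forms"
      then obtain w d where s: "s = (\<lambda>y. w * y + d)" unfolding scalar_forms_def by blast
      show "(\<lambda>x. 1 * s (l x)) \<in> L" using L[OF step.hyps(2), of w d] by (simp add: s)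
    qed (use M in \<open>auto simp: abs_le_iff\<close>)
    from net_approx_add[OF step.IH net_approx_scale[OF this, of c]]
    show ?case by (simp add: algebra_simps)
  qed
  moreover have "\<bar>\<omega> b * F x - \<omega> b * f x\<bar> \<le> e" if "b \<in> I" "x \<in> X" for b x
  proof -
    have "\<bar>\<omega> b * F x - \<omega> b * f x\<bar> = \<bar>\<omega> b\<bar> * \<bar>F x - f x\<bar>" by (simp add: abs_mult flip: right_diff_distrib)
    also have "\<dots> \<le> (\<bar>W\<bar> + 1) * (e / (\<bar>W\<bar> + 1))"
      using bd[OF that(1)] f(2)[OF that(2)] by (intro mult_mono) auto
    finally show ?thesis by simp
  qed
  ultimately show "\<exists>G. net_approx \<sigma> L I X G \<and> (\<forall>b\<in>I. \<forall>x\<in>X. \<bar>\<omega> b * F x - G b x\<bar> \<le> e)" by blast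
qed

text \<open>
  The modes \<open>axis j t\<close> with \<open>\<bar>t\<bar> \<ge> 2\<close> carry the functional number \<open>\<bar>t\<bar> - 1\<close>; all other modes carry
  the functional number 0.  In particular \<open>axis i 1\<close> carries number 0, so the ratios to the mean
  value reveal the position \<open>x\<close>.
\<close>

definition mode_index :: "'d::finite \<Rightarrow> int^'d \<Rightarrow> nat" where
  "mode_index j k = (if k = axis j (k $ j) \<and> \<bar>k $ j\<bar> \<ge> 2 then nat \<bar>k $ j\<bar> - 1 else 0)"

lemma mode_index_uminus: "mode_index j (- k) = mode_index j k"
proof -
  have "- k = axis j ((- k) $ j) \<longleftrightarrow> k = axis j (k $ j)"
    by (auto simp: vec_eq_iff axis_def)
  then show ?thesis by (simp add: mode_index_def)
qed

lemma mode_index_axis: "i \<ge> 1 \<Longrightarrow> mode_index j (axis j (int i + 1)) = i"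
  by (simp add: mode_index_def)

lemma mode_index_unit: "mode_index j (axis i 1) = 0"
  by (auto simp: mode_index_def axis_def)

lemma mode_index_le:
  assumes "k \<in> freq_modes (n + 1)"
  shows "mode_index j k \<le> n"
proof -
  have "\<bar>k $ j\<bar> \<le> int (n + 1)" using assms by (simp add: freq_modes_def)
  then have "nat \<bar>k $ j\<bar> - 1 \<le> n" by linarith
  then show ?thesis by (simp add: mode_index_def)
qed

section \<open>The forms computed by a Fourier layer\<close>

definition hermitian :: "(int^'d \<Rightarrow> complex) \<Rightarrow> bool" where
  "hermitian r \<longleftrightarrow> (\<forall>k. r (- k) = cnj (r k))"

text \<open>One output channel before the activation; a holds the Fourier coefficients of the
  extended input, which are prescribed to be real.\<close>

definition trig_form :: "nat \<Rightarrow> (int^'d \<Rightarrow> complex) \<Rightarrow> (int^'d \<Rightarrow> real) \<Rightarrow> real^'d \<Rightarrow> real" where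
  "trig_form K r a x = Re (\<Sum>k\<in>freq_modes K. r k * of_real (a k) * cis (freq_phase k x))"

text \<open>A point p consists of a position and the ratios to functional 0. After division by this
  functional every mode of index 0 has amplitude 1.\<close>

definition fno_forms :: "'d::finite \<Rightarrow> nat \<Rightarrow> ((real^'d) \<times> (nat \<Rightarrow> real) \<Rightarrow> real) set" where
  "fno_forms j n = {\<lambda>p. trig_form (n + 1) r (\<lambda>k. if mode_index j k = 0 then 1 else snd p (mode_index j k)) (fst p)
     | r. hermitian r}"

lemma trig_form_add:
  "trig_form K r a x + trig_form K s a x = trig_form K (\<lambda>k. r k + s k) a x"
  by (simp add: trig_form_def sum.distrib distrib_right)

lemma trig_form_scale: "c * trig_form K r a x = trig_form K (\<lambda>k. of_real c * r k) a x"
proof -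
  have "c * trig_form K r a x = Re (of_real c * (\<Sum>k\<in>freq_modes K. r k * of_real (a k) * cis (freq_phase k x)))"
    by (simp add: trig_form_def)
  then show ?thesis by (simp add: trig_form_def sum_distrib_left mult.assoc)
qed

lemma zero_in_freq_modes: "0 \<in> freq_modes K" by (simp add: freq_modes_def)

lemma trig_form_const:
  fixes a :: "int^'d \<Rightarrow> real"
  assumes "a 0 = 1"
  shows "trig_form K (\<lambda>k. if k = 0 then of_real c else 0) a x = c"
proof -
  have "(\<Sum>k\<in>freq_modes K. (if k = 0 then of_real c else 0) * of_real (a k) * cis (freq_phase k x))
     = (\<Sum>k\<in>freq_modes K. if k = (0 :: int^'d) then complex_of_real c else 0)"
    by (rule sum.cong[OF refl]) (simp add: assms freq_phase_def)
  also have "\<dots> = of_real c"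
    by (simp add: sum.delta finite_freq_modes zero_in_freq_modes)
  finally show ?thesis by (simp only: trig_form_def Re_complex_of_real)
qed

text \<open>A conjugate pair of modes gives the real waves: c = 1 yields the cosine and c = - \<i>
  the sine.\<close>

lemma trig_form_pair:
  assumes "k \<in> freq_modes K" "k \<noteq> 0" "a (- k) = a k"
  shows "trig_form K (\<lambda>k'. if k' = k then c else if k' = - k then cnj c else 0) a x
     = 2 * a k * Re (c * cis (freq_phase k x))"
proof -
  have k: "- k \<in> freq_modes K" using assms(1) by (simp add: freq_modes_def)
  have ne: "- k \<noteq> k"
  proof
    assume "- k = k"
    then have "- (k $ i) = k $ i" for i by (metis vector_uminus_component)
    then have "k $ i = 0" for i by (metis add.inverse_neutral equal_neg_zero neg_equal_zero)
    then show False using assms(2) by (simp add: vec_eq_iff)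
  qed
  have "(\<Sum>k'\<in>freq_modes K. (if k' = k then c else if k' = - k then cnj c else 0) * of_real (a k') * cis (freq_phase k' x))
     = (\<Sum>k'\<in>{k, - k}. (if k' = k then c else if k' = - k then cnj c else 0) * of_real (a k') * cis (freq_phase k' x))"
    by (rule sum.mono_neutral_right) (use k assms finite_freq_modes in auto)
  also have "\<dots> = c * of_real (a k) * cis (freq_phase k x) + cnj (c * of_real (a k) * cis (freq_phase k x))"
    using ne assms(3) by (simp add: freq_phase_uminus cis_cnj)
  finally have eq: "(\<Sum>k'\<in>freq_modes K. (if k' = k then c else if k' = - k then cnj c else 0) * of_real (a k') * cis (freq_phase k' x))
     = c * of_real (a k) * cis (freq_phase k x) + cnj (c * of_real (a k) * cis (freq_phase k x))" .
  show ?thesis unfolding trig_form_def eq by (simp add: algebra_simps)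
qed

lemma hermitian_pair:
  assumes "k \<noteq> (0 :: int^'d)"
  shows "hermitian (\<lambda>k'. if k' = k then c else if k' = - k then cnj c else 0)"
proof -
  have ne: "- k \<noteq> k"
  proof
    assume "- k = k"
    then have "- (k $ i) = k $ i" for i by (metis vector_uminus_component)
    then have "k $ i = 0" for i by (metis add.inverse_neutral equal_neg_zero neg_equal_zero)
    then show False using assms(1) by (simp add: vec_eq_iff)
  qed
  show ?thesis unfolding hermitian_def using ne
    by (auto simp: minus_equation_iff)
qed

lemma fno_forms_add:
  assumes "l \<in> fno_forms j n" "l' \<in> fno_forms j n"
  shows "(\<lambda>p. l p + l' p) \<in> fno_forms j n"
  using assms unfolding fno_forms_def
  by (auto simp: trig_form_add) (rule exI, rule conjI, rule refl, simp add: hermitian_def)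

text \<open>The zero mode carries functional 0 and so takes over the part of a bias.\<close>

lemma fno_forms_const: "(\<lambda>p. c) \<in> fno_forms j n"
proof -
  have "mode_index j 0 = 0" by (simp add: mode_index_def)
  then have "(\<lambda>p. c) = (\<lambda>p. trig_form (n + 1) (\<lambda>k. if k = 0 then of_real c else 0)
     (\<lambda>k. if mode_index j k = 0 then 1 else snd p (mode_index j k)) (fst p))"
    by (subst trig_form_const) auto
  moreover have "hermitian (\<lambda>k. if k = 0 then complex_of_real c else 0)" by (simp add: hermitian_def)
  ultimately show ?thesis unfolding fno_forms_def by blast
qed

lemma fno_forms_scale:
  assumes "l \<in> fno_forms j n"
  shows "(\<lambda>p. c * l p) \<in> fno_forms j n"
  using assms unfolding fno_forms_def
  by (auto simp: trig_form_scale) (rule exI, rule conjI, rule refl, simp add: hermitian_def)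

lemma fno_forms_affine:
  assumes "l \<in> fno_forms j n"
  shows "(\<lambda>p. c * l p + d) \<in> fno_forms j n"
  by (rule fno_forms_add[OF fno_forms_scale[OF assms] fno_forms_const])

definition coord_box :: "(real^'d) set \<Rightarrow> nat \<Rightarrow> real \<Rightarrow> ((real^'d) \<times> (nat \<Rightarrow> real)) set" where
  "coord_box D n Z = D \<times> {z. \<forall>i\<in>{1..n}. \<bar>z i\<bar> \<le> Z}"

lemma fno_forms_bounded:
  assumes "l \<in> fno_forms j n"
  shows "\<exists>M. \<forall>p\<in>coord_box D n Z. \<bar>l p\<bar> \<le> M"
proof -
  obtain r where l: "l = (\<lambda>p. trig_form (n + 1) r (\<lambda>k. if mode_index j k = 0 then 1 else snd p (mode_index j k)) (fst p))"
    using assms unfolding fno_forms_def by blast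
  have "\<bar>l p\<bar> \<le> (\<Sum>k\<in>freq_modes (n + 1). norm (r k) * (\<bar>Z\<bar> + 1))" if p: "p \<in> coord_box D n Z" for p
  proof -
    have "\<bar>l p\<bar> \<le> norm (\<Sum>k\<in>freq_modes (n + 1). r k * of_real (if mode_index j k = 0 then 1 else snd p (mode_index j k)) * cis (freq_phase k (fst p)))"
      unfolding l trig_form_def by (rule abs_Re_le_cmod)
    also have "\<dots> \<le> (\<Sum>k\<in>freq_modes (n + 1). norm (r k) * (\<bar>Z\<bar> + 1))"
    proof (rule order_trans[OF norm_sum sum_mono])
      fix k :: "int^'a" assume k: "k \<in> freq_modes (n + 1)"
      have "\<bar>if mode_index j k = 0 then 1 else snd p (mode_index j k)\<bar> \<le> \<bar>Z\<bar> + 1"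
      proof (cases "mode_index j k = 0")
        case False
        then have "mode_index j k \<in> {1..n}" using mode_index_le[OF k, of j] by auto
        then have "\<bar>snd p (mode_index j k)\<bar> \<le> Z" using p by (auto simp: coord_box_def)
        then show ?thesis using False by simp
      qed simp
      then show "norm (r k * of_real (if mode_index j k = 0 then 1 else snd p (mode_index j k)) * cis (freq_phase k (fst p)))
        \<le> norm (r k) * (\<bar>Z\<bar> + 1)"
        by (simp add: norm_mult mult_left_mono del: of_real_1)
    qed
    finally show ?thesis .
  qed
  then show ?thesis by blast
qed

lemma continuous_on_trig_form:
  assumes "continuous_on A f" "\<And>k. continuous_on A (\<lambda>p. a p k)"
  shows "continuous_on A (\<lambda>p. trig_form K r (a p) (f p))"
  unfolding trig_form_def cis_conv_exp
  by (intro continuous_intros assms)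

text \<open>Stone-Weierstrass on the compact set of positions and values of one ratio. Functions of
  several ratios are later built as products, so the space of sequences needs no topology.\<close>

lemma exp_approx_coordinate:
  fixes D :: "(real^'d) set" and \<phi> :: "(real^'d) \<times> real \<Rightarrow> real"
  assumes D: "bounded D" "closure D \<subseteq> torus_cube" and i: "i \<in> {1..n}"
    and \<phi>: "continuous_on UNIV \<phi>"
  shows "exp_approx (fno_forms j n) (coord_box D n Z) (\<lambda>p. \<phi> (fst p, snd p i))"
proof -
  define a where "a t k = (if mode_index j k = 0 then 1 else if mode_index j k = i then t else 0)" for t :: real and k
  \<comment> \<open>Multipliers restricted to modes of index 0 and i, so that the form depends on
    the ratio with number i alone.\<close>
  define adm where "adm r \<longleftrightarrow> hermitian r \<and> (\<forall>k. r k \<noteq> 0 \<longrightarrow> mode_index j k \<in> {0, i})" for r :: "int^'d \<Rightarrow> complex"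
  define Li where "Li = {\<lambda>p. trig_form (n + 1) r (a (snd p)) (fst p) | r. adm r}"
  have aneg: "a t (- k) = a t k" for t k by (simp add: a_def mode_index_uminus)
  have Li_add: "(\<lambda>p. l p + l' p) \<in> Li" if l: "l \<in> Li" "l' \<in> Li" for l l'
  proof -
    obtain r r' where r: "l = (\<lambda>p. trig_form (n + 1) r (a (snd p)) (fst p))" "adm r"
      "l' = (\<lambda>p. trig_form (n + 1) r' (a (snd p)) (fst p))" "adm r'"
      using l unfolding Li_def by blast
    have "adm (\<lambda>k. r k + r' k)" using r(2,4) unfolding adm_def hermitian_def
      by (metis add.right_neutral add.left_neutral complex_cnj_add)
    then show ?thesis unfolding r(1,3) trig_form_add Li_def by blast
  qed
  have Li_0: "(\<lambda>p. 0) \<in> Li"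
  proof -
    have "adm (\<lambda>k. 0)" by (simp add: adm_def hermitian_def)
    moreover have "(\<lambda>p. 0) = (\<lambda>p. trig_form (n + 1) (\<lambda>k. 0) (a (snd p)) (fst p))" by (simp add: trig_form_def)
    ultimately show ?thesis unfolding Li_def by blast
  qed
  have Li_cont: "continuous_on UNIV l" if l: "l \<in> Li" for l
  proof -
    obtain r where "l = (\<lambda>p. trig_form (n + 1) r (a (snd p)) (fst p))" using l unfolding Li_def by blast
    moreover have "continuous_on UNIV (\<lambda>p :: (real^'d) \<times> real. a (snd p) k)" for k
      unfolding a_def by (cases "mode_index j k = 0"; cases "mode_index j k = i") (auto intro!: continuous_intros)
    ultimately show ?thesis by (auto intro!: continuous_on_trig_form continuous_intros)
  qed
  have pair: "(\<lambda>p. 2 * a (snd p) k * Re (c * cis (freq_phase k (fst p)))) \<in> Li"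
    if k: "k \<in> freq_modes (n + 1)" "k \<noteq> 0" "mode_index j k \<in> {0, i}" for k c
  proof -
    have "adm (\<lambda>k'. if k' = k then c else if k' = - k then cnj c else 0)"
      unfolding adm_def using hermitian_pair[OF k(2)] k(3) by (auto simp: mode_index_uminus)
    moreover have "(\<lambda>p. 2 * a (snd p) k * Re (c * cis (freq_phase k (fst p))))
      = (\<lambda>p. trig_form (n + 1) (\<lambda>k'. if k' = k then c else if k' = - k then cnj c else 0) (a (snd p)) (fst p))"
    proof
      fix p :: "(real^'d) \<times> real"
      show "2 * a (snd p) k * Re (c * cis (freq_phase k (fst p)))
        = trig_form (n + 1) (\<lambda>k'. if k' = k then c else if k' = - k then cnj c else 0) (a (snd p)) (fst p)"
        by (rule trig_form_pair[where a = "a (snd p)", symmetric, OF k(1,2) aneg])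
    qed
    ultimately show ?thesis unfolding Li_def by blast
  qed
  interpret function_ring_on "exp_sums Li" "closure D \<times> {-Z..Z}"
  proof
    show "compact (closure D \<times> {-Z..Z})" using D by (intro compact_Times) auto
    show "continuous_on (closure D \<times> {- Z..Z}) f" if "f \<in> exp_sums Li" for f
      using that
    proof (induction rule: exp_sums.induct)
      case (step f l c)
      have "continuous_on (closure D \<times> {- Z..Z}) l"
        by (rule continuous_on_subset[OF Li_cont[OF step.hyps(2)]]) simp
      then show ?case by (intro continuous_intros step.IH)
    qed simp
    fix f g assume fg: "f \<in> exp_sums Li" "g \<in> exp_sums Li"
    show "(\<lambda>x. f x + g x) \<in> exp_sums Li" by (rule exp_sums_add[OF fg])
    show "(\<lambda>x. f x * g x) \<in> exp_sums Li" by (rule exp_sums_mult[OF Li_add fg])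
  next
    show "(\<lambda>_. c) \<in> exp_sums Li" for c by (rule exp_sums_const[OF Li_0])
  next
    fix p q :: "(real^'d) \<times> real"
    assume p: "p \<in> closure D \<times> {-Z..Z}" and q: "q \<in> closure D \<times> {-Z..Z}" and "p \<noteq> q"
    have ex: "\<exists>l\<in>Li. l p \<noteq> l q"
    proof (cases "fst p = fst q")
      case False
      then obtain m where m: "fst p $ m \<noteq> fst q $ m" by (auto simp: vec_eq_iff)
      \<comment> \<open>The cosine and sine of one coordinate separate positions because the closure
        of D lies in the open cube, where coordinates differ by less than 2 pi.\<close>
      define k :: "int^'d" where "k = axis m 1"
      have k: "k \<in> freq_modes (n + 1)" "k \<noteq> 0" "mode_index j k \<in> {0, i}"
      proof -
        show "k \<in> freq_modes (n + 1)" by (simp add: k_def freq_modes_def axis_def)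
        show "k \<noteq> 0" by (simp add: k_def axis_eq_0_iff)
        show "mode_index j k \<in> {0, i}" by (simp add: k_def mode_index_unit)
      qed
      have ph: "freq_phase k x = x $ m" for x
        by (simp add: freq_phase_def k_def axis_def if_distrib[of "\<lambda>z. of_int z * _"] cong: if_cong)
      have a1: "a t k = 1" for t by (simp add: a_def k_def mode_index_unit)
      have "fst p \<in> torus_cube" "fst q \<in> torus_cube" using p q D by auto
      then have "\<bar>fst p $ m - fst q $ m\<bar> < 2 * pi" by (auto simp: torus_cube_def abs_less_iff) (smt (verit))+
      then have "cis (fst p $ m) \<noteq> cis (fst q $ m)" using m cis_eq_imp by blast
      then have "cos (fst p $ m) \<noteq> cos (fst q $ m) \<or> sin (fst p $ m) \<noteq> sin (fst q $ m)"
        by (auto simp: complex_eq_iff)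
      moreover obtain l1 where "l1 \<in> Li" "\<And>p. l1 p = 2 * cos (fst p $ m)"
        by (rule that[OF pair[OF k, of 1]]) (simp add: ph a1)
      moreover obtain l2 where "l2 \<in> Li" "\<And>p. l2 p = 2 * sin (fst p $ m)"
        by (rule that[OF pair[OF k, of "- \<i>"]]) (simp add: ph a1)
      ultimately show ?thesis by (elim disjE) (rule bexI[of _ l1] bexI[of _ l2]; simp; fail)+
    next
      case True
      then have ne: "snd p \<noteq> snd q" using \<open>p \<noteq> q\<close> by (simp add: prod_eq_iff)
      \<comment> \<open>The amplitude of this mode is the ratio itself. Its cosine and sine do not
        vanish together, so one of the two waves sees a change of the ratio.\<close>
      define k :: "int^'d" where "k = axis j (int i + 1)"
      have ki: "mode_index j k = i" using i by (simp add: k_def mode_index_axis)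
      have k: "k \<in> freq_modes (n + 1)" "k \<noteq> 0" "mode_index j k \<in> {0, i}"
      proof -
        show "k \<in> freq_modes (n + 1)" using i by (simp add: k_def freq_modes_def axis_def)
        show "k \<noteq> 0" by (simp add: k_def axis_eq_0_iff)
        show "mode_index j k \<in> {0, i}" by (simp add: ki)
      qed
      have a1: "a t k = t" for t using ki i by (simp add: a_def)
      define \<theta> where "\<theta> = freq_phase k (fst q)"
      have "cos \<theta> \<noteq> 0 \<or> sin \<theta> \<noteq> 0"
      proof (rule ccontr)
        assume "\<not> ?thesis"
        then have "(sin \<theta>)\<^sup>2 + (cos \<theta>)\<^sup>2 = 0" by simp
        then show False unfolding sin_cos_squared_add by simp
      qed
      moreover obtain l1 where "l1 \<in> Li" "\<And>p. l1 p = 2 * snd p * cos (freq_phase k (fst p))"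
        by (rule that[OF pair[OF k, of 1]]) (simp add: a1)
      moreover obtain l2 where "l2 \<in> Li" "\<And>p. l2 p = 2 * snd p * sin (freq_phase k (fst p))"
        by (rule that[OF pair[OF k, of "- \<i>"]]) (simp add: a1)
      ultimately show ?thesis using ne True
        by (elim disjE) (rule bexI[of _ l1] bexI[of _ l2]; simp add: \<theta>_def; fail)+
    qed
    then obtain l where "l \<in> Li" "l p \<noteq> l q" by blast
    then show "\<exists>f\<in>exp_sums Li. f p \<noteq> f q"
      by (intro bexI[where x = "\<lambda>x. exp (l x)"]) (auto intro: exp_sums_exp)
  qed
  show ?thesis
    unfolding exp_approx_def
  proof (intro allI impI)
    fix e :: real assume "e > 0"
    obtain f where f: "f \<in> exp_sums Li" "\<And>x. x \<in> closure D \<times> {-Z..Z} \<Longrightarrow> \<bar>\<phi> x - f x\<bar> < e"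
      using Stone_Weierstrass_basic[OF continuous_on_subset[OF \<phi>] \<open>e > 0\<close>] by auto
    have "(\<lambda>p. f ((\<lambda>p. (fst p, snd p i)) p)) \<in> exp_sums (fno_forms j n)"
    proof (rule exp_sums_compose[OF f(1)])
      fix l assume "l \<in> Li"
      then obtain r where r: "l = (\<lambda>p. trig_form (n + 1) r (a (snd p)) (fst p))" "adm r"
        unfolding Li_def by blast
      have "r k * of_real (a (z i) k) = r k * of_real (if mode_index j k = 0 then 1 else z (mode_index j k))" for k and z :: "nat \<Rightarrow> real"
        using r(2) unfolding adm_def a_def by auto
      then have "(\<lambda>p. l (fst p, snd p i)) = (\<lambda>p. trig_form (n + 1) r (\<lambda>k. if mode_index j k = 0 then 1 else snd p (mode_index j k)) (fst p))"
        unfolding r(1) trig_form_def by (simp only: fst_conv snd_conv)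
      then show "(\<lambda>p. l (fst p, snd p i)) \<in> fno_forms j n"
        unfolding fno_forms_def using r(2) by (auto simp: adm_def)
    qed
    then have f': "(\<lambda>p. f (fst p, snd p i)) \<in> exp_sums (fno_forms j n)" by simp
    show "\<exists>f\<in>exp_sums (fno_forms j n). \<forall>x\<in>coord_box D n Z. \<bar>\<phi> (fst x, snd x i) - f x\<bar> \<le> e"
    proof (rule bexI[where x = "\<lambda>p. f (fst p, snd p i)"])
      show "\<forall>x\<in>coord_box D n Z. \<bar>\<phi> (fst x, snd x i) - f (fst x, snd x i)\<bar> \<le> e"
      proof
        fix p assume p: "p \<in> coord_box D n Z"
        have "fst p \<in> closure D" using p closure_subset[of D] by (auto simp: coord_box_def)
        moreover have "\<bar>snd p i\<bar> \<le> Z" using p i by (auto simp: coord_box_def)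
        ultimately have "(fst p, snd p i) \<in> closure D \<times> {-Z..Z}" by auto
        then show "\<bar>\<phi> (fst p, snd p i) - f (fst p, snd p i)\<bar> \<le> e" using f(2) by (intro less_imp_le)
      qed
    qed (rule f')
  qed
qed

section \<open>From nets to FNO modules\<close>

lemma fno_module_of_nets:
  fixes D :: "(real^'d) set"
  assumes D: "D \<in> lmeasurable" "closure D \<subset> torus_cube"
    and gs: "\<And>i. gs i \<in> L2 D" and \<sigma>: "continuous_on UNIV \<sigma>"
    and g: "g \<in> nets \<sigma> (fno_forms j n)"
  obtains A where "fno_module D \<sigma> A" "\<And>u. u \<in> L2 D \<Longrightarrow> continuous_on UNIV (A u)"
    "\<And>u x. u \<in> L2 D \<Longrightarrow> L2_inner D u (gs 0) \<noteq> 0 \<Longrightarrow>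
       A u x = g (L2_inner D u (gs 0)) (x, \<lambda>i. L2_inner D u (gs i) / L2_inner D u (gs 0))"
proof -
  obtain N :: nat and q l where N: "\<And>i. i < N \<Longrightarrow> l i \<in> fno_forms j n" "g = (\<lambda>b x. \<Sum>i<N. q i * \<sigma> (b * l i x))"
    using nets_finite_sum[OF g] by metis
  have "\<forall>i. \<exists>r. i < N \<longrightarrow> hermitian r \<and>
     l i = (\<lambda>p. trig_form (n + 1) r (\<lambda>k. if mode_index j k = 0 then 1 else snd p (mode_index j k)) (fst p))"
    using N(1) unfolding fno_forms_def by blast
  then have "\<exists>r. \<forall>i. i < N \<longrightarrow> hermitian (r i) \<and>
     l i = (\<lambda>p. trig_form (n + 1) (r i) (\<lambda>k. if mode_index j k = 0 then 1 else snd p (mode_index j k)) (fst p))"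
    by (rule choice)
  then obtain r where r: "\<And>i. i < N \<Longrightarrow> hermitian (r i)"
    "\<And>i. i < N \<Longrightarrow> l i = (\<lambda>p. trig_form (n + 1) (r i) (\<lambda>k. if mode_index j k = 0 then 1 else snd p (mode_index j k)) (fst p))"
    by blast
  obtain E where E: "extension_operator D E"
    "\<And>u k. u \<in> L2 D \<Longrightarrow> k \<in> freq_modes (n + 1) \<Longrightarrow> fourier_coeff (E u) k = of_real (L2_inner D u (gs (mode_index j k)))"
    using extension_operator_prescribed[OF D, of "\<lambda>k. gs (mode_index j k)", OF gs, where K = "n + 1"]
    by (auto simp: mode_index_uminus)
  \<comment> \<open>Every channel of the lifted input equals E u, so reading channel 0 suffices;
    output channel i < N computes one summand of the net. One further channel of weight 0 keeps the
    number of channels positive when N = 0.\<close>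
  define Q where "Q i = (if i < N then q i else 0)" for i
  define R where "R = (\<lambda>(m :: nat) k i (j :: nat). if j = 0 \<and> i < N then r i k else 0)"
  define A where "A = (\<lambda>u x. \<Sum>i<Suc N. Q i * fno_kernel \<sigma> (Suc N) (n + 1) R (\<lambda>_ _ _. 0) 1 (\<lambda>y j. 1 * E u y) x i)"
  have mod: "fno_module D \<sigma> A"
    unfolding fno_module_def
  proof (intro exI conjI)
    show "extension_operator D E" by (rule E(1))
    show "\<forall>l<1. hermitian_multiplier (Suc N) (n + 1) (R l)"
      using r(1) by (auto simp: hermitian_multiplier_def R_def hermitian_def)
    show "A = (\<lambda>u x. \<Sum>i<Suc N. Q i * fno_kernel \<sigma> (Suc N) (n + 1) R (\<lambda>_ _ _. 0) 1 (\<lambda>y j. (\<lambda>_. 1) j * E u y) x i)"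
      by (simp add: A_def)
  qed auto
  have A_eq: "A u x = (\<Sum>i<N. q i * \<sigma> (trig_form (n + 1) (r i) (\<lambda>k. L2_inner D u (gs (mode_index j k))) x))"
    if u: "u \<in> L2 D" for u x
  proof -
    have inner: "(\<Sum>j<Suc N. R 0 k i j * fourier_coeff (E u) k) = r i k * fourier_coeff (E u) k" if "i < N" for i k
    proof -
      have "(\<Sum>j<Suc N. R 0 k i j * fourier_coeff (E u) k) = (\<Sum>j<Suc N. if j = 0 then r i k * fourier_coeff (E u) k else 0)"
        using that by (intro sum.cong) (auto simp: R_def)
      then show ?thesis by simp
    qed
    have "fno_kernel \<sigma> (Suc N) (n + 1) R (\<lambda>_ _ _. 0) 1 (\<lambda>y j. 1 * E u y) x i
       = \<sigma> (trig_form (n + 1) (r i) (\<lambda>k. L2_inner D u (gs (mode_index j k))) x)" if i: "i < N" for i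
    proof -
      have "fno_kernel \<sigma> (Suc N) (n + 1) R (\<lambda>_ _ _. 0) 1 (\<lambda>y j. 1 * E u y) x i
        = \<sigma> (Re (\<Sum>k\<in>freq_modes (n + 1). (\<Sum>j<Suc N. R 0 k i j * fourier_coeff (E u) k) * cis (freq_phase k x)))"
        by (simp add: fno_layer_def del: sum.lessThan_Suc)
      also have "(\<Sum>k\<in>freq_modes (n + 1). (\<Sum>j<Suc N. R 0 k i j * fourier_coeff (E u) k) * cis (freq_phase k x))
         = (\<Sum>k\<in>freq_modes (n + 1). r i k * of_real (L2_inner D u (gs (mode_index j k))) * cis (freq_phase k x))"
        by (intro sum.cong refl, simp only: inner[OF i], simp only: E(2)[OF u])
      finally show ?thesis by (simp add: trig_form_def)
    qed
    then show ?thesis by (simp add: A_def Q_def)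
  qed
  have cont: "continuous_on UNIV (A u)" if u: "u \<in> L2 D" for u
  proof -
    have "continuous_on UNIV (\<lambda>x. \<Sum>i<N. q i * \<sigma> (trig_form (n + 1) (r i) (\<lambda>k. L2_inner D u (gs (mode_index j k))) x))"
      by (intro continuous_intros continuous_on_compose2[OF \<sigma>] continuous_on_trig_form) auto
    then show ?thesis by (simp add: A_eq[OF u, abs_def])
  qed
  have val: "A u x = g (L2_inner D u (gs 0)) (x, \<lambda>i. L2_inner D u (gs i) / L2_inner D u (gs 0))"
    if u: "u \<in> L2 D" and nz: "L2_inner D u (gs 0) \<noteq> 0" for u x
  proof -
    define b where "b = L2_inner D u (gs 0)"
    \<comment> \<open>Homogeneity of the form extracts b; a nonzero b is needed to pass from
      functionals to ratios.\<close>
    have tf: "trig_form (n + 1) (r i) (\<lambda>k. L2_inner D u (gs (mode_index j k))) x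
       = b * trig_form (n + 1) (r i) (\<lambda>k. if mode_index j k = 0 then 1 else L2_inner D u (gs (mode_index j k)) / b) x" for i
    proof -
      have "L2_inner D u (gs (mode_index j k)) = b * (if mode_index j k = 0 then 1 else L2_inner D u (gs (mode_index j k)) / b)" for k
        using nz by (simp add: b_def)
      then have "r i k * of_real (L2_inner D u (gs (mode_index j k))) * cis (freq_phase k x)
         = of_real b * (r i k * of_real (if mode_index j k = 0 then 1 else L2_inner D u (gs (mode_index j k)) / b) * cis (freq_phase k x))" for k
        by (metis (no_types, lifting) mult.assoc mult.left_commute of_real_mult)
      then have eq: "(\<Sum>k\<in>freq_modes (n + 1). r i k * of_real (L2_inner D u (gs (mode_index j k))) * cis (freq_phase k x))
         = of_real b * (\<Sum>k\<in>freq_modes (n + 1). r i k * of_real (if mode_index j k = 0 then 1 else L2_inner D u (gs (mode_index j k)) / b) * cis (freq_phase k x))"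
        by (simp only: sum_distrib_left)
      have Re_b: "Re (of_real b * z) = b * Re z" for z by simp
      show ?thesis unfolding trig_form_def eq Re_b ..
    qed
    show ?thesis
      unfolding A_eq[OF u] N(2) b_def[symmetric]
    proof (intro sum.cong refl)
      fix i assume "i \<in> {..<N}"
      then have "i < N" by simp
      show "q i * \<sigma> (trig_form (n + 1) (r i) (\<lambda>k. L2_inner D u (gs (mode_index j k))) x)
        = q i * \<sigma> (b * l i (x, \<lambda>i. L2_inner D u (gs i) / b))"
        unfolding tf r(2)[OF \<open>i < N\<close>] fst_conv snd_conv ..
    qed
  qed
  show ?thesis by (rule that[OF mod cont val])
qed

text \<open>The target F has access to position and ratios but not to b, which appears only in the
  factor \<open>\<omega> b\<close>; this factor is left for a later module to undo.\<close>

lemma fno_universal: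
  fixes D :: "(real^'d) set"
  assumes D: "D \<in> lmeasurable" "closure D \<subset> torus_cube"
    and gs: "\<And>i. gs i \<in> L2 D" and \<sigma>: "continuous_on UNIV \<sigma>"
    and app: "\<And>j M. net_approx \<sigma> scalar_forms I {-M..M} (\<lambda>b y. \<omega> b * y ^ j)"
    and bd: "\<And>b. b \<in> I \<Longrightarrow> \<bar>\<omega> b\<bar> \<le> W" and I: "0 \<notin> I"
    and F: "exp_approx (fno_forms j n) (coord_box D n Z) F" and e: "e > 0"
  obtains A where "fno_module D \<sigma> A" "\<And>u. u \<in> L2 D \<Longrightarrow> continuous_on UNIV (A u)"
    "\<And>u x. u \<in> L2 D \<Longrightarrow> L2_inner D u (gs 0) \<in> I \<Longrightarrow>
       (\<And>i. i \<in> {1..n} \<Longrightarrow> \<bar>L2_inner D u (gs i) / L2_inner D u (gs 0)\<bar> \<le> Z) \<Longrightarrow> x \<in> D \<Longrightarrow>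
       \<bar>A u x - \<omega> (L2_inner D u (gs 0)) * F (x, \<lambda>i. L2_inner D u (gs i) / L2_inner D u (gs 0))\<bar> \<le> e"
proof -
  have na: "net_approx \<sigma> (fno_forms j n) I (coord_box D n Z) (\<lambda>b x. \<omega> b * F x)"
    by (rule net_approx_exp_approx[OF app bd fno_forms_affine fno_forms_bounded F])
  obtain g where g: "g \<in> nets \<sigma> (fno_forms j n)"
    "\<And>b x. b \<in> I \<Longrightarrow> x \<in> coord_box D n Z \<Longrightarrow> \<bar>\<omega> b * F x - g b x\<bar> \<le> e"
    by (rule net_approxD[OF na e], rule that)
  obtain A where A: "fno_module D \<sigma> A" "\<And>u. u \<in> L2 D \<Longrightarrow> continuous_on UNIV (A u)"
    "\<And>u x. u \<in> L2 D \<Longrightarrow> L2_inner D u (gs 0) \<noteq> 0 \<Longrightarrow>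
       A u x = g (L2_inner D u (gs 0)) (x, \<lambda>i. L2_inner D u (gs i) / L2_inner D u (gs 0))"
    by (rule fno_module_of_nets[OF D gs \<sigma> g(1)], rule that)
  have fin: "\<bar>A u x - \<omega> (L2_inner D u (gs 0)) * F (x, \<lambda>i. L2_inner D u (gs i) / L2_inner D u (gs 0))\<bar> \<le> e"
    if u: "u \<in> L2 D" "L2_inner D u (gs 0) \<in> I"
      "\<And>i. i \<in> {1..n} \<Longrightarrow> \<bar>L2_inner D u (gs i) / L2_inner D u (gs 0)\<bar> \<le> Z" "x \<in> D" for u x
  proof -
    have nz: "L2_inner D u (gs 0) \<noteq> 0" using u(2) I by metis
    have "(x, \<lambda>i. L2_inner D u (gs i) / L2_inner D u (gs 0)) \<in> coord_box D n Z"
      using u(3,4) by (simp add: coord_box_def)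
    from g(2)[OF u(2) this] show ?thesis unfolding A(3)[OF u(1) nz] by (simp add: abs_minus_commute)
  qed
  show ?thesis
    by (rule that, rule A(1), rule A(2), assumption, rule fin)
qed

section \<open>Averaging over finitely many cells\<close>

text \<open>Positive measure makes the averages meaningful; covering only up to a null set allows
  null pieces to be discarded.\<close>

locale cells =
  fixes D :: "(real^'d) set" and m :: nat and A :: "nat \<Rightarrow> (real^'d) set"
  assumes D: "D \<in> lmeasurable"
    and cell: "\<And>k. k < m \<Longrightarrow> A k \<in> sets lebesgue" "\<And>k. k < m \<Longrightarrow> A k \<subseteq> D"
    and disjoint: "\<And>k l. k < m \<Longrightarrow> l < m \<Longrightarrow> k \<noteq> l \<Longrightarrow> A k \<inter> A l = {}"
    and pos: "\<And>k. k < m \<Longrightarrow> measure lebesgue (A k) > 0"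
    and cover: "AE x in lebesgue_on D. x \<in> (\<Union>k<m. A k)"
begin

definition step :: "(nat \<Rightarrow> real) \<Rightarrow> real^'d \<Rightarrow> real" where
  "step c x = (\<Sum>k<m. c k * indicator (A k) x)"

definition avg :: "nat \<Rightarrow> (real^'d \<Rightarrow> real) \<Rightarrow> real" where
  "avg k u = L2_inner D u (indicator (A k)) / measure lebesgue (A k)"

lemma Ds: "D \<in> sets lebesgue" using D by auto

lemma cell_on: "k < m \<Longrightarrow> A k \<in> sets (lebesgue_on D)"
  using cell Ds by (simp add: sets_restrict_space_iff)

lemma ind_L2: "k < m \<Longrightarrow> indicator (A k) \<in> L2 D"
  by (rule L2_bounded[OF D, where C = 1]) (auto simp: cell_on indicator_def intro!: borel_measurable_indicator)

lemma ind_inner: "k < m \<Longrightarrow> l < m \<Longrightarrow> L2_inner D (indicator (A k)) (indicator (A l)) = (if k = l then measure lebesgue (A k) else 0)"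
proof -
  assume k: "k < m" and l: "l < m"
  have "L2_inner D (indicator (A k)) (indicator (A l)) = (LINT x|lebesgue_on D. (if k = l then indicator (A k) x else 0))"
    unfolding L2_inner_def
    by (rule Bochner_Integration.integral_cong) (use disjoint[OF k l] in \<open>auto simp: indicator_def\<close>)
  also have "\<dots> = (if k = l then measure (lebesgue_on D) (A k) else 0)"
    using cell_on[OF k] by (simp add: Int_absorb2[OF cell(2)[OF k]] Int_absorb2[OF cell(2)[OF l]])
  also have "measure (lebesgue_on D) (A k) = measure lebesgue (A k)"
    using cell[OF k] Ds by (simp add: measure_restrict_space)
  finally show ?thesis .
qed

lemma step_L2: "step c \<in> L2 D"
  unfolding step_def[abs_def] by (intro L2_sum L2_scale ind_L2) auto

lemma step_eq: "x \<in> A k \<Longrightarrow> k < m \<Longrightarrow> step c x = c k"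
proof -
  assume x: "x \<in> A k" "k < m"
  have "step c x = (\<Sum>l<m. if l = k then c k else 0)"
    unfolding step_def using x disjoint by (intro sum.cong) (auto simp: indicator_def)
  then show ?thesis using x by simp
qed

lemma step_inner: "w \<in> L2 D \<Longrightarrow> L2_inner D (step c) w = (\<Sum>k<m. c k * L2_inner D w (indicator (A k)))"
  unfolding step_def[abs_def]
  by (subst L2_inner_sum_left) (auto simp: L2_inner_scale_left L2_inner_commute intro!: L2_scale ind_L2)

lemma avg_step: "j < m \<Longrightarrow> avg j (step c) = c j"
proof -
  assume j: "j < m"
  have "L2_inner D (step c) (indicator (A j)) = (\<Sum>k<m. c k * (if k = j then measure lebesgue (A j) else 0))"
    unfolding step_inner[OF ind_L2[OF j]] using j
    by (intro sum.cong refl) (auto simp: ind_inner)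
  then show ?thesis using j pos[OF j] by (simp add: avg_def if_distrib cong: if_cong)
qed

lemma avg_diff:
  "u \<in> L2 D \<Longrightarrow> v \<in> L2 D \<Longrightarrow> j < m \<Longrightarrow> avg j (\<lambda>x. u x - v x) = avg j u - avg j v"
  by (simp add: avg_def L2_inner_diff_left ind_L2 diff_divide_distrib)

lemma step_norm_square: "(L2_norm D (step c))\<^sup>2 = (\<Sum>k<m. (c k)\<^sup>2 * measure lebesgue (A k))"
proof -
  have "L2_inner D (step c) (indicator (A k)) = c k * measure lebesgue (A k)" if "k < m" for k
    using avg_step[OF that, of c] pos[OF that] by (simp add: avg_def field_simps)
  then show ?thesis
    unfolding L2_norm_square step_inner[OF step_L2] by (intro sum.cong) (auto simp: power2_eq_square)
qed

text \<open>Averaging is the orthogonal projection onto step functions: the squared norm of the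
  projection equals its inner product with v.\<close>

lemma step_avg_norm_le:
  assumes "v \<in> L2 D"
  shows "L2_norm D (step (\<lambda>k. avg k v)) \<le> L2_norm D v"
proof -
  let ?P = "step (\<lambda>k. avg k v)"
  have "(L2_norm D ?P)\<^sup>2 = L2_inner D ?P v"
    unfolding step_norm_square step_inner[OF assms]
    using pos by (intro sum.cong refl) (force simp: avg_def power2_eq_square)
  also have "\<dots> \<le> L2_norm D ?P * L2_norm D v"
    using L2_Cauchy_Schwarz[OF step_L2 assms] by (rule order_trans[OF abs_ge_self])
  finally have "L2_norm D ?P * L2_norm D ?P \<le> L2_norm D ?P * L2_norm D v" by (simp add: power2_eq_square)
  then show ?thesis
    by (cases "L2_norm D ?P = 0") (auto simp: mult_le_cancel_left dest: order_less_le_trans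
        intro: order_trans[OF _ L2_norm_nonneg] simp: less_le)
qed

lemma step_diff: "step c x - step c' x = step (\<lambda>k. c k - c' k) x"
  by (simp add: step_def sum_subtractf left_diff_distrib)

lemma step_cong: "(\<And>k. k < m \<Longrightarrow> c k = c' k) \<Longrightarrow> step c = step c'"
  unfolding step_def by (intro ext sum.cong) auto

text \<open>The projection fixes step functions and does not increase norms, so up to the factor 2
  the averages do as well as any other step function.\<close>

lemma step_avg_error:
  assumes "u \<in> L2 D"
  shows "L2_norm D (\<lambda>x. u x - step (\<lambda>k. avg k u) x) \<le> 2 * L2_norm D (\<lambda>x. u x - step c x)"
proof -
  have "L2_norm D (\<lambda>x. step c x - step (\<lambda>k. avg k u) x) = L2_norm D (\<lambda>x. step (\<lambda>k. avg k u) x - step c x)"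
    by (rule L2_norm_minus_commute)
  also have "(\<lambda>x. step (\<lambda>k. avg k u) x - step c x) = step (\<lambda>k. avg k (\<lambda>x. u x - step c x))"
  proof -
    have "step (\<lambda>k. avg k u - c k) = step (\<lambda>k. avg k (\<lambda>x. u x - step c x))"
      by (rule step_cong) (simp add: avg_diff[OF assms step_L2] avg_step)
    then show ?thesis by (simp add: step_diff)
  qed
  also have "L2_norm D \<dots> \<le> L2_norm D (\<lambda>x. u x - step c x)"
    by (intro step_avg_norm_le L2_diff assms step_L2)
  finally have "L2_norm D (\<lambda>x. step c x - step (\<lambda>k. avg k u) x) \<le> L2_norm D (\<lambda>x. u x - step c x)" .
  then show ?thesis
    using L2_triangle_diff[OF assms step_L2[of c] step_L2[of "\<lambda>k. avg k u"]] by linarith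
qed

lemma abs_avg_le:
  assumes "u \<in> L2 D" "k < m"
  shows "\<bar>avg k u\<bar> \<le> L2_norm D u / sqrt (measure lebesgue (A k))"
proof -
  let ?a = "measure lebesgue (A k)"
  have n: "L2_norm D (indicator (A k)) = sqrt ?a"
    using ind_inner[OF assms(2,2)] by (simp add: L2_norm_def)
  have "\<bar>avg k u\<bar> = \<bar>L2_inner D u (indicator (A k))\<bar> / ?a"
    using pos[OF assms(2)] by (simp add: avg_def)
  also have "\<dots> \<le> (L2_norm D u * sqrt ?a) / ?a"
    using L2_Cauchy_Schwarz[OF assms(1) ind_L2[OF assms(2)]] pos[OF assms(2)] n
    by (intro divide_right_mono) auto
  also have "\<dots> = L2_norm D u / sqrt ?a"
    using pos[OF assms(2)] by (simp add: field_simps)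
  finally show ?thesis .
qed

end

section \<open>Cells adapted to a compact set of data\<close>

lemma simple_function_approx_L2:
  assumes D: "D \<in> lmeasurable" and u: "u \<in> L2 D" and e: "e > 0"
  obtains s :: "real^'d \<Rightarrow> real" where "simple_function (lebesgue_on D) s" "s \<in> L2 D" "L2_norm D (\<lambda>x. u x - s x) < e"
proof -
  obtain F where F: "\<And>i. simple_function (lebesgue_on D) (F i)"
    "\<And>x. x \<in> space (lebesgue_on D) \<Longrightarrow> (\<lambda>i. F i x) \<longlonglongrightarrow> u x"
    "\<And>i x. x \<in> space (lebesgue_on D) \<Longrightarrow> dist (F i x) 0 \<le> 2 * dist (u x) 0"
    using borel_measurable_implies_sequence_metric[OF L2_measurable[OF u], of 0] by metis
  have Fm: "F i \<in> borel_measurable (lebesgue_on D)" for i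
    using F(1) by (rule borel_measurable_simple_function)
  have um: "u \<in> borel_measurable (lebesgue_on D)" by (rule L2_measurable[OF u])
  have "(\<lambda>i. LINT x|lebesgue_on D. (u x - F i x) * (u x - F i x)) \<longlonglongrightarrow> (LINT x|lebesgue_on D. 0)"
  proof (rule integral_dominated_convergence[where w = "\<lambda>x. 9 * (u x)\<^sup>2"])
    show "(\<lambda>x. (u x - F i x) * (u x - F i x)) \<in> borel_measurable (lebesgue_on D)" for i
      by (intro borel_measurable_times borel_measurable_diff um Fm)
    show "integrable (lebesgue_on D) (\<lambda>x. 9 * (u x)\<^sup>2)" using u by (simp add: L2_def)
    show "AE x in lebesgue_on D. (\<lambda>i. (u x - F i x) * (u x - F i x)) \<longlonglongrightarrow> 0"
    proof (rule AE_I2)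
      fix x assume x: "x \<in> space (lebesgue_on D)"
      have "(\<lambda>i. (u x - F i x) * (u x - F i x)) \<longlonglongrightarrow> (u x - u x) * (u x - u x)"
        by (intro tendsto_intros F(2)[OF x])
      then show "(\<lambda>i. (u x - F i x) * (u x - F i x)) \<longlonglongrightarrow> 0" by simp
    qed
    show "AE x in lebesgue_on D. norm ((u x - F i x) * (u x - F i x)) \<le> 9 * (u x)\<^sup>2" for i
    proof (rule AE_I2)
      fix x assume x: "x \<in> space (lebesgue_on D)"
      have "\<bar>u x - F i x\<bar> \<le> \<bar>3 * u x\<bar>" using F(3)[OF x, of i] by (simp add: dist_real_def)
      then have "(u x - F i x)\<^sup>2 \<le> (3 * u x)\<^sup>2" by (simp only: abs_le_square_iff)
      then show "norm ((u x - F i x) * (u x - F i x)) \<le> 9 * (u x)\<^sup>2" by (simp add: power2_eq_square)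
    qed
  qed simp
  then have "(\<lambda>i. sqrt (L2_inner D (\<lambda>x. u x - F i x) (\<lambda>x. u x - F i x))) \<longlonglongrightarrow> sqrt 0"
    by (intro tendsto_real_sqrt) (simp add: L2_inner_def)
  then have "(\<lambda>i. L2_norm D (\<lambda>x. u x - F i x)) \<longlonglongrightarrow> 0" by (simp add: L2_norm_def)
  then have "eventually (\<lambda>i. L2_norm D (\<lambda>x. u x - F i x) < e) sequentially"
    using e by (rule order_tendstoD(2))
  then obtain i where i: "L2_norm D (\<lambda>x. u x - F i x) < e" by (auto simp: eventually_sequentially)
  have "F i \<in> L2 D"
  proof -
    have fin: "finite (F i ` D)" using F(1)[of i] by (simp add: simple_function_def)
    have "\<bar>F i x\<bar> \<le> (\<Sum>y\<in>F i ` D. \<bar>y\<bar>)" if "x \<in> D" for x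
      using member_le_sum[of "F i x" "F i ` D" abs] fin that by auto
    then show ?thesis by (rule L2_bounded[OF D Fm])
  qed
  then show ?thesis using that[OF F(1)[of i]] i by blast
qed

text \<open>The cells are the joint level sets, of positive measure, of simple functions close to
  the u i; on them each of these simple functions is constant.\<close>

lemma cells_exist:
  fixes J :: nat
  assumes D: "D \<in> lmeasurable" and Dpos: "measure lebesgue D > 0"
    and u: "\<And>i. i < J \<Longrightarrow> u i \<in> L2 D" and e: "e > 0"
  obtains m A where "cells D m A" "m \<ge> 1"
    "\<And>i. i < J \<Longrightarrow> \<exists>c. L2_norm D (\<lambda>x. u i x - cells.step m A c x) < e"
proof -
  have "\<exists>s. simple_function (lebesgue_on D) s \<and> s \<in> L2 D \<and> L2_norm D (\<lambda>x. u i x - s x) < e" if "i < J" for i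
    using simple_function_approx_L2[OF D u[OF that] e] by metis
  then obtain s where s: "\<And>i. i < J \<Longrightarrow> simple_function (lebesgue_on D) (s i)"
    "\<And>i. i < J \<Longrightarrow> s i \<in> L2 D" "\<And>i. i < J \<Longrightarrow> L2_norm D (\<lambda>x. u i x - s i x) < e"
    by metis
  have Ds: "D \<in> sets lebesgue" using D by auto
  define G where "G x = (\<lambda>i. if i < J then s i x else 0)" for x
  define cell where "cell w = {x \<in> D. G x = w}" for w
  have fin: "finite (G ` D)"
  proof (rule finite_subset)
    show "G ` D \<subseteq> {w. \<forall>i. (i \<in> {..<J} \<longrightarrow> w i \<in> (\<Union>i<J. s i ` D)) \<and> (i \<notin> {..<J} \<longrightarrow> w i = 0)}"
    proof
      fix w assume "w \<in> G ` D"
      then obtain x where "x \<in> D" "w = G x" by blast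
      then show "w \<in> {w. \<forall>i. (i \<in> {..<J} \<longrightarrow> w i \<in> (\<Union>i<J. s i ` D)) \<and> (i \<notin> {..<J} \<longrightarrow> w i = 0)}"
        unfolding G_def by (intro CollectI allI conjI impI) (simp_all, blast)
    qed
    have "finite (s i ` D)" if "i < J" for i using simple_functionD[OF s(1)[OF that]] by simp
    then have "finite (\<Union>i<J. s i ` D)" by (intro finite_UN_I) auto
    then show "finite {w. \<forall>i. (i \<in> {..<J} \<longrightarrow> w i \<in> (\<Union>i<J. s i ` D)) \<and> (i \<notin> {..<J} \<longrightarrow> w i = 0)}"
      by (intro finite_set_of_finite_funs) auto
  qed
  have cell_m: "cell w \<in> sets lebesgue" if "w \<in> G ` D" for w
  proof -
    have "cell w = {x \<in> D. \<forall>i\<in>{..<J}. s i x = w i}" using that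
      unfolding cell_def G_def by (auto simp: fun_eq_iff)
    moreover have "{x \<in> space (lebesgue_on D). \<forall>i\<in>{..<J}. s i x = w i} \<in> sets (lebesgue_on D)"
    proof (rule sets.sets_Collect_finite_All)
      fix i assume "i \<in> {..<J}"
      then have "s i -` {w i} \<inter> space (lebesgue_on D) \<in> sets (lebesgue_on D)"
        using simple_functionD(2)[OF s(1)] by blast
      moreover have "s i -` {w i} \<inter> space (lebesgue_on D) = {x \<in> space (lebesgue_on D). s i x = w i}" by auto
      ultimately show "{x \<in> space (lebesgue_on D). s i x = w i} \<in> sets (lebesgue_on D)" by simp
    qed simp
    ultimately show ?thesis using Ds by (auto simp: sets_restrict_space_iff)
  qed
  define P where "P = {w \<in> G ` D. measure lebesgue (cell w) > 0}"
  have finP: "finite P" using fin by (simp add: P_def)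
  obtain h where h: "bij_betw h {0..<card P} P" using ex_bij_betw_nat_finite[OF finP] by blast
  define m where "m = card P"
  define A where "A k = cell (h k)" for k
  have hP: "h k \<in> P" if "k < m" for k using h that by (auto simp: bij_betw_def m_def)
  have null: "AE x in lebesgue_on D. x \<in> (\<Union>k<m. A k)"
  proof -
    have "negligible (\<Union>w\<in>G ` D - P. cell w)"
    proof (intro negligible_Union finite_imageI)
      fix t assume "t \<in> cell ` (G ` D - P)"
      then obtain w where w: "t = cell w" "w \<in> G ` D" "w \<notin> P" by blast
      then have "measure lebesgue (cell w) = 0" by (simp add: P_def zero_less_measure_iff)
      moreover have "cell w \<in> lmeasurable"
      proof (rule fmeasurableI2[OF D _ cell_m[OF w(2)]])
        show "cell w \<subseteq> D" unfolding cell_def by blast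
      qed
      ultimately show "negligible t" unfolding w(1) negligible_iff_measure by simp
    qed (use fin in auto)
    then have "AE x in lebesgue. x \<notin> (\<Union>w\<in>G ` D - P. cell w)"
      unfolding negligible_iff_null_sets by (rule AE_not_in)
    then have "AE x in lebesgue. x \<in> D \<longrightarrow> x \<in> (\<Union>k<m. A k)"
    proof eventually_elim
      case (elim x)
      show ?case
      proof
        assume x: "x \<in> D"
        then have "x \<in> cell (G x)" by (simp add: cell_def)
        then have "G x \<in> P" using elim x by blast
        then have "G x \<in> h ` {0..<card P}" using h by (simp add: bij_betw_def)
        then obtain k where "k < m" "h k = G x" unfolding m_def by force
        then have "k < m" "x \<in> A k" using \<open>x \<in> cell (G x)\<close> by (simp_all add: A_def)
        then show "x \<in> (\<Union>k<m. A k)" by blast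
      qed
    qed
    then show ?thesis using Ds by (simp add: AE_restrict_space_iff)
  qed
  have cells: "cells D m A"
  proof
    fix k assume k: "k < m"
    show "A k \<in> sets lebesgue" using cell_m hP[OF k] by (auto simp: A_def P_def)
    show "A k \<subseteq> D" by (auto simp: A_def cell_def)
    show "measure lebesgue (A k) > 0" using hP[OF k] by (simp add: A_def P_def)
    fix l assume l: "l < m" "k \<noteq> l"
    then have "h k \<noteq> h l" using h k by (auto simp: bij_betw_def m_def inj_on_def)
    then show "A k \<inter> A l = {}" by (auto simp: A_def cell_def)
  qed (use D null in auto)
  interpret cells D m A by (rule cells)
  have m1: "m \<ge> 1"
  proof (rule ccontr)
    assume "\<not> m \<ge> 1"
    then have "m = 0" by simp
    then have "AE x in lebesgue_on D. False" using null by simp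
    then have "AE x in lebesgue. x \<notin> D" using Ds by (simp add: AE_restrict_space_iff)
    then have "negligible D" using Ds AE_iff_null_sets negligible_iff_null_sets by blast
    then show False using Dpos negligible_imp_measure0 by fastforce
  qed
  have "\<exists>c. L2_norm D (\<lambda>x. u i x - step c x) < e" if i: "i < J" for i
  proof -
    have "AE x in lebesgue_on D. u i x - step (\<lambda>k. h k i) x = u i x - s i x"
      using null
    proof eventually_elim
      case (elim x)
      then obtain k where k: "k < m" "x \<in> A k" by blast
      then have "G x i = h k i" by (simp add: A_def cell_def)
      then have "s i x = h k i" using i by (simp add: G_def)
      then show ?case using step_eq[OF k(2,1)] by simp
    qed
    then have "L2_norm D (\<lambda>x. u i x - step (\<lambda>k. h k i) x) = L2_norm D (\<lambda>x. u i x - s i x)"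
      by (rule L2_norm_cong_AE) (intro L2_diff u[OF i] step_L2 s(2)[OF i])+
    then show ?thesis using s(3)[OF i] by (intro exI[where x = "\<lambda>k. h k i"]) simp
  qed
  then show ?thesis by (rule that[OF cells m1])
qed

lemma openin_L2_ball:
  assumes "v \<in> L2 D"
  shows "openin (L2_topology D) {w \<in> L2 D. L2_norm D (\<lambda>x. w x - v x) < r}"
  unfolding openin_L2_topology
proof (intro conjI ballI)
  fix u assume "u \<in> {w \<in> L2 D. L2_norm D (\<lambda>x. w x - v x) < r}"
  then have u: "u \<in> L2 D" "L2_norm D (\<lambda>x. u x - v x) < r" by auto
  have "w \<in> {w \<in> L2 D. L2_norm D (\<lambda>x. w x - v x) < r}"
    if "w \<in> L2 D" "L2_norm D (\<lambda>x. w x - u x) < r - L2_norm D (\<lambda>x. u x - v x)" for w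
    using L2_triangle_diff[OF that(1) u(1) assms] that by simp
  then show "\<exists>d>0. \<forall>w\<in>L2 D. L2_norm D (\<lambda>x. w x - u x) < d \<longrightarrow> w \<in> {w \<in> L2 D. L2_norm D (\<lambda>x. w x - v x) < r}"
    using u(2) by (intro exI[of _ "r - L2_norm D (\<lambda>x. u x - v x)"]) auto
qed auto

lemma compactin_finite_net:
  assumes K: "compactin (prod_topology (L2_topology D) (L2_topology D)) K" and e: "e > 0"
  obtains F where "finite F" "F \<subseteq> K"
    "\<And>y f. (y, f) \<in> K \<Longrightarrow> \<exists>(y', f')\<in>F. L2_norm D (\<lambda>x. y x - y' x) < e \<and> L2_norm D (\<lambda>x. f x - f' x) < e"
proof -
  have KL: "K \<subseteq> L2 D \<times> L2 D"
    using compactin_subset_topspace[OF K] by (simp add: topspace_L2_topology)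
  define U where "U p = {w \<in> L2 D. L2_norm D (\<lambda>x. w x - fst p x) < e} \<times> {w \<in> L2 D. L2_norm D (\<lambda>x. w x - snd p x) < e}" for p
  have "\<exists>\<F>. finite \<F> \<and> \<F> \<subseteq> U ` K \<and> K \<subseteq> \<Union>\<F>"
  proof (rule compactinD[OF K])
    show "openin (prod_topology (L2_topology D) (L2_topology D)) V" if "V \<in> U ` K" for V
      using that KL by (auto simp: U_def openin_prod_Times_iff intro!: openin_L2_ball)
    have "p \<in> U p" if "p \<in> K" for p using that KL e by (cases p) (auto simp: U_def)
    then show "K \<subseteq> \<Union>(U ` K)" by blast
  qed
  then obtain \<F> where "finite \<F>" "\<F> \<subseteq> U ` K" "K \<subseteq> \<Union>\<F>" by blast
  then obtain F where F: "F \<subseteq> K" "finite F" "K \<subseteq> \<Union>(U ` F)" by (metis finite_subset_image)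
  have "\<exists>(y', f')\<in>F. L2_norm D (\<lambda>x. y x - y' x) < e \<and> L2_norm D (\<lambda>x. f x - f' x) < e" if yf: "(y, f) \<in> K" for y f
  proof -
    obtain p where p: "p \<in> F" "(y, f) \<in> U p" using F(3) yf by blast
    then have "L2_norm D (\<lambda>x. y x - fst p x) < e \<and> L2_norm D (\<lambda>x. f x - snd p x) < e"
      unfolding U_def by simp
    then show ?thesis by (intro bexI[OF _ p(1)]) (simp add: case_prod_beta)
  qed
  then show ?thesis using that F by blast
qed

lemma compactin_L2_bounded:
  assumes K: "compactin (prod_topology (L2_topology D) (L2_topology D)) K"
  obtains R where "R \<ge> 0" "\<And>y f. (y, f) \<in> K \<Longrightarrow> L2_norm D y \<le> R \<and> L2_norm D f \<le> R"
proof -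
  have KL: "K \<subseteq> L2 D \<times> L2 D"
    using compactin_subset_topspace[OF K] by (simp add: topspace_L2_topology)
  obtain F where F: "finite F" "F \<subseteq> K"
    "\<And>y f. (y, f) \<in> K \<Longrightarrow> \<exists>(y', f')\<in>F. L2_norm D (\<lambda>x. y x - y' x) < 1 \<and> L2_norm D (\<lambda>x. f x - f' x) < 1"
    using compactin_finite_net[OF K, of 1] by auto
  define R where "R = (\<Sum>p\<in>F. L2_norm D (fst p) + L2_norm D (snd p)) + 1"
  have "L2_norm D y \<le> R \<and> L2_norm D f \<le> R" if yf: "(y, f) \<in> K" for y f
  proof -
    obtain y' f' where p: "(y', f') \<in> F" "L2_norm D (\<lambda>x. y x - y' x) < 1" "L2_norm D (\<lambda>x. f x - f' x) < 1"
      using F(3)[OF yf] by blast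
    have L: "y \<in> L2 D" "f \<in> L2 D" "y' \<in> L2 D" "f' \<in> L2 D" using yf p(1) F(2) KL by auto
    have "L2_norm D y' + L2_norm D f' \<le> R - 1"
      using member_le_sum[OF p(1), of "\<lambda>p. L2_norm D (fst p) + L2_norm D (snd p)"] F(1) by (simp add: R_def)
    moreover have "L2_norm D y \<le> L2_norm D (\<lambda>x. y x - y' x) + L2_norm D y'"
      using L2_triangle[OF L2_diff[OF L(1,3)] L(3)] by simp
    moreover have "L2_norm D f \<le> L2_norm D (\<lambda>x. f x - f' x) + L2_norm D f'"
      using L2_triangle[OF L2_diff[OF L(2,4)] L(4)] by simp
    ultimately show ?thesis using p L2_norm_nonneg[of D y'] L2_norm_nonneg[of D f'] by linarith
  qed
  moreover have "R \<ge> 0" by (simp add: R_def sum_nonneg add_nonneg_nonneg)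
  ultimately show ?thesis using that by blast
qed

text \<open>A finite net of K and its image under T are nearly constant on common cells, and the
  Lipschitz bound carries this over to all of K.\<close>

lemma cells_for_Lipschitz_map:
  assumes D0: "D \<in> lmeasurable" "measure lebesgue D > 0"
    and K: "compactin (prod_topology (L2_topology D) (L2_topology D)) K"
    and C: "C \<ge> 0"
    and TL: "\<And>y f. y \<in> L2 D \<Longrightarrow> f \<in> L2 D \<Longrightarrow> T (y, f) \<in> L2 D"
    and lip: "\<And>y f y' f'. y \<in> L2 D \<Longrightarrow> f \<in> L2 D \<Longrightarrow> y' \<in> L2 D \<Longrightarrow> f' \<in> L2 D \<Longrightarrow>
       L2_norm D (\<lambda>x. T (y, f) x - T (y', f') x) \<le> C * (L2_norm D (\<lambda>x. y x - y' x) + L2_norm D (\<lambda>x. f x - f' x))"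
    and e: "e > 0"
  obtains m A where "cells D m A" "m \<ge> 1"
    "\<And>y f. (y, f) \<in> K \<Longrightarrow> L2_norm D (\<lambda>x. T (y, f) x
        - cells.step m A (\<lambda>j. cells.avg D A j (T (cells.step m A (\<lambda>k. cells.avg D A k y), cells.step m A (\<lambda>k. cells.avg D A k f)))) x) \<le> e"
proof -
  have KL: "K \<subseteq> L2 D \<times> L2 D"
    using compactin_subset_topspace[OF K] by (simp add: topspace_L2_topology)
  \<comment> \<open>Averaging \<open>T (y, f)\<close> will cost 4 C d + 2 d, and replacing the data
    by their averages another 8 C d.\<close>
  define d where "d = e / (12 * C + 2)"
  have d: "d > 0" "(12 * C + 2) * d = e" using e C by (auto simp: d_def)
  obtain F where F: "finite F" "F \<subseteq> K"
    "\<And>y f. (y, f) \<in> K \<Longrightarrow> \<exists>(y', f')\<in>F. L2_norm D (\<lambda>x. y x - y' x) < d \<and> L2_norm D (\<lambda>x. f x - f' x) < d"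
    by (rule compactin_finite_net[OF K d(1)], rule that)
  \<comment> \<open>The values of T at the net points are included because the output, too, is
    averaged over the cells.\<close>
  define W where "W = fst ` F \<union> snd ` F \<union> T ` F"
  have finW: "finite W" using F by (simp add: W_def)
  have WL: "W \<subseteq> L2 D" using F(2) KL TL by (auto simp: W_def)
  obtain g where g: "bij_betw g {0..<card W} W" using ex_bij_betw_nat_finite[OF finW] by blast
  have gW: "g i \<in> W" if "i < card W" for i using g that by (auto simp: bij_betw_def)
  have gL: "g i \<in> L2 D" if "i < card W" for i using gW[OF that] WL by blast
  obtain m A where mA: "cells D m A" "m \<ge> 1"
    "\<And>i. i < card W \<Longrightarrow> \<exists>c. L2_norm D (\<lambda>x. g i x - cells.step m A c x) < d"
    by (rule cells_exist[OF D0 gL d(1)], assumption, rule that)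
  interpret cells D m A by (rule mA(1))
  have appr: "\<exists>c. L2_norm D (\<lambda>x. w x - step c x) < d" if "w \<in> W" for w
  proof -
    have "w \<in> g ` {0..<card W}" using g that by (simp add: bij_betw_def)
    then obtain i where "i < card W" "w = g i" by force
    then show ?thesis using mA(3) by blast
  qed
  have proj: "L2_norm D (\<lambda>x. v x - step (\<lambda>k. avg k v) x) \<le> 2 * (r + d)"
    if v: "v \<in> L2 D" and w: "w \<in> W" and vw: "L2_norm D (\<lambda>x. v x - w x) \<le> r" for v w r
  proof -
    obtain c where c: "L2_norm D (\<lambda>x. w x - step c x) < d" using appr[OF w] by blast
    have "L2_norm D (\<lambda>x. v x - step c x) \<le> r + d"
      using L2_triangle_diff[OF v subsetD[OF WL w] step_L2, of c] c vw by linarith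
    then show ?thesis using step_avg_error[OF v, of c] by argo
  qed
  have "L2_norm D (\<lambda>x. T (y, f) x - step (\<lambda>j. avg j (T (step (\<lambda>k. avg k y), step (\<lambda>k. avg k f)))) x) \<le> e"
    if yf: "(y, f) \<in> K" for y f
  proof -
    obtain y' f' where p: "(y', f') \<in> F" "L2_norm D (\<lambda>x. y x - y' x) < d" "L2_norm D (\<lambda>x. f x - f' x) < d"
      using F(3)[OF yf] by blast
    have L: "y \<in> L2 D" "f \<in> L2 D" "y' \<in> L2 D" "f' \<in> L2 D" using yf p(1) F(2) KL by auto
    have W: "y' \<in> W" "f' \<in> W" "T (y', f') \<in> W" using p(1) by (force simp: W_def)+
    define Py Pf where "Py = step (\<lambda>k. avg k y)" and "Pf = step (\<lambda>k. avg k f)"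
    have PL: "Py \<in> L2 D" "Pf \<in> L2 D" by (simp_all add: Py_def Pf_def step_L2)
    have 1: "L2_norm D (\<lambda>x. y x - Py x) \<le> 4 * d" "L2_norm D (\<lambda>x. f x - Pf x) \<le> 4 * d"
      using proj[OF L(1) W(1), of d] proj[OF L(2) W(2), of d] p unfolding Py_def Pf_def by simp_all
    have "C * (L2_norm D (\<lambda>x. y x - y' x) + L2_norm D (\<lambda>x. f x - f' x)) \<le> C * (2 * d)"
      using C p by (intro mult_left_mono) auto
    then have "L2_norm D (\<lambda>x. T (y, f) x - T (y', f') x) \<le> 2 * C * d"
      using lip[OF L] by simp
    from proj[OF TL[OF L(1,2)] W(3) this]
    have 2: "L2_norm D (\<lambda>x. T (y, f) x - step (\<lambda>k. avg k (T (y, f))) x) \<le> 2 * (2 * C * d + d)" .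
    have "C * (L2_norm D (\<lambda>x. y x - Py x) + L2_norm D (\<lambda>x. f x - Pf x)) \<le> C * (8 * d)"
      using C 1 by (intro mult_left_mono) auto
    then have 3: "L2_norm D (\<lambda>x. T (y, f) x - T (Py, Pf) x) \<le> 8 * C * d"
      using lip[OF L(1,2) PL] by simp
    have "L2_norm D (\<lambda>x. step (\<lambda>k. avg k (T (y, f))) x - step (\<lambda>k. avg k (T (Py, Pf))) x)
       = L2_norm D (step (\<lambda>k. avg k (\<lambda>x. T (y, f) x - T (Py, Pf) x)))"
    proof -
      have "step (\<lambda>k. avg k (T (y, f)) - avg k (T (Py, Pf))) = step (\<lambda>k. avg k (\<lambda>x. T (y, f) x - T (Py, Pf) x))"
        by (rule step_cong) (simp add: avg_diff[OF TL[OF L(1,2)] TL[OF PL]])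
      then show ?thesis by (simp add: step_diff)
    qed
    also have "\<dots> \<le> 8 * C * d"
      by (rule order_trans[OF step_avg_norm_le 3]) (intro L2_diff TL L PL)
    finally have 4: "L2_norm D (\<lambda>x. step (\<lambda>k. avg k (T (y, f))) x - step (\<lambda>k. avg k (T (Py, Pf))) x) \<le> 8 * C * d" .
    have "L2_norm D (\<lambda>x. T (y, f) x - step (\<lambda>k. avg k (T (Py, Pf))) x) \<le> 2 * (2 * C * d + d) + 8 * C * d"
      using L2_triangle_diff[OF TL[OF L(1,2)] step_L2[of "\<lambda>k. avg k (T (y, f))"] step_L2[of "\<lambda>k. avg k (T (Py, Pf))"]] 2 4
      by linarith
    also have "\<dots> = e" using d(2) by (simp add: algebra_simps)
    finally show ?thesis by (simp add: Py_def Pf_def)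
  qed
  then show ?thesis by (rule that[OF mA(1,2)])
qed

section \<open>One-dimensional ReLU networks\<close>

text \<open>Every layer receives r again, so the hidden layer takes it from its own
  \<open>In_r\<close> column and bypasses layer 0.\<close>

lemma relu_net_one_hidden:
  obtains n W b where "\<And>l. n l \<ge> (1 :: nat)"
    "\<And>r (\<xi> :: real^'m) \<eta>. relu_net 2 n W b r \<xi> \<eta> = (\<Sum>i<Suc K. c i * max 0 (r - t i)) + d"
proof -
  define n :: "nat \<Rightarrow> nat" where "n l = (if l = 1 then Suc K else 1)" for l
  define W :: "nat \<Rightarrow> nat \<Rightarrow> 'm column \<Rightarrow> real" where
    "W l i = (\<lambda>q. if l = 1 then (if q = In_r then 1 else 0)
       else (case q of Hidden j \<Rightarrow> c j | _ \<Rightarrow> 0))" for l i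
  define b :: "nat \<Rightarrow> nat \<Rightarrow> real" where "b l i = (if l = 1 then - t i else d)" for l i
  have "relu_layers n W b r \<xi> \<eta> 1 = (\<lambda>i. max 0 (r - t i))" for r and \<xi> :: "real^'m" and \<eta>
    by (auto simp: weight_apply_def W_def b_def)
  then have "relu_net 2 n W b r \<xi> \<eta> = (\<Sum>i<Suc K. c i * max 0 (r - t i)) + d" for r and \<xi> :: "real^'m" and \<eta>
    by (simp add: relu_net_def weight_apply_def W_def b_def n_def)
  then show ?thesis by (intro that[of n W b]) (auto simp: n_def)
qed

text \<open>A difference of two neighbouring ramps is constant outside one grid interval, so all
  terms left of r contribute full increments and at most one term contributes a part.\<close>

lemma relu_interpolation:
  fixes F :: "real \<Rightarrow> real"
  assumes h: "h > 0" and x: "\<And>i. x i = x0 + real i * h"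
  shows "F (x 0) + (\<Sum>i<K. (F (x (Suc i)) - F (x i)) / h * (max 0 (r - x i) - max 0 (r - x (Suc i))))
    = (if r \<le> x 0 then F (x 0) else if r \<ge> x K then F (x K)
       else F (x (nat \<lfloor>(r - x0) / h\<rfloor>)) + (F (x (Suc (nat \<lfloor>(r - x0) / h\<rfloor>))) - F (x (nat \<lfloor>(r - x0) / h\<rfloor>))) / h * (r - x (nat \<lfloor>(r - x0) / h\<rfloor>)))"
proof -
  define T where "T i = (F (x (Suc i)) - F (x i)) / h * (max 0 (r - x i) - max 0 (r - x (Suc i)))" for i
  have xs: "x (Suc i) = x i + h" for i by (simp add: x algebra_simps)
  have mono: "x i \<le> x j" if "i \<le> j" for i j using that h by (simp add: x mult_right_mono)
  have low: "T i = 0" if "r \<le> x i" for i using that h by (simp add: T_def xs)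
  have high: "T i = F (x (Suc i)) - F (x i)" if "r \<ge> x (Suc i)" for i
    using that h by (simp add: T_def xs)
  have tele: "(\<Sum>i<j. F (x (Suc i)) - F (x i)) = F (x j) - F (x 0)" for j
    using sum_lessThan_telescope[of "\<lambda>i. F (x i)" j] by simp
  consider "r \<le> x 0" | "r > x 0" "r \<ge> x K" | "r > x 0" "r < x K" by (metis linorder_not_le)
  then show ?thesis
  proof cases
    case 1
    have "T i = 0" for i using mono[of 0 i] 1 by (intro low) simp
    then have "(\<Sum>i<K. T i) = 0" by simp
    then show ?thesis using 1 by (simp add: T_def)
  next
    case 2
    have "(\<Sum>i<K. T i) = (\<Sum>i<K. F (x (Suc i)) - F (x i))"
    proof (intro sum.cong refl high)
      fix i assume "i \<in> {..<K}"
      then have "x (Suc i) \<le> x K" by (intro mono) auto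
      then show "x (Suc i) \<le> r" using 2 by linarith
    qed
    then show ?thesis using 2 unfolding tele by (simp add: T_def)
  next
    case 3
    define j where "j = nat \<lfloor>(r - x0) / h\<rfloor>"
    have q: "(r - x0) / h \<ge> 0" using 3 h by (simp add: x)
    have j: "real j \<le> (r - x0) / h" "(r - x0) / h < real j + 1"
      using q unfolding j_def by linarith+
    have xj: "x j \<le> r" "r < x (Suc j)" using j h by (simp_all add: x field_simps)
    have jK: "j < K"
    proof (rule ccontr)
      assume "\<not> j < K"
      then have "x K \<le> x j" by (intro mono) auto
      then show False using xj 3 by linarith
    qed
    have "(\<Sum>i<K. T i) = (\<Sum>i<Suc j. T i)"
    proof (rule sum.mono_neutral_right)
      show "\<forall>i\<in>{..<K} - {..<Suc j}. T i = 0"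
      proof
        fix i assume "i \<in> {..<K} - {..<Suc j}"
        then have "x (Suc j) \<le> x i" by (intro mono) auto
        then show "T i = 0" using xj by (intro low) linarith
      qed
    qed (use jK in auto)
    also have "(\<Sum>i<j. T i) = (\<Sum>i<j. F (x (Suc i)) - F (x i))"
    proof (intro sum.cong refl high)
      fix i assume "i \<in> {..<j}"
      then have "x (Suc i) \<le> x j" by (intro mono) auto
      then show "x (Suc i) \<le> r" using xj by linarith
    qed
    then have "(\<Sum>i<Suc j. T i) = F (x j) - F (x 0) + T j" unfolding tele by simp
    also have "T j = (F (x (Suc j)) - F (x j)) / h * (r - x j)" using xj by (simp add: T_def)
    finally show ?thesis using 3 unfolding j_def[symmetric] T_def[symmetric] by simp
  qed
qed

lemma relu_net_approximates:
  fixes F :: "real \<Rightarrow> real"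
  assumes F: "continuous_on UNIV F" and B: "\<And>r. \<bar>F r\<bar> \<le> B" and R: "R > 0" and e: "e > 0"
  obtains n W b G where "\<And>l. n l \<ge> (1 :: nat)"
    "\<And>r (\<xi> :: real^'m) \<eta>. relu_net 2 n W b r \<xi> \<eta> = G r"
    "continuous_on UNIV G" "\<And>r. \<bar>r\<bar> \<le> R \<Longrightarrow> \<bar>G r - F r\<bar> \<le> e" "\<And>r. \<bar>G r\<bar> \<le> B"
proof -
  have "uniformly_continuous_on {-R..R} F"
    by (intro compact_uniformly_continuous continuous_on_subset[OF F]) auto
  then obtain d where d: "d > 0" "\<And>u v. u \<in> {-R..R} \<Longrightarrow> v \<in> {-R..R} \<Longrightarrow> dist v u < d \<Longrightarrow> dist (F v) (F u) < e"
    unfolding uniformly_continuous_on_def using e by metis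
  obtain K0 :: nat where K0: "2 * R / d < real K0" using reals_Archimedean2 by blast
  define K where "K = Suc K0"
  define h where "h = 2 * R / real K"
  have h: "h > 0" "h < d" "real K * h = 2 * R"
    using K0 d(1) R by (auto simp: h_def K_def field_simps)
  define x where "x i = - R + real i * h" for i :: nat
  have xK: "x 0 = - R" "x K = R" using h(3) by (auto simp: x_def)
  define s where "s i = (F (x (Suc i)) - F (x i)) / h" for i
  \<comment> \<open>Summation by parts: each coefficient is a change of slope. The last one makes G
    constant to the right of R, so that the bound holds on the whole line.\<close>
  define c where "c i = (if i < K then s i else 0) - (if i > 0 then s (i - 1) else 0)" for i
  define G where "G r = (\<Sum>i<Suc K. c i * max 0 (r - x i)) + F (x 0)" for r
  obtain n W b where net: "\<And>l. n l \<ge> (1 :: nat)"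
    "\<And>r (\<xi> :: real^'m) \<eta>. relu_net 2 n W b r \<xi> \<eta> = (\<Sum>i<Suc K. c i * max 0 (r - x i)) + F (x 0)"
    by (rule relu_net_one_hidden[where c = c and t = x and d = "F (x 0)" and K = K], rule that)
  have G_eq: "G r = F (x 0) + (\<Sum>i<K. s i * (max 0 (r - x i) - max 0 (r - x (Suc i))))" for r
  proof -
    have "(\<Sum>i<Suc K. c i * max 0 (r - x i)) = (\<Sum>i<Suc K. (if i < K then s i else 0) * max 0 (r - x i))
       - (\<Sum>i<Suc K. (if i > 0 then s (i - 1) else 0) * max 0 (r - x i))"
      by (simp only: c_def left_diff_distrib sum_subtractf)
    also have "(\<Sum>i<Suc K. (if i < K then s i else 0) * max 0 (r - x i)) = (\<Sum>i<K. s i * max 0 (r - x i))"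
      by simp
    also have "(\<Sum>i<Suc K. (if i > 0 then s (i - 1) else 0) * max 0 (r - x i)) = (\<Sum>i<K. s i * max 0 (r - x (Suc i)))"
      by (simp only: sum.lessThan_Suc_shift) simp
    finally show ?thesis by (simp add: G_def right_diff_distrib sum_subtractf)
  qed
  have cases: "G r = (if r \<le> x 0 then F (x 0) else if r \<ge> x K then F (x K)
       else F (x (nat \<lfloor>(r - - R) / h\<rfloor>)) + (F (x (Suc (nat \<lfloor>(r - - R) / h\<rfloor>))) - F (x (nat \<lfloor>(r - - R) / h\<rfloor>))) / h * (r - x (nat \<lfloor>(r - - R) / h\<rfloor>)))" for r
    unfolding G_eq s_def by (rule relu_interpolation[OF h(1)]) (auto simp: x_def)
  \<comment> \<open>Inside the range G is a convex combination of values of F at grid points at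
    distance at most h; both closeness and boundedness follow from this.\<close>
  have convex: "\<exists>l. 0 \<le> l \<and> l \<le> 1 \<and> (\<exists>u v. u \<in> {-R..R} \<and> v \<in> {-R..R} \<and> \<bar>u - r\<bar> \<le> h \<and> \<bar>v - r\<bar> \<le> h \<and> G r = (1 - l) * F u + l * F v)"
    if r: "\<bar>r\<bar> \<le> R" for r
  proof -
    consider "r \<le> x 0" | "r > x 0" "r \<ge> x K" | "r > x 0" "r < x K" by (metis linorder_not_le)
    then show ?thesis
    proof cases
      case 1
      then have "G r = F (- R)" "r = - R" using r xK by (auto simp: cases)
      then show ?thesis using R h(1) by (intro exI[of _ 0] conjI exI[of _ "-R"]) auto
    next
      case 2
      then have "G r = F R" "r = R" using r xK by (auto simp: cases)
      then show ?thesis using R h(1) by (intro exI[of _ 0] conjI exI[of _ R]) auto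
    next
      case 3
      define j where "j = nat \<lfloor>(r - - R) / h\<rfloor>"
      have q: "(r - - R) / h \<ge> 0" using 3 h xK by simp
      have j: "real j \<le> (r - - R) / h" "(r - - R) / h < real j + 1"
        using q unfolding j_def by linarith+
      have xj: "x j \<le> r" "r < x (Suc j)" using j h by (simp_all add: x_def field_simps)
      have xs: "x (Suc j) = x j + h" by (simp add: x_def algebra_simps)
      have "real j < real K"
      proof -
        have "(r - - R) / h < real K" using 3 xK h by (simp add: field_simps)
        then show ?thesis using j by linarith
      qed
      then have "real (Suc j) * h \<le> real K * h" using h(1) by (intro mult_right_mono) auto
      then have "x (Suc j) \<le> x K" unfolding x_def by (rule add_left_mono)
      moreover have "- R \<le> x j" using h(1) by (simp add: x_def)
      ultimately have mem: "x j \<in> {-R..R}" "x (Suc j) \<in> {-R..R}" using xK(2) xs h(1) by auto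
      define l where "l = (r - x j) / h"
      have l: "0 \<le> l" "l \<le> 1" using xj xs h(1) by (auto simp: l_def field_simps)
      have "G r = F (x j) + (F (x (Suc j)) - F (x j)) / h * (r - x j)"
        using 3 unfolding cases j_def[symmetric] by simp
      also have "\<dots> = (1 - l) * F (x j) + l * F (x (Suc j))" by (simp add: l_def algebra_simps diff_divide_distrib)
      finally show ?thesis using l mem xj xs by (intro exI[of _ l] conjI exI[of _ "x j"] exI[of _ "x (Suc j)"]) auto
    qed
  qed
  have combo: "\<bar>(1 - l) * a + l * b - c\<bar> \<le> m" if "0 \<le> l" "l \<le> 1" "\<bar>a - c\<bar> \<le> m" "\<bar>b - c\<bar> \<le> m" for l a b c m :: real
  proof -
    have "(1 - l) * a + l * b - c = (1 - l) * (a - c) + l * (b - c)" by (simp add: algebra_simps)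
    then have "\<bar>(1 - l) * a + l * b - c\<bar> \<le> \<bar>(1 - l) * (a - c)\<bar> + \<bar>l * (b - c)\<bar>" by (simp only: abs_triangle_ineq)
    also have "\<dots> = (1 - l) * \<bar>a - c\<bar> + l * \<bar>b - c\<bar>" using that by (simp add: abs_mult)
    also have "\<dots> \<le> (1 - l) * m + l * m" using that by (intro add_mono mult_left_mono) auto
    finally show ?thesis by (simp add: algebra_simps)
  qed
  have close: "\<bar>G r - F r\<bar> \<le> e" if r: "\<bar>r\<bar> \<le> R" for r
  proof -
    obtain l u v where luv: "0 \<le> l" "l \<le> 1" "u \<in> {-R..R}" "v \<in> {-R..R}" "\<bar>u - r\<bar> \<le> h" "\<bar>v - r\<bar> \<le> h"
      "G r = (1 - l) * F u + l * F v" using convex[OF r] by blast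
    have rr: "r \<in> {-R..R}" using r by auto
    have "\<bar>F u - F r\<bar> \<le> e" "\<bar>F v - F r\<bar> \<le> e"
      using d(2)[OF rr luv(3)] d(2)[OF rr luv(4)] luv(5,6) h(2) by (auto simp: dist_real_def)
    then show ?thesis unfolding luv(7) by (rule combo[OF luv(1,2)])
  qed
  have bound: "\<bar>G r\<bar> \<le> B" for r
  proof (cases "\<bar>r\<bar> \<le> R")
    case True
    obtain l u v where luv: "0 \<le> l" "l \<le> 1" "G r = (1 - l) * F u + l * F v" using convex[OF True] by blast
    then show ?thesis using combo[OF luv(1,2), of "F u" 0 B "F v"] B by simp
  next
    case False
    then show ?thesis using B by (auto simp: cases xK)
  qed
  have cont: "continuous_on UNIV G" unfolding G_def by (intro continuous_intros)
  have net': "relu_net 2 n W b r \<xi> \<eta> = G r" for r and \<xi> :: "real^'m" and \<eta>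
    unfolding net(2) G_def ..
  show ?thesis by (rule that[OF net(1) net' cont close bound])
qed

section \<open>Dithered quantisation\<close>

text \<open>A continuous substitute for the floor on the interval from 0 to Q; it can be wrong only
  where the fractional part is below \<eta>.\<close>

definition stair :: "nat \<Rightarrow> real \<Rightarrow> real \<Rightarrow> real" where
  "stair Q \<eta> t = (\<Sum>k\<in>{1..<Q}. max 0 (min 1 ((t - real k) / \<eta>)))"

lemma continuous_on_stair: "continuous_on A f \<Longrightarrow> continuous_on A (\<lambda>x. stair Q \<eta> (f x))"
  unfolding stair_def divide_inverse by (intro continuous_intros)

lemma stair_bounds: "0 \<le> stair Q \<eta> t" "stair Q \<eta> t \<le> real Q"
proof -
  show "0 \<le> stair Q \<eta> t" unfolding stair_def by (intro sum_nonneg) auto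
  have "stair Q \<eta> t \<le> (\<Sum>k\<in>{1..<Q}. 1)" unfolding stair_def by (intro sum_mono) auto
  then show "stair Q \<eta> t \<le> real Q" by simp
qed

lemma stair_eq_floor:
  assumes "0 \<le> t" "t < real Q" "0 < \<eta>" "\<eta> \<le> frac t"
  shows "stair Q \<eta> t = real (nat \<lfloor>t\<rfloor>)" "nat \<lfloor>t\<rfloor> < Q"
proof -
  define j where "j = nat \<lfloor>t\<rfloor>"
  have j: "real j = of_int \<lfloor>t\<rfloor>" using assms(1) by (simp add: j_def)
  have jt: "real j + \<eta> \<le> t" "t < real j + 1" using assms(4) j by (auto simp: frac_def)
  have "real j < real Q" using jt(1) assms(2,3) by linarith
  then have jQ: "j < Q" by simp
  have "max 0 (min 1 ((t - real k) / \<eta>)) = (if k \<le> j then 1 else 0)" for k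
  proof (cases "k \<le> j")
    case True
    then have "t - real k \<ge> \<eta>" using jt by (simp add: of_nat_le_iff[symmetric] del: of_nat_le_iff)
    then have "(t - real k) / \<eta> \<ge> 1" using assms(3) by simp
    then show ?thesis using True by simp
  next
    case False
    then have "real j + 1 \<le> real k" by (simp add: of_nat_Suc[symmetric] del: of_nat_Suc)
    then have "(t - real k) / \<eta> \<le> 0" using jt assms(3) by (intro divide_nonpos_pos) auto
    then show ?thesis using False by simp
  qed
  then have "stair Q \<eta> t = (\<Sum>k\<in>{1..<Q}. if k \<le> j then 1 else 0)" unfolding stair_def by simp
  also have "\<dots> = (\<Sum>k\<in>{1..j}. 1)" using jQ by (intro sum.mono_neutral_cong_right) auto
  finally show "stair Q \<eta> t = real (nat \<lfloor>t\<rfloor>)" by (simp add: j_def)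
  show "nat \<lfloor>t\<rfloor> < Q" using jQ by (simp add: j_def)
qed

lemma digit_sum_less:
  assumes "\<And>i. i < n \<Longrightarrow> q i < (Q :: nat)"
  shows "(\<Sum>i<n. q i * Q ^ i) < Q ^ n"
  using assms
proof (induction n)
  case (Suc n)
  have "(\<Sum>i<n. q i * Q ^ i) < Q ^ n" using Suc by simp
  moreover have "q n * Q ^ n \<le> (Q - 1) * Q ^ n" using Suc.prems[of n] by (intro mult_right_mono) auto
  ultimately have "(\<Sum>i<Suc n. q i * Q ^ i) < Q ^ n + (Q - 1) * Q ^ n"
    unfolding sum.lessThan_Suc by linarith
  also have "\<dots> = Q ^ Suc n" using Suc.prems[of n] by (cases Q) auto
  finally show ?case .
qed simp

lemma digit_extract:
  assumes "\<And>i. i < n \<Longrightarrow> q i < (Q :: nat)" "i < n"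
  shows "(\<Sum>i<n. q i * Q ^ i) div Q ^ i mod Q = q i"
  using assms
proof (induction n arbitrary: q i)
  case (Suc n)
  have Q: "Q > 0" using Suc.prems by (metis gr_zeroI not_less0)
  define S where "S = (\<Sum>i<n. q (Suc i) * Q ^ i)"
  have eq: "(\<Sum>i<Suc n. q i * Q ^ i) = q 0 + Q * S"
    by (simp only: sum.lessThan_Suc_shift S_def sum_distrib_left) (simp add: mult_ac)
  show ?case
  proof (cases i)
    case 0
    then show ?thesis using Suc.prems(1)[of 0] unfolding eq by simp
  next
    case (Suc i')
    have "(q 0 + Q * S) div Q ^ Suc i' = (q 0 + Q * S) div Q div Q ^ i'"
      by (simp add: div_mult2_eq)
    also have "(q 0 + Q * S) div Q = S" using Suc.prems(1)[of 0] Q by simp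
    finally show ?thesis unfolding eq Suc
      using Suc.IH[of "\<lambda>i. q (Suc i)" i'] Suc.prems Suc by (simp add: S_def)
  qed
qed simp

lemma slab_measure:
  fixes j :: "'d::finite"
  assumes "w \<ge> 0"
  shows "{x :: real^'d. x \<in> torus_cube \<and> c \<le> x $ j \<and> x $ j \<le> c + w} \<in> lmeasurable"
    "measure lebesgue {x :: real^'d. x \<in> torus_cube \<and> c \<le> x $ j \<and> x $ j \<le> c + w} \<le> w * (2 * pi) ^ (CARD('d) - 1)"
proof -
  let ?S = "{x :: real^'d. x \<in> torus_cube \<and> c \<le> x $ j \<and> x $ j \<le> c + w}"
  define a b where "a = (\<chi> i. if i = j then c else 0 :: real^'d)" and "b = (\<chi> i. if i = j then c + w else 2 * pi :: real^'d)"
  have sub: "?S \<subseteq> cbox a b" by (auto simp: mem_box_cart a_def b_def torus_cube_def less_imp_le)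
  have cl: "closed {x :: real^'d. c \<le> x $ j \<and> x $ j \<le> c + w}"
    by (intro closed_Collect_conj closed_Collect_le continuous_intros)
  have S: "?S = torus_cube \<inter> {x. c \<le> x $ j \<and> x $ j \<le> c + w}" by auto
  have "?S \<in> sets lebesgue"
    unfolding S using borel_closed[OF cl]
    by (intro sets.Int fmeasurableD[OF lmeasurable_torus_cube]) (simp add: sets_completionI_sets)
  then show m: "?S \<in> lmeasurable" by (rule fmeasurableI2[OF lmeasurable_cbox sub])
  have "measure lebesgue ?S \<le> measure lebesgue (cbox a b)"
    by (rule measure_mono_fmeasurable[OF sub]) (use m in auto)
  also have "\<dots> = (\<Prod>i\<in>UNIV. if i = j then w else 2 * pi)"
  proof -
    have "cbox a b \<noteq> {}" using assms by (auto simp: interval_ne_empty_cart a_def b_def)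
    then show ?thesis by (simp add: content_cbox_cart a_def b_def if_distrib cong: if_cong)
  qed
  also have "\<dots> = w * (2 * pi) ^ (CARD('d) - 1)"
    by (simp add: prod.If_cases prod.remove[of UNIV j] Compl_eq_Diff_UNIV)
  finally show "measure lebesgue ?S \<le> w * (2 * pi) ^ (CARD('d) - 1)" .
qed

section \<open>Lusin approximation\<close>

text \<open>A Urysohn function between a closed set inside A and the complement of an open set
  around A, both close to A in measure.\<close>

lemma Lusin_indicator:
  fixes A D :: "(real^'d) set"
  assumes A: "A \<in> sets lebesgue" and D: "D \<in> sets lebesgue" and e: "e > 0"
  obtains h B where "continuous_on UNIV h" "\<And>x. 0 \<le> h x \<and> h x \<le> (1::real)"
    "B \<in> lmeasurable" "B \<subseteq> D" "measure lebesgue B \<le> e" "\<And>x. x \<in> D \<Longrightarrow> x \<notin> B \<Longrightarrow> h x = indicator A x"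
proof -
  have e2: "e / 2 > 0" using e by simp
  obtain C where C: "closed C" "C \<subseteq> A" "A - C \<in> lmeasurable" "emeasure lebesgue (A - C) < ennreal (e / 2)"
    by (rule sets_lebesgue_inner_closed[OF A e2])
  obtain G where G: "open G" "A \<subseteq> G" "G - A \<in> lmeasurable" "emeasure lebesgue (G - A) < ennreal (e / 2)"
    by (rule sets_lebesgue_outer_open[OF A e2])
  have "closed (- G)" using G(1) by (rule closed_Compl)
  moreover have "(- G) \<inter> C = {}" using C(2) G(2) by auto
  ultimately obtain h :: "real^'d \<Rightarrow> real" where h: "continuous_on UNIV h" "\<And>x. h x \<in> closed_segment 0 1"
    "\<And>x. x \<in> - G \<Longrightarrow> h x = 0" "\<And>x. x \<in> C \<Longrightarrow> h x = 1"
    using Urysohn[of "- G" C 0 "1 :: real"] C(1) by metis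
  define B where "B = D \<inter> ((A - C) \<union> (G - A))"
  have U: "(A - C) \<union> (G - A) \<in> lmeasurable" using C G by (intro fmeasurable.Un)
  have B: "B \<in> lmeasurable"
    unfolding B_def by (rule fmeasurableI2[OF U]) (use D U in \<open>auto intro: sets.Int fmeasurableD\<close>)
  have "measure lebesgue B \<le> measure lebesgue ((A - C) \<union> (G - A))"
    by (rule measure_mono_fmeasurable) (use B U in \<open>auto simp: B_def\<close>)
  also have "\<dots> \<le> measure lebesgue (A - C) + measure lebesgue (G - A)"
    by (rule measure_Un_le) (use C G in auto)
  also have "\<dots> \<le> e / 2 + e / 2"
  proof (intro add_mono)
    show "measure lebesgue (A - C) \<le> e / 2"
      using C(4) e2 unfolding emeasure_eq_measure2[OF C(3)] by (simp add: ennreal_less_iff)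
    show "measure lebesgue (G - A) \<le> e / 2"
      using G(4) e2 unfolding emeasure_eq_measure2[OF G(3)] by (simp add: ennreal_less_iff)
  qed
  finally have "measure lebesgue B \<le> e" by simp
  moreover have "h x = indicator A x" if "x \<in> D" "x \<notin> B" for x
    using that h(3,4)[of x] C(2) G(2) by (auto simp: B_def indicator_def)
  moreover have "0 \<le> h x \<and> h x \<le> 1" for x using h(2)[of x] by (simp add: closed_segment_eq_real_ivl)
  ultimately show ?thesis using that[of h B] h(1) B by (auto simp: B_def)
qed

lemma continuous_L2:
  fixes D :: "(real^'d) set"
  assumes D: "D \<in> lmeasurable" "bounded D" and g: "continuous_on UNIV g"
  shows "g \<in> L2 D"
proof -
  have "compact (g ` closure D)"
    using D(2) by (intro compact_continuous_image continuous_on_subset[OF g]) (auto simp: compact_closure)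
  then obtain C where C: "\<And>x. x \<in> closure D \<Longrightarrow> \<bar>g x\<bar> \<le> C"
    by (metis bounded_iff compact_imp_bounded imageI real_norm_def)
  have "g \<in> borel_measurable (lebesgue_on D)"
    using borel_measurable_continuous_onI[OF g] by (rule borel_measurable_lebesgue_on_borel)
  then show ?thesis using C closure_subset by (intro L2_bounded[OF D(1)]) auto
qed

section \<open>Decoding\<close>

lemma continuous_on_finite_closed_Union:
  fixes f :: "'a::topological_space \<Rightarrow> 'b::topological_space"
  assumes "\<And>i. i < (n :: nat) \<Longrightarrow> closed (Y i)" "\<And>i. i < n \<Longrightarrow> continuous_on (Y i) f"
  shows "continuous_on (\<Union>i<n. Y i) f"
  using assms
proof (induction n)
  case (Suc n)
  have "closed (\<Union>i<n. Y i)" using Suc.prems by auto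
  then show ?case using Suc by (auto simp: lessThan_Suc intro!: continuous_on_closed_Un)
qed simp

text \<open>The values \<open>\<omega> b * 4 ^ k\<close> for different \<open>k\<close> lie in disjoint intervals because \<open>\<omega>\<close> takes its
  values in [1/2, 3/2], so that both \<open>k\<close> and \<open>b\<close> can be recovered.\<close>

lemma profile_decoder:
  fixes \<omega> :: "real \<Rightarrow> real" and I :: "real set"
  assumes I: "compact I" and \<omega>: "continuous_on I \<omega>" "inj_on \<omega> I" "\<And>b. b \<in> I \<Longrightarrow> \<bar>\<omega> b - 1\<bar> \<le> 1/2"
    and H: "\<And>k. k < (n :: nat) \<Longrightarrow> continuous_on I (H k)"
  obtains F M where "continuous_on UNIV F" "\<And>s. \<bar>F s\<bar> \<le> M"
    "\<And>k b. k < n \<Longrightarrow> b \<in> I \<Longrightarrow> F (\<omega> b * 4 ^ k) = (H k b :: real)"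
proof -
  define Y where "Y k = (\<lambda>b. \<omega> b * 4 ^ k) ` I" for k :: nat
  have compY: "compact (Y k)" for k
    unfolding Y_def by (intro compact_continuous_image continuous_intros \<omega> I)
  have inj: "k = l \<and> b = c" if "b \<in> I" "c \<in> I" "\<omega> b * 4 ^ k = \<omega> c * 4 ^ l" for b c k l
  proof -
    have lt: "\<omega> b * 4 ^ k < \<omega> c * 4 ^ l" if "k < l" "b \<in> I" "c \<in> I" for b c and k l :: nat
    proof -
      have "\<omega> b \<le> 3/2" "1/2 \<le> \<omega> c" using \<omega>(3)[OF that(2)] \<omega>(3)[OF that(3)] by linarith+
      then have "\<omega> b * 4 ^ k \<le> 3/2 * 4 ^ k" "1/2 * 4 ^ l \<le> \<omega> c * 4 ^ l"
        by (intro mult_right_mono; simp)+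
      moreover have "(4::real) ^ Suc k \<le> 4 ^ l" using that(1) by (intro power_increasing) auto
      moreover have "(4::real) ^ k > 0" by simp
      ultimately show ?thesis unfolding power_Suc by linarith
    qed
    have "k = l" using lt[of k l b c] lt[of l k c b] that by (metis linorder_neq_iff)
    then show ?thesis using that \<omega>(2) by (auto dest: inj_onD)
  qed
  \<comment> \<open>By \<open>inj\<close> the choice is unique at every value that occurs.\<close>
  define G where "G y = H (fst (SOME p. snd p \<in> I \<and> y = \<omega> (snd p) * 4 ^ fst p))
     (snd (SOME p. snd p \<in> I \<and> y = \<omega> (snd p) * 4 ^ fst p))" for y
  have G: "G (\<omega> b * 4 ^ k) = H k b" if "b \<in> I" for b k
  proof -
    have "(SOME p. snd p \<in> I \<and> \<omega> b * 4 ^ k = \<omega> (snd p) * 4 ^ fst p) = (k, b)"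
    proof (rule some_equality)
      show "snd (k, b) \<in> I \<and> \<omega> b * 4 ^ k = \<omega> (snd (k, b)) * 4 ^ fst (k, b)" using that by simp
      fix p assume p: "snd p \<in> I \<and> \<omega> b * 4 ^ k = \<omega> (snd p) * 4 ^ fst p"
      then have "k = fst p \<and> b = snd p" using inj[of b "snd p" k "fst p"] that by blast
      then show "p = (k, b)" by (simp add: prod_eq_iff)
    qed
    then show ?thesis by (simp add: G_def)
  qed
  have contG: "continuous_on (Y k) G" if k: "k < n" for k
  proof -
    define w where "w = the_inv_into I (\<lambda>b. \<omega> b * 4 ^ k)"
    have ik: "inj_on (\<lambda>b. \<omega> b * 4 ^ k) I"
    proof (rule inj_onI)
      fix b c assume "b \<in> I" "c \<in> I" "\<omega> b * 4 ^ k = \<omega> c * 4 ^ k"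
      then show "b = c" using inj[of b c k k] by blast
    qed
    have cw: "continuous_on (Y k) w"
      unfolding Y_def w_def
    proof (rule continuous_on_inv)
      show "continuous_on I (\<lambda>b. \<omega> b * 4 ^ k)" by (intro continuous_intros \<omega>)
      show "\<forall>x\<in>I. the_inv_into I (\<lambda>b. \<omega> b * 4 ^ k) (\<omega> x * 4 ^ k) = x"
        using the_inv_into_f_f[OF ik] by blast
    qed (rule I)
    have wI: "w y \<in> I" if "y \<in> Y k" for y
      using the_inv_into_into[OF ik, of y I] that by (simp add: w_def Y_def)
    have wy: "\<omega> (w y) * 4 ^ k = y" if "y \<in> Y k" for y
      using f_the_inv_into_f[OF ik, of y] that by (simp add: w_def Y_def)
    have "continuous_on (Y k) (\<lambda>y. H k (w y))"
      by (rule continuous_on_compose2[OF H[OF k] cw]) (use wI in auto)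
    moreover have "G y = H k (w y)" if "y \<in> Y k" for y
      using G[OF wI[OF that], of k] wy[OF that] by simp
    ultimately show ?thesis by (simp cong: continuous_on_cong)
  qed
  define X where "X = (\<Union>k<n. Y k)"
  have X: "compact X" unfolding X_def using compY by (intro compact_UN) auto
  have GX: "continuous_on X G" unfolding X_def
    using compY contG by (intro continuous_on_finite_closed_Union) (auto intro: compact_imp_closed)
  have "bounded (G ` X)" using compact_continuous_image[OF GX X] by (rule compact_imp_bounded)
  then obtain M where M: "M > 0" "\<And>y. y \<in> X \<Longrightarrow> norm (G y) \<le> M"
    by (auto simp: bounded_pos)
  \<comment> \<open>Boundedness of the Tietze extension limits the damage at positions where the
    code is misread.\<close>
  obtain F where F: "continuous_on UNIV F" "\<And>y. y \<in> X \<Longrightarrow> F y = G y" "\<And>s. s \<in> UNIV \<Longrightarrow> norm (F s) \<le> M"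
    by (rule Tietze[OF GX, of UNIV M]) (use X M in \<open>auto intro: compact_imp_closed\<close>)
  have val: "F (\<omega> b * 4 ^ k) = H k b" if "k < n" "b \<in> I" for k b
  proof -
    have "\<omega> b * 4 ^ k \<in> X" using that by (auto simp: X_def Y_def)
    then show ?thesis using F(2) G that by simp
  qed
  show ?thesis by (rule that[of F M]) (use F(1,3) val in auto)
qed

section \<open>Encoding by dithered quantisation\<close>

text \<open>The dither is between 0 and 1 on the cube, so s plus the dither can only have floor
  \<lfloor>s\<rfloor> or \<lfloor>s\<rfloor> + 1. The bad positions fill at most two slabs, whose
  measure does not depend on s and hence not on the data.\<close>

lemma dither_exceptional_set:
  fixes j :: "'d::finite"
  assumes \<eta>: "\<eta> > 0"
  obtains B where "B \<in> lmeasurable" "measure lebesgue B \<le> 2 * \<eta> * (2 * pi) ^ CARD('d)"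
    "\<And>x :: real^'d. x \<in> torus_cube \<Longrightarrow> x \<notin> B \<Longrightarrow> \<eta> \<le> frac (s + x $ j / (2 * pi))"
proof -
  define w where "w = 2 * pi * \<eta>"
  define S where "S c = {x :: real^'d. x \<in> torus_cube \<and> c \<le> x $ j \<and> x $ j \<le> c + w}" for c
  have w: "w \<ge> 0" using \<eta> by (simp add: w_def)
  have S: "S c \<in> lmeasurable" "measure lebesgue (S c) \<le> w * (2 * pi) ^ (CARD('d) - 1)" for c
    unfolding S_def by (rule slab_measure[OF w])+
  define c where "c k = 2 * pi * (of_int k - s)" for k :: int
  define B where "B = S (c \<lfloor>s\<rfloor>) \<union> S (c (\<lfloor>s\<rfloor> + 1))"
  have "w * (2 * pi) ^ (CARD('d) - 1) = \<eta> * (2 * pi) ^ CARD('d)"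
    by (simp add: w_def power_eq_if[of _ "CARD('d)"])
  moreover have "measure lebesgue B \<le> measure lebesgue (S (c \<lfloor>s\<rfloor>)) + measure lebesgue (S (c (\<lfloor>s\<rfloor> + 1)))"
    unfolding B_def by (rule measure_Un_le) (use S(1) in auto)
  ultimately have mB: "measure lebesgue B \<le> 2 * \<eta> * (2 * pi) ^ CARD('d)"
    using S(2)[of "c \<lfloor>s\<rfloor>"] S(2)[of "c (\<lfloor>s\<rfloor> + 1)"] by linarith
  have "\<eta> \<le> frac (s + x $ j / (2 * pi))" if x: "x \<in> torus_cube" "x \<notin> B" for x
  proof (rule ccontr)
    assume *: "\<not> \<eta> \<le> frac (s + x $ j / (2 * pi))"
    define U where "U = x $ j / (2 * pi)"
    define k where "k = \<lfloor>s + U\<rfloor>"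
    have U: "0 < U" "U < 1" using x(1) by (auto simp: U_def torus_cube_def)
    have kk: "of_int k \<le> s + U" "s + U < of_int k + \<eta>" using * by (auto simp: k_def U_def frac_def)
    have "c k \<le> x $ j" "x $ j \<le> c k + w"
    proof -
      have "x $ j = 2 * pi * U" by (simp add: U_def)
      moreover have "2 * pi * (of_int k - s) \<le> 2 * pi * U" "2 * pi * U \<le> 2 * pi * (of_int k - s + \<eta>)"
        using kk by (intro mult_left_mono; simp)+
      ultimately show "c k \<le> x $ j" "x $ j \<le> c k + w" by (simp_all add: c_def w_def algebra_simps)
    qed
    moreover have "k = \<lfloor>s\<rfloor> \<or> k = \<lfloor>s\<rfloor> + 1" using U unfolding k_def by linarith
    ultimately show False using x by (auto simp: B_def S_def)
  qed
  then show ?thesis using that[of B] S(1) mB by (auto simp: B_def intro: fmeasurable.Un)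
qed

text \<open>The exponent is a mixed-radix number: the cell is the lowest digit in base m, followed
  by the quantised ratios in base Q. As an exponential it splits into factors that depend on the
  position and a single ratio each. The exceptional set varies with u, but its measure is bounded
  uniformly.\<close>

lemma encode_universal:
  fixes D :: "(real^'d) set"
  assumes cells: "cells D m A" and dom: "bounded D" "closure D \<subset> torus_cube"
    and gs: "\<And>i. gs i \<in> L2 D" and \<sigma>: "continuous_on UNIV \<sigma>"
    and app: "\<And>j M. net_approx \<sigma> scalar_forms I {-M..M} (\<lambda>b y. \<omega> b * y ^ j)"
    and bd: "\<And>b. b \<in> I \<Longrightarrow> \<bar>\<omega> b\<bar> \<le> W" and I: "0 \<notin> I"
    and n: "n \<ge> 1" and h: "h > 0" and Z: "Z \<ge> 0" and Q: "2 * Z / h + 1 \<le> real Q"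
    and e: "e > 0" and \<eta>: "\<eta> > 0"
  obtains N where "fno_module D \<sigma> N" "\<And>u. u \<in> L2 D \<Longrightarrow> continuous_on UNIV (N u)"
    "\<And>u. u \<in> L2 D \<Longrightarrow> L2_inner D u (gs 0) \<in> I \<Longrightarrow>
       (\<And>i. i \<in> {1..n} \<Longrightarrow> \<bar>L2_inner D u (gs i) / L2_inner D u (gs 0)\<bar> \<le> Z) \<Longrightarrow>
       \<exists>B q. B \<in> lmeasurable \<and> B \<subseteq> D \<and> measure lebesgue B \<le> \<eta> \<and>
         (\<forall>j<m. \<forall>x\<in>A j - B.
            (\<forall>i<n. q x i < Q \<and> \<bar>L2_inner D u (gs (Suc i)) / L2_inner D u (gs 0) - (h * real (q x i) - Z)\<bar> \<le> h) \<and>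
            \<bar>N u x - \<omega> (L2_inner D u (gs 0)) * 4 ^ (j + m * (\<Sum>i<n. q x i * Q ^ i))\<bar> \<le> e)"
proof -
  interpret cells D m A by (rule cells)
  define k0 :: 'd where "k0 = undefined"
  have "\<forall>j. \<exists>f B. j < m \<longrightarrow> continuous_on UNIV f \<and> (\<forall>x. 0 \<le> f x \<and> f x \<le> (1::real)) \<and> B \<in> lmeasurable \<and>
     B \<subseteq> D \<and> measure lebesgue B \<le> \<eta> / (2 * real (m + 1)) \<and> (\<forall>x\<in>D - B. f x = indicator (A j) x)"
  proof
    fix j
    show "\<exists>f B. j < m \<longrightarrow> continuous_on UNIV f \<and> (\<forall>x. 0 \<le> f x \<and> f x \<le> (1::real)) \<and> B \<in> lmeasurable \<and>
     B \<subseteq> D \<and> measure lebesgue B \<le> \<eta> / (2 * real (m + 1)) \<and> (\<forall>x\<in>D - B. f x = indicator (A j) x)"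
    proof (cases "j < m")
      case True
      have "\<eta> / (2 * real (m + 1)) > 0" using \<eta> by simp
      from Lusin_indicator[OF cell(1)[OF True] Ds this] show ?thesis by (metis DiffE)
    qed simp
  qed
  from choice[OF this] obtain f where
    "\<forall>j. \<exists>B. j < m \<longrightarrow> continuous_on UNIV (f j) \<and> (\<forall>x. 0 \<le> f j x \<and> f j x \<le> (1::real)) \<and> B \<in> lmeasurable \<and>
     B \<subseteq> D \<and> measure lebesgue B \<le> \<eta> / (2 * real (m + 1)) \<and> (\<forall>x\<in>D - B. f j x = indicator (A j) x)" ..
  from choice[OF this] obtain B1 where
    "\<forall>j. j < m \<longrightarrow> continuous_on UNIV (f j) \<and> (\<forall>x. 0 \<le> f j x \<and> f j x \<le> (1::real)) \<and> B1 j \<in> lmeasurable \<and>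
     B1 j \<subseteq> D \<and> measure lebesgue (B1 j) \<le> \<eta> / (2 * real (m + 1)) \<and> (\<forall>x\<in>D - B1 j. f j x = indicator (A j) x)" ..
  then have f: "\<And>j. j < m \<Longrightarrow> continuous_on UNIV (f j)" "\<And>j x. j < m \<Longrightarrow> 0 \<le> f j x \<and> f j x \<le> 1"
    and B1: "\<And>j. j < m \<Longrightarrow> B1 j \<in> lmeasurable"
      "\<And>j. j < m \<Longrightarrow> measure lebesgue (B1 j) \<le> \<eta> / (2 * real (m + 1))"
      "\<And>j x. j < m \<Longrightarrow> x \<in> D \<Longrightarrow> x \<notin> B1 j \<Longrightarrow> f j x = indicator (A j) x"
    by blast+
  define c where "c = (2 * pi) ^ CARD('d)"
  have c: "c > 0" by (simp add: c_def)
  \<comment> \<open>Half of \<eta> is reserved for the m Lusin sets and half for the n dithered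
    digits, each of which may cost \<open>2 * \<eta>1 * c\<close>.\<close>
  define \<eta>1 where "\<eta>1 = \<eta> / (2 * real (n + 1)) / (2 * c)"
  have \<eta>1: "\<eta>1 > 0" using \<eta> c by (simp add: \<eta>1_def)
  define t where "t i p = (snd p (Suc i) + Z) / h + fst p $ k0 / (2 * pi)" for i and p :: "(real^'d) \<times> (nat \<Rightarrow> real)"
  \<comment> \<open>Factor 0 marks the cell and factor Suc i contributes the digit of ratio Suc i;
    ln 4 turns the product into a power of 4.\<close>
  define G where "G j i p = (case i of 0 \<Rightarrow> f j (fst p) * 4 ^ j
      | Suc i \<Rightarrow> exp (real (m * Q ^ i) * ln 4 * stair Q \<eta>1 (t i p)))" for j i p
  define F where "F p = (\<Sum>j<m. \<Prod>i<Suc n. G j i p)" for p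
  have GF: "exp_approx (fno_forms k0 n) (coord_box D n Z) F"
    unfolding F_def
  proof (rule exp_approx_sum[OF fno_forms_const], rule exp_approx_prod)
    fix j assume "j \<in> {..<m}"
    then have j: "j < m" by simp
    show "(\<lambda>p. l p + l' p) \<in> fno_forms k0 n" if "l \<in> fno_forms k0 n" "l' \<in> fno_forms k0 n" for l l'
      by (rule fno_forms_add[OF that])
    show "(\<lambda>p. 0) \<in> fno_forms k0 n" by (rule fno_forms_const)
    fix i assume "i \<in> {..<Suc n}"
    then have i: "i \<le> n" by simp
    have clD: "closure D \<subseteq> torus_cube" using dom(2) by auto
    show "exp_approx (fno_forms k0 n) (coord_box D n Z) (G j i)"
    proof (cases i)
      case 0
      have "continuous_on UNIV (\<lambda>p :: (real^'d) \<times> real. f j (fst p) * 4 ^ j)"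
        by (intro continuous_intros continuous_on_compose2[OF f(1)[OF j]]) auto
      from exp_approx_coordinate[OF dom(1) clD _ this, of 1 n k0 Z] n show ?thesis
        by (simp add: G_def[abs_def] 0)
    next
      case (Suc i')
      have "continuous_on UNIV (\<lambda>p :: (real^'d) \<times> real. exp (real (m * Q ^ i') * ln 4 * stair Q \<eta>1 ((snd p + Z) / h + fst p $ k0 / (2 * pi))))"
        using h by (intro continuous_intros continuous_on_stair) auto
      from exp_approx_coordinate[OF dom(1) clD _ this, of i n k0 Z] i Suc show ?thesis
        by (simp add: G_def[abs_def] t_def)
    qed
    fix p
    show "\<bar>G j i p\<bar> \<le> (case i of 0 \<Rightarrow> 4 ^ j | Suc i \<Rightarrow> exp (real (m * Q ^ i) * ln 4 * real Q))"
    proof (cases i)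
      case 0
      then show ?thesis using f(2)[OF j, of "fst p"] by (simp add: G_def abs_mult)
    next
      case (Suc i')
      have "real (m * Q ^ i') * ln 4 * stair Q \<eta>1 (t i' p) \<le> real (m * Q ^ i') * ln 4 * real Q"
        by (intro mult_left_mono stair_bounds) auto
      then show ?thesis by (simp add: G_def Suc)
    qed
  qed
  obtain N where N: "fno_module D \<sigma> N" "\<And>u. u \<in> L2 D \<Longrightarrow> continuous_on UNIV (N u)"
    "\<And>u x. u \<in> L2 D \<Longrightarrow> L2_inner D u (gs 0) \<in> I \<Longrightarrow>
       (\<And>i. i \<in> {1..n} \<Longrightarrow> \<bar>L2_inner D u (gs i) / L2_inner D u (gs 0)\<bar> \<le> Z) \<Longrightarrow> x \<in> D \<Longrightarrow>
       \<bar>N u x - \<omega> (L2_inner D u (gs 0)) * F (x, \<lambda>i. L2_inner D u (gs i) / L2_inner D u (gs 0))\<bar> \<le> e"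
  proof (rule fno_universal[OF D dom(2) gs \<sigma> app _ I GF e])
    fix N
    assume N: "fno_module D \<sigma> N" "\<And>u. u \<in> L2 D \<Longrightarrow> continuous_on UNIV (N u)"
      "\<And>u x. u \<in> L2 D \<Longrightarrow> L2_inner D u (gs 0) \<in> I \<Longrightarrow>
       (\<And>i. i \<in> {1..n} \<Longrightarrow> \<bar>L2_inner D u (gs i) / L2_inner D u (gs 0)\<bar> \<le> Z) \<Longrightarrow> x \<in> D \<Longrightarrow>
       \<bar>N u x - \<omega> (L2_inner D u (gs 0)) * F (x, \<lambda>i. L2_inner D u (gs i) / L2_inner D u (gs 0))\<bar> \<le> e"
    show ?thesis
      by (rule that, rule N(1), rule N(2), assumption, rule N(3))
  qed (rule bd)
  have main: "\<exists>B q. B \<in> lmeasurable \<and> B \<subseteq> D \<and> measure lebesgue B \<le> \<eta> \<and>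
         (\<forall>j<m. \<forall>x\<in>A j - B.
            (\<forall>i<n. q x i < Q \<and> \<bar>L2_inner D u (gs (Suc i)) / L2_inner D u (gs 0) - (h * real (q x i) - Z)\<bar> \<le> h) \<and>
            \<bar>N u x - \<omega> (L2_inner D u (gs 0)) * 4 ^ (j + m * (\<Sum>i<n. q x i * Q ^ i))\<bar> \<le> e)"
    if u: "u \<in> L2 D" and b: "L2_inner D u (gs 0) \<in> I"
      and zb: "\<And>i. i \<in> {1..n} \<Longrightarrow> \<bar>L2_inner D u (gs i) / L2_inner D u (gs 0)\<bar> \<le> Z" for u
  proof -
    define z where "z = (\<lambda>i. L2_inner D u (gs i) / L2_inner D u (gs 0))"
    define s where "s i = (z (Suc i) + Z) / h" for i
    have z: "\<bar>z (Suc i)\<bar> \<le> Z" if "i < n" for i using zb[of "Suc i"] that by (simp add: z_def)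
    have s: "0 \<le> s i" "s i \<le> 2 * Z / h" if "i < n" for i
      using z[OF that] h by (auto simp: s_def intro!: divide_right_mono)
    have "\<forall>i. \<exists>B. B \<in> lmeasurable \<and> measure lebesgue B \<le> 2 * \<eta>1 * c \<and>
       (\<forall>x\<in>torus_cube - B. \<eta>1 \<le> frac (s i + x $ k0 / (2 * pi)))"
    proof
      fix i
      show "\<exists>B. B \<in> lmeasurable \<and> measure lebesgue B \<le> 2 * \<eta>1 * c \<and>
       (\<forall>x\<in>torus_cube - B. \<eta>1 \<le> frac (s i + x $ k0 / (2 * pi)))"
        unfolding c_def by (rule dither_exceptional_set[OF \<eta>1, where s = "s i" and j = k0]) blast
    qed
    from choice[OF this] obtain B2 where B2: "\<And>i. B2 i \<in> lmeasurable" "\<And>i. measure lebesgue (B2 i) \<le> 2 * \<eta>1 * c"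
      "\<And>i x. x \<in> torus_cube \<Longrightarrow> x \<notin> B2 i \<Longrightarrow> \<eta>1 \<le> frac (s i + x $ k0 / (2 * pi))" by blast
    define X where "X = (\<Union>j<m. B1 j) \<union> (\<Union>i<n. B2 i)"
    define B where "B = D \<inter> X"
    have U1: "(\<Union>j<m. B1 j) \<in> lmeasurable" "(\<Union>i<n. B2 i) \<in> lmeasurable"
      using B1(1) B2(1) by (auto intro!: fmeasurable.finite_UN)
    then have X: "X \<in> lmeasurable" unfolding X_def by (rule fmeasurable.Un)
    have B: "B \<in> lmeasurable" unfolding B_def
      by (rule fmeasurableI2[OF X]) (use Ds X in \<open>auto intro: sets.Int fmeasurableD\<close>)
    have "measure lebesgue B \<le> measure lebesgue X"
      by (rule measure_mono_fmeasurable) (use B X in \<open>auto simp: B_def\<close>)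
    also have "\<dots> \<le> measure lebesgue (\<Union>j<m. B1 j) + measure lebesgue (\<Union>i<n. B2 i)"
      unfolding X_def by (rule measure_Un_le) (use U1 in auto)
    also have "\<dots> \<le> (\<Sum>j<m. measure lebesgue (B1 j)) + (\<Sum>i<n. measure lebesgue (B2 i))"
      using B1(1) B2(1) by (intro add_mono measure_UNION_le) auto
    also have "\<dots> \<le> (\<Sum>j<m. \<eta> / (2 * real (m + 1))) + (\<Sum>i<n. 2 * \<eta>1 * c)"
      using B1(2) B2(2) by (intro add_mono sum_mono) auto
    also have "\<dots> \<le> \<eta> / 2 + \<eta> / 2"
    proof (intro add_mono)
      show "(\<Sum>j<m. \<eta> / (2 * real (m + 1))) \<le> \<eta> / 2" using \<eta> by (simp add: field_simps)
      have "2 * \<eta>1 * c = \<eta> / (2 * real (n + 1))"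
      proof -
        have "2 * (r / (2 * c)) * c = r" for r using c by simp
        then show ?thesis unfolding \<eta>1_def .
      qed
      then have "(\<Sum>i<n. 2 * \<eta>1 * c) = real n * (\<eta> / (2 * real (n + 1)))"
        by (simp only: sum_constant card_lessThan)
      also have "\<dots> \<le> \<eta> / 2" using \<eta> by (simp add: field_simps)
      finally show "(\<Sum>i<n. 2 * \<eta>1 * c) \<le> \<eta> / 2" .
    qed
    finally have mB: "measure lebesgue B \<le> \<eta>" by simp
    \<comment> \<open>The dither makes the digit depend on x, but wherever it is read it stays
      within one grid step of the scaled ratio.\<close>
    define q where "q x i = nat \<lfloor>s i + x $ k0 / (2 * pi)\<rfloor>" for i and x :: "real^'d"
    have pt: "(\<forall>i<n. q x i < Q \<and> \<bar>z (Suc i) - (h * real (q x i) - Z)\<bar> \<le> h) \<and>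
            \<bar>N u x - \<omega> (L2_inner D u (gs 0)) * 4 ^ (j + m * (\<Sum>i<n. q x i * Q ^ i))\<bar> \<le> e"
      if j: "j < m" and x: "x \<in> A j" "x \<notin> B" for j x
    proof -
      have xD: "x \<in> D" using cell(2)[OF j] x by auto
      then have xt: "x \<in> torus_cube" using dom(2) closure_subset by blast
      have nB: "x \<notin> B1 l" if "l < m" for l using x xD that by (auto simp: B_def X_def)
      have nB2: "x \<notin> B2 i" if "i < n" for i using x xD that by (auto simp: B_def X_def)
      define U where "U = x $ k0 / (2 * pi)"
      have U: "0 < U" "U < 1" using xt by (auto simp: U_def torus_cube_def)
      have st: "stair Q \<eta>1 (s i + U) = real (q x i)" "q x i < Q" if i: "i < n" for i
      proof -
        have lo: "0 \<le> s i + U" using s(1)[OF i] U by linarith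
        have hi: "s i + U < real Q" using s(2)[OF i] U Q by linarith
        have fr: "\<eta>1 \<le> frac (s i + U)" using B2(3)[OF xt nB2[OF i]] by (simp add: U_def)
        show "stair Q \<eta>1 (s i + U) = real (q x i)" "q x i < Q"
          unfolding q_def U_def[symmetric] by (rule stair_eq_floor[OF lo hi \<eta>1 fr])+
      qed
      have near: "\<bar>z (Suc i) - (h * real (q x i) - Z)\<bar> \<le> h" if i: "i < n" for i
      proof -
        have "0 \<le> s i + U" using s(1)[OF i] U by linarith
        then have "real (q x i) \<le> s i + U" "s i + U < real (q x i) + 1"
          unfolding q_def U_def[symmetric] by linarith+
        then have "\<bar>s i - real (q x i)\<bar> \<le> 1" using U by linarith
        then have "h * \<bar>s i - real (q x i)\<bar> \<le> h * 1" using h by (intro mult_left_mono) auto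
        moreover have "z (Suc i) - (h * real (q x i) - Z) = h * (s i - real (q x i))"
          using h by (simp add: s_def field_simps)
        ultimately show ?thesis using h by (simp add: abs_mult)
      qed
      have ex: "exp (real (m * Q ^ i) * ln 4 * real (q x i)) = (4::real) ^ (m * (q x i * Q ^ i))" for i
      proof -
        have "exp (real (m * (q x i * Q ^ i)) * ln 4) = (4::real) ^ (m * (q x i * Q ^ i))"
          by (simp only: exp_of_nat_mult) simp
        then show ?thesis by (simp add: mult_ac)
      qed
      have Gj: "(\<Prod>i<Suc n. G l i (x, z)) = (if l = j then 4 ^ (j + m * (\<Sum>i<n. q x i * Q ^ i)) else 0)" if l: "l < m" for l
      proof (cases "l = j")
        case True
        have "(\<Prod>i<Suc n. G l i (x, z)) = f j x * 4 ^ j * (\<Prod>i<n. exp (real (m * Q ^ i) * ln 4 * stair Q \<eta>1 (s i + U)))"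
          unfolding prod.lessThan_Suc_shift by (simp add: G_def True t_def s_def U_def)
        also have "f j x = 1" using B1(3)[OF j xD nB[OF j]] x by simp
        also have "(\<Prod>i<n. exp (real (m * Q ^ i) * ln 4 * stair Q \<eta>1 (s i + U))) = (\<Prod>i<n. 4 ^ (m * (q x i * Q ^ i)))"
          by (intro prod.cong refl) (simp only: st ex lessThan_iff)
        also have "\<dots> = 4 ^ (m * (\<Sum>i<n. q x i * Q ^ i))"
          by (simp only: sum_distrib_left power_sum)
        finally show ?thesis using True by (simp add: power_add)
      next
        case False
        have "x \<notin> A l" using disjoint[OF l j False] x by auto
        then have "f l x = 0" using B1(3)[OF l xD nB[OF l]] by simp
        then have "G l 0 (x, z) = 0" by (simp add: G_def)
        then show ?thesis using False unfolding prod.lessThan_Suc_shift by simp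
      qed
      have "F (x, z) = (\<Sum>l<m. if l = j then 4 ^ (j + m * (\<Sum>i<n. q x i * Q ^ i)) else 0)"
        unfolding F_def by (intro sum.cong refl Gj) simp
      also have "\<dots> = 4 ^ (j + m * (\<Sum>i<n. q x i * Q ^ i))" using j by simp
      finally have Fx: "F (x, z) = 4 ^ (j + m * (\<Sum>i<n. q x i * Q ^ i))" .
      have "\<bar>N u x - \<omega> (L2_inner D u (gs 0)) * F (x, z)\<bar> \<le> e"
        unfolding z_def by (rule N(3)[OF u b zb xD])
      then show ?thesis using st(2) near unfolding Fx by blast
    qed
    show ?thesis
      by (rule exI[of _ B], rule exI[of _ q]) (use B mB pt in \<open>auto simp: B_def z_def\<close>)
  qed
  show ?thesis by (rule that, rule N(1), rule N(2), assumption, rule main)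
qed

text \<open>The argument k - N u x has the form in which the second update reaches the activation
  network, with k standing for \<tau> times the first control. Three errors add up off the
  exceptional set: e from quantising the target and e / 2 each from the inexact code and from the
  ReLU network.\<close>

lemma quantised_controller:
  fixes D :: "(real^'d) set" and H :: "nat \<Rightarrow> (nat \<Rightarrow> nat) \<Rightarrow> real \<Rightarrow> real"
  assumes cells: "cells D m A" "m \<ge> 1" and dom: "bounded D" "closure D \<subset> torus_cube"
    and gs: "\<And>i. gs i \<in> L2 D" and \<sigma>: "continuous_on UNIV \<sigma>"
    and app: "\<And>j M. net_approx \<sigma> scalar_forms I {-M..M} (\<lambda>b y. \<omega> b * y ^ j)"
    and I: "compact I" "0 \<notin> I"
    and \<omega>: "continuous_on I \<omega>" "inj_on \<omega> I" "\<And>b. b \<in> I \<Longrightarrow> \<bar>\<omega> b - 1\<bar> \<le> 1/2"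
    and n: "n \<ge> 1" and h: "h > 0" and Z: "Z \<ge> 0" and e: "e > 0" and Mt: "Mt \<ge> 0"
    and H: "\<And>j q. j < m \<Longrightarrow> continuous_on I (H j q)"
    and H_cong: "\<And>j q q'. (\<And>i. i < n \<Longrightarrow> q i = q' i) \<Longrightarrow> H j q = H j q'"
  shows "\<exists>N w W c G. fno_module D \<sigma> N \<and> (\<forall>l. w l \<ge> (1::nat)) \<and>
     (\<forall>r (\<xi> :: real^'m) \<eta>. relu_net 2 w W c r \<xi> \<eta> = G r) \<and>
     (\<forall>u\<in>L2 D. (\<lambda>x. G (k - N u x)) \<in> L2 D) \<and>
     (\<forall>u\<in>L2 D. \<forall>t. L2_inner D u (gs 0) \<in> I \<longrightarrow>
        (\<forall>i\<in>{1..n}. \<bar>L2_inner D u (gs i) / L2_inner D u (gs 0)\<bar> \<le> Z) \<longrightarrow>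
        (\<forall>j<m. \<bar>t j\<bar> \<le> Mt) \<longrightarrow>
        (\<forall>j<m. \<forall>q. (\<forall>i<n. \<bar>L2_inner D u (gs (Suc i)) / L2_inner D u (gs 0) - (h * real (q i) - Z)\<bar> \<le> h) \<longrightarrow>
           \<bar>t j - H j q (L2_inner D u (gs 0))\<bar> \<le> e) \<longrightarrow>
        L2_norm D (\<lambda>x. cells.step m A t x - G (k - N u x)) \<le> 2 * e * sqrt (measure lebesgue D) + e)"
proof -
  interpret cells D m A by (rule cells)
  obtain Q :: nat where Q: "2 * Z / h + 1 \<le> real Q" using real_arch_simple by blast
  define K where "K = m * Q ^ n"
  \<comment> \<open>Reads the mixed-radix digits back: the cell modulo m, then the digits in base
    Q.\<close>
  define Hk where "Hk k = H (k mod m) (\<lambda>i. k div m div Q ^ i mod Q)" for k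
  have cHk: "continuous_on I (Hk k)" for k unfolding Hk_def by (rule H) (use cells(2) in simp)
  obtain F0 M where F0: "continuous_on UNIV F0" "\<And>s. \<bar>F0 s\<bar> \<le> M"
    "\<And>k b. k < K \<Longrightarrow> b \<in> I \<Longrightarrow> F0 (\<omega> b * 4 ^ k) = Hk k b"
    by (rule profile_decoder[where n = K and H = Hk, OF I(1) \<omega>(1,2)], erule \<omega>(3), rule cHk, rule that)
  define R where "R = 3/2 * 4 ^ K + (1::real)"
  have R: "R > 0" by (simp add: R_def add_pos_pos)
  have M: "M \<ge> 0" using F0(2)[of 0] by linarith
  have "e / 2 > 0" using e by simp
  have cF: "continuous_on UNIV (\<lambda>s. F0 (k - s))"
    by (rule continuous_on_compose2[OF F0(1)]) (auto intro!: continuous_intros)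
  have R': "\<bar>k\<bar> + R > 0" using R by linarith
  obtain w W c G where net: "\<And>l. w l \<ge> (1 :: nat)"
    "\<And>r (\<xi> :: real^'m) \<eta>. relu_net 2 w W c r \<xi> \<eta> = G r"
    "continuous_on UNIV G" "\<And>r. \<bar>r\<bar> \<le> \<bar>k\<bar> + R \<Longrightarrow> \<bar>G r - F0 (k - r)\<bar> \<le> e / 2" "\<And>r. \<bar>G r\<bar> \<le> M"
    by (rule relu_net_approximates[OF cF F0(2) R' \<open>e / 2 > 0\<close>], rule that)
  have "uniformly_continuous_on {-R..R} F0"
    by (intro compact_uniformly_continuous continuous_on_subset[OF F0(1)]) auto
  then obtain d where d: "d > 0" "\<And>s s'. s \<in> {-R..R} \<Longrightarrow> s' \<in> {-R..R} \<Longrightarrow> dist s' s < d \<Longrightarrow> dist (F0 s') (F0 s) < e / 2"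
    unfolding uniformly_continuous_on_def using \<open>e / 2 > 0\<close> by metis
  \<comment> \<open>Below d for the uniform continuity of the decoder, and at most 1 so that the
    module's output stays in the interval bounded by R.\<close>
  define ef where "ef = min (d / 2) 1"
  have ef: "ef > 0" "ef < d" "ef \<le> 1" using d(1) by (auto simp: ef_def)
  \<comment> \<open>On the exceptional set the error is only known to be at most Mt + M; this
    measure keeps its contribution to the squared norm below the square of e.\<close>
  define \<eta> where "\<eta> = e\<^sup>2 / ((Mt + M)\<^sup>2 + 1)"
  have \<eta>: "\<eta> > 0" using e by (simp add: \<eta>_def add_nonneg_pos)
  have "(Mt + M)\<^sup>2 * \<eta> = e\<^sup>2 * ((Mt + M)\<^sup>2 / ((Mt + M)\<^sup>2 + 1))" by (simp add: \<eta>_def)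
  also have "\<dots> \<le> e\<^sup>2 * 1" by (intro mult_left_mono) (auto simp: divide_le_eq add_nonneg_pos)
  finally have \<eta>': "(Mt + M)\<^sup>2 * \<eta> \<le> e\<^sup>2" by simp
  have \<omega>2: "\<bar>\<omega> b\<bar> \<le> 3/2" if "b \<in> I" for b using \<omega>(3)[OF that] by linarith
  show ?thesis
  proof (rule encode_universal[OF cells(1) dom gs \<sigma> app _ I(2) n h Z Q ef(1) \<eta>])
    fix N
    assume N: "fno_module D \<sigma> N" "\<And>u. u \<in> L2 D \<Longrightarrow> continuous_on UNIV (N u)"
      "\<And>u. u \<in> L2 D \<Longrightarrow> L2_inner D u (gs 0) \<in> I \<Longrightarrow>
       (\<And>i. i \<in> {1..n} \<Longrightarrow> \<bar>L2_inner D u (gs i) / L2_inner D u (gs 0)\<bar> \<le> Z) \<Longrightarrow>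
       \<exists>B q. B \<in> lmeasurable \<and> B \<subseteq> D \<and> measure lebesgue B \<le> \<eta> \<and>
         (\<forall>j<m. \<forall>x\<in>A j - B.
            (\<forall>i<n. q x i < Q \<and> \<bar>L2_inner D u (gs (Suc i)) / L2_inner D u (gs 0) - (h * real (q x i) - Z)\<bar> \<le> h) \<and>
            \<bar>N u x - \<omega> (L2_inner D u (gs 0)) * 4 ^ (j + m * (\<Sum>i<n. q x i * Q ^ i))\<bar> \<le> ef)"
    have NL2: "(\<lambda>x. G (k - N u x)) \<in> L2 D" if "u \<in> L2 D" for u
      by (rule continuous_L2[OF D dom(1)], rule continuous_on_compose2[OF net(3)])
        (auto intro!: continuous_intros N(2) that)
    have main: "L2_norm D (\<lambda>x. step t x - G (k - N u x)) \<le> 2 * e * sqrt (measure lebesgue D) + e"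
      if u: "u \<in> L2 D" and b0: "L2_inner D u (gs 0) \<in> I"
        and z: "\<forall>i\<in>{1..n}. \<bar>L2_inner D u (gs i) / L2_inner D u (gs 0)\<bar> \<le> Z"
        and t: "\<forall>j<m. \<bar>t j\<bar> \<le> Mt"
        and tH: "\<forall>j<m. \<forall>q. (\<forall>i<n. \<bar>L2_inner D u (gs (Suc i)) / L2_inner D u (gs 0) - (h * real (q i) - Z)\<bar> \<le> h) \<longrightarrow>
           \<bar>t j - H j q (L2_inner D u (gs 0))\<bar> \<le> e" for u t
    proof -
      define b where "b = L2_inner D u (gs 0)"
      have bI: "b \<in> I" using b0 by (simp add: b_def)
      obtain B q where B: "B \<in> lmeasurable" "B \<subseteq> D" "measure lebesgue B \<le> \<eta>"
        and q: "\<And>j x i. j < m \<Longrightarrow> x \<in> A j \<Longrightarrow> x \<notin> B \<Longrightarrow> i < n \<Longrightarrow> q x i < Q"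
          "\<And>j x i. j < m \<Longrightarrow> x \<in> A j \<Longrightarrow> x \<notin> B \<Longrightarrow> i < n \<Longrightarrow> \<bar>L2_inner D u (gs (Suc i)) / b - (h * real (q x i) - Z)\<bar> \<le> h"
          "\<And>j x. j < m \<Longrightarrow> x \<in> A j \<Longrightarrow> x \<notin> B \<Longrightarrow> \<bar>N u x - \<omega> b * 4 ^ (j + m * (\<Sum>i<n. q x i * Q ^ i))\<bar> \<le> ef"
        using N(3)[OF u b0] z unfolding b_def by blast
      have step_t: "\<bar>step t x\<bar> \<le> Mt" for x
      proof (cases "\<exists>j<m. x \<in> A j")
        case True
        then show ?thesis using step_eq t by metis
      next
        case False
        then show ?thesis using Mt by (simp add: step_def indicator_def)
      qed
      have good: "\<bar>step t x - G (k - N u x)\<bar> \<le> 2 * e" if j: "j < m" and x: "x \<in> A j" "x \<notin> B" for j x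
      proof -
        define S where "S = (\<Sum>i<n. q x i * Q ^ i)"
        define kx where "kx = j + m * S"
        have "S < Q ^ n" unfolding S_def by (rule digit_sum_less) (rule q(1)[OF j x])
        then have "m * (S + 1) \<le> m * Q ^ n" by (intro mult_left_mono) auto
        then have kx: "kx < K" using j by (simp add: kx_def K_def)
        have digits: "kx mod m = j" "kx div m = S" using j by (simp_all add: kx_def)
        have "Hk kx = H j (q x)"
          unfolding Hk_def digits
        proof (rule H_cong)
          fix i assume "i < n"
          then show "S div Q ^ i mod Q = q x i"
            unfolding S_def by (intro digit_extract q(1)[OF j x])
        qed
        then have val: "F0 (\<omega> b * 4 ^ kx) = H j (q x) b" using F0(3)[OF kx bI] by simp
        have near: "\<bar>N u x - \<omega> b * 4 ^ kx\<bar> \<le> ef" using q(3)[OF j x] by (simp add: kx_def S_def)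
        have "\<bar>\<omega> b * 4 ^ kx\<bar> \<le> 3/2 * 4 ^ K"
          unfolding abs_mult using \<omega>2[OF bI] kx by (intro mult_mono) (auto intro: power_increasing)
        then have in1: "\<omega> b * 4 ^ kx \<in> {-R..R}" and in2: "N u x \<in> {-R..R}"
          using near ef(3) by (auto simp: R_def)
        have "\<bar>k - N u x\<bar> \<le> \<bar>k\<bar> + R" using in2 by (auto simp: abs_le_iff)
        then have "\<bar>G (k - N u x) - F0 (k - (k - N u x))\<bar> \<le> e / 2" by (rule net(4))
        then have g1: "\<bar>G (k - N u x) - F0 (N u x)\<bar> \<le> e / 2" by simp
        have "dist (N u x) (\<omega> b * 4 ^ kx) < d" using near ef(2) by (simp add: dist_real_def)
        from d(2)[OF in1 in2 this] have g2: "\<bar>F0 (N u x) - H j (q x) b\<bar> < e / 2"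
          by (simp add: dist_real_def val)
        have g3: "\<bar>t j - H j (q x) b\<bar> \<le> e" using tH j q(2)[OF j x] unfolding b_def by blast
        have "step t x = t j" by (rule step_eq[OF x(1) j])
        then show ?thesis using g1 g2 g3 by linarith
      qed
      have "(L2_norm D (\<lambda>x. step t x - G (k - N u x)))\<^sup>2 \<le> (2 * e)\<^sup>2 * measure lebesgue D + (Mt + M)\<^sup>2 * measure lebesgue B"
      proof (rule L2_norm_split_bound[OF D _ B(1,2)])
        show "(\<lambda>x. step t x - G (k - N u x)) \<in> L2 D" by (rule L2_diff[OF step_L2 NL2[OF u]])
        show "AE x in lebesgue_on D. x \<notin> B \<longrightarrow> \<bar>step t x - G (k - N u x)\<bar> \<le> 2 * e"
          using cover by eventually_elim (use good in blast)
        show "\<bar>step t x - G (k - N u x)\<bar> \<le> Mt + M" for x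
          using step_t[of x] net(5)[of "k - N u x"] by linarith
      qed
      also have "\<dots> \<le> (2 * e)\<^sup>2 * measure lebesgue D + e\<^sup>2"
        using \<eta>' mult_left_mono[OF B(3), of "(Mt + M)\<^sup>2"] by simp
      also have "\<dots> \<le> (2 * e * sqrt (measure lebesgue D) + e)\<^sup>2"
        using e by (simp add: power2_sum power_mult_distrib)
      finally show ?thesis
        by (rule power2_le_imp_le) (use e in simp)
    qed
    show ?thesis
      by (rule exI[of _ N], rule exI[of _ w], rule exI[of _ W], rule exI[of _ c], rule exI[of _ G])
        (use N(1) net(1,2) NL2 main in blast)
  qed (rule \<omega>2)
qed

section \<open>Separable responses of FNO modules\<close>

lemma L2_norm_bound_const:
  fixes D :: "(real^'d) set"
  assumes D: "D \<in> lmeasurable" and u: "u \<in> L2 D" and b: "\<And>x. x \<in> D \<Longrightarrow> \<bar>u x\<bar> \<le> e" and e: "e \<ge> 0"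
  shows "L2_norm D u \<le> e * sqrt (measure lebesgue D)"
proof -
  have "(L2_norm D u)\<^sup>2 \<le> e\<^sup>2 * measure lebesgue D + 0\<^sup>2 * measure lebesgue ({} :: (real^'d) set)"
  proof (rule L2_norm_split_bound[OF D u])
    show "AE x in lebesgue_on D. x \<notin> {} \<longrightarrow> \<bar>u x\<bar> \<le> e"
      by (rule AE_I2) (use b in simp)
  qed auto
  also have "\<dots> = (e * sqrt (measure lebesgue D))\<^sup>2" by (simp add: power_mult_distrib)
  finally show ?thesis by (rule power2_le_imp_le) (use e in simp)
qed

text \<open>Targets of FNO modules have to be continuous, whereas the oscillations used below are
  cut off at the cells.\<close>

lemma indicator_mult_continuous_approx:
  fixes D :: "(real^'d) set"
  assumes D: "D \<in> lmeasurable" "bounded D" and A: "A \<in> sets lebesgue" and g: "continuous_on UNIV g" and e: "e > 0"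
  shows "\<exists>f. continuous_on UNIV f \<and> L2_norm D (\<lambda>x. f x - indicator A x * g x) \<le> e"
proof -
  have "compact (g ` closure D)"
    using D(2) by (intro compact_continuous_image continuous_on_subset[OF g]) (auto simp: compact_closure)
  then obtain C where C: "\<And>x. x \<in> closure D \<Longrightarrow> \<bar>g x\<bar> \<le> C"
    by (metis bounded_iff compact_imp_bounded imageI real_norm_def)
  have Ds: "D \<in> sets lebesgue" using D(1) by (rule fmeasurableD)
  define r where "r = e\<^sup>2 / (C\<^sup>2 + 1)"
  have r: "r > 0" using e by (simp add: r_def add_nonneg_pos)
  have "C\<^sup>2 * r = e\<^sup>2 * (C\<^sup>2 / (C\<^sup>2 + 1))" by (simp add: r_def)
  also have "\<dots> \<le> e\<^sup>2 * 1" by (intro mult_left_mono) (auto simp: divide_le_eq add_nonneg_pos)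
  finally have Cr: "C\<^sup>2 * r \<le> e\<^sup>2" by simp
  obtain h B where h: "continuous_on UNIV h" "\<And>x. 0 \<le> h x \<and> h x \<le> (1::real)"
    and B: "B \<in> lmeasurable" "B \<subseteq> D" "measure lebesgue B \<le> r" "\<And>x. x \<in> D \<Longrightarrow> x \<notin> B \<Longrightarrow> h x = indicator A x"
    by (rule Lusin_indicator[OF A Ds r], rule that)
  have c: "continuous_on UNIV (\<lambda>x. h x * g x)" by (intro continuous_intros h g)
  have ind: "(\<lambda>x. indicator A x * g x) \<in> L2 D"
  proof (rule L2_mult_bounded[OF continuous_L2[OF D g], of _ 1])
    show "indicat_real A \<in> borel_measurable (lebesgue_on D)"
      using A by (intro measurable_restrict_space1 borel_measurable_indicator) simp
  qed (simp add: indicator_def)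
  have "(L2_norm D (\<lambda>x. h x * g x - indicator A x * g x))\<^sup>2 \<le> 0\<^sup>2 * measure lebesgue D + C\<^sup>2 * measure lebesgue B"
  proof (rule L2_norm_split_bound[OF D(1) L2_diff[OF continuous_L2[OF D c] ind] B(1,2)])
    show "AE x in lebesgue_on D. x \<notin> B \<longrightarrow> \<bar>h x * g x - indicator A x * g x\<bar> \<le> 0"
      by (rule AE_I2) (use B(4) in simp)
    fix x assume "x \<in> B"
    then have "\<bar>g x\<bar> \<le> C" using C B(2) closure_subset by blast
    moreover have "\<bar>h x - indicator A x\<bar> \<le> 1" using h(2)[of x] by (auto simp: indicator_def)
    ultimately have "\<bar>h x - indicator A x\<bar> * \<bar>g x\<bar> \<le> 1 * C" by (intro mult_mono) auto
    then show "\<bar>h x * g x - indicator A x * g x\<bar> \<le> C" by (simp add: abs_mult[symmetric] left_diff_distrib)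
  qed
  also have "\<dots> \<le> e\<^sup>2" using mult_left_mono[OF B(3), of "C\<^sup>2"] Cr by simp
  finally have "L2_norm D (\<lambda>x. h x * g x - indicator A x * g x) \<le> e" by (rule power2_le_imp_le) (use e in simp)
  then show ?thesis using c by blast
qed

text \<open>The target is linear in the ratios, so each summand depends on one ratio and the
  position. The discontinuous el i are reached in norm only, which is enough for functionals of the
  output.\<close>

lemma fno_linear_response:
  fixes D :: "(real^'d) set" and el :: "nat \<Rightarrow> real^'d \<Rightarrow> real"
  assumes D: "D \<in> lmeasurable" "bounded D" "closure D \<subset> torus_cube"
    and gs: "\<And>i. gs i \<in> L2 D" and \<sigma>: "continuous_on UNIV \<sigma>"
    and app: "\<And>j M. net_approx \<sigma> scalar_forms I {-M..M} (\<lambda>b y. \<omega> b * y ^ j)"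
    and \<omega>: "\<And>b. b \<in> I \<Longrightarrow> \<bar>\<omega> b\<bar> \<le> 3/2" and I: "0 \<notin> I"
    and Z: "Z \<ge> 0" and \<rho>: "\<rho> > 0"
    and el: "\<And>i. i < n \<Longrightarrow> el i \<in> L2 D"
    and dense: "\<And>i e. i < n \<Longrightarrow> e > 0 \<Longrightarrow> \<exists>f. continuous_on UNIV f \<and> L2_norm D (\<lambda>x. f x - el i x) \<le> e"
  shows "\<exists>N. fno_module D \<sigma> N \<and> (\<forall>u\<in>L2 D. continuous_on UNIV (N u)) \<and>
     (\<forall>u\<in>L2 D. L2_inner D u (gs 0) \<in> I \<longrightarrow>
        (\<forall>i<n. \<bar>L2_inner D u (gs (Suc i)) / L2_inner D u (gs 0)\<bar> \<le> Z) \<longrightarrow>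
        L2_norm D (\<lambda>x. N u x - \<omega> (L2_inner D u (gs 0)) * (\<Sum>i<n. L2_inner D u (gs (Suc i)) / L2_inner D u (gs 0) * el i x)) \<le> \<rho>)"
proof -
  define r where "r = \<rho> / (3 * real (n + 1) * (Z + 1))"
  have r: "r > 0" using \<rho> Z by (simp add: r_def)
  have "\<forall>i. \<exists>f. i < n \<longrightarrow> continuous_on UNIV f \<and> L2_norm D (\<lambda>x. f x - el i x) \<le> r"
    using dense r by blast
  from choice[OF this] obtain f where f: "\<And>i. i < n \<Longrightarrow> continuous_on UNIV (f i)"
    "\<And>i. i < n \<Longrightarrow> L2_norm D (\<lambda>x. f i x - el i x) \<le> r" by blast
  define F where "F p = (\<Sum>i<n. snd p (Suc i) * f i (fst p))" for p :: "(real^'d) \<times> (nat \<Rightarrow> real)"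
  define e1 where "e1 = \<rho> / (2 * (sqrt (measure lebesgue D) + 1))"
  have e1: "e1 > 0" using \<rho> by (simp add: e1_def add_nonneg_pos)
  have GF: "exp_approx (fno_forms undefined n) (coord_box D n Z) F"
    unfolding F_def
  proof (rule exp_approx_sum[OF fno_forms_const])
    fix i assume "i \<in> {..<n}"
    then have i: "i < n" by simp
    have clD: "closure D \<subseteq> torus_cube" using D(3) by auto
    have "continuous_on UNIV (\<lambda>p :: (real^'d) \<times> real. snd p * f i (fst p))"
      by (intro continuous_intros continuous_on_compose2[OF f(1)[OF i]]) auto
    from exp_approx_coordinate[OF D(2) clD _ this, of "Suc i" n undefined Z] i
    show "exp_approx (fno_forms undefined n) (coord_box D n Z) (\<lambda>p. snd p (Suc i) * f i (fst p))" by simp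
  qed
  show ?thesis
  proof (rule fno_universal[OF D(1,3) gs \<sigma> app _ I GF e1])
    fix N
    assume N: "fno_module D \<sigma> N" "\<And>u. u \<in> L2 D \<Longrightarrow> continuous_on UNIV (N u)"
      "\<And>u x. u \<in> L2 D \<Longrightarrow> L2_inner D u (gs 0) \<in> I \<Longrightarrow>
       (\<And>i. i \<in> {1..n} \<Longrightarrow> \<bar>L2_inner D u (gs i) / L2_inner D u (gs 0)\<bar> \<le> Z) \<Longrightarrow> x \<in> D \<Longrightarrow>
       \<bar>N u x - \<omega> (L2_inner D u (gs 0)) * F (x, \<lambda>i. L2_inner D u (gs i) / L2_inner D u (gs 0))\<bar> \<le> e1"
    have main: "L2_norm D (\<lambda>x. N u x - \<omega> (L2_inner D u (gs 0)) * (\<Sum>i<n. L2_inner D u (gs (Suc i)) / L2_inner D u (gs 0) * el i x)) \<le> \<rho>"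
      if u: "u \<in> L2 D" and b0: "L2_inner D u (gs 0) \<in> I"
        and z0: "\<forall>i<n. \<bar>L2_inner D u (gs (Suc i)) / L2_inner D u (gs 0)\<bar> \<le> Z" for u
    proof -
      define b where "b = L2_inner D u (gs 0)"
      define z where "z i = L2_inner D u (gs (Suc i)) / b" for i
      have z: "\<bar>z i\<bar> \<le> Z" if "i < n" for i using z0 that by (simp add: z_def b_def)
      have bI: "b \<in> I" using b0 by (simp add: b_def)
      define v where "v x = \<omega> b * (\<Sum>i<n. z i * f i x)" for x
      define w where "w x = \<omega> b * (\<Sum>i<n. z i * el i x)" for x
      have fL: "f i \<in> L2 D" if "i < n" for i by (rule continuous_L2[OF D(1,2) f(1)[OF that]])
      have vL: "v \<in> L2 D" unfolding v_def by (intro L2_scale L2_sum fL) auto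
      have wL: "w \<in> L2 D" unfolding w_def by (intro L2_scale L2_sum el) auto
      have NL: "N u \<in> L2 D" by (rule continuous_L2[OF D(1,2) N(2)[OF u]])
      have "\<bar>N u x - v x\<bar> \<le> e1" if "x \<in> D" for x
      proof -
        have "\<bar>L2_inner D u (gs i) / L2_inner D u (gs 0)\<bar> \<le> Z" if "i \<in> {1..n}" for i
          using z0 that by (cases i) auto
        then show ?thesis
          using N(3)[OF u b0 _ that] by (simp add: v_def F_def z_def b_def)
      qed
      then have 1: "L2_norm D (\<lambda>x. N u x - v x) \<le> e1 * sqrt (measure lebesgue D)"
        by (intro L2_norm_bound_const[OF D(1) L2_diff[OF NL vL]]) (use e1 in auto)
      have "v x - w x = (\<Sum>i<n. (\<omega> b * z i) * (f i x - el i x))" for x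
        by (simp add: v_def w_def sum_distrib_left sum_subtractf[symmetric] algebra_simps)
      then have "L2_norm D (\<lambda>x. v x - w x) = L2_norm D (\<lambda>x. \<Sum>i<n. (\<omega> b * z i) * (f i x - el i x))" by simp
      also have "\<dots> \<le> (\<Sum>i<n. L2_norm D (\<lambda>x. (\<omega> b * z i) * (f i x - el i x)))"
        by (intro L2_norm_sum_le L2_scale L2_diff fL el) auto
      also have "\<dots> \<le> (\<Sum>i<n. 3/2 * Z * r)"
      proof (intro sum_mono)
        fix i assume "i \<in> {..<n}"
        then have i: "i < n" by simp
        have "\<bar>\<omega> b * z i\<bar> \<le> 3/2 * Z"
          unfolding abs_mult using \<omega>[OF bI] z[OF i] by (intro mult_mono) auto
        then show "L2_norm D (\<lambda>x. (\<omega> b * z i) * (f i x - el i x)) \<le> 3/2 * Z * r"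
          unfolding L2_norm_scale using f(2)[OF i] Z by (intro mult_mono) auto
      qed
      also have "\<dots> = real n * (3/2 * Z * r)" by simp
      also have "\<dots> \<le> \<rho> / 2"
      proof -
        have "real n * (3/2 * Z * r) = (real n * Z) * (3/2 * r)" by simp
        also have "\<dots> \<le> (real (n + 1) * (Z + 1)) * (3/2 * r)"
          using Z r by (intro mult_right_mono mult_mono) auto
        also have "\<dots> = 3 * real (n + 1) * (Z + 1) * r / 2" by simp
        also have "\<dots> = \<rho> / 2"
        proof -
          have "3 * real (n + 1) * (Z + 1) \<noteq> 0" using Z by simp
          then have "3 * real (n + 1) * (Z + 1) * r = \<rho>" unfolding r_def by (rule nonzero_eq_divide_eq[THEN iffD1, THEN trans[OF mult.commute], OF _ refl])
          then show ?thesis by simp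
        qed
        finally show ?thesis .
      qed
      finally have 2: "L2_norm D (\<lambda>x. v x - w x) \<le> \<rho> / 2" .
      have "e1 * sqrt (measure lebesgue D) \<le> e1 * (sqrt (measure lebesgue D) + 1)" using e1 by (intro mult_left_mono) auto
      also have "\<dots> = \<rho> / 2"
      proof -
        have "\<rho> / (2 * s) * s = \<rho> / 2" if "s > 0" for s using that by simp
        moreover have "sqrt (measure lebesgue D) + 1 > 0" by (simp add: add_nonneg_pos)
        ultimately show ?thesis unfolding e1_def by blast
      qed
      finally have "L2_norm D (\<lambda>x. N u x - w x) \<le> \<rho>"
        using L2_triangle_diff[OF NL vL wL] 1 2 by linarith
      then show ?thesis by (simp add: w_def z_def b_def)
    qed
    show ?thesis
      by (rule exI[of _ N]) (use N(1,2) main in blast)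
  qed (rule \<omega>)
qed

section \<open>Oscillations inside the cells\<close>

context cells
begin

text \<open>U centred on one cell and cut off outside it. Centring gives orthogonality to the
  indicators, disjointness of the cells gives mutual orthogonality.\<close>

definition osc :: "(real^'d \<Rightarrow> real) \<Rightarrow> nat \<Rightarrow> real^'d \<Rightarrow> real" where
  "osc U k x = indicator (A k) x * (U x - avg k U)"

lemma osc_L2:
  assumes "U \<in> L2 D" "k < m"
  shows "osc U k \<in> L2 D"
  unfolding osc_def
proof (rule L2_mult_bounded[of _ _ _ 1])
  show "(\<lambda>x. U x - avg k U) \<in> L2 D" by (rule L2_diff[OF assms(1) L2_const[OF D]])
  show "indicat_real (A k) \<in> borel_measurable (lebesgue_on D)" by (rule L2_measurable[OF ind_L2[OF assms(2)]])
qed (simp add: indicator_def)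

lemma inner_osc_indicator:
  assumes U: "U \<in> L2 D" and k: "k < m" and j: "j < m"
  shows "L2_inner D (osc U k) (indicator (A j)) = 0"
proof (cases "k = j")
  case True
  have "L2_inner D (osc U k) (indicator (A j)) = L2_inner D (\<lambda>x. U x - avg k U * indicator (A k) x) (indicator (A k))"
    unfolding L2_inner_def True osc_def by (intro Bochner_Integration.integral_cong) (auto simp: indicator_def)
  also have "\<dots> = L2_inner D U (indicator (A k)) - L2_inner D (\<lambda>x. avg k U * indicator (A k) x) (indicator (A k))"
    by (rule L2_inner_diff_left[OF U L2_scale[OF ind_L2[OF k]] ind_L2[OF k]])
  also have "\<dots> = 0"
    unfolding L2_inner_scale_left ind_inner[OF k k] using pos[OF k] by (simp add: avg_def)
  finally show ?thesis .
next
  case False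
  have "osc U k x * indicator (A j) x = 0" for x
    using disjoint[OF k j False] by (auto simp: osc_def indicator_def)
  then show ?thesis unfolding L2_inner_def by (simp only: integral_zero)
qed

lemma inner_osc_osc:
  assumes k: "k < m" and j: "j < m" and ne: "k \<noteq> j"
  shows "L2_inner D (osc U k) (osc U j) = 0"
proof -
  have "osc U k x * osc U j x = 0" for x
    using disjoint[OF k j ne] by (auto simp: osc_def indicator_def)
  then show ?thesis unfolding L2_inner_def by (simp only: integral_zero)
qed

text \<open>A coordinate equals its average only on a hyperplane, which is null, whereas the cell
  has positive measure.\<close>

lemma osc_coordinate_norm_pos:
  assumes U: "(\<lambda>x. x $ i) \<in> L2 D" and k: "k < m"
  shows "L2_norm D (osc (\<lambda>x. x $ i) k) > 0"
proof (rule ccontr)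
  let ?U = "\<lambda>x :: real^'d. x $ i"
  assume "\<not> L2_norm D (osc ?U k) > 0"
  then have "L2_norm D (osc ?U k) = 0" using L2_norm_nonneg[of D "osc ?U k"] by linarith
  then have "L2_inner D (osc ?U k) (osc ?U k) = 0" using L2_norm_square[of D "osc ?U k"] by simp
  then have "AE x in lebesgue_on D. osc ?U k x * osc ?U k x = 0"
    unfolding L2_inner_def
    using integral_nonneg_eq_0_iff_AE[OF L2_integrable_mult[OF osc_L2[OF U k] osc_L2[OF U k]]] by simp
  then have "AE x in lebesgue. x \<in> D \<longrightarrow> osc ?U k x * osc ?U k x = 0"
    by (subst (asm) AE_restrict_space_iff) (use Ds in auto)
  then obtain N where N: "N \<in> null_sets lebesgue" "{x. \<not> (x \<in> D \<longrightarrow> osc ?U k x * osc ?U k x = 0)} \<subseteq> N"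
    by (auto simp: eventually_ae_filter)
  define c where "c = avg k ?U"
  have H: "{x :: real^'d. x $ i = c} \<in> null_sets lebesgue"
  proof -
    have "negligible {x :: real^'d. axis i 1 \<bullet> x = c}"
      by (rule negligible_hyperplane) (simp add: axis_eq_0_iff)
    then show ?thesis by (simp add: inner_axis' negligible_iff_null_sets)
  qed
  have "A k \<subseteq> N \<union> {x. x $ i = c}"
    using N(2) cell(2)[OF k] by (auto simp: osc_def c_def)
  moreover have "N \<union> {x. x $ i = c} \<in> null_sets lebesgue" using N(1) H by (rule null_sets.Un)
  ultimately have "A k \<in> null_sets lebesgue" using cell(1)[OF k] null_sets_subset by blast
  then have "measure lebesgue (A k) = 0" by (simp add: measure_eq_0_null_sets)
  then show False using pos[OF k] by simp
qed

lemma step_norm_le: "L2_norm D (step c) \<le> (\<Sum>k<m. \<bar>c k\<bar>) * (\<Sum>k<m. L2_norm D (indicator (A k)))"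
proof -
  have "L2_norm D (step c) \<le> (\<Sum>k<m. L2_norm D (\<lambda>x. c k * indicator (A k) x))"
    unfolding step_def by (intro L2_norm_sum_le L2_scale ind_L2) auto
  also have "\<dots> \<le> (\<Sum>k<m. \<bar>c k\<bar> * (\<Sum>l<m. L2_norm D (indicator (A l))))"
    unfolding L2_norm_scale by (intro sum_mono mult_left_mono member_le_sum) auto
  finally show ?thesis by (simp add: sum_distrib_right)
qed

text \<open>The finite-dimensional form of the Lipschitz bound: for fixed cells the norm of a step
  function is controlled by its coefficients, and an average by the norm.\<close>

lemma cell_map_Lipschitz:
  assumes C: "C \<ge> 0"
    and TL: "\<And>y f. y \<in> L2 D \<Longrightarrow> f \<in> L2 D \<Longrightarrow> T (y, f) \<in> L2 D"
    and lip: "\<And>y f y' f'. y \<in> L2 D \<Longrightarrow> f \<in> L2 D \<Longrightarrow> y' \<in> L2 D \<Longrightarrow> f' \<in> L2 D \<Longrightarrow>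
       L2_norm D (\<lambda>x. T (y, f) x - T (y', f') x) \<le> C * (L2_norm D (\<lambda>x. y x - y' x) + L2_norm D (\<lambda>x. f x - f' x))"
  obtains C' where "C' \<ge> 0" "\<And>j \<alpha> \<zeta> \<alpha>' \<zeta>'. j < m \<Longrightarrow>
    \<bar>avg j (T (step \<alpha>, step \<zeta>)) - avg j (T (step \<alpha>', step \<zeta>'))\<bar> \<le> C' * (\<Sum>k<m. \<bar>\<alpha> k - \<alpha>' k\<bar> + \<bar>\<zeta> k - \<zeta>' k\<bar>)"
proof -
  define S where "S = (\<Sum>k<m. L2_norm D (indicator (A k)))"
  define P where "P = (\<Sum>j<m. 1 / sqrt (measure lebesgue (A j)))"
  have S: "S \<ge> 0" unfolding S_def by (intro sum_nonneg) simp
  have P: "P \<ge> 0" unfolding P_def by (intro sum_nonneg) simp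
  have "\<bar>avg j (T (step \<alpha>, step \<zeta>)) - avg j (T (step \<alpha>', step \<zeta>'))\<bar> \<le> (C * S * P) * (\<Sum>k<m. \<bar>\<alpha> k - \<alpha>' k\<bar> + \<bar>\<zeta> k - \<zeta>' k\<bar>)"
    if j: "j < m" for j \<alpha> \<zeta> \<alpha>' \<zeta>'
  proof -
    define s where "s = (\<Sum>k<m. \<bar>\<alpha> k - \<alpha>' k\<bar> + \<bar>\<zeta> k - \<zeta>' k\<bar>)"
    let ?u = "T (step \<alpha>, step \<zeta>)" and ?v = "T (step \<alpha>', step \<zeta>')"
    have uv: "?u \<in> L2 D" "?v \<in> L2 D" by (intro TL step_L2)+
    have "L2_norm D (\<lambda>x. ?u x - ?v x) \<le> C * (L2_norm D (\<lambda>x. step \<alpha> x - step \<alpha>' x) + L2_norm D (\<lambda>x. step \<zeta> x - step \<zeta>' x))"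
      by (intro lip step_L2)
    also have "\<dots> \<le> C * ((\<Sum>k<m. \<bar>\<alpha> k - \<alpha>' k\<bar>) * S + (\<Sum>k<m. \<bar>\<zeta> k - \<zeta>' k\<bar>) * S)"
      unfolding step_diff S_def by (intro mult_left_mono add_mono step_norm_le C)
    also have "\<dots> = C * S * s" by (simp add: s_def sum.distrib algebra_simps)
    finally have 1: "L2_norm D (\<lambda>x. ?u x - ?v x) \<le> C * S * s" .
    have s: "s \<ge> 0" unfolding s_def by (intro sum_nonneg) simp
    have "\<bar>avg j ?u - avg j ?v\<bar> = \<bar>avg j (\<lambda>x. ?u x - ?v x)\<bar>" by (simp only: avg_diff[OF uv j])
    also have "\<dots> \<le> L2_norm D (\<lambda>x. ?u x - ?v x) / sqrt (measure lebesgue (A j))"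
      by (rule abs_avg_le[OF L2_diff[OF uv] j])
    also have "\<dots> = L2_norm D (\<lambda>x. ?u x - ?v x) * (1 / sqrt (measure lebesgue (A j)))" by simp
    also have "\<dots> \<le> (C * S * s) * P"
      unfolding P_def using 1 C S s j by (intro mult_mono member_le_sum) auto
    finally show ?thesis by (simp add: s_def mult_ac)
  qed
  then show ?thesis using C S P by (intro that[of "C * S * P"]) auto
qed

end

section \<open>The two-layer network\<close>

text \<open>Both \<beta> and b carry the same unknown factor w, up to \<eta>; the quotient removes
  it.\<close>

lemma ratio_estimate:
  fixes \<beta> b w y \<eta> :: real
  assumes "\<bar>\<beta> - w * y\<bar> \<le> \<eta>" "\<bar>b - w\<bar> \<le> \<eta>" "\<bar>y\<bar> \<le> 2" "b \<ge> 1/2" "\<eta> \<ge> 0"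
  shows "\<bar>\<beta> / b - y\<bar> \<le> 6 * \<eta>"
proof -
  have "\<bar>\<beta> - b * y\<bar> = \<bar>(\<beta> - w * y) - (b - w) * y\<bar>" by (simp add: algebra_simps)
  also have "\<dots> \<le> \<bar>\<beta> - w * y\<bar> + \<bar>b - w\<bar> * \<bar>y\<bar>" by (metis abs_mult abs_triangle_ineq4)
  also have "\<dots> \<le> \<eta> + \<eta> * 2" using assms by (intro add_mono mult_mono) auto
  also have "\<dots> \<le> 6 * \<eta> * b" using mult_left_mono[OF assms(4), of "6 * \<eta>"] assms(5) by simp
  finally have "\<bar>\<beta> - b * y\<bar> / b \<le> 6 * \<eta>" using assms(4) by (simp add: pos_divide_le_eq)
  moreover have "\<beta> / b - y = (\<beta> - b * y) / b" using assms(4) by (simp add: field_simps)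
  ultimately show ?thesis using assms(4) by (simp add: abs_divide)
qed

text \<open>Here y is the true ratio, z the measured one and zt its quantisation, while V and v are
  the decoded and the true reference value. The map to c * (v * y - 1) inverts the normalisation of
  an average of f.\<close>

lemma decoded_coordinate_error:
  fixes V v zt z y c M h \<eta> \<epsilon> :: real
  assumes "\<bar>z - zt\<bar> \<le> h" "\<bar>z - y\<bar> \<le> 6 * \<eta>" "\<bar>V\<bar> \<le> M" "\<bar>V - v\<bar> \<le> \<epsilon>" "\<bar>y\<bar> \<le> 2" "c \<ge> 0"
  shows "\<bar>c * (v * y - 1) - c * (V * zt - 1)\<bar> \<le> c * (M * (h + 6 * \<eta>) + \<epsilon> * 2)"
proof -
  have "\<bar>zt - y\<bar> \<le> h + 6 * \<eta>" using assms(1,2) by linarith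
  then have "\<bar>V\<bar> * \<bar>zt - y\<bar> + \<bar>V - v\<bar> * \<bar>y\<bar> \<le> M * (h + 6 * \<eta>) + \<epsilon> * 2"
    using assms by (intro add_mono mult_mono) auto
  moreover have "\<bar>V * zt - v * y\<bar> \<le> \<bar>V\<bar> * \<bar>zt - y\<bar> + \<bar>V - v\<bar> * \<bar>y\<bar>"
  proof -
    have "V * zt - v * y = V * (zt - y) + (V - v) * y" by (simp add: algebra_simps)
    then show ?thesis by (metis abs_mult abs_triangle_ineq)
  qed
  ultimately have "c * \<bar>V * zt - v * y\<bar> \<le> c * (M * (h + 6 * \<eta>) + \<epsilon> * 2)"
    using assms(6) by (intro mult_left_mono) auto
  moreover have "c * (v * y - 1) - c * (V * zt - 1) = - (c * (V * zt - v * y))" by (simp add: algebra_simps)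
  ultimately show ?thesis using assms(6) by (simp add: abs_mult)
qed

context cells
begin

lemma avg_const_add:
  assumes "f \<in> L2 D" "k < m"
  shows "avg k (\<lambda>x. c + f x) = c + avg k f"
proof -
  have "L2_inner D (\<lambda>x. c) (indicator (A k)) = L2_inner D (\<lambda>x. c * indicator (A k) x) (indicator (A k))"
    unfolding L2_inner_def by (intro Bochner_Integration.integral_cong) (auto simp: indicator_def)
  also have "\<dots> = c * measure lebesgue (A k)" unfolding L2_inner_scale_left ind_inner[OF assms(2,2)] by simp
  finally show ?thesis
    unfolding avg_def L2_inner_add_left[OF L2_const[OF D] assms(1) ind_L2[OF assms(2)]]
    using pos[OF assms(2)] by (simp add: add_divide_distrib)
qed

text \<open>The first stage turns c + f into a reference bb and ratios z, from which
  \<open>avg k f = c * (bb * z k - 1)\<close>. From p the second stage reads \<beta> close to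
  \<open>\<omega> bb * z\<close>, so its own reference b' is close to \<open>\<omega> bb\<close>: z
  reappears as a ratio, and a left inverse V of \<omega> recovers bb from b'. The averages of y are
  read off directly.\<close>

lemma two_stage_approximation:
  fixes t :: "nat \<Rightarrow> (nat \<Rightarrow> real) \<Rightarrow> (nat \<Rightarrow> real) \<Rightarrow> real" and \<sigma> :: "real \<Rightarrow> real"
  assumes m: "m \<ge> 1" and dom: "bounded D" "closure D \<subset> torus_cube"
    and K: "\<And>y f. (y, f) \<in> K \<Longrightarrow> y \<in> L2 D \<and> f \<in> L2 D \<and> L2_norm D y \<le> R \<and> L2_norm D f \<le> R" and R: "R \<ge> 0"
    and \<sigma>: "continuous_on UNIV \<sigma>"
    and \<delta>: "0 < \<delta>" "\<delta> \<le> 1/2"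
    and \<omega>: "continuous_on {1-\<delta>..1+\<delta>} \<omega>" "inj_on \<omega> {1-\<delta>..1+\<delta>}" "\<omega> 1 = 1"
      "\<And>b. b \<in> {1-\<delta>..1+\<delta>} \<Longrightarrow> \<bar>\<omega> b - 1\<bar> \<le> 1/2"
    and app: "\<And>j M. net_approx \<sigma> scalar_forms {1-\<delta>..1+\<delta>} {-M..M} (\<lambda>b y. \<omega> b * y ^ j)"
    and C: "C \<ge> 0" and t: "\<And>j \<alpha> \<zeta> \<alpha>' \<zeta>'. \<bar>t j \<alpha> \<zeta> - t j \<alpha>' \<zeta>'\<bar> \<le> C * (\<Sum>k<m. \<bar>\<alpha> k - \<alpha>' k\<bar> + \<bar>\<zeta> k - \<zeta>' k\<bar>)"
    and \<gamma>: "\<gamma> > 0" and e: "e > 0"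
  shows "\<exists>c S N w W b G. fno_module D \<sigma> S \<and> (\<forall>u\<in>L2 D. continuous_on UNIV (S u)) \<and>
     fno_module D \<sigma> N \<and> (\<forall>l. w l \<ge> (1::nat)) \<and>
     (\<forall>r (\<xi> :: real^'m) \<eta>. relu_net 2 w W b r \<xi> \<eta> = G r) \<and>
     (\<forall>u\<in>L2 D. (\<lambda>x. G (\<tau> * c - N u x)) \<in> L2 D) \<and>
     (\<forall>y f. (y, f) \<in> K \<longrightarrow>
        L2_norm D (\<lambda>x. step (\<lambda>j. t j (\<lambda>k. avg k y) (\<lambda>k. avg k f)) x
          - G (\<tau> * c - N (\<lambda>x. \<gamma> * (S (\<lambda>x. c + f x) x - y x)) x)) \<le> 2 * e * sqrt (measure lebesgue D) + e)"
proof -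
  define I where "I = {1-\<delta>..1+\<delta>}"
  note \<omega> = \<omega>[folded I_def] and app = app[folded I_def]
  have I: "compact I" "0 \<notin> I" "1 \<in> I" using \<delta> by (auto simp: I_def)
  have \<omega>32: "\<bar>\<omega> b\<bar> \<le> 3/2" if "b \<in> I" for b using \<omega>(4)[OF that] by linarith
  define i0 :: 'd where "i0 = undefined"
  define U where "U = (\<lambda>x :: real^'d. x $ i0)"
  have cU: "continuous_on UNIV U" unfolding U_def by (intro continuous_intros)
  have UL: "U \<in> L2 D" by (rule continuous_L2[OF D dom(1) cU])
  define E where "E k = L2_norm D (osc U k)" for k
  have E: "E k > 0" if "k < m" for k
    unfolding E_def U_def by (rule osc_coordinate_norm_pos[OF UL[unfolded U_def] that])
  have EE: "L2_inner D (osc U k) (osc U k) = (E k)\<^sup>2" for k by (simp add: E_def L2_norm_square)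
  define a where "a k = measure lebesgue (A k)" for k
  have a: "a k > 0" if "k < m" for k unfolding a_def by (rule pos[OF that])
  define a0 where "a0 = (\<Sum>k<m. a k)"
  have a0: "a0 > 0" unfolding a0_def using m a by (intro sum_pos) (auto simp: lessThan_empty_iff)
  \<comment> \<open>Convex weights: the weighted mean of numbers near a common value stays near it,
    and the ratios to this mean have weighted mean 1.\<close>
  define wt where "wt k = a k / a0" for k
  have wt: "wt k \<ge> 0" if "k < m" for k using a[OF that] a0 by (simp add: wt_def)
  have wt1: "(\<Sum>k<m. wt k) = 1" using a0 by (simp add: wt_def sum_divide_distrib[symmetric] a0_def[symmetric])
  have wavg: "\<bar>(\<Sum>k<m. wt k * g k) - s\<bar> \<le> r" if "\<And>k. k < m \<Longrightarrow> \<bar>g k - s\<bar> \<le> r" for g :: "nat \<Rightarrow> real" and s r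
  proof -
    have "(\<Sum>k<m. wt k * g k) - s = (\<Sum>k<m. wt k * (g k - s))"
      by (simp add: right_diff_distrib sum_subtractf sum_distrib_right[symmetric] wt1)
    also have "\<bar>\<dots>\<bar> \<le> (\<Sum>k<m. wt k * r)"
      by (rule order_trans[OF sum_abs], rule sum_mono) (use wt that in \<open>auto simp: abs_mult intro!: mult_left_mono\<close>)
    also have "\<dots> = r" by (simp add: sum_distrib_right[symmetric] wt1)
    finally show ?thesis .
  qed
  define Sa where "Sa = (\<Sum>k<m. 1 / sqrt (a k))"
  have Sa: "1 / sqrt (a k) \<le> Sa" if "k < m" for k
    unfolding Sa_def using that a by (intro member_le_sum) (auto intro: less_imp_le)
  have Sa0: "Sa \<ge> 0" unfolding Sa_def using a by (intro sum_nonneg) (auto intro: less_imp_le)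
  define Se where "Se = (\<Sum>k<m. 1 / E k)"
  have Se: "1 / E k \<le> Se" if "k < m" for k
    unfolding Se_def using that E by (intro member_le_sum) (auto intro: less_imp_le)
  have Se0: "Se \<ge> 0" unfolding Se_def using E by (intro sum_nonneg) (auto intro: less_imp_le)
  define R1 where "R1 = R * Sa"
  have R1: "R1 \<ge> 0" using R Sa0 by (simp add: R1_def)
  have avg_le: "\<bar>avg k u\<bar> \<le> r * Sa" if "u \<in> L2 D" "L2_norm D u \<le> r" "k < m" for u k r
  proof -
    have "\<bar>avg k u\<bar> \<le> L2_norm D u * (1 / sqrt (a k))" using abs_avg_le[OF that(1,3)] by (simp add: a_def)
    also have "\<dots> \<le> r * Sa" using that Sa order_trans[OF L2_norm_nonneg that(2)] a[OF that(3)]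
      by (intro mult_mono) (auto intro: less_imp_le)
    finally show ?thesis .
  qed
  \<comment> \<open>The decoder for a single exponent: a bounded continuous extension of the inverse
    of \<omega> to the whole line.\<close>
  obtain V MV where V: "continuous_on UNIV V" "\<And>s. \<bar>V s\<bar> \<le> MV" "\<And>b. b \<in> I \<Longrightarrow> V (\<omega> b) = b"
  proof (rule profile_decoder[where n = "Suc 0" and H = "\<lambda>k b. b", OF I(1) \<omega>(1,2)])
    fix F M assume "continuous_on UNIV F" "\<And>s. \<bar>F s\<bar> \<le> M" "\<And>k b. k < Suc 0 \<Longrightarrow> b \<in> I \<Longrightarrow> F (\<omega> b * 4 ^ k) = b"
    from that[OF this(1,2)] this(3)[of 0] show ?thesis by simp
  qed (use \<omega>(4) in auto)
  have MV: "MV \<ge> 0" using V(2)[of 0] by linarith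
  \<comment> \<open>The value \<open>\<omega> bb\<close> becomes the reference of the second stage
    and must lie in I again, with a margin \<delta> / 2 for errors.\<close>
  obtain \<kappa>0 where \<kappa>0: "\<kappa>0 > 0" "\<And>b. b \<in> I \<Longrightarrow> \<bar>b - 1\<bar> < \<kappa>0 \<Longrightarrow> \<bar>\<omega> b - 1\<bar> < \<delta> / 2"
  proof -
    have "\<exists>d>0. \<forall>b\<in>I. dist b 1 < d \<longrightarrow> dist (\<omega> b) (\<omega> 1) < \<delta> / 2"
      by (rule \<omega>(1)[unfolded continuous_on_iff, rule_format, OF I(3)]) (use \<delta>(1) in simp)
    then show ?thesis using that \<omega>(3) by (auto simp: dist_real_def)
  qed
  define \<kappa> where "\<kappa> = min (\<kappa>0 / 2) (min \<delta> (1/8))"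
  have \<kappa>: "\<kappa> > 0" "\<kappa> < \<kappa>0" "\<kappa> \<le> \<delta>" "\<kappa> \<le> 1/8" using \<kappa>0(1) \<delta>(1) by (auto simp: \<kappa>_def)
  \<comment> \<open>A large first control makes the averages of f relative perturbations of size at
    most \<kappa>; adding 1 keeps c positive for R1 = 0.\<close>
  define c where "c = (R1 + 1) / \<kappa>"
  have c: "c > 0" "R1 \<le> \<kappa> * c" using R1 \<kappa>(1) by (simp_all add: c_def)
  define tol where "tol = e / (2 * real m * (C + 1))"
  have tol: "tol > 0" using e C m by (simp add: tol_def)
  have Ctol: "C * (2 * real m * tol) \<le> e"
  proof -
    have "C * (2 * real m * tol) \<le> (C + 1) * (2 * real m * tol)" using tol by (intro mult_right_mono) auto
    also have "\<dots> = e" using C m by (simp add: tol_def)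
    finally show ?thesis .
  qed
  have "uniformly_continuous_on {1/2..3/2} V"
    by (intro compact_uniformly_continuous continuous_on_subset[OF V(1)]) auto
  moreover have "tol / (4 * c) > 0" using tol c by simp
  ultimately obtain dV where dV: "dV > 0" "\<And>s s'. s \<in> {1/2..3/2} \<Longrightarrow> s' \<in> {1/2..3/2} \<Longrightarrow> dist s' s < dV \<Longrightarrow> dist (V s') (V s) < tol / (4 * c)"
    unfolding uniformly_continuous_on_def by metis
  \<comment> \<open>Recovering f multiplies errors by c and by the bound MV, whence the second
    entry; the first one serves the averages of y. The choice of \<eta> below follows the same
    pattern.\<close>
  define h where "h = min (tol / 4) (tol / (4 * c * (MV + 1)))"
  have h: "h > 0" "h \<le> tol / 4" "h \<le> tol / (4 * c * (MV + 1))"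
  proof -
    have "tol / (4 * c * (MV + 1)) > 0" using tol c MV by simp
    then show "h > 0" "h \<le> tol / 4" "h \<le> tol / (4 * c * (MV + 1))" using tol unfolding h_def by linarith+
  qed
  define \<eta> where "\<eta> = min (min (\<delta> / 2) (dV / 2)) (min (tol / 2) (tol / (24 * c * (MV + 1))))"
  have \<eta>: "\<eta> > 0" "\<eta> \<le> \<delta> / 2" "\<eta> < dV" "\<eta> \<le> tol / 2" "\<eta> \<le> tol / (24 * c * (MV + 1))"
  proof -
    have "tol / (24 * c * (MV + 1)) > 0" using tol c MV by simp
    then show "\<eta> > 0" "\<eta> \<le> \<delta> / 2" "\<eta> < dV" "\<eta> \<le> tol / 2" "\<eta> \<le> tol / (24 * c * (MV + 1))"
      using tol \<delta>(1) dV(1) unfolding \<eta>_def by linarith+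
  qed
  have cMV: "c * (MV * (h + 6 * \<eta>) + tol / (4 * c) * 2) \<le> tol"
  proof -
    have p: "c * (MV + 1) > 0" using c MV by simp
    have "h + 6 * \<eta> \<le> tol / (4 * c * (MV + 1)) + 6 * (tol / (24 * c * (MV + 1)))" using h(3) \<eta>(5) by linarith
    also have "\<dots> = tol / (2 * (c * (MV + 1)))"
    proof -
      have "tol / (4 * s) + 6 * (tol / (24 * s)) = tol / (2 * s)" if "s > 0" for s
        using that by (simp add: field_simps)
      from this[OF p] show ?thesis by (simp only: mult.assoc)
    qed
    finally have "c * (MV + 1) * (h + 6 * \<eta>) \<le> c * (MV + 1) * (tol / (2 * (c * (MV + 1))))"
      using p by (intro mult_left_mono) auto
    also have "\<dots> = tol / 2"
    proof -
      have "s * (tol / (2 * s)) = tol / 2" if "s > 0" for s using that by simp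
      then show ?thesis using p by blast
    qed
    finally have "c * (MV + 1) * (h + 6 * \<eta>) \<le> tol / 2" .
    moreover have "c * (MV * (h + 6 * \<eta>)) \<le> c * (MV + 1) * (h + 6 * \<eta>)"
      using c h(1) \<eta>(1) by (simp add: mult.assoc[symmetric] mult_right_mono)
    moreover have "c * (tol / (4 * c) * 2) = tol / 2" using c by simp
    ultimately show ?thesis unfolding distrib_left[of c] by linarith
  qed
  define \<rho> where "\<rho> = \<eta> / (Sa + 1)"
  have \<rho>: "\<rho> > 0" "\<rho> * Sa \<le> \<eta>"
  proof -
    show "\<rho> > 0" using \<eta>(1) Sa0 by (simp add: \<rho>_def)
    have "\<rho> * Sa \<le> \<rho> * (Sa + 1)" using \<open>\<rho> > 0\<close> by (intro mult_left_mono) auto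
    then show "\<rho> * Sa \<le> \<eta>" using Sa0 by (simp add: \<rho>_def)
  qed
  \<comment> \<open>The amplitude of the stored oscillations: whatever y and the approximation error
    contribute along them falls below \<eta> after division by \<open>B * E k\<close>.\<close>
  define B where "B = (\<rho> + R) * (Se + 1) / \<eta>"
  have B: "B > 0" using \<rho>(1) R Se0 \<eta>(1) by (simp add: B_def add_pos_nonneg add_nonneg_pos)
  have BE: "(\<rho> + R) / (B * E k) \<le> \<eta>" if k: "k < m" for k
  proof -
    have "(\<rho> + R) * (1 / E k) \<le> (\<rho> + R) * (Se + 1)" using Se[OF k] \<rho>(1) R by (intro mult_left_mono) auto
    also have "\<dots> = \<eta> * B" using \<eta>(1) by (simp add: B_def)
    finally show ?thesis using B E[OF k] by (simp add: field_simps)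
  qed

  \<comment> \<open>Functional 0 is the mean over all cells, the others are the cell averages, each
    divided by c and therefore close to 1 on c + f.\<close>
  define g1 where "g1 i = (case i of 0 \<Rightarrow> (\<lambda>x. \<Sum>k<m. 1 / (c * a0) * indicator (A k) x)
      | Suc k \<Rightarrow> (\<lambda>x. if k < m then 1 / (c * a k) * indicator (A k) x else 0))" for i
  have g1L: "g1 i \<in> L2 D" for i
  proof (cases i)
    case 0
    have "(\<lambda>x. \<Sum>k<m. 1 / (c * a0) * indicator (A k) x) \<in> L2 D" by (intro L2_sum L2_scale ind_L2) auto
    then show ?thesis by (simp add: g1_def 0)
  next
    case (Suc k)
    show ?thesis
    proof (cases "k < m")
      case True
      then have "g1 i = (\<lambda>x. 1 / (c * a k) * indicator (A k) x)" by (simp add: g1_def Suc)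
      then show ?thesis by (simp only: L2_scale[OF ind_L2[OF True]])
    qed (simp add: g1_def Suc)
  qed
  have inner_ind: "L2_inner D u (indicator (A k)) = a k * avg k u" if "k < m" for u k
    using a[OF that] by (simp add: avg_def a_def)
  have g1_Suc: "L2_inner D u (g1 (Suc k)) = avg k u / c" if "k < m" for u k
  proof -
    have "g1 (Suc k) = (\<lambda>x. 1 / (c * a k) * indicator (A k) x)" using that by (simp add: g1_def)
    then show ?thesis using a[OF that] by (simp only: L2_inner_scale_right inner_ind[OF that]) simp
  qed
  have g1_0: "L2_inner D u (g1 0) = (\<Sum>k<m. wt k * (avg k u / c))" if "u \<in> L2 D" for u
  proof -
    have "L2_inner D u (g1 0) = (\<Sum>k<m. L2_inner D u (\<lambda>x. 1 / (c * a0) * indicator (A k) x))"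
      unfolding g1_def nat.case by (intro L2_inner_sum_right L2_scale ind_L2 that) auto
    also have "\<dots> = (\<Sum>k<m. wt k * (avg k u / c))"
      by (intro sum.cong refl, simp only: L2_inner_scale_right inner_ind lessThan_iff wt_def) simp
    finally show ?thesis .
  qed
  define el where "el k x = B * osc U k x" for k x
  have elL: "el k \<in> L2 D" if "k < m" for k unfolding el_def by (rule L2_scale[OF osc_L2[OF UL that]])
  have dense: "\<exists>f. continuous_on UNIV f \<and> L2_norm D (\<lambda>x. f x - el k x) \<le> r" if "k < m" "r > 0" for k r
  proof -
    have "continuous_on UNIV (\<lambda>x. B * (U x - avg k U))" by (intro continuous_intros cU)
    from indicator_mult_continuous_approx[OF D dom(1) cell(1)[OF that(1)] this that(2)]
    show ?thesis by (simp add: el_def osc_def mult.left_commute)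
  qed
  obtain S where S: "fno_module D \<sigma> S" "\<forall>u\<in>L2 D. continuous_on UNIV (S u)"
    "\<And>u. u \<in> L2 D \<Longrightarrow> L2_inner D u (g1 0) \<in> I \<Longrightarrow>
        (\<forall>i<m. \<bar>L2_inner D u (g1 (Suc i)) / L2_inner D u (g1 0)\<bar> \<le> 2) \<Longrightarrow>
        L2_norm D (\<lambda>x. S u x - \<omega> (L2_inner D u (g1 0)) * (\<Sum>i<m. L2_inner D u (g1 (Suc i)) / L2_inner D u (g1 0) * el i x)) \<le> \<rho>"
    using fno_linear_response[OF D dom, where gs = g1 and \<sigma> = \<sigma> and I = I and \<omega> = \<omega> and Z = 2 and \<rho> = \<rho> and el = el and n = m,
        OF g1L \<sigma> app \<omega>32 I(2) _ \<rho>(1) elL dense] by (force simp only: zero_le_numeral)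

  \<comment> \<open>Dual functionals: gb reads the coefficient of an oscillation, ga an average,
    with a minus sign because p contains - y. Both undo the factor \<gamma>.\<close>
  define gb where "gb k x = 1 / (\<gamma> * B * (E k)\<^sup>2) * osc U k x" for k x
  define ga where "ga k x = - 1 / (\<gamma> * a k) * indicator (A k) x" for k and x :: "real^'d"
  define g2 where "g2 i = (case i of 0 \<Rightarrow> (\<lambda>x. \<Sum>k<m. wt k * gb k x)
      | Suc k \<Rightarrow> if k < m then gb k else if k < 2 * m then ga (k - m) else (\<lambda>x. 0))" for i
  have gbL: "gb k \<in> L2 D" if "k < m" for k unfolding gb_def by (rule L2_scale[OF osc_L2[OF UL that]])
  have gaL: "ga k \<in> L2 D" if "k < m" for k unfolding ga_def by (rule L2_scale[OF ind_L2[OF that]])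
  have g2L: "g2 i \<in> L2 D" for i
  proof (cases i)
    case 0
    have "(\<lambda>x. \<Sum>k<m. wt k * gb k x) \<in> L2 D" by (intro L2_sum L2_scale gbL) auto
    then show ?thesis by (simp add: g2_def 0)
  next
    case (Suc k)
    then show ?thesis using gbL[of k] gaL[of "k - m"] by (auto simp: g2_def)
  qed
  define Z where "Z = 2 * R1 + 4"
  have Z: "Z \<ge> 0" using R1 by (simp add: Z_def)
  define Mt where "Mt = (\<Sum>j<m. \<bar>t j (\<lambda>k. 0) (\<lambda>k. 0)\<bar>) + C * (real m * (2 * R1))"
  have Mt: "Mt \<ge> 0" using C R1 by (simp add: Mt_def sum_nonneg)
  \<comment> \<open>The inversion of both stages on grid values: digits below m are the ratios that
    encode f, the remaining ones the averages of y divided by b.\<close>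
  define H where "H j q b = t j (\<lambda>k. b * (h * real (q (m + k)) - Z)) (\<lambda>k. c * (V b * (h * real (q k) - Z) - 1))" for j q b
  have H_cont: "continuous_on I (H j q)" for j q
    unfolding continuous_on_def
  proof
    fix b assume "b \<in> I"
    let ?s = "\<lambda>b'. \<Sum>k<m. \<bar>b' * (h * real (q (m + k)) - Z) - b * (h * real (q (m + k)) - Z)\<bar>
        + \<bar>c * (V b' * (h * real (q k) - Z) - 1) - c * (V b * (h * real (q k) - Z) - 1)\<bar>"
    have "(V \<longlongrightarrow> V b) (at b within I)" using V(1) by (auto simp: continuous_on_def intro: tendsto_within_subset)
    then have "((\<lambda>b'. C * ?s b') \<longlongrightarrow> C * ?s b) (at b within I)" by (intro tendsto_intros)
    then have "((\<lambda>b'. C * ?s b') \<longlongrightarrow> 0) (at b within I)" by simp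
    then have "((\<lambda>b'. H j q b' - H j q b) \<longlongrightarrow> 0) (at b within I)"
      by (rule Lim_null_comparison[rotated]) (auto simp: H_def intro!: always_eventually t)
    then show "(H j q \<longlongrightarrow> H j q b) (at b within I)" by (simp add: LIM_zero_iff)
  qed
  have H_cong: "H j q = H j q'" if "\<And>i. i < 2 * m \<Longrightarrow> q i = q' i" for j and q q' :: "nat \<Rightarrow> nat"
  proof
    fix b
    have "\<bar>H j q b - H j q' b\<bar> \<le> C * (\<Sum>k<m. 0)"
      unfolding H_def by (rule order_trans[OF t]) (use that C in \<open>auto intro!: mult_left_mono sum_mono\<close>)
    then show "H j q b = H j q' b" by simp
  qed
  have n2: "2 * m \<ge> 1" using m by simp
  have "\<exists>N w W b G. fno_module D \<sigma> N \<and> (\<forall>l. w l \<ge> (1::nat)) \<and>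
     (\<forall>r (\<xi> :: real^'m) \<eta>. relu_net 2 w W b r \<xi> \<eta> = G r) \<and>
     (\<forall>u\<in>L2 D. (\<lambda>x. G (\<tau> * c - N u x)) \<in> L2 D) \<and>
     (\<forall>u\<in>L2 D. \<forall>t. L2_inner D u (g2 0) \<in> I \<longrightarrow>
        (\<forall>i\<in>{1..2 * m}. \<bar>L2_inner D u (g2 i) / L2_inner D u (g2 0)\<bar> \<le> Z) \<longrightarrow>
        (\<forall>j<m. \<bar>t j\<bar> \<le> Mt) \<longrightarrow>
        (\<forall>j<m. \<forall>q. (\<forall>i<2 * m. \<bar>L2_inner D u (g2 (Suc i)) / L2_inner D u (g2 0) - (h * real (q i) - Z)\<bar> \<le> h) \<longrightarrow>
           \<bar>t j - H j q (L2_inner D u (g2 0))\<bar> \<le> e) \<longrightarrow>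
        L2_norm D (\<lambda>x. step t x - G (\<tau> * c - N u x)) \<le> 2 * e * sqrt (measure lebesgue D) + e)"
    by (rule quantised_controller[OF cells_axioms m dom g2L \<sigma> app I(1,2) \<omega>(1,2) _ n2 h(1) Z e Mt H_cont H_cong])
      (rule \<omega>(4))
  then obtain N w W b G where N: "fno_module D \<sigma> N" "\<forall>l. w l \<ge> (1::nat)"
     "\<forall>r (\<xi> :: real^'m) \<eta>. relu_net 2 w W b r \<xi> \<eta> = G r"
     "\<forall>u\<in>L2 D. (\<lambda>x. G (\<tau> * c - N u x)) \<in> L2 D"
     "\<And>u t. u \<in> L2 D \<Longrightarrow> L2_inner D u (g2 0) \<in> I \<Longrightarrow>
        \<forall>i\<in>{1..2 * m}. \<bar>L2_inner D u (g2 i) / L2_inner D u (g2 0)\<bar> \<le> Z \<Longrightarrow>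
        \<forall>j<m. \<bar>t j\<bar> \<le> Mt \<Longrightarrow>
        \<forall>j<m. \<forall>q. (\<forall>i<2 * m. \<bar>L2_inner D u (g2 (Suc i)) / L2_inner D u (g2 0) - (h * real (q i) - Z)\<bar> \<le> h) \<longrightarrow>
           \<bar>t j - H j q (L2_inner D u (g2 0))\<bar> \<le> e \<Longrightarrow>
        L2_norm D (\<lambda>x. step t x - G (\<tau> * c - N u x)) \<le> 2 * e * sqrt (measure lebesgue D) + e"
    by blast

  have main: "L2_norm D (\<lambda>x. step (\<lambda>j. t j (\<lambda>k. avg k y) (\<lambda>k. avg k f)) x
          - G (\<tau> * c - N (\<lambda>x. \<gamma> * (S (\<lambda>x. c + f x) x - y x)) x)) \<le> 2 * e * sqrt (measure lebesgue D) + e"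
    if yf: "(y, f) \<in> K" for y f
  proof -
    have yL: "y \<in> L2 D" and fL: "f \<in> L2 D" and yR: "L2_norm D y \<le> R" and fR: "L2_norm D f \<le> R"
      using K[OF yf] by auto
    define v where "v = (\<lambda>x. c + f x)"
    have vL: "v \<in> L2 D" unfolding v_def by (rule L2_add[OF L2_const[OF D] fL])
    define l where "l k = avg k v / c" for k
    have l: "l k = 1 + avg k f / c" if "k < m" for k
      using c(1) by (simp add: l_def v_def avg_const_add[OF fL that] add_divide_distrib)
    have l1: "\<bar>l k - 1\<bar> \<le> \<kappa>" if "k < m" for k
    proof -
      have "\<bar>avg k f\<bar> \<le> \<kappa> * c" using avg_le[OF fL fR that] c(2) by (simp add: R1_def)
      then show ?thesis using c(1) by (simp add: l[OF that] pos_divide_le_eq)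
    qed
    define bb where "bb = L2_inner D v (g1 0)"
    have bb: "bb = (\<Sum>k<m. wt k * l k)" unfolding bb_def g1_0[OF vL] l_def ..
    have bb1: "\<bar>bb - 1\<bar> \<le> \<kappa>" unfolding bb by (rule wavg[OF l1])
    have bbI: "bb \<in> I" using bb1 \<kappa>(3) by (auto simp: I_def)
    have bb78: "bb \<ge> 7/8" using bb1 \<kappa>(4) by linarith
    define z where "z k = l k / bb" for k
    have z2: "\<bar>z k\<bar> \<le> 2" if "k < m" for k
    proof -
      have "\<bar>l k\<bar> \<le> 2 * bb" using l1[OF that] \<kappa>(4) bb78 by linarith
      then show ?thesis using bb78 by (simp add: z_def pos_divide_le_eq)
    qed
    have zsum: "(\<Sum>k<m. wt k * z k) = 1"
      using bb78 by (simp add: z_def sum_divide_distrib[symmetric] bb[symmetric])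
    define wb where "wb = \<omega> bb"
    have wb: "\<bar>wb - 1\<bar> \<le> \<delta> / 2" unfolding wb_def using \<kappa>0(2)[OF bbI] bb1 \<kappa>(2) by linarith
    define s where "s = S v"
    have sL: "s \<in> L2 D" unfolding s_def by (rule continuous_L2[OF D dom(1)]) (use S(2) vL in blast)
    define M where "M x = wb * (\<Sum>k<m. z k * el k x)" for x
    have M_L2: "M \<in> L2 D" unfolding M_def by (intro L2_scale L2_sum elL) auto
    define err where "err = (\<lambda>x. s x - M x)"
    have errL: "err \<in> L2 D" unfolding err_def by (rule L2_diff[OF sL M_L2])
    have err: "L2_norm D err \<le> \<rho>"
    proof -
      have "\<forall>i<m. \<bar>L2_inner D v (g1 (Suc i)) / L2_inner D v (g1 0)\<bar> \<le> 2"
        using z2 by (simp add: g1_Suc l_def z_def bb_def)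
      from S(3)[OF vL bbI[unfolded bb_def] this]
      have "L2_norm D (\<lambda>x. s x - wb * (\<Sum>i<m. L2_inner D v (g1 (Suc i)) / bb * el i x)) \<le> \<rho>"
        by (simp add: s_def wb_def bb_def)
      moreover have "(\<Sum>i<m. L2_inner D v (g1 (Suc i)) / bb * el i x) = (\<Sum>i<m. z i * el i x)" for x
        by (intro sum.cong refl) (simp add: g1_Suc l_def z_def)
      ultimately show ?thesis by (simp add: err_def M_def)
    qed
    have M_inner: "L2_inner D M u = wb * (\<Sum>k<m. z k * (B * L2_inner D (osc U k) u))" if u: "u \<in> L2 D" for u
    proof -
      have "L2_inner D M u = wb * L2_inner D (\<lambda>x. \<Sum>k<m. z k * el k x) u"
        unfolding M_def by (rule L2_inner_scale_left)
      also have "L2_inner D (\<lambda>x. \<Sum>k<m. z k * el k x) u = (\<Sum>k<m. L2_inner D (\<lambda>x. z k * el k x) u)"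
        by (intro L2_inner_sum_left L2_scale elL u) auto
      also have "\<dots> = (\<Sum>k<m. z k * (B * L2_inner D (osc U k) u))"
        unfolding L2_inner_scale_left el_def ..
      finally show ?thesis .
    qed
    have M_osc: "L2_inner D M (osc U k) = wb * z k * B * (E k)\<^sup>2" if k: "k < m" for k
    proof -
      have "(\<Sum>l<m. z l * (B * L2_inner D (osc U l) (osc U k))) = (\<Sum>l<m. if l = k then z k * (B * (E k)\<^sup>2) else 0)"
        by (intro sum.cong refl) (use k in \<open>auto simp: EE inner_osc_osc\<close>)
      then show ?thesis using k by (simp add: M_inner[OF osc_L2[OF UL k]])
    qed
    \<comment> \<open>The stored copy of f is invisible to the cell averages, so those of y survive
      in p.\<close>
    have M_ind: "L2_inner D M (indicator (A k)) = 0" if k: "k < m" for k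
      unfolding M_inner[OF ind_L2[OF k]] using k by (simp add: inner_osc_indicator[OF UL])
    define p where "p = (\<lambda>x. \<gamma> * (s x - y x))"
    have pL: "p \<in> L2 D" unfolding p_def by (rule L2_scale[OF L2_diff[OF sL yL]])
    have p_inner: "L2_inner D p u = \<gamma> * (L2_inner D M u + L2_inner D err u - L2_inner D y u)" if u: "u \<in> L2 D" for u
    proof -
      have "L2_inner D p u = \<gamma> * (L2_inner D s u - L2_inner D y u)"
        unfolding p_def L2_inner_scale_left L2_inner_diff_left[OF sL yL u] ..
      moreover have "L2_inner D err u = L2_inner D s u - L2_inner D M u"
        unfolding err_def by (rule L2_inner_diff_left[OF sL M_L2 u])
      ultimately show ?thesis by simp
    qed
    define \<beta> where "\<beta> k = L2_inner D p (gb k)" for k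
    define \<alpha> where "\<alpha> k = L2_inner D p (ga k)" for k
    have \<beta>: "\<bar>\<beta> k - wb * z k\<bar> \<le> \<eta>" if k: "k < m" for k
    proof -
      have oL: "osc U k \<in> L2 D" by (rule osc_L2[OF UL k])
      define g where "g = L2_inner D err (osc U k) - L2_inner D y (osc U k)"
      have "\<beta> k = 1 / (\<gamma> * B * (E k)\<^sup>2) * (\<gamma> * (wb * z k * B * (E k)\<^sup>2 + g))"
        unfolding \<beta>_def gb_def L2_inner_scale_right p_inner[OF oL] M_osc[OF k] g_def by simp
      also have "\<dots> = wb * z k + g / (B * (E k)\<^sup>2)" using \<gamma> B E[OF k] by (simp add: field_simps)
      finally have "\<beta> k - wb * z k = g / (B * (E k)\<^sup>2)" by simp
      moreover have "\<bar>g\<bar> \<le> (\<rho> + R) * E k"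
      proof -
        have "\<bar>g\<bar> \<le> L2_norm D err * E k + L2_norm D y * E k"
          unfolding g_def E_def using L2_Cauchy_Schwarz[OF errL oL] L2_Cauchy_Schwarz[OF yL oL] by linarith
        also have "\<dots> \<le> \<rho> * E k + R * E k" using err yR E[OF k] by (intro add_mono mult_right_mono) auto
        finally show ?thesis by (simp add: distrib_right)
      qed
      ultimately have "\<bar>\<beta> k - wb * z k\<bar> \<le> (\<rho> + R) * E k / (B * (E k)\<^sup>2)"
        using B E[OF k] by (simp add: abs_divide abs_mult divide_right_mono)
      also have "\<dots> = (\<rho> + R) / (B * E k)" using E[OF k] by (simp add: power2_eq_square)
      finally show ?thesis using BE[OF k] by linarith
    qed
    have \<alpha>: "\<bar>\<alpha> k - avg k y\<bar> \<le> \<eta>" if k: "k < m" for k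
    proof -
      have "\<alpha> k = - 1 / (\<gamma> * a k) * (\<gamma> * (0 + a k * avg k err - a k * avg k y))"
        unfolding \<alpha>_def ga_def L2_inner_scale_right p_inner[OF ind_L2[OF k]]
        unfolding M_ind[OF k] unfolding inner_ind[OF k] ..
      also have "\<dots> = avg k y - avg k err" using \<gamma> a[OF k] by (simp add: field_simps)
      finally show ?thesis using avg_le[OF errL err k] \<rho>(2) by simp
    qed
    define b' where "b' = L2_inner D p (g2 0)"
    have b': "b' = (\<Sum>k<m. wt k * \<beta> k)"
    proof -
      have "b' = (\<Sum>k<m. L2_inner D p (\<lambda>x. wt k * gb k x))"
        unfolding b'_def g2_def nat.case by (intro L2_inner_sum_right L2_scale gbL pL) auto
      then show ?thesis by (simp only: L2_inner_scale_right \<beta>_def)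
    qed
    \<comment> \<open>The ratios z have weighted mean 1, so the weighted mean of the \<beta> exposes
      the factor wb itself.\<close>
    have bw: "\<bar>b' - wb\<bar> \<le> \<eta>"
    proof -
      have "b' - wb = (\<Sum>k<m. wt k * (\<beta> k - wb * z k)) "
        using zsum by (simp add: b' right_diff_distrib sum_subtractf mult.left_commute[of _ wb] sum_distrib_left[symmetric])
      moreover have "\<bar>(\<Sum>k<m. wt k * (\<beta> k - wb * z k)) - 0\<bar> \<le> \<eta>" by (rule wavg) (use \<beta> in simp)
      ultimately show ?thesis by simp
    qed
    have "1 - \<delta> \<le> b'" "b' \<le> 1 + \<delta>" using bw wb \<eta>(2) by linarith+
    then have b'I: "b' \<in> I" by (simp add: I_def)
    have b'12: "1/2 \<le> b'" "b' \<le> 3/2" using b'I \<delta>(2) by (auto simp: I_def)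
    have z1: "\<bar>\<beta> k / b' - z k\<bar> \<le> 6 * \<eta>" if "k < m" for k
      by (rule ratio_estimate[OF \<beta>[OF that] bw z2[OF that] b'12(1)]) (use \<eta>(1) in simp)
    have g2b: "L2_inner D p (g2 (Suc k)) = \<beta> k" if "k < m" for k using that by (simp add: g2_def \<beta>_def)
    have g2a: "L2_inner D p (g2 (Suc (m + k))) = \<alpha> k" if "k < m" for k using that by (simp add: g2_def \<alpha>_def)
    have Zbd: "\<bar>L2_inner D p (g2 i) / b'\<bar> \<le> Z" if i: "i \<in> {1..2 * m}" for i
    proof -
      obtain k where k: "i = Suc k" using i by (cases i) auto
      show ?thesis
      proof (cases "k < m")
        case True
        have "\<bar>\<beta> k / b'\<bar> \<le> 2 + 6 * \<eta>" using z1[OF True] z2[OF True] by linarith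
        also have "\<dots> \<le> Z" using \<eta>(2) \<delta>(2) R1 by (simp add: Z_def)
        finally show ?thesis unfolding k g2b[OF True] .
      next
        case False
        define l where "l = k - m"
        have l: "l < m" "k = m + l" using False i k by (auto simp: l_def)
        have "\<bar>\<alpha> l\<bar> \<le> R1 + 1" using \<alpha>[OF l(1)] avg_le[OF yL yR l(1)] \<eta>(2) \<delta>(2) unfolding R1_def by linarith
        then have "\<bar>\<alpha> l\<bar> \<le> 2 * (R1 + 1) * (1/2)" by simp
        also have "\<dots> \<le> 2 * (R1 + 1) * b'" using R1 b'12 by (intro mult_left_mono) auto
        also have "\<dots> \<le> Z * b'" using R1 b'12 by (intro mult_right_mono) (auto simp: Z_def)
        finally show ?thesis unfolding k l(2) g2a[OF l(1)] using b'12 by (simp add: pos_divide_le_eq)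
      qed
    qed
    have tMt: "\<bar>t j (\<lambda>k. avg k y) (\<lambda>k. avg k f)\<bar> \<le> Mt" if j: "j < m" for j
    proof -
      have "\<bar>t j (\<lambda>k. avg k y) (\<lambda>k. avg k f) - t j (\<lambda>k. 0) (\<lambda>k. 0)\<bar> \<le> C * (\<Sum>k<m. \<bar>avg k y - 0\<bar> + \<bar>avg k f - 0\<bar>)"
        by (rule t)
      also have "\<dots> \<le> C * (\<Sum>k<m. R1 + R1)"
        using C avg_le[OF yL yR] avg_le[OF fL fR] by (intro mult_left_mono sum_mono add_mono) (auto simp: R1_def)
      finally have 1: "\<bar>t j (\<lambda>k. avg k y) (\<lambda>k. avg k f) - t j (\<lambda>k. 0) (\<lambda>k. 0)\<bar> \<le> C * (real m * (2 * R1))" by simp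
      have "\<bar>t j (\<lambda>k. 0) (\<lambda>k. 0)\<bar> \<le> (\<Sum>j<m. \<bar>t j (\<lambda>k. 0) (\<lambda>k. 0)\<bar>)"
        using j by (intro member_le_sum) auto
      then show ?thesis using 1 unfolding Mt_def by linarith
    qed
    have tH: "\<bar>t j (\<lambda>k. avg k y) (\<lambda>k. avg k f) - H j q b'\<bar> \<le> e"
      if q: "\<forall>i<2 * m. \<bar>L2_inner D p (g2 (Suc i)) / b' - (h * real (q i) - Z)\<bar> \<le> h" for j q
    proof -
      have "dist b' wb < dV" using bw \<eta>(3) by (simp add: dist_real_def)
      moreover have "1/2 \<le> wb" "wb \<le> 3/2" using wb \<delta>(2) by linarith+
      ultimately have "dist (V b') (V wb) < tol / (4 * c)" using b'12 by (intro dV(2)) auto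
      then have Vb: "\<bar>V b' - bb\<bar> \<le> tol / (4 * c)" using V(3)[OF bbI] by (simp add: wb_def dist_real_def)
      have 1: "\<bar>avg k f - c * (V b' * (h * real (q k) - Z) - 1)\<bar> \<le> tol" if k: "k < m" for k
      proof -
        have "\<bar>\<beta> k / b' - (h * real (q k) - Z)\<bar> \<le> h" using q[rule_format, of k] k by (simp add: g2b)
        from decoded_coordinate_error[OF this z1[OF k] V(2) Vb z2[OF k], of c]
        have "\<bar>c * (bb * z k - 1) - c * (V b' * (h * real (q k) - Z) - 1)\<bar> \<le> tol" using c(1) cMV by linarith
        moreover have "c * (bb * z k - 1) = avg k f" using bb78 c(1) by (simp add: z_def l[OF k])
        ultimately show ?thesis by simp
      qed
      have 2: "\<bar>avg k y - b' * (h * real (q (m + k)) - Z)\<bar> \<le> tol" if k: "k < m" for k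
      proof -
        have "\<bar>\<alpha> k / b' - (h * real (q (m + k)) - Z)\<bar> \<le> h" using q[rule_format, of "m + k"] k by (simp add: g2a)
        then have "b' * \<bar>\<alpha> k / b' - (h * real (q (m + k)) - Z)\<bar> \<le> 3/2 * h" using b'12 by (intro mult_mono) auto
        moreover have "b' * \<bar>\<alpha> k / b' - (h * real (q (m + k)) - Z)\<bar> = \<bar>b' * (\<alpha> k / b' - (h * real (q (m + k)) - Z))\<bar>"
          using b'12 by (simp add: abs_mult)
        moreover have "b' * (\<alpha> k / b' - (h * real (q (m + k)) - Z)) = \<alpha> k - b' * (h * real (q (m + k)) - Z)"
          using b'12 by (simp add: right_diff_distrib)
        ultimately have "\<bar>\<alpha> k - b' * (h * real (q (m + k)) - Z)\<bar> \<le> 3/2 * h" by simp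
        then show ?thesis using \<alpha>[OF k] h(2) \<eta>(4) tol by linarith
      qed
      have "\<bar>t j (\<lambda>k. avg k y) (\<lambda>k. avg k f) - H j q b'\<bar>
         \<le> C * (\<Sum>k<m. \<bar>avg k y - b' * (h * real (q (m + k)) - Z)\<bar> + \<bar>avg k f - c * (V b' * (h * real (q k) - Z) - 1)\<bar>)"
        unfolding H_def by (rule t)
      also have "\<dots> \<le> C * (\<Sum>k<m. tol + tol)"
        using C 1 2 by (intro mult_left_mono sum_mono add_mono) auto
      also have "\<dots> \<le> e" using Ctol by simp
      finally show ?thesis .
    qed
    have "L2_norm D (\<lambda>x. step (\<lambda>j. t j (\<lambda>k. avg k y) (\<lambda>k. avg k f)) x - G (\<tau> * c - N p x)) \<le> 2 * e * sqrt (measure lebesgue D) + e"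
      by (rule N(5)[OF pL]) (use b'I Zbd tMt tH in \<open>auto simp: b'_def\<close>)
    then show ?thesis by (simp only: p_def s_def v_def)
  qed
  show ?thesis
    by (rule exI[of _ c], rule exI[of _ S], rule exI[of _ N], rule exI[of _ w], rule exI[of _ W], rule exI[of _ b], rule exI[of _ G])
      (use S(1,2) N(1-4) main in blast)
qed

end

section \<open>Assembling the two layers\<close>

lemma relu_net_const:
  obtains n W b where "\<And>l. n l \<ge> (1::nat)" "\<And>r (\<xi> :: real^'m) \<eta>. relu_net 1 n W b r \<xi> \<eta> = c"
  by (rule that[of "\<lambda>_. 1" "\<lambda>_ _ _. 0" "\<lambda>_ _. c"]) (simp_all add: relu_net_def weight_apply_def)

text \<open>The lifting P = 0 removes the kernel part and leaves \<open>\<gamma> * u\<close>, so the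
  dual update neither loses nor mixes information.\<close>

lemma qs_module_scale:
  fixes D :: "(real^'d) set"
  assumes "D \<in> lmeasurable" "closure D \<subset> torus_cube"
  shows "qs_module D \<gamma> (\<lambda>u x. \<gamma> * u x)"
proof -
  obtain E where E: "extension_operator D E"
  proof (rule extension_operator_prescribed[OF assms, where g = "\<lambda>_ _. 0" and K = 0])
    fix E assume "extension_operator D E"
    then show ?thesis by (rule that)
  qed simp_all
  show ?thesis
    unfolding qs_module_def
    by (rule exI[of _ E], rule exI[of _ 1], rule exI[of _ "\<lambda>_. 0"], rule exI[of _ "\<lambda>_ _. 0"], rule exI[of _ "\<lambda>_ _ _. 0"])
      (use E in \<open>auto simp: L2_torus_def\<close>)
qed

theorem theorem3p8:
  fixes \<Omega> :: "(real^'d) set"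
    and S N :: "(real^'d \<Rightarrow> real) \<Rightarrow> (real^'d \<Rightarrow> real)"
    and \<theta> :: "(real^'d \<Rightarrow> real) \<Rightarrow> ereal"
    and T :: "(real^'d \<Rightarrow> real) \<times> (real^'d \<Rightarrow> real) \<Rightarrow> (real^'d \<Rightarrow> real)"
    and lam :: "real^'d \<Rightarrow> real"
    and \<mu> :: "real^'d \<Rightarrow> real^'m"
    and E :: "(real^'m) set"
    and \<psi> :: "real^'m \<Rightarrow> real \<Rightarrow> ereal"
    and \<sigma> :: "real \<Rightarrow> real"
    and c0 \<tau> \<gamma> \<epsilon> :: real
    and K :: "((real^'d \<Rightarrow> real) \<times> (real^'d \<Rightarrow> real)) set"
  assumes domain: "lipschitz_domain \<Omega>" "closure \<Omega> \<subseteq> torus_cube"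
    and S: "L2_bounded_linear \<Omega> \<Omega> S"
    and N: "L2_bounded_linear \<Omega> \<Omega> N" "L2_self_adjoint \<Omega> N"
           "c0 > 0" "\<forall>u\<in>L2 \<Omega>. L2_inner \<Omega> u (N u) \<ge> c0 * (L2_norm \<Omega> u)\<^sup>2"
    and \<theta>: "L2_convex_lsc_proper \<Omega> \<theta>"
    and N_pointwise: "lam \<in> Linfty \<Omega>" "AE x in lebesgue_on \<Omega>. lam x \<ge> c0"
           "\<forall>u\<in>L2 \<Omega>. AE x in lebesgue_on \<Omega>. N u x = lam x * u x"
    and \<theta>_pointwise: "closed E" "\<forall>\<xi>\<in>E. convex_lsc_proper (\<psi> \<xi>)"
           "\<mu> \<in> Linfty \<Omega>" "AE x in lebesgue_on \<Omega>. \<mu> x \<in> E"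
           "\<forall>u\<in>L2 \<Omega>. has_ereal_integral (lebesgue_on \<Omega>) (\<lambda>x. \<psi> (\<mu> x) (u x)) (\<theta> u)"
    and T: "solution_operator \<Omega> S N \<theta> T"
    and net: "nonlinear_activation \<sigma>" "\<tau> \<ge> 0" "\<gamma> > 0"
    and K: "compactin (prod_topology (L2_topology \<Omega>) (L2_topology \<Omega>)) K"
    and \<epsilon>: "\<epsilon> > 0"
  shows "\<exists>\<T>. iuzawa_net \<Omega> \<mu> lam \<sigma> \<tau> \<gamma> 2 \<T> \<and>
           (\<forall>yd\<in>L2 \<Omega>. \<forall>f\<in>L2 \<Omega>. \<T> (yd, f) \<in> L2 \<Omega>) \<and>
           (SUP (yd, f)\<in>K. ereal (L2_norm \<Omega> (\<lambda>x. T (yd, f) x - \<T> (yd, f) x))) \<le> ereal \<epsilon>"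
proof -
  have dom: "open \<Omega>" "\<Omega> \<noteq> {}" "bounded \<Omega>" using domain(1) by (auto simp: lipschitz_domain_def)
  have D: "\<Omega> \<in> lmeasurable" using lmeasurable_open[OF dom(3,1)] .
  have Dpos: "measure lebesgue \<Omega> > 0"
  proof (rule ccontr)
    assume "\<not> measure lebesgue \<Omega> > 0"
    then have "negligible \<Omega>" using D by (simp add: negligible_iff_measure zero_less_measure_iff)
    then show False using open_not_negligible[OF dom(1,2)] by blast
  qed
  \<comment> \<open>Strictness provides the gap in which extensions may be prescribed. Equality
    would make the cube open and closed, hence empty or the whole space.\<close>
  have strict: "closure \<Omega> \<subset> torus_cube"
  proof -
    have "closure \<Omega> \<noteq> torus_cube"
    proof
      assume eq: "closure \<Omega> = torus_cube"
      then have "closed (torus_cube :: (real^'d) set)" by (metis closed_closure)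
      then have "(torus_cube :: (real^'d) set) = {} \<or> (torus_cube :: (real^'d) set) = UNIV"
        using open_torus_cube clopen by blast
      moreover have "bounded (torus_cube :: (real^'d) set)" using dom(3) eq by (metis bounded_closure)
      ultimately show False using dom(2) eq closure_subset[of \<Omega>] not_bounded_UNIV by auto
    qed
    then show ?thesis using domain(2) by blast
  qed
  have TL: "T (y, f) \<in> L2 \<Omega>" if "y \<in> L2 \<Omega>" "f \<in> L2 \<Omega>" for y f
    using T that unfolding solution_operator_def optimal_control_def admissible_def by fast
  obtain C where C: "C \<ge> 0"
    "\<And>yd f yd' f'. yd \<in> L2 \<Omega> \<Longrightarrow> f \<in> L2 \<Omega> \<Longrightarrow> yd' \<in> L2 \<Omega> \<Longrightarrow> f' \<in> L2 \<Omega> \<Longrightarrow>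
       L2_norm \<Omega> (\<lambda>x. T (yd, f) x - T (yd', f') x)
         \<le> C * (L2_norm \<Omega> (\<lambda>x. yd x - yd' x) + L2_norm \<Omega> (\<lambda>x. f x - f' x))"
    by (rule solution_operator_Lipschitz[OF D S N(1,3,4) \<theta> T], rule that)
  have \<epsilon>2: "\<epsilon> / 2 > 0" using \<epsilon> by simp
  obtain m A where mA: "cells \<Omega> m A" "m \<ge> 1"
    "\<And>y f. (y, f) \<in> K \<Longrightarrow> L2_norm \<Omega> (\<lambda>x. T (y, f) x
        - cells.step m A (\<lambda>j. cells.avg \<Omega> A j (T (cells.step m A (\<lambda>k. cells.avg \<Omega> A k y), cells.step m A (\<lambda>k. cells.avg \<Omega> A k f)))) x) \<le> \<epsilon> / 2"
  proof (rule cells_for_Lipschitz_map[OF D Dpos K C(1) _ _ \<epsilon>2])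
    show "T (y, f) \<in> L2 \<Omega>" if "y \<in> L2 \<Omega>" "f \<in> L2 \<Omega>" for y f by (rule TL[OF that])
  qed (rule C(2); assumption | rule that; assumption)+
  interpret cells \<Omega> m A by (rule mA(1))
  obtain R where R: "R \<ge> 0" "\<And>y f. (y, f) \<in> K \<Longrightarrow> L2_norm \<Omega> y \<le> R \<and> L2_norm \<Omega> f \<le> R"
    by (rule compactin_L2_bounded[OF K], rule that)
  have KL2: "y \<in> L2 \<Omega> \<and> f \<in> L2 \<Omega>" if "(y, f) \<in> K" for y f
    using compactin_subset_topspace[OF K] that by (auto simp: topspace_prod_topology topspace_L2_topology)
  obtain g where g: "\<And>s. \<bar>\<sigma> s\<bar> \<le> g * (1 + \<bar>s\<bar>)" using net(1) unfolding nonlinear_activation_def by blast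
  have \<sigma>: "continuous_on UNIV \<sigma>" "\<not> (\<exists>a b. \<forall>s. \<sigma> s = a * s + b)"
    using net(1) unfolding nonlinear_activation_def by blast+
  obtain \<omega> \<delta> where \<omega>: "0 < \<delta>" "\<delta> \<le> 1/2" "continuous_on {1-\<delta>..1+\<delta>} \<omega>" "inj_on \<omega> {1-\<delta>..1+\<delta>}"
    "\<omega> 1 = 1" "\<And>b. b \<in> {1-\<delta>..1+\<delta>} \<Longrightarrow> \<bar>\<omega> b - 1\<bar> \<le> 1/2"
    "\<And>j M. net_approx \<sigma> scalar_forms {1-\<delta>..1+\<delta>} {-M..M} (\<lambda>b y. \<omega> b * y ^ j)"
    by (rule injective_profile_exists[OF \<sigma> g], rule that)
  obtain C' where C': "C' \<ge> 0" "\<And>j \<alpha> \<zeta> \<alpha>' \<zeta>'. j < m \<Longrightarrow>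
    \<bar>avg j (T (step \<alpha>, step \<zeta>)) - avg j (T (step \<alpha>', step \<zeta>'))\<bar> \<le> C' * (\<Sum>k<m. \<bar>\<alpha> k - \<alpha>' k\<bar> + \<bar>\<zeta> k - \<zeta>' k\<bar>)"
    by (rule cell_map_Lipschitz[OF C(1) TL C(2)], assumption+, rule that)
  \<comment> \<open>The value 0 for indices from m on makes the Lipschitz bound hold for every
    j.\<close>
  define t where "t j \<alpha> \<zeta> = (if j < m then avg j (T (step \<alpha>, step \<zeta>)) else 0)" for j \<alpha> \<zeta>
  have t: "\<bar>t j \<alpha> \<zeta> - t j \<alpha>' \<zeta>'\<bar> \<le> C' * (\<Sum>k<m. \<bar>\<alpha> k - \<alpha>' k\<bar> + \<bar>\<zeta> k - \<zeta>' k\<bar>)" for j \<alpha> \<zeta> \<alpha>' \<zeta>'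
    using C' by (auto simp: t_def intro!: mult_nonneg_nonneg sum_nonneg)
  define d where "d = 2 * sqrt (measure lebesgue \<Omega>) + 1"
  have d: "d > 0" by (simp add: d_def add_nonneg_pos)
  define e where "e = \<epsilon> / (2 * d)"
  have e: "e > 0" "2 * e * sqrt (measure lebesgue \<Omega>) + e = \<epsilon> / 2"
  proof -
    show "e > 0" using \<epsilon> d by (simp add: e_def)
    have "2 * e * sqrt (measure lebesgue \<Omega>) + e = e * d" by (simp add: d_def algebra_simps)
    also have "\<dots> = \<epsilon> / 2" using d by (simp add: e_def)
    finally show "2 * e * sqrt (measure lebesgue \<Omega>) + e = \<epsilon> / 2" .
  qed
  have KR: "y \<in> L2 \<Omega> \<and> f \<in> L2 \<Omega> \<and> L2_norm \<Omega> y \<le> R \<and> L2_norm \<Omega> f \<le> R" if "(y, f) \<in> K" for y f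
    using KL2[OF that] R(2)[OF that] by blast
  have "\<exists>c S N w W b G. fno_module \<Omega> \<sigma> S \<and> (\<forall>u\<in>L2 \<Omega>. continuous_on UNIV (S u)) \<and>
     fno_module \<Omega> \<sigma> N \<and> (\<forall>l. w l \<ge> (1::nat)) \<and>
     (\<forall>r (\<xi> :: real^'m) \<eta>. relu_net 2 w W b r \<xi> \<eta> = G r) \<and>
     (\<forall>u\<in>L2 \<Omega>. (\<lambda>x. G (\<tau> * c - N u x)) \<in> L2 \<Omega>) \<and>
     (\<forall>y f. (y, f) \<in> K \<longrightarrow>
        L2_norm \<Omega> (\<lambda>x. step (\<lambda>j. t j (\<lambda>k. avg k y) (\<lambda>k. avg k f)) x
          - G (\<tau> * c - N (\<lambda>x. \<gamma> * (S (\<lambda>x. c + f x) x - y x)) x)) \<le> 2 * e * sqrt (measure lebesgue \<Omega>) + e)"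
    by (rule two_stage_approximation[OF mA(2) dom(3) strict KR R(1) \<sigma>(1) \<omega>(1-5) _ \<omega>(7) C'(1) t net(3) e(1)])
      (assumption, rule \<omega>(6))
  then obtain c S0 A1 w W b G where net2: "fno_module \<Omega> \<sigma> S0" "\<forall>u\<in>L2 \<Omega>. continuous_on UNIV (S0 u)"
     "fno_module \<Omega> \<sigma> A1" "\<forall>l. w l \<ge> (1::nat)"
     "\<forall>r (\<xi> :: real^'m) \<eta>. relu_net 2 w W b r \<xi> \<eta> = G r"
     "\<forall>u\<in>L2 \<Omega>. (\<lambda>x. G (\<tau> * c - A1 u x)) \<in> L2 \<Omega>"
     "\<And>y f. (y, f) \<in> K \<Longrightarrow>
        L2_norm \<Omega> (\<lambda>x. step (\<lambda>j. t j (\<lambda>k. avg k y) (\<lambda>k. avg k f)) x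
          - G (\<tau> * c - A1 (\<lambda>x. \<gamma> * (S0 (\<lambda>x. c + f x) x - y x)) x)) \<le> 2 * e * sqrt (measure lebesgue \<Omega>) + e"
    by blast
  obtain w' W' b' where const: "\<And>l. w' l \<ge> (1::nat)" "\<And>r (\<xi> :: real^'m) \<eta>. relu_net 1 w' W' b' r \<xi> \<eta> = c"
    by (rule relu_net_const[of c], rule that)
  \<comment> \<open>As \<open>QA 0\<close> is constant, any FNO module may serve as the first A. The
    second S and the second dual update affect only p^2, and the output is u^2, so S0 is simply
    repeated.\<close>
  define SS where "SS = (\<lambda>k :: nat. S0)"
  define AA where "AA = (\<lambda>k :: nat. if k = 0 then S0 else A1)"
  define QS where "QS = (\<lambda>(k :: nat) u (x :: real^'d). \<gamma> * u x)"
  define QA where "QA = (\<lambda>(k :: nat) u (x :: real^'d). if k = 0 then c else G (u x))"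
  define \<T> where "\<T> = (\<lambda>(yd, f). fst (iuzawa_iter \<tau> SS AA QS QA yd f 2))"
  have qa: "qa_module \<mu> lam (QA k)" for k
  proof (cases "k = 0")
    case True
    have "1 \<ge> (1::nat) \<and> (\<forall>l. w' l \<ge> 1) \<and> QA k = (\<lambda>u x. relu_net 1 w' W' b' (u x) (\<mu> x) (lam x))"
      using const True by (simp add: QA_def)
    then show ?thesis unfolding qa_module_def by blast
  next
    case False
    have "2 \<ge> (1::nat) \<and> (\<forall>l. w l \<ge> 1) \<and> QA k = (\<lambda>u x. relu_net 2 w W b (u x) (\<mu> x) (lam x))"
      using net2(4,5) False by (simp add: QA_def)
    then show ?thesis unfolding qa_module_def by blast
  qed
  have fno: "fno_module \<Omega> \<sigma> (SS k)" "fno_module \<Omega> \<sigma> (AA k)" for k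
    using net2(1,3) by (simp_all add: SS_def AA_def)
  have qs: "qs_module \<Omega> \<gamma> (QS k)" for k
    unfolding QS_def by (rule qs_module_scale[OF D strict])
  have iu: "iuzawa_net \<Omega> \<mu> lam \<sigma> \<tau> \<gamma> 2 \<T>"
    unfolding iuzawa_net_def \<T>_def
    by (rule exI[of _ SS], rule exI[of _ AA], rule exI[of _ QS], rule exI[of _ QA]) (use fno qs qa in simp)
  \<comment> \<open>The unrolled iteration: u^1 = c, then p^1 = \<gamma> * (S0 (c + f) - y_d)
    because p^0 = 0, and finally u^2.\<close>
  have \<T>: "\<T> (yd, f) = (\<lambda>x. G (\<tau> * c - A1 (\<lambda>x. \<gamma> * (S0 (\<lambda>x. c + f x) x - yd x)) x))" for yd f
    by (simp add: \<T>_def numeral_2_eq_2 SS_def AA_def QS_def QA_def Let_def)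
  have \<T>L: "\<T> (yd, f) \<in> L2 \<Omega>" if "yd \<in> L2 \<Omega>" "f \<in> L2 \<Omega>" for yd f
  proof -
    have "(\<lambda>x. c + f x) \<in> L2 \<Omega>" by (rule L2_add[OF L2_const[OF D] that(2)])
    then have "S0 (\<lambda>x. c + f x) \<in> L2 \<Omega>" using net2(2) continuous_L2[OF D dom(3)] by blast
    then have "(\<lambda>x. \<gamma> * (S0 (\<lambda>x. c + f x) x - yd x)) \<in> L2 \<Omega>" by (intro L2_scale L2_diff that)
    then show ?thesis using net2(6) unfolding \<T> by blast
  qed
  have err: "L2_norm \<Omega> (\<lambda>x. T (yd, f) x - \<T> (yd, f) x) \<le> \<epsilon>" if yf: "(yd, f) \<in> K" for yd f
  proof -
    have L: "yd \<in> L2 \<Omega>" "f \<in> L2 \<Omega>" using KL2[OF yf] by auto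
    have "step (\<lambda>j. avg j (T (step (\<lambda>k. avg k yd), step (\<lambda>k. avg k f)))) = step (\<lambda>j. t j (\<lambda>k. avg k yd) (\<lambda>k. avg k f))"
      by (rule step_cong) (simp add: t_def)
    then have 1: "L2_norm \<Omega> (\<lambda>x. T (yd, f) x - step (\<lambda>j. t j (\<lambda>k. avg k yd) (\<lambda>k. avg k f)) x) \<le> \<epsilon> / 2"
      using mA(3)[OF yf] by simp
    have 2: "L2_norm \<Omega> (\<lambda>x. step (\<lambda>j. t j (\<lambda>k. avg k yd) (\<lambda>k. avg k f)) x - \<T> (yd, f) x) \<le> \<epsilon> / 2"
      unfolding \<T> e(2)[symmetric] by (rule net2(7)[OF yf])
    show ?thesis
      by (rule order_trans[OF L2_triangle_diff[OF TL[OF L] step_L2[of "\<lambda>j. t j (\<lambda>k. avg k yd) (\<lambda>k. avg k f)"] \<T>L[OF L]]])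
        (use add_mono[OF 1 2] in simp)
  qed
  have "(SUP (yd, f)\<in>K. ereal (L2_norm \<Omega> (\<lambda>x. T (yd, f) x - \<T> (yd, f) x))) \<le> ereal \<epsilon>"
    by (rule SUP_least) (use err in auto)
  then show ?thesis using iu \<T>L by blast
qed

end
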